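(* Let $(E,\{S_\alpha,g_\alpha\}_{\alpha\in I})$ be a stratified Riemannian state space and suppose that Assumptions (D) and (J) stated in the context hold. Let $(A,\mathcal D_0)$ be the operator defined in the context. Then for every starting point $x\in E$ there exist a filtered probability space $(\Omega,(\mathcal F^x_t)_{t\ge0},\mathbb P_x)$ and an $E$-valued càdlàg process $(X_t)_{t\ge 0}$ on it such that: (i) $X_0=x$ $\mathbb P_x$-a.s.; (ii) between its jump times the process remains in a single stratum: if $X_{t-}\in S_\alpha$ and $X_t=X_{t-}$, then $X_s\in S_\alpha$ for all $s$ in a neighborhood of $t$; on each such interval, $X$ evolves as the diffusion with generator $L_\alpha$; (iii) the jumps of $X$ are governed by the structural kernels and rates: whenever $X_{t-}=y\in S_\alpha$, jumps of type $e\in\mathcal E$ with $\alpha(e)=\alpha$ occur with conditional intensity $\lambda_e(y)$, and conditional on such a jump of type $e$, the post-jump location has law $K_e(y,\cdot)$; (iv) for every $f\in\mathcal D_0$, the process $$M^f_t=f(X_t)-f(X_0)-\int_0^t Af(X_s)\,ds,\qquad t\ge 0,$$ is an $(\mathcal F^x_t)$-martingale. In particular, the law of $X$ on $D([0,\infty);E)$ is a solution of the martingale problem for $(A,\mathcal D_0)$ with initial condition $x$. Moreover, $X$ is non-explosive, and the map $x\mapsto\mathbb P_x$ (with $\mathbb P_x$ identified with the law of $X$ on $D([0,\infty);E)$) is Borel from $E$ to $\mathcal P(D([0,\infty);E))$.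
   Context: **Notation.** $(E,d)$ is a locally compact separable metric space, $\mathcal B(E)$ its Borel $\sigma$-algebra, $B_b(E)$ the bounded Borel functions $E\to\mathbb R$, $D_E=D([0,\infty);E)$ the Skorokhod space of càdlàg paths, $\mathcal P(\cdot)$ the space of Borel probability measures. **Stratified Riemannian state space.** $I$ is a countable set and $E=\bigsqcup_{\alpha\in I}S_\alpha$ is a partition such that: each $S_\alpha$ is a connected smooth finite-dimensional manifold without boundary, equipped with a Riemannian metric $g_\alpha$; each inclusion $S_\alpha\hookrightarrow E$ is a homeomorphism onto its image, and this image is a Borel subset of $E$. **Assumption (D).** For every $\alpha\in I$ there is a conservative càdlàg Markov family $(\mathbb Q^\alpha_x)_{x\in S_\alpha}$ on $D([0,\infty);S_\alpha)$, with canonical process $\eta_t(\omega)=\omega(t)$, such that: (D1) $x\mapsto\mathbb Q^\alpha_x\in\mathcal P(D([0,\infty);S_\alpha))$ is Borel measurable; (D2) for every $x\in S_\alpha$, $\mathbb Q^\alpha_x(\eta_0=x)=1$, $\mathbb Q^\alpha_x(\eta_t\in S_\alpha\ \forall t\ge0)=1$, and the paths are continuous in the topology of $S_\alpha$; (D3) with $P^\alpha_tg(x):=\mathbb E_{\mathbb Q^\alpha_x}[g(\eta_t)]$, $(P^\alpha_t)_{t\ge0}$ restricts to a strongly continuous contraction semigroup on $C_0(S_\alpha)$ (in particular $P^\alpha_tC_0(S_\alpha)\subset C_0(S_\alpha)$); (D4) with $(L_\alpha,D(L_\alpha))$ the generator of $(P^\alpha_t)$ on $C_0(S_\alpha)$,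 there is a linear subspace $\mathcal C_\alpha\subset D(L_\alpha)\subset C_0(S_\alpha)$ which is a core for $L_\alpha$ and is measure determining (finite Borel measures $\mu,\nu$ on $S_\alpha$ with $\int g\,d\mu=\int g\,d\nu$ for all $g\in\mathcal C_\alpha$ are equal). **Assumption (J).** There is a directed graph $(I,\mathcal E)$ with countable edge set; $e\in\mathcal E$ has tail $\alpha(e)$ and head $\beta(e)$. For each $e$ there are a Borel probability kernel $K_e:S_{\alpha(e)}\times\mathcal B(E)\to[0,1]$ with $K_e(x,S_{\beta(e)})=1$ and $K_e(x,\{x\})=0$ for all $x\in S_{\alpha(e)}$, and a Borel rate $\lambda_e:S_{\alpha(e)}\to[0,\infty)$. For $x\in S_\alpha$, $\Lambda(x):=\sum_{e:\alpha(e)=\alpha}\lambda_e(x)$ and $\nu(x,B):=\sum_{e:\alpha(e)=\alpha}\lambda_e(x)K_e(x,B)$. It is assumed that $\sup_{x\in E}\Lambda(x)\le\overline\Lambda<\infty$. **Operator.** $\mathcal D_0:=\bigoplus_{\alpha}\mathcal C_\alpha$ is the set of bounded Borel $f:E\to\mathbb R$ with $f|_{S_\alpha}\in\mathcal C_\alpha$ for every $\alpha$ and $f|_{S_\alpha}=0$ for all but finitely many $\alpha$. For $f\in\mathcal D_0$, $x\in S_\alpha$: $Jf(x):=\int_E(f(y)-f(x))\,\nu(x,dy)$ and $Af(x):=L_\alpha(f|_{S_\alpha})(x)+Jf(x)$; so $A:\mathcal D_0\to B_b(E)$. **Martingale problem.** $\mathbb P\in\mathcal P(D_E)$ solves the martingale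 problem for $(A,\mathcal D_0)$ with initial condition $x$ if, for the canonical process $X$, $\mathbb P(X_0=x)=1$ and for every $f\in\mathcal D_0$ the process $f(X_t)-f(X_0)-\int_0^tAf(X_s)\,ds$ is a martingale under $\mathbb P$ for the filtration generated by $X$. **Conventions.** $(\mathcal F^x_t)$ is the right-continuous completed natural filtration of $X$ under $\mathbb P_x$. Non-explosive means: for an increasing sequence of open relatively compact sets $O_m$ with $\overline{O_m}\subset O_{m+1}$, $\bigcup_mO_m=E$, and $T_m=\inf\{t:X_t\notin O_m\}$, one has $\lim_mT_m=\infty$ a.s. Meaning of (ii) and (iii): $X$ can be realized (with the same law) so that, with $0=\tau_0<\tau_1<\dots$ its successive jump times, conditionally on the history up to $\tau_n<\infty$, $X$ on $[\tau_n,\tau_{n+1})$ is the piece, up to time $\tau_{n+1}-\tau_n$, of a path with law $\mathbb Q^{\alpha}_{X_{\tau_n}}$, where $X_{\tau_n}\in S_\alpha$; and each jump carries a type $e\in\mathcal E$ such that for every $e$ and $B\in\mathcal B(E)$ the process counting jumps of type $e$ with post-jump position in $B$ has compensator $\int_0^t\lambda_e(X_{s-})K_e(X_{s-},B)\,ds$ (with $\lambda_e$ extended by $0$ off $S_{\alpha(e)}$). *)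

theory Defs
  imports "HOL-Probability.Probability"
begin

section \<open>Stratified Riemannian state spaces\<close>

text \<open>
  The dimension varies with the stratum, so \<open>\<real>\<^sup>n\<close> is \<^const>\<open>Euclidean_space\<close> \<open>n\<close>, whose points are
  the sequences vanishing from index \<open>n\<close> on.
\<close>

text \<open>
  \<open>C\<^sup>\<infinity>\<close> on an open \<open>W \<subseteq> \<real>\<^sup>n\<close>: all iterated partial derivatives exist and are continuous;
  \<open>D (i # is)\<close> is the \<open>i\<close>-th partial derivative of \<open>D is\<close>.
\<close>

definition smooth_fun :: "nat \<Rightarrow> (nat \<Rightarrow> real) set \<Rightarrow> ((nat \<Rightarrow> real) \<Rightarrow> real) \<Rightarrow> bool" where
  "smooth_fun n W f \<longleftrightarrow>
     (\<exists>D :: nat list \<Rightarrow> (nat \<Rightarrow> real) \<Rightarrow> real.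
        (\<forall>y\<in>W. D [] y = f y) \<and>
        (\<forall>is\<in>lists {..<n}.
           continuous_map (subtopology (Euclidean_space n) W) euclideanreal (D is) \<and>
           (\<forall>i<n. \<forall>y\<in>W.
              ((\<lambda>h. D is (y(i := y i + h))) has_real_derivative D (i # is) y) (at 0))))"

definition partial_deriv :: "nat \<Rightarrow> ((nat \<Rightarrow> real) \<Rightarrow> real) \<Rightarrow> (nat \<Rightarrow> real) \<Rightarrow> real" where
  "partial_deriv i f y = deriv (\<lambda>h. f (y(i := y i + h))) 0"

type_synonym 'a chart = "'a set \<times> ('a \<Rightarrow> nat \<Rightarrow> real)"

definition is_chart :: "'a::topological_space set \<Rightarrow> nat \<Rightarrow> 'a chart \<Rightarrow> bool" where
  "is_chart S n c \<longleftrightarrow> (case c of (U, \<phi>) \<Rightarrow>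
     openin (top_of_set S) U \<and> openin (Euclidean_space n) (\<phi> ` U) \<and>
     homeomorphic_map (top_of_set U) (subtopology (Euclidean_space n) (\<phi> ` U)) \<phi>)"

definition transition_map :: "'a chart \<Rightarrow> 'a chart \<Rightarrow> (nat \<Rightarrow> real) \<Rightarrow> nat \<Rightarrow> real" where
  "transition_map c c' = (\<lambda>y. snd c' (inv_into (fst c) (snd c) y))"

text \<open>
  A stratum is a subset of the ambient space with the subspace topology, which is what the inclusion
  being a homeomorphism onto its image amounts to; Hausdorffness and second countability are
  inherited.
\<close>

definition smooth_atlas :: "'a::topological_space set \<Rightarrow> nat \<Rightarrow> 'a chart set \<Rightarrow> bool" where
  "smooth_atlas S n \<A> \<longleftrightarrow>
     (\<forall>c\<in>\<A>. is_chart S n c) \<and> (\<Union>c\<in>\<A>. fst c) = S \<and>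
     (\<forall>c\<in>\<A>. \<forall>c'\<in>\<A>. \<forall>k<n.
        smooth_fun n (snd c ` (fst c \<inter> fst c')) (\<lambda>y. transition_map c c' y k))"

text \<open>A Riemannian metric is given by its coefficient matrices in the charts of the atlas.\<close>

definition riemannian_metric ::
    "nat \<Rightarrow> 'a chart set \<Rightarrow> ('a chart \<Rightarrow> (nat \<Rightarrow> real) \<Rightarrow> nat \<Rightarrow> nat \<Rightarrow> real) \<Rightarrow> bool" where
  "riemannian_metric n \<A> g \<longleftrightarrow>
     (\<forall>c\<in>\<A>. \<forall>i<n. \<forall>j<n. smooth_fun n (snd c ` fst c) (\<lambda>y. g c y i j)) \<and>
     (\<forall>c\<in>\<A>. \<forall>y\<in>snd c ` fst c.
        (\<forall>i<n. \<forall>j<n. g c y i j = g c y j i) \<and>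
        (\<forall>v :: nat \<Rightarrow> real. (\<exists>i<n. v i \<noteq> 0) \<longrightarrow> 0 < (\<Sum>i<n. \<Sum>j<n. g c y i j * v i * v j))) \<and>
     (\<forall>c\<in>\<A>. \<forall>c'\<in>\<A>. \<forall>x\<in>fst c \<inter> fst c'. \<forall>i<n. \<forall>j<n.
        g c (snd c x) i j =
          (\<Sum>k<n. \<Sum>l<n. partial_deriv i (\<lambda>y. transition_map c c' y k) (snd c x) *
                          partial_deriv j (\<lambda>y. transition_map c c' y l) (snd c x) *
                          g c' (snd c' x) k l))"

definition stratified_riemannian_space ::
    "'i set \<Rightarrow> ('i \<Rightarrow> 'a::metric_space set) \<Rightarrow> ('i \<Rightarrow> nat) \<Rightarrow> ('i \<Rightarrow> 'a chart set) \<Rightarrow>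
     ('i \<Rightarrow> 'a chart \<Rightarrow> (nat \<Rightarrow> real) \<Rightarrow> nat \<Rightarrow> nat \<Rightarrow> real) \<Rightarrow> bool" where
  "stratified_riemannian_space I S dm \<A> g \<longleftrightarrow>
     countable I \<and> disjoint_family_on S I \<and> (\<Union>\<alpha>\<in>I. S \<alpha>) = UNIV \<and>
     (\<forall>\<alpha>\<in>I. S \<alpha> \<in> sets borel \<and> connected (S \<alpha>) \<and>
        smooth_atlas (S \<alpha>) (dm \<alpha>) (\<A> \<alpha>) \<and> riemannian_metric (dm \<alpha>) (\<A> \<alpha>) (g \<alpha>))"


section \<open>Skorokhod space\<close>

text \<open>
  Paths on \<open>[0, \<infinity>)\<close> are extensional functions on \<open>{0..}\<close>; the left limits are required to lie
  in \<open>S\<close>.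
\<close>

definition cadlag_paths :: "'a::metric_space set \<Rightarrow> (real \<Rightarrow> 'a) set" where
  "cadlag_paths S = {\<omega> \<in> {0..} \<rightarrow>\<^sub>E S. \<forall>t\<ge>0.
      (\<omega> \<longlongrightarrow> \<omega> t) (at_right t) \<and> (0 < t \<longrightarrow> (\<exists>l\<in>S. (\<omega> \<longlongrightarrow> l) (at_left t)))}"

text \<open>
  Basic \<open>J\<^sub>1\<close>-neighbourhoods (not necessarily open). A sequence converges to \<open>\<omega>\<close> in Skorokhod's
  \<open>J\<^sub>1\<close> sense iff it is eventually in each of them.
\<close>

definition skorokhod_nbhd ::
    "'a::metric_space set \<Rightarrow> (real \<Rightarrow> 'a) \<Rightarrow> real \<Rightarrow> real \<Rightarrow> (real \<Rightarrow> 'a) set" where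
  "skorokhod_nbhd S \<omega> T \<epsilon> = {\<omega>' \<in> cadlag_paths S.
      \<exists>l :: real \<Rightarrow> real. strict_mono_on {0..} l \<and> l ` {0..} = {0..} \<and>
        (\<forall>t\<in>{0..T}. \<bar>l t - t\<bar> < \<epsilon> \<and> dist (\<omega>' t) (\<omega> (l t)) < \<epsilon>)}"

definition skorokhod_topology :: "'a::metric_space set \<Rightarrow> (real \<Rightarrow> 'a) topology" where
  "skorokhod_topology S = topology (\<lambda>U. U \<subseteq> cadlag_paths S \<and>
      (\<forall>\<omega>\<in>U. \<exists>T>0. \<exists>\<epsilon>>0. skorokhod_nbhd S \<omega> T \<epsilon> \<subseteq> U))"

lemma istopology_skorokhod:
  "istopology (\<lambda>U. U \<subseteq> cadlag_paths S \<and>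
      (\<forall>\<omega>\<in>U. \<exists>T>0. \<exists>\<epsilon>>0. skorokhod_nbhd S \<omega> T \<epsilon> \<subseteq> U))"
proof -
  have mono: "skorokhod_nbhd S \<omega> T \<epsilon> \<subseteq> skorokhod_nbhd S \<omega> T' \<epsilon>'"
    if "T' \<le> T" "\<epsilon> \<le> \<epsilon>'" for \<omega> T T' \<epsilon> \<epsilon>'
  proof
    fix y assume "y \<in> skorokhod_nbhd S \<omega> T \<epsilon>"
    then obtain l where y: "y \<in> cadlag_paths S" "strict_mono_on {0..} l" "l ` {0..} = {0..}"
      and l: "\<forall>t\<in>{0..T}. \<bar>l t - t\<bar> < \<epsilon> \<and> dist (y t) (\<omega> (l t)) < \<epsilon>"
      unfolding skorokhod_nbhd_def by blast
    have "\<bar>l t - t\<bar> < \<epsilon>' \<and> dist (y t) (\<omega> (l t)) < \<epsilon>'" if "t \<in> {0..T'}" for t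
      using bspec[OF l, of t] that \<open>T' \<le> T\<close> \<open>\<epsilon> \<le> \<epsilon>'\<close> by simp
    then show "y \<in> skorokhod_nbhd S \<omega> T' \<epsilon>'"
      unfolding skorokhod_nbhd_def mem_Collect_eq using y by (intro conjI exI[of _ l]) blast+
  qed
  let ?L = "\<lambda>U. U \<subseteq> cadlag_paths S \<and>
      (\<forall>\<omega>\<in>U. \<exists>T>0. \<exists>\<epsilon>>0. skorokhod_nbhd S \<omega> T \<epsilon> \<subseteq> U)"
  have inter: "?L (U \<inter> V)" if U: "?L U" and V: "?L V" for U V
  proof (intro conjI ballI)
    show "U \<inter> V \<subseteq> cadlag_paths S" using U by auto
    fix \<omega> assume \<omega>: "\<omega> \<in> U \<inter> V"
    obtain T \<epsilon> where 1: "T > 0" "\<epsilon> > 0" "skorokhod_nbhd S \<omega> T \<epsilon> \<subseteq> U"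
      using U \<omega> by auto
    obtain T' \<epsilon>' where 2: "T' > 0" "\<epsilon>' > 0" "skorokhod_nbhd S \<omega> T' \<epsilon>' \<subseteq> V"
      using V \<omega> by auto
    have "skorokhod_nbhd S \<omega> (max T T') (min \<epsilon> \<epsilon>') \<subseteq> U \<inter> V"
      using mono[of T "max T T'" "min \<epsilon> \<epsilon>'" \<epsilon> \<omega>] mono[of T' "max T T'" "min \<epsilon> \<epsilon>'" \<epsilon>' \<omega>] 1(3) 2(3)
      by auto
    then show "\<exists>T>0. \<exists>\<epsilon>>0. skorokhod_nbhd S \<omega> T \<epsilon> \<subseteq> U \<inter> V"
      using 1(1,2) 2(1,2) by (intro exI[of _ "max T T'"] conjI exI[of _ "min \<epsilon> \<epsilon>'"]) auto
  qed
  have union: "?L (\<Union>\<U>)" if U: "\<forall>V\<in>\<U>. ?L V" for \<U>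
  proof (intro conjI ballI)
    show "\<Union>\<U> \<subseteq> cadlag_paths S" using U by auto
    fix \<omega> assume "\<omega> \<in> \<Union>\<U>"
    then obtain V where V: "V \<in> \<U>" "\<omega> \<in> V" by auto
    obtain T \<epsilon> where "T > 0" "\<epsilon> > 0" "skorokhod_nbhd S \<omega> T \<epsilon> \<subseteq> V"
      using bspec[OF conjunct2[OF bspec[OF U V(1)]] V(2)] by (elim exE conjE)
    moreover have "V \<subseteq> \<Union>\<U>" using V by auto
    ultimately show "\<exists>T>0. \<exists>\<epsilon>>0. skorokhod_nbhd S \<omega> T \<epsilon> \<subseteq> \<Union>\<U>"
      by (intro exI[of _ T] conjI exI[of _ \<epsilon>]) auto
  qed
  show ?thesis
    unfolding istopology_def
  proof (rule conjI; intro allI impI)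
    show "?L (U \<inter> V)" if "?L U" "?L V" for U V
      using that by (rule inter)
    show "?L (\<Union>\<U>)" if "\<forall>V\<in>\<U>. ?L V" for \<U>
      using that by (rule union)
  qed
qed

lemma openin_skorokhod_topology:
  "openin (skorokhod_topology S) U \<longleftrightarrow> U \<subseteq> cadlag_paths S \<and>
      (\<forall>\<omega>\<in>U. \<exists>T>0. \<exists>\<epsilon>>0. skorokhod_nbhd S \<omega> T \<epsilon> \<subseteq> U)"
  unfolding skorokhod_topology_def topology_inverse'[OF istopology_skorokhod] ..

definition skorokhod_borel :: "'a::metric_space set \<Rightarrow> (real \<Rightarrow> 'a) measure" where
  "skorokhod_borel S = sigma (cadlag_paths S) {U. openin (skorokhod_topology S) U}"

definition shift_path :: "real \<Rightarrow> (real \<Rightarrow> 'a) \<Rightarrow> real \<Rightarrow> 'a" where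
  "shift_path s \<omega> = (\<lambda>t\<in>{0..}. \<omega> (s + t))"

definition left_lim :: "(real \<Rightarrow> 'a::metric_space) \<Rightarrow> real \<Rightarrow> 'a" where
  "left_lim \<omega> t = (if t = 0 then \<omega> 0 else Lim (at_left t) \<omega>)"


section \<open>Filtrations and martingales\<close>

definition natural_filtration ::
    "'w set \<Rightarrow> ('w \<Rightarrow> real \<Rightarrow> 'a::topological_space) \<Rightarrow> real \<Rightarrow> 'w measure" where
  "natural_filtration \<Omega> X t = sigma \<Omega> {(\<lambda>\<omega>. X \<omega> s) -` B \<inter> \<Omega> | s B. s \<in> {0..t} \<and> B \<in> sets borel}"

definition usual_augmentation ::
    "'w measure \<Rightarrow> (real \<Rightarrow> 'w measure) \<Rightarrow> real \<Rightarrow> 'w measure" where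
  "usual_augmentation M F t =
     sigma (space M) (\<Inter>u\<in>{t<..}. sets (sigma (space M) (sets (F u) \<union> null_sets M)))"

definition martingale ::
    "'w measure \<Rightarrow> (real \<Rightarrow> 'w measure) \<Rightarrow> (real \<Rightarrow> 'w \<Rightarrow> real) \<Rightarrow> bool" where
  "martingale M F Z \<longleftrightarrow>
     filtration (space M) F \<and>
     (\<forall>t\<ge>0. subalgebra M (F t) \<and> Z t \<in> borel_measurable (F t) \<and> integrable M (Z t)) \<and>
     (\<forall>s\<ge>0. \<forall>t\<ge>s. AE \<omega> in M. real_cond_exp M (F s) (Z t) \<omega> = Z s \<omega>)"


section \<open>The diffusions on the strata\<close>

text \<open>
  Functions on a stratum \<open>S\<close> are extensional functions, so that \<^const>\<open>restrict\<close> is restriction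
  to \<open>S\<close>.
\<close>

definition C0 :: "'a::metric_space set \<Rightarrow> ('a \<Rightarrow> real) set" where
  "C0 S = {f \<in> extensional S. continuous_on S f \<and>
      (\<forall>\<epsilon>>0. \<exists>K\<subseteq>S. compact K \<and> (\<forall>x\<in>S - K. \<bar>f x\<bar> < \<epsilon>))}"

definition fun_subspace :: "'a set \<Rightarrow> ('a \<Rightarrow> real) set \<Rightarrow> bool" where
  "fun_subspace S C \<longleftrightarrow> C \<subseteq> extensional S \<and> (\<lambda>x\<in>S. 0) \<in> C \<and>
     (\<forall>f\<in>C. \<forall>h\<in>C. (\<lambda>x\<in>S. f x + h x) \<in> C) \<and> (\<forall>f\<in>C. \<forall>a. (\<lambda>x\<in>S. a * f x) \<in> C)"

definition markov_family ::
    "'a::metric_space set \<Rightarrow> ('a \<Rightarrow> (real \<Rightarrow> 'a) measure) \<Rightarrow> bool" where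
  "markov_family S Q \<longleftrightarrow>
     (\<forall>x\<in>S. Q x \<in> space (prob_algebra (skorokhod_borel S)) \<and>
        (\<forall>s\<ge>0. \<forall>\<Gamma>\<in>sets (skorokhod_borel S). AE \<omega> in Q x.
           real_cond_exp (Q x) (natural_filtration (cadlag_paths S) (\<lambda>\<omega>. \<omega>) s)
             (indicator {\<omega> \<in> cadlag_paths S. shift_path s \<omega> \<in> \<Gamma>}) \<omega>
           = measure (Q (\<omega> s)) \<Gamma>))"

definition transition_op ::
    "'a set \<Rightarrow> ('a \<Rightarrow> (real \<Rightarrow> 'a) measure) \<Rightarrow> real \<Rightarrow> ('a \<Rightarrow> real) \<Rightarrow> 'a \<Rightarrow> real" where
  "transition_op S Q t f = (\<lambda>x\<in>S. \<integral>\<omega>. f (\<omega> t) \<partial>Q x)"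

definition C0_contraction_semigroup ::
    "'a::metric_space set \<Rightarrow> (real \<Rightarrow> ('a \<Rightarrow> real) \<Rightarrow> 'a \<Rightarrow> real) \<Rightarrow> bool" where
  "C0_contraction_semigroup S P \<longleftrightarrow>
     (\<forall>f\<in>C0 S. P 0 f = f) \<and>
     (\<forall>t\<ge>0. \<forall>f\<in>C0 S. P t f \<in> C0 S) \<and>
     (\<forall>s\<ge>0. \<forall>t\<ge>0. \<forall>f\<in>C0 S. P (s + t) f = P s (P t f)) \<and>
     (\<forall>t\<ge>0. \<forall>f\<in>C0 S. \<forall>h\<in>C0 S. \<forall>a b.
        P t (\<lambda>x\<in>S. a * f x + b * h x) = (\<lambda>x\<in>S. a * P t f x + b * P t h x)) \<and>
     (\<forall>t\<ge>0. \<forall>f\<in>C0 S. \<forall>c. (\<forall>x\<in>S. \<bar>f x\<bar> \<le> c) \<longrightarrow> (\<forall>x\<in>S. \<bar>P t f x\<bar> \<le> c)) \<and>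
     (\<forall>f\<in>C0 S. uniform_limit S (\<lambda>t. P t f) f (at_right 0))"

definition is_generator_value ::
    "'a::metric_space set \<Rightarrow> (real \<Rightarrow> ('a \<Rightarrow> real) \<Rightarrow> 'a \<Rightarrow> real) \<Rightarrow> ('a \<Rightarrow> real) \<Rightarrow> ('a \<Rightarrow> real) \<Rightarrow> bool"
  where
  "is_generator_value S P f h \<longleftrightarrow> f \<in> C0 S \<and> h \<in> C0 S \<and>
     uniform_limit S (\<lambda>t x. (P t f x - f x) / t) h (at_right 0)"

definition generator_domain ::
    "'a::metric_space set \<Rightarrow> (real \<Rightarrow> ('a \<Rightarrow> real) \<Rightarrow> 'a \<Rightarrow> real) \<Rightarrow> ('a \<Rightarrow> real) set" where
  "generator_domain S P = {f. \<exists>h. is_generator_value S P f h}"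

definition generator ::
    "'a::metric_space set \<Rightarrow> (real \<Rightarrow> ('a \<Rightarrow> real) \<Rightarrow> 'a \<Rightarrow> real) \<Rightarrow> ('a \<Rightarrow> real) \<Rightarrow> 'a \<Rightarrow> real" where
  "generator S P f = (THE h. is_generator_value S P f h)"

definition generator_core ::
    "'a::metric_space set \<Rightarrow> (real \<Rightarrow> ('a \<Rightarrow> real) \<Rightarrow> 'a \<Rightarrow> real) \<Rightarrow> ('a \<Rightarrow> real) set \<Rightarrow> bool" where
  "generator_core S P C \<longleftrightarrow> fun_subspace S C \<and> C \<subseteq> generator_domain S P \<and>
     (\<forall>f\<in>generator_domain S P. \<forall>\<epsilon>>0. \<exists>h\<in>C. \<forall>x\<in>S.
        \<bar>h x - f x\<bar> < \<epsilon> \<and> \<bar>generator S P h x - generator S P f x\<bar> < \<epsilon>)"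

definition measure_determining :: "'a::metric_space set \<Rightarrow> ('a \<Rightarrow> real) set \<Rightarrow> bool" where
  "measure_determining S C \<longleftrightarrow>
     (\<forall>\<mu> \<nu>. finite_measure \<mu> \<and> finite_measure \<nu> \<and>
        sets \<mu> = sets (restrict_space borel S) \<and> sets \<nu> = sets (restrict_space borel S) \<and>
        (\<forall>f\<in>C. (\<integral>x. f x \<partial>\<mu>) = (\<integral>x. f x \<partial>\<nu>)) \<longrightarrow> \<mu> = \<nu>)"

definition strata_diffusions ::
    "'i set \<Rightarrow> ('i \<Rightarrow> 'a::metric_space set) \<Rightarrow> ('i \<Rightarrow> 'a \<Rightarrow> (real \<Rightarrow> 'a) measure) \<Rightarrow>
     ('i \<Rightarrow> ('a \<Rightarrow> real) set) \<Rightarrow> bool" where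
  "strata_diffusions I S Q C \<longleftrightarrow> (\<forall>\<alpha>\<in>I.
     markov_family (S \<alpha>) (Q \<alpha>) \<and>
     Q \<alpha> \<in> restrict_space borel (S \<alpha>) \<rightarrow>\<^sub>M prob_algebra (skorokhod_borel (S \<alpha>)) \<and>
     (\<forall>x\<in>S \<alpha>. AE \<omega> in Q \<alpha> x. \<omega> 0 = x \<and> (\<forall>t\<ge>0. \<omega> t \<in> S \<alpha>) \<and> continuous_on {0..} \<omega>) \<and>
     C0_contraction_semigroup (S \<alpha>) (transition_op (S \<alpha>) (Q \<alpha>)) \<and>
     generator_core (S \<alpha>) (transition_op (S \<alpha>) (Q \<alpha>)) (C \<alpha>) \<and>
     measure_determining (S \<alpha>) (C \<alpha>))"


section \<open>The jump mechanism\<close>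

definition stratum_of :: "'i set \<Rightarrow> ('i \<Rightarrow> 'a set) \<Rightarrow> 'a \<Rightarrow> 'i" where
  "stratum_of I S x = (THE \<alpha>. \<alpha> \<in> I \<and> x \<in> S \<alpha>)"

definition edges_at :: "'i set \<Rightarrow> ('i \<Rightarrow> 'a set) \<Rightarrow> 'e set \<Rightarrow> ('e \<Rightarrow> 'i) \<Rightarrow> 'a \<Rightarrow> 'e set" where
  "edges_at I S Edges src x = {e \<in> Edges. src e = stratum_of I S x}"

definition total_rate ::
    "'i set \<Rightarrow> ('i \<Rightarrow> 'a set) \<Rightarrow> 'e set \<Rightarrow> ('e \<Rightarrow> 'i) \<Rightarrow> ('e \<Rightarrow> 'a \<Rightarrow> real) \<Rightarrow> 'a \<Rightarrow> ennreal" where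
  "total_rate I S Edges src rate x = (\<Sum>\<^sub>\<infinity>e\<in>edges_at I S Edges src x. ennreal (rate e x))"

definition jump_measure ::
    "'i set \<Rightarrow> ('i \<Rightarrow> 'a set) \<Rightarrow> 'e set \<Rightarrow> ('e \<Rightarrow> 'i) \<Rightarrow> ('e \<Rightarrow> 'a \<Rightarrow> 'a::metric_space measure) \<Rightarrow>
     ('e \<Rightarrow> 'a \<Rightarrow> real) \<Rightarrow> 'a \<Rightarrow> 'a measure" where
  "jump_measure I S Edges src K rate x = measure_of UNIV (sets borel)
     (\<lambda>B. \<Sum>\<^sub>\<infinity>e\<in>edges_at I S Edges src x. ennreal (rate e x) * emeasure (K e x) B)"

definition jump_structure ::
    "'i set \<Rightarrow> ('i \<Rightarrow> 'a::metric_space set) \<Rightarrow> 'e set \<Rightarrow> ('e \<Rightarrow> 'i) \<Rightarrow> ('e \<Rightarrow> 'i) \<Rightarrow>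
     ('e \<Rightarrow> 'a \<Rightarrow> 'a measure) \<Rightarrow> ('e \<Rightarrow> 'a \<Rightarrow> real) \<Rightarrow> real \<Rightarrow> bool" where
  "jump_structure I S Edges src tgt K rate \<Lambda>max \<longleftrightarrow>
     countable Edges \<and>
     (\<forall>e\<in>Edges. src e \<in> I \<and> tgt e \<in> I \<and>
        K e \<in> restrict_space borel (S (src e)) \<rightarrow>\<^sub>M prob_algebra borel \<and>
        rate e \<in> borel_measurable (restrict_space borel (S (src e))) \<and>
        (\<forall>x\<in>S (src e). measure (K e x) (S (tgt e)) = 1 \<and> measure (K e x) {x} = 0 \<and> 0 \<le> rate e x)) \<and>
     (\<forall>x. total_rate I S Edges src rate x \<le> ennreal \<Lambda>max)"


section \<open>The operator and its martingale problem\<close>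

definition op_domain ::
    "'i set \<Rightarrow> ('i \<Rightarrow> 'a::metric_space set) \<Rightarrow> ('i \<Rightarrow> ('a \<Rightarrow> real) set) \<Rightarrow> ('a \<Rightarrow> real) set" where
  "op_domain I S C = {f \<in> borel_measurable borel. bounded (range f) \<and>
     (\<forall>\<alpha>\<in>I. restrict f (S \<alpha>) \<in> C \<alpha>) \<and> finite {\<alpha>\<in>I. \<exists>x\<in>S \<alpha>. f x \<noteq> 0}}"

definition hybrid_op ::
    "'i set \<Rightarrow> ('i \<Rightarrow> 'a::metric_space set) \<Rightarrow> ('i \<Rightarrow> 'a \<Rightarrow> (real \<Rightarrow> 'a) measure) \<Rightarrow>
     'e set \<Rightarrow> ('e \<Rightarrow> 'i) \<Rightarrow> ('e \<Rightarrow> 'a \<Rightarrow> 'a measure) \<Rightarrow> ('e \<Rightarrow> 'a \<Rightarrow> real) \<Rightarrow>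
     ('a \<Rightarrow> real) \<Rightarrow> 'a \<Rightarrow> real" where
  "hybrid_op I S Q Edges src K rate f x =
     (let \<alpha> = stratum_of I S x in
        generator (S \<alpha>) (transition_op (S \<alpha>) (Q \<alpha>)) (restrict f (S \<alpha>)) x) +
     (\<integral>y. (f y - f x) \<partial>jump_measure I S Edges src K rate x)"

definition martingale_process ::
    "(('a \<Rightarrow> real) \<Rightarrow> 'a \<Rightarrow> real) \<Rightarrow> ('w \<Rightarrow> real \<Rightarrow> 'a) \<Rightarrow> ('a \<Rightarrow> real) \<Rightarrow> real \<Rightarrow> 'w \<Rightarrow> real" where
  "martingale_process A X f t \<omega> =
     f (X \<omega> t) - f (X \<omega> 0) - (LINT s:{0..t}|lborel. A f (X \<omega> s))"

definition solves_martingale_problem ::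
    "(('a::metric_space \<Rightarrow> real) \<Rightarrow> 'a \<Rightarrow> real) \<Rightarrow> ('a \<Rightarrow> real) set \<Rightarrow> 'a \<Rightarrow> (real \<Rightarrow> 'a) measure \<Rightarrow> bool"
  where
  "solves_martingale_problem A D x P \<longleftrightarrow>
     P \<in> space (prob_algebra (skorokhod_borel UNIV)) \<and>
     (AE \<omega> in P. \<omega> 0 = x) \<and>
     (\<forall>f\<in>D. martingale P (natural_filtration (cadlag_paths UNIV) (\<lambda>\<omega>. \<omega>))
        (martingale_process A (\<lambda>\<omega>. \<omega>) f))"


section \<open>Jump times, jump types and diffusive pieces of the process\<close>

text \<open>
  \<open>\<tau> n\<close> is the \<open>n\<close>-th jump time (\<open>\<tau> 0 = 0\<close>; \<open>\<infinity>\<close> if there are fewer than \<open>n\<close> jumps) and \<open>Y n\<close> the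
  type of the \<open>n\<close>-th jump, meaningful for \<open>n \<ge> 1\<close> and \<open>\<tau> n < \<infinity>\<close>.
\<close>

definition successive_jumps ::
    "'w measure \<Rightarrow> ('w \<Rightarrow> real \<Rightarrow> 'a::metric_space) \<Rightarrow> 'e set \<Rightarrow> (nat \<Rightarrow> 'w \<Rightarrow> ereal) \<Rightarrow>
     (nat \<Rightarrow> 'w \<Rightarrow> 'e) \<Rightarrow> bool" where
  "successive_jumps M X Edges \<tau> Y \<longleftrightarrow>
     (\<forall>n. \<tau> n \<in> borel_measurable M \<and> Y n \<in> M \<rightarrow>\<^sub>M count_space UNIV) \<and>
     (AE \<omega> in M.
        \<tau> 0 \<omega> = 0 \<and>
        (\<forall>n. if \<tau> n \<omega> < \<infinity> then \<tau> n \<omega> < \<tau> (Suc n) \<omega> else \<tau> (Suc n) \<omega> = \<infinity>) \<and>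
        (\<lambda>n. \<tau> n \<omega>) \<longlonglongrightarrow> \<infinity> \<and>
        {t. 0 < t \<and> X \<omega> t \<noteq> left_lim (X \<omega>) t} = {t. \<exists>n\<ge>1. \<tau> n \<omega> = ereal t} \<and>
        (\<forall>n\<ge>1. \<tau> n \<omega> < \<infinity> \<longrightarrow> Y n \<omega> \<in> Edges))"

abbreviation state_at_jump ::
    "('w \<Rightarrow> real \<Rightarrow> 'a) \<Rightarrow> (nat \<Rightarrow> 'w \<Rightarrow> ereal) \<Rightarrow> nat \<Rightarrow> 'w \<Rightarrow> 'a" where
  "state_at_jump X \<tau> n \<omega> \<equiv> X \<omega> (real_of_ereal (\<tau> n \<omega>))"

definition jump_history ::
    "'w measure \<Rightarrow> ('w \<Rightarrow> real \<Rightarrow> 'a::metric_space) \<Rightarrow> (nat \<Rightarrow> 'w \<Rightarrow> ereal) \<Rightarrow> (nat \<Rightarrow> 'w \<Rightarrow> 'e) \<Rightarrow>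
     nat \<Rightarrow> 'w measure" where
  "jump_history M X \<tau> Y n = sigma (space M)
     ({(\<lambda>\<omega>. X \<omega> (real_of_ereal (min (ereal s) (\<tau> n \<omega>)))) -` B \<inter> space M | s B.
          0 \<le> s \<and> B \<in> sets borel} \<union>
      {\<tau> k -` B \<inter> space M | k B. k \<le> n \<and> B \<in> sets borel} \<union>
      {Y k -` B \<inter> space M | k B. 1 \<le> k \<and> k \<le> n})"

text \<open>
  \<open>\<eta> n\<close> is the path, of conditional law \<open>Q \<alpha> (X\<^bsub>\<tau> n\<^esub>)\<close> given the history up to \<open>\<tau> n\<close>, of which
  \<open>X\<close> follows the initial piece during \<open>[\<tau> n, \<tau> (n + 1))\<close>.
\<close>

definition diffuses_between_jumps ::
    "'i set \<Rightarrow> ('i \<Rightarrow> 'a::metric_space set) \<Rightarrow> ('i \<Rightarrow> 'a \<Rightarrow> (real \<Rightarrow> 'a) measure) \<Rightarrow>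
     'w measure \<Rightarrow> ('w \<Rightarrow> real \<Rightarrow> 'a) \<Rightarrow> (nat \<Rightarrow> 'w \<Rightarrow> ereal) \<Rightarrow> (nat \<Rightarrow> 'w \<Rightarrow> 'e) \<Rightarrow>
     (nat \<Rightarrow> 'w \<Rightarrow> real \<Rightarrow> 'a) \<Rightarrow> bool" where
  "diffuses_between_jumps I S Q M X \<tau> Y \<eta> \<longleftrightarrow>
     (AE \<omega> in M. \<forall>n. \<tau> n \<omega> < \<infinity> \<longrightarrow>
        (\<forall>s\<ge>0. \<tau> n \<omega> + ereal s < \<tau> (Suc n) \<omega> \<longrightarrow>
           X \<omega> (real_of_ereal (\<tau> n \<omega>) + s) = \<eta> n \<omega> s)) \<and>
     (\<forall>n. subalgebra M (jump_history M X \<tau> Y n)) \<and>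
     (\<forall>n. \<forall>\<alpha>\<in>I.
        let R = {\<omega> \<in> space M. \<tau> n \<omega> < \<infinity> \<and> state_at_jump X \<tau> n \<omega> \<in> S \<alpha>} in
          \<eta> n \<in> restrict_space M R \<rightarrow>\<^sub>M skorokhod_borel (S \<alpha>) \<and>
          (\<forall>\<Gamma>\<in>sets (skorokhod_borel (S \<alpha>)). AE \<omega> in M. \<omega> \<in> R \<longrightarrow>
             real_cond_exp M (jump_history M X \<tau> Y n) (indicator {\<omega>\<in>R. \<eta> n \<omega> \<in> \<Gamma>}) \<omega>
             = measure (Q \<alpha> (state_at_jump X \<tau> n \<omega>)) \<Gamma>))"

definition jump_count ::
    "('w \<Rightarrow> real \<Rightarrow> 'a) \<Rightarrow> (nat \<Rightarrow> 'w \<Rightarrow> ereal) \<Rightarrow> (nat \<Rightarrow> 'w \<Rightarrow> 'e) \<Rightarrow> 'e \<Rightarrow> 'a set \<Rightarrow>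
     real \<Rightarrow> 'w \<Rightarrow> real" where
  "jump_count X \<tau> Y e B t \<omega> =
     real (card {n. 1 \<le> n \<and> \<tau> n \<omega> \<le> ereal t \<and> Y n \<omega> = e \<and> state_at_jump X \<tau> n \<omega> \<in> B})"

definition marked_filtration ::
    "'w measure \<Rightarrow> ('w \<Rightarrow> real \<Rightarrow> 'a::metric_space) \<Rightarrow> 'e set \<Rightarrow> (nat \<Rightarrow> 'w \<Rightarrow> ereal) \<Rightarrow>
     (nat \<Rightarrow> 'w \<Rightarrow> 'e) \<Rightarrow> real \<Rightarrow> 'w measure" where
  "marked_filtration M X Edges \<tau> Y t = sigma (space M)
     (sets (natural_filtration (space M) X t) \<union>
      {jump_count X \<tau> Y e B s -` N \<inter> space M | e B s N.
         e \<in> Edges \<and> B \<in> sets borel \<and> s \<in> {0..t} \<and> N \<in> sets borel})"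

text \<open>
  The compensator is continuous and adapted, hence predictable, so that being the compensator means
  that the difference is a martingale. The rates are extended by \<open>0\<close> off the source stratum.
\<close>

definition jumps_governed_by ::
    "('i \<Rightarrow> 'a::metric_space set) \<Rightarrow> 'e set \<Rightarrow> ('e \<Rightarrow> 'i) \<Rightarrow> ('e \<Rightarrow> 'a \<Rightarrow> 'a measure) \<Rightarrow>
     ('e \<Rightarrow> 'a \<Rightarrow> real) \<Rightarrow> 'w measure \<Rightarrow> ('w \<Rightarrow> real \<Rightarrow> 'a) \<Rightarrow> (nat \<Rightarrow> 'w \<Rightarrow> ereal) \<Rightarrow>
     (nat \<Rightarrow> 'w \<Rightarrow> 'e) \<Rightarrow> bool" where
  "jumps_governed_by S Edges src K rate M X \<tau> Y \<longleftrightarrow>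
     (\<forall>e\<in>Edges. \<forall>B\<in>sets borel.
        martingale M (usual_augmentation M (marked_filtration M X Edges \<tau> Y))
          (\<lambda>t \<omega>. jump_count X \<tau> Y e B t \<omega> -
             (LINT s:{0..t}|lborel. let y = left_lim (X \<omega>) s in
                if y \<in> S (src e) then rate e y * measure (K e y) B else 0)))"

definition relatively_compact_exhaustion :: "(nat \<Rightarrow> 'a::metric_space set) \<Rightarrow> bool" where
  "relatively_compact_exhaustion O' \<longleftrightarrow>
     (\<forall>m. open (O' m) \<and> compact (closure (O' m)) \<and> closure (O' m) \<subseteq> O' (Suc m)) \<and> (\<Union>m. O' m) = UNIV"

definition exit_time :: "'a set \<Rightarrow> (real \<Rightarrow> 'a) \<Rightarrow> ereal" where
  "exit_time U \<omega> = Inf (ereal ` {t. 0 \<le> t \<and> \<omega> t \<notin> U})"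

definition non_explosive :: "'w measure \<Rightarrow> ('w \<Rightarrow> real \<Rightarrow> 'a::metric_space) \<Rightarrow> bool" where
  "non_explosive M X \<longleftrightarrow>
     (\<exists>O' :: nat \<Rightarrow> 'a set. relatively_compact_exhaustion O') \<and>
     (\<forall>O' :: nat \<Rightarrow> 'a set. relatively_compact_exhaustion O' \<longrightarrow>
        (AE \<omega> in M. (\<lambda>m. exit_time (O' m) (X \<omega>)) \<longlonglongrightarrow> \<infinity>))"

text \<open>
  A sample space large enough for the construction. HOL cannot quantify existentially over types, so
  the carrier type is fixed: for each stage a path, a clock, a jump type and a landing point.
\<close>

type_synonym ('a, 'e) sample = "nat \<Rightarrow> (real \<Rightarrow> 'a) \<times> real \<times> 'e \<times> 'a"

end

(*
  The process is assembled from independent stages. A stage started at y consists of a path of the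
  diffusion on the stratum of y, a clock that rings at time t with hazard rate \<Lambda> along the path,
  and a mark (edge and landing point) drawn from the normalised jump kernel at the position where the
  clock rings; the next stage starts at the landing point. As the rates are bounded, the expected
  discount exp(-clock) of a stage is bounded away from 1, so that infinitely many jumps in finite time
  have probability 0. Each stage satisfies Dynkin's formula up to its clock, by the Markov property of
  the diffusion and integration by parts against the clock; summing over the stages gives a martingale
  for every observable of the state and the marks, in particular for the functions of the operator's
  domain and for the number of jumps of a given type.
*)
theory Submission
  imports Defs
begin

section \<open>The Borel sets of Skorokhod space\<close>

text \<open>Measurability is settled by showing that the Borel sets of Skorokhod space are generated
  by the evaluations, so that path-valued maps are handled one time at a time. The obstacle in the
  martingale argument is that a clock is drawn after the whole path of its stage, whereas the
  filtration sees that path only up to the present. What saves the argument: as long as the clock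
  has not rung at elapsed time u, the observed past is a function of the earlier stages and of the
  running path stopped at u. The predicate \<open>determined\<close> records this, and it suffices
  to test one stage against events of its path up to u. Integrating out clock and mark leaves a path
  functional with survival weight exp(-H); Dynkin's formula and a swap of integrals over the
  triangle q \<le> r finish it. Right continuity in time and an integrable majorant then carry the
  identity over to the right-continuous completed filtration. The locale
  \<open>jump_martingale\<close> has three functions a, l, d, so that (iii) and (iv) are two
  instances of one computation: a = l = 0 with d an indicator, and d = 0.\<close>

lemma cadlag_pathsD:
  assumes "w \<in> cadlag_paths S"
  shows "w \<in> {0..} \<rightarrow>\<^sub>E S" "0 \<le> t \<Longrightarrow> (w \<longlongrightarrow> w t) (at_right t)"
    "0 < t \<Longrightarrow> \<exists>l\<in>S. (w \<longlongrightarrow> l) (at_left t)" "0 \<le> t \<Longrightarrow> w t \<in> S"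
  using assms by (auto simp: cadlag_paths_def)

lemma cadlag_paths_mono: "S \<subseteq> S' \<Longrightarrow> cadlag_paths S \<subseteq> cadlag_paths S'"
  unfolding cadlag_paths_def using PiE_mono[of "{0..}" "\<lambda>_. S" "\<lambda>_. S'"] by blast

text \<open>The trace of the product sigma-algebra. Unlike \<open>skorokhod_borel\<close> it also
  makes sense for path sets that are not of the form \<open>cadlag_paths S\<close>, such as the
  union of the path spaces of all strata.\<close>

definition path_algebra :: "(real \<Rightarrow> 'a::topological_space) set \<Rightarrow> (real \<Rightarrow> 'a) measure" where
  "path_algebra \<Omega> = restrict_space (PiM {0..} (\<lambda>_. borel)) \<Omega>"

lemma space_path_algebra: "\<Omega> \<subseteq> {0..} \<rightarrow>\<^sub>E UNIV \<Longrightarrow> space (path_algebra \<Omega>) = \<Omega>"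
  by (auto simp: path_algebra_def space_restrict_space space_PiM)

lemma cadlag_paths_subset: "cadlag_paths S \<subseteq> {0..} \<rightarrow>\<^sub>E UNIV"
  by (auto simp: cadlag_paths_def PiE_def)

lemma measurable_path_algebra_eval:
  "0 \<le> t \<Longrightarrow> (\<lambda>w. w t) \<in> path_algebra \<Omega> \<rightarrow>\<^sub>M borel"
  unfolding path_algebra_def by (rule measurable_restrict_space1) simp

lemma measurable_into_path_algebra:
  assumes "\<Omega> \<subseteq> {0..} \<rightarrow>\<^sub>E UNIV" "\<And>x. x \<in> space M \<Longrightarrow> f x \<in> \<Omega>"
    and "\<And>t. 0 \<le> t \<Longrightarrow> (\<lambda>x. f x t) \<in> M \<rightarrow>\<^sub>M borel"
  shows "f \<in> M \<rightarrow>\<^sub>M path_algebra \<Omega>"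
  unfolding path_algebra_def
proof (rule measurable_restrict_space2)
  show "f \<in> space M \<rightarrow> \<Omega>" using assms(2) by auto
  have "(\<lambda>x. \<lambda>i\<in>{0..}. f x i) \<in> M \<rightarrow>\<^sub>M PiM {0..} (\<lambda>_. borel)"
    using assms(3) by (intro measurable_restrict) auto
  moreover have "(\<lambda>i\<in>{0..}. f x i) = f x" if "x \<in> space M" for x
    using assms(1) assms(2)[OF that] by (auto simp: restrict_def PiE_def extensional_def fun_eq_iff)
  ultimately show "f \<in> M \<rightarrow>\<^sub>M PiM {0..} (\<lambda>_. borel)"
    by (simp cong: measurable_cong)
qed

text \<open>Evaluate at the next grid point to the right of t: this is a countable selection among
  measurable maps, and refining the grid recovers the value at t by right continuity.\<close>

lemma measurable_right_continuous_process:
  fixes X :: "'w \<Rightarrow> real \<Rightarrow> 'a::metric_space"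
  assumes rc: "\<And>w t. w \<in> space M \<Longrightarrow> 0 \<le> t \<Longrightarrow> (X w \<longlongrightarrow> X w t) (at_right t)"
    and m: "\<And>t. 0 \<le> t \<Longrightarrow> (\<lambda>w. X w t) \<in> M \<rightarrow>\<^sub>M borel"
  shows "(\<lambda>(w, t). X w (max 0 t)) \<in> M \<Otimes>\<^sub>M borel \<rightarrow>\<^sub>M borel"
proof -
  \<comment> \<open>The \<open>+ 1\<close> after the floor makes the grid point lie strictly to the
    right of t, as a limit along \<open>at_right\<close> demands.\<close>
  define q where "q n t = (real (nat \<lfloor>real (Suc n) * max 0 t\<rfloor>) + 1) / real (Suc n)" for n :: nat and t :: real
  have q_gt: "q n t > max 0 t" for n t
  proof -
    have "real (Suc n) * max 0 t < real (nat \<lfloor>real (Suc n) * max 0 t\<rfloor>) + 1"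
      by linarith
    then have "real (Suc n) * max 0 t < real (Suc n) * q n t" unfolding q_def by simp
    then show ?thesis by (simp only: mult_less_cancel_left_pos of_nat_0_less_iff zero_less_Suc)
  qed
  have q_le: "q n t \<le> max 0 t + 1 / real (Suc n)" for n t
  proof -
    have "real (nat \<lfloor>real (Suc n) * max 0 t\<rfloor>) \<le> real (Suc n) * max 0 t"
      by (simp add: of_nat_nat)
    moreover have "(a + 1) / c \<le> b + 1 / c" if "a \<le> c * b" "0 < c" for a b c :: real
      using that by (simp add: field_simps)
    ultimately show ?thesis unfolding q_def by simp
  qed
  have q_lim: "filterlim (\<lambda>n. q n t) (at_right (max 0 t)) sequentially" for t
    unfolding filterlim_at
  proof
    show "\<forall>\<^sub>F n in sequentially. q n t \<in> {max 0 t<..} \<and> q n t \<noteq> max 0 t"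
      using q_gt[of t] by (intro always_eventually allI) (metis greaterThan_iff less_irrefl)
    show "(\<lambda>n. q n t) \<longlonglongrightarrow> max 0 t"
    proof (rule tendsto_sandwich[where f="\<lambda>n. max 0 t" and h="\<lambda>n. max 0 t + 1 / real (Suc n)"])
      have "(\<lambda>n. max 0 t + 1 / real (Suc n)) \<longlonglongrightarrow> max 0 t + 0"
        using LIMSEQ_inverse_real_of_nat by (intro tendsto_intros) (simp add: inverse_eq_divide)
      then show "(\<lambda>n. max 0 t + 1 / real (Suc n)) \<longlonglongrightarrow> max 0 t" by simp
    qed (use less_imp_le[OF q_gt[of t]] q_le[where t=t] in \<open>auto intro!: always_eventually simp del: of_nat_Suc\<close>)
  qed
  show ?thesis
  proof (rule borel_measurable_LIMSEQ_metric)
    fix n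
    have "(\<lambda>x. X (fst x) ((real (nat \<lfloor>real (Suc n) * max 0 (snd x)\<rfloor>) + 1) / real (Suc n)))
        \<in> M \<Otimes>\<^sub>M borel \<rightarrow>\<^sub>M borel"
      by (rule measurable_compose_countable[where f="\<lambda>i x. X (fst x) ((real i + 1) / real (Suc n))"])
        (auto intro!: measurable_compose[OF measurable_fst m])
    then show "(\<lambda>x. X (fst x) (q n (snd x))) \<in> M \<Otimes>\<^sub>M borel \<rightarrow>\<^sub>M borel"
      by (simp add: q_def)
  next
    fix x :: "'w \<times> real" assume "x \<in> space (M \<Otimes>\<^sub>M borel)"
    then have "fst x \<in> space M" by (auto simp: space_pair_measure)
    from filterlim_compose[OF rc[OF this, of "max 0 (snd x)"] q_lim[of "snd x"]]
    show "(\<lambda>n. X (fst x) (q n (snd x))) \<longlonglongrightarrow> (case x of (w, t) \<Rightarrow> X w (max 0 t))"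
      by (simp add: split_beta)
  qed
qed

lemma measurable_process_at:
  fixes X :: "'w \<Rightarrow> real \<Rightarrow> 'a::metric_space"
  assumes rc: "\<And>w t. w \<in> space M \<Longrightarrow> 0 \<le> t \<Longrightarrow> (X w \<longlongrightarrow> X w t) (at_right t)"
    and m: "\<And>t. 0 \<le> t \<Longrightarrow> (\<lambda>w. X w t) \<in> M \<rightarrow>\<^sub>M borel"
    and T: "T \<in> borel_measurable M" "\<And>w. w \<in> space M \<Longrightarrow> 0 \<le> T w"
  shows "(\<lambda>w. X w (T w)) \<in> M \<rightarrow>\<^sub>M borel"
proof -
  have "(\<lambda>w. (case (w, T w) of (w, t) \<Rightarrow> X w (max 0 t))) \<in> M \<rightarrow>\<^sub>M borel"
    by (rule measurable_compose[OF _ measurable_right_continuous_process[OF rc m]]) (use T in auto)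
  then show ?thesis
    by (rule measurable_cong[THEN iffD1, rotated]) (use T in auto)
qed

text \<open>
  Cutting a path whenever it has moved by more than \<open>\<delta>\<close> since the previous cut yields finitely many
  pieces on every bounded interval. Two paths with close cutting times and close values there are
  close in Skorokhod's sense.
\<close>

primrec osc_time :: "real \<Rightarrow> (real \<Rightarrow> 'a::metric_space) \<Rightarrow> nat \<Rightarrow> ereal" where
  "osc_time \<delta> w 0 = 0"
| "osc_time \<delta> w (Suc i) = Inf (ereal ` {t. osc_time \<delta> w i < ereal t \<and>
     \<delta> < dist (w t) (w (real_of_ereal (osc_time \<delta> w i)))})"

lemma osc_time_le_Suc: "osc_time \<delta> w i \<le> osc_time \<delta> w (Suc i)"
  by (auto intro!: Inf_greatest)

lemma osc_time_nonneg: "0 \<le> osc_time \<delta> w i"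
proof (induction i)
  case (Suc i)
  then show ?case using osc_time_le_Suc[of \<delta> w i] by (rule order_trans)
qed simp

lemma osc_time_mono: "i \<le> j \<Longrightarrow> osc_time \<delta> w i \<le> osc_time \<delta> w j"
  using osc_time_le_Suc by (rule lift_Suc_mono_le[of "osc_time \<delta> w"])

lemma osc_time_real:
  "osc_time \<delta> w i < \<infinity> \<Longrightarrow> ereal (real_of_ereal (osc_time \<delta> w i)) = osc_time \<delta> w i"
  using osc_time_nonneg[of \<delta> w i] by (cases "osc_time \<delta> w i") auto

lemma osc_time_dist:
  assumes "0 \<le> \<delta>" "osc_time \<delta> w i \<le> ereal t" "ereal t < osc_time \<delta> w (Suc i)"
  shows "dist (w t) (w (real_of_ereal (osc_time \<delta> w i))) \<le> \<delta>"
proof (cases "osc_time \<delta> w i = ereal t")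
  case False
  show ?thesis
  proof (rule ccontr)
    assume "\<not> ?thesis"
    then have "osc_time \<delta> w (Suc i) \<le> ereal t"
      using False assms by (auto intro!: Inf_lower)
    then show False using assms(3) by simp
  qed
qed (use assms in auto)

text \<open>Right continuity keeps the path within \<delta> of its value at a cut for some positive
  time.\<close>

lemma osc_time_less_Suc:
  assumes "w \<in> cadlag_paths S" "0 < \<delta>" "osc_time \<delta> w i < \<infinity>"
  shows "osc_time \<delta> w i < osc_time \<delta> w (Suc i)"
proof -
  define s where "s = real_of_ereal (osc_time \<delta> w i)"
  have s: "osc_time \<delta> w i = ereal s" "0 \<le> s"
    using osc_time_real[OF assms(3)] osc_time_nonneg[of \<delta> w i] by (auto simp: s_def real_of_ereal_pos)
  from tendstoD[OF cadlag_pathsD(2)[OF assms(1) s(2)] assms(2)]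
  obtain b where b: "b > s" "\<And>t. s < t \<Longrightarrow> t < b \<Longrightarrow> dist (w t) (w s) < \<delta>"
    unfolding eventually_at_right_field by auto
  have "ereal b \<le> osc_time \<delta> w (Suc i)"
    unfolding osc_time.simps
  proof (rule Inf_greatest, clarsimp simp: s)
    fix t assume t: "s < t" "\<delta> < dist (w t) (w s)"
    then show "b \<le> t" using b(2)[of t] by (cases "t < b") auto
  qed
  then show ?thesis using b(1) s by (metis less_ereal.simps(1) less_le_trans)
qed

text \<open>If the cuts accumulated at L, the left limit at L would bring all values just before L
  within \<delta>/2 of each other, and no further cut could occur before L.\<close>

lemma osc_time_unbounded:
  assumes w: "w \<in> cadlag_paths S" and "0 < \<delta>"
  shows "\<exists>k. ereal T < osc_time \<delta> w k"
proof (rule ccontr)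
  assume "\<not> ?thesis"
  then have le: "osc_time \<delta> w k \<le> ereal T" for k by (auto simp: not_less)
  define s where "s k = real_of_ereal (osc_time \<delta> w k)" for k
  have fin: "osc_time \<delta> w k < \<infinity>" for k using le[of k] by (cases "osc_time \<delta> w k") auto
  have s: "osc_time \<delta> w k = ereal (s k)" for k
    using osc_time_real[OF fin] by (simp add: s_def)
  have s0: "0 \<le> s k" for k using osc_time_nonneg[of \<delta> w k] s by simp
  have sT: "s k \<le> T" for k using le[of k] s by simp
  have inc: "s k < s (Suc k)" for k using osc_time_less_Suc[OF w assms(2) fin[of k]] unfolding s by simp
  have "incseq s" using inc by (intro incseq_SucI less_imp_le)
  from incseq_convergent[OF this] sT obtain L where L: "s \<longlonglongrightarrow> L" "\<And>k. s k \<le> L" by blast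
  have sL: "s k < L" for k using L(2)[of "Suc k"] inc[of k] by simp
  have "0 < L" using sL[of 0] s0[of 0] by simp
  then obtain l where l: "(w \<longlongrightarrow> l) (at_left L)" using cadlag_pathsD(3)[OF w] by blast
  from tendstoD[OF l, of "\<delta>/4"] \<open>0 < \<delta>\<close>
  obtain b where b: "b < L" "\<And>t. b < t \<Longrightarrow> t < L \<Longrightarrow> dist (w t) l < \<delta>/4"
    unfolding eventually_at_left_field by auto
  obtain k where k: "b < s k" using order_tendstoD(1)[OF L(1) b(1)] by (auto simp: eventually_sequentially)
  have "ereal L \<le> osc_time \<delta> w (Suc k)"
    unfolding osc_time.simps
  proof (rule Inf_greatest, clarsimp simp: s)
    fix t assume t: "s k < t" "\<delta> < dist (w t) (w (s k))"
    show "L \<le> t"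
    proof (rule ccontr)
      assume "\<not> L \<le> t"
      then have "dist (w t) l < \<delta>/4" "dist (w (s k)) l < \<delta>/4"
        using b(2)[of t] b(2)[of "s k"] t k sL[of k] by auto
      then show False using dist_triangle2[of "w t" "w (s k)" l] t \<open>0 < \<delta>\<close> by linarith
    qed
  qed
  then show False using sL[of "Suc k"] s[of "Suc k"] by simp
qed

text \<open>The cutting time and the value there are treated together, since the next cutting time
  is defined through the value at the current one.\<close>

lemma measurable_osc_time:
  fixes S :: "'a::{metric_space, second_countable_topology} set"
  assumes "0 < \<delta>"
  shows "(\<lambda>w. osc_time \<delta> w i) \<in> borel_measurable (path_algebra (cadlag_paths S))"
    "(\<lambda>w. w (real_of_ereal (osc_time \<delta> w i))) \<in> path_algebra (cadlag_paths S) \<rightarrow>\<^sub>M borel"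
proof -
  let ?M = "path_algebra (cadlag_paths S)"
  have sp: "space ?M = cadlag_paths S" by (rule space_path_algebra[OF cadlag_paths_subset])
  have 2: "(\<lambda>w. w (real_of_ereal (osc_time \<delta> w i))) \<in> ?M \<rightarrow>\<^sub>M borel"
    if "(\<lambda>w. osc_time \<delta> w i) \<in> borel_measurable ?M" for i
  proof (rule measurable_process_at[where X="\<lambda>w. w"])
    show "(\<lambda>w. real_of_ereal (osc_time \<delta> w i)) \<in> borel_measurable ?M" using that by simp
    show "0 \<le> real_of_ereal (osc_time \<delta> w i)" for w :: "real \<Rightarrow> 'a"
      by (rule real_of_ereal_pos[OF osc_time_nonneg])
  qed (auto simp: sp intro: cadlag_pathsD(2) measurable_path_algebra_eval)
  show 1: "(\<lambda>w. osc_time \<delta> w i) \<in> borel_measurable ?M"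
  proof (induction i)
    case (Suc i)
    note [measurable] = Suc 2[OF Suc]
    \<comment> \<open>The oscillation condition is strict, so by right continuity a real witness can
      be moved slightly to the right onto a rational one. The \<open>max 0\<close> is there because
      evaluation is measurable only at nonnegative times.\<close>
    have *: "osc_time \<delta> w (Suc i) < c \<longleftrightarrow> (\<exists>q::rat. osc_time \<delta> w i < ereal (of_rat q) \<and>
        \<delta> < dist (w (max 0 (of_rat q))) (w (real_of_ereal (osc_time \<delta> w i))) \<and> ereal (of_rat q) < c)"
      (is "?l \<longleftrightarrow> ?r") if w: "w \<in> space ?M" for w c
    proof
      assume ?l
      then obtain t where t: "osc_time \<delta> w i < ereal t"
        "\<delta> < dist (w t) (w (real_of_ereal (osc_time \<delta> w i)))" "ereal t < c"
        by (auto simp: Inf_less_iff)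
      have "0 \<le> t" using osc_time_nonneg[of \<delta> w i] t(1) by (metis ereal_less_eq(5) order.strict_trans1 order_less_imp_le)
      with w have "(w \<longlongrightarrow> w t) (at_right t)" by (simp add: sp cadlag_pathsD)
      then have "((\<lambda>s. dist (w s) (w (real_of_ereal (osc_time \<delta> w i)))) \<longlongrightarrow>
          dist (w t) (w (real_of_ereal (osc_time \<delta> w i)))) (at_right t)"
        by (intro tendsto_intros)
      from order_tendstoD(1)[OF this t(2)] obtain b where b: "b > t"
        "\<And>s. t < s \<Longrightarrow> s < b \<Longrightarrow> \<delta> < dist (w s) (w (real_of_ereal (osc_time \<delta> w i)))"
        unfolding eventually_at_right_field by auto
      obtain b' where b': "t < b'" "ereal b' \<le> c"
      proof (cases c)
        case (real r) then show ?thesis using that[of r] t by auto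
      next
        case PInf then show ?thesis using that[of "t+1"] by auto
      qed (use t in auto)
      obtain q where q: "t < of_rat q" "of_rat q < min b b'"
        using of_rat_dense[of t "min b b'"] b(1) b'(1) by auto
      have "ereal (of_rat q) < c" using q b'(2) by (metis less_ereal.simps(1) min_less_iff_conj order_less_le_trans)
      moreover have "osc_time \<delta> w i < ereal (of_rat q)"
        using t(1) q(1) by (meson less_ereal.simps(1) order.strict_trans)
      ultimately show ?r
        using q b(2)[of "of_rat q"] max_absorb2[of 0 "of_rat q :: real"] \<open>0 \<le> t\<close>
        by (intro exI[of _ q]) (simp del: zero_le_of_rat_iff)
    next
      assume ?r
      then obtain q :: rat where q: "osc_time \<delta> w i < ereal (of_rat q)"
        "\<delta> < dist (w (max 0 (of_rat q))) (w (real_of_ereal (osc_time \<delta> w i)))" "ereal (of_rat q) < c"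
        by auto
      have "0 \<le> (of_rat q :: real)"
        using osc_time_nonneg[of \<delta> w i] q(1) by (metis ereal_less_eq(5) order.strict_trans1 order_less_imp_le)
      then have "max 0 (of_rat q) = (of_rat q :: real)" by simp
      then show ?l unfolding osc_time.simps Inf_less_iff using q
        by (intro bexI[of _ "ereal (of_rat q)"]) simp_all
    qed
    have [measurable]: "(\<lambda>w. w (max 0 (of_rat q))) \<in> ?M \<rightarrow>\<^sub>M borel" for q
      by (rule measurable_path_algebra_eval) simp
    show ?case
    proof (rule borel_measurableI_less)
      fix c
      have "{w \<in> space ?M. osc_time \<delta> w (Suc i) < c} = {w \<in> space ?M. \<exists>q::rat. osc_time \<delta> w i < ereal (of_rat q) \<and>
        \<delta> < dist (w (max 0 (of_rat q))) (w (real_of_ereal (osc_time \<delta> w i))) \<and> ereal (of_rat q) < c}"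
        using * by blast
      also have "\<dots> \<in> sets ?M" by measurable
      finally show "{w \<in> space ?M. osc_time \<delta> w (Suc i) < c} \<in> sets ?M" .
    qed
  qed simp
  show "(\<lambda>w. w (real_of_ereal (osc_time \<delta> w i))) \<in> ?M \<rightarrow>\<^sub>M borel" by (rule 2[OF 1])
qed

text \<open>Linear interpolation of the nodes, continued with slope 1 after the last node. The
  induction changes the function only beyond \<open>a k\<close>, where the previous one has slope
  1.\<close>

lemma time_change_exists:
  fixes a b :: "nat \<Rightarrow> real"
  assumes "0 < \<epsilon>" "a 0 = 0" "b 0 = 0"
    and "\<And>i. i < k \<Longrightarrow> a i < a (Suc i)" "\<And>i. i < k \<Longrightarrow> b i < b (Suc i)"
    and "\<And>i. i \<le> k \<Longrightarrow> \<bar>b i - a i\<bar> < \<epsilon>"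
  shows "\<exists>l. strict_mono_on {0..} l \<and> l ` {0..} = {0..} \<and> (\<forall>t\<ge>0. \<bar>l t - t\<bar> < \<epsilon>) \<and>
    (\<forall>i\<le>k. l (a i) = b i) \<and> (\<forall>t\<ge>a k. l t = b k + (t - a k))"
  using assms(4-)
proof (induction k)
  case 0
  have "(\<lambda>t. t) ` {0::real..} = {0..}" by auto
  then show ?case using assms(1-3) by (intro exI[of _ "\<lambda>t. t"]) (auto intro: strict_mono_onI)
next
  case (Suc k)
  then obtain l where l: "strict_mono_on {0..} l" "l ` {0..} = {0..}" "\<And>t. 0 \<le> t \<Longrightarrow> \<bar>l t - t\<bar> < \<epsilon>"
    "\<And>i. i \<le> k \<Longrightarrow> l (a i) = b i" "\<And>t. a k \<le> t \<Longrightarrow> l t = b k + (t - a k)"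
    by (metis (no_types, lifting) le_Suc_eq less_SucI)
  have inc: "a k < a (Suc k)" "b k < b (Suc k)" using Suc.prems by auto
  define l' where "l' t = (if t \<le> a k then l t else if t \<le> a (Suc k)
    then b k + (t - a k) * ((b (Suc k) - b k) / (a (Suc k) - a k)) else b (Suc k) + (t - a (Suc k)))" for t
  have step: "a j < a (Suc j)" if "j < Suc k" for j using Suc.prems(1) that .
  define r where "r = (b (Suc k) - b k) / (a (Suc k) - a k)"
  have r: "0 < r" "(a (Suc k) - a k) * r = b (Suc k) - b k" using inc by (auto simp: r_def)
  have a_mono: "a i \<le> a j" if "i \<le> j" "j \<le> Suc k" for i j
    using that
  proof (induction j)
    case (Suc j)
    then show ?case using step[of j] by (cases "i = Suc j") force+
  qed simp
  have a0: "0 \<le> a k" using a_mono[of 0 k] assms(2) by simp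
  have lk: "l (a k) = b k" using l(4)[of k] by simp
  have mono: "l' s < l' t" if "0 \<le> s" "s < t" for s t
  proof -
    have A: "s < t \<Longrightarrow> t \<le> a k \<Longrightarrow> l s < l t" using l(1) that by (auto simp: strict_mono_on_def)
    have B: "l s \<le> b k" if "s \<le> a k"
      using strict_mono_onD[OF l(1), of s "a k"] lk that \<open>0 \<le> s\<close> a0 by (cases "s = a k") auto
    have C: "0 < (t - a k) * r" if "a k < t" for t using r(1) that by simp
    have D: "(t - a k) * r \<le> b (Suc k) - b k" if "t \<le> a (Suc k)" for t
      using r mult_right_mono[of "t - a k" "a (Suc k) - a k" r] that by simp
    have F: "(s - a k) * r < (t - a k) * r" using r(1) that by simp
    show ?thesis
      unfolding l'_def r_def[symmetric]
      using A B C[of t] D[of s] F inc \<open>s < t\<close> by (smt (verit))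
  qed
  have nn: "0 \<le> l' t" if "0 \<le> t" for t
  proof -
    have "l' 0 = 0" using l(4)[of 0] a0 assms(2,3) by (simp add: l'_def)
    then show ?thesis using mono[of 0 t] that by (cases "t = 0") auto
  qed
  have surj: "\<exists>t\<ge>0. l' t = u" if "0 \<le> u" for u
  proof -
    consider "u \<le> b k" | "b k < u" "u \<le> b (Suc k)" | "b (Suc k) < u" by linarith
    then show ?thesis
    proof cases
      case 1
      have "u \<in> l ` {0..}" using l(2) that by simp
      then obtain t where t: "0 \<le> t" "l t = u" by auto
      have "t \<le> a k"
      proof (rule ccontr)
        assume "\<not> t \<le> a k"
        then have "b k < l t" using l(5)[of t] by simp
        then show False using t 1 by simp
      qed
      then show ?thesis using t by (auto simp: l'_def)
    next
      case 2
      define t where "t = a k + (u - b k) / r"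
      have "a k < t" using 2 r(1) by (simp add: t_def)
      moreover have "t \<le> a (Suc k)" using 2 r by (simp add: t_def field_simps)
      moreover have "b k + (t - a k) * r = u" using r(1) by (simp add: t_def)
      ultimately show ?thesis using a0 by (intro exI[of _ t]) (auto simp: l'_def r_def[symmetric])
    next
      case 3
      then show ?thesis using inc a0
        by (intro exI[of _ "u - b (Suc k) + a (Suc k)"]) (auto simp: l'_def)
    qed
  qed
  have close: "\<bar>l' t - t\<bar> < \<epsilon>" if "0 \<le> t" for t
  proof -
    consider "t \<le> a k" | "a k < t" "t \<le> a (Suc k)" | "a (Suc k) < t" by linarith
    then show ?thesis
    proof cases
      case 2
      \<comment> \<open>Between two nodes the displacement l' t - t is a convex combination of the
        displacements at the nodes, hence still below \<epsilon>.\<close>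
      define c where "c = (t - a k) / (a (Suc k) - a k)"
      have c: "0 \<le> c" "c \<le> 1" using 2 by (auto simp: c_def)
      have tc: "t - a k = c * (a (Suc k) - a k)" using inc by (simp add: c_def)
      have "l' t = b k + c * (b (Suc k) - b k)" using 2 by (simp add: l'_def c_def)
      then have "l' t - t = (1 - c) * (b k - a k) + c * (b (Suc k) - a (Suc k))"
        using tc by (simp add: algebra_simps)
      also have "\<bar>\<dots>\<bar> \<le> (1 - c) * \<bar>b k - a k\<bar> + c * \<bar>b (Suc k) - a (Suc k)\<bar>"
        using c by (intro order_trans[OF abs_triangle_ineq]) (simp add: abs_mult)
      also have "\<dots> < \<epsilon>"
        using Suc.prems(3)[of k] Suc.prems(3)[of "Suc k"] c
        by (intro convex_bound_lt) auto
      finally show ?thesis .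
    qed (use l(3)[OF that] inc Suc.prems(3)[of "Suc k"] in \<open>auto simp: l'_def\<close>)
  qed
  have vals: "l' (a i) = b i" if "i \<le> Suc k" for i
  proof (cases "i = Suc k")
    case True
    then show ?thesis using inc r by (simp add: l'_def r_def[symmetric] mult.commute)
  next
    case False
    then show ?thesis using that l(4)[of i] a_mono[of i k] by (simp add: l'_def)
  qed
  have "strict_mono_on {0..} l'" using mono by (auto intro!: strict_mono_onI)
  moreover have "l' ` {0..} = {0..}" using nn surj by (force simp: image_iff)
  moreover have "\<forall>t\<ge>a (Suc k). l' t = b (Suc k) + (t - a (Suc k))"
    using inc r by (auto simp: l'_def r_def[symmetric] mult.commute)
  ultimately show ?case using close vals by blast
qed

text \<open>Evaluations are not continuous for the J1 topology, but hitting an open set during an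
  open time interval is an open event, and shrinking intervals to the right of t recover the value
  at t. Conversely, an open set is a countable union, over mesh, number of cuts and horizon, of sets
  described by finitely many cutting times and values.\<close>

lemma sets_skorokhod_borel:
  fixes S :: "'a::{metric_space, second_countable_topology} set"
  shows "sets (skorokhod_borel S) = sets (path_algebra (cadlag_paths S))"
proof (rule equalityI)
  let ?D = "cadlag_paths S" and ?M = "path_algebra (cadlag_paths S)"
  have sp: "space ?M = ?D" by (rule space_path_algebra[OF cadlag_paths_subset])
  have open_Pow: "{U. openin (skorokhod_topology S) U} \<subseteq> Pow ?D"
    by (auto simp: openin_skorokhod_topology)
  have ssb: "sets (skorokhod_borel S) = sigma_sets ?D {U. openin (skorokhod_topology S) U}"
    unfolding skorokhod_borel_def by (rule sets_measure_of[OF open_Pow])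
  have spb: "space (skorokhod_borel S) = ?D"
    unfolding skorokhod_borel_def by (rule space_measure_of[OF open_Pow])
  show "sets ?M \<subseteq> sets (skorokhod_borel S)"
  proof -
    \<comment> \<open>A small time change keeps the hitting time inside the open window, and a small
      displacement keeps the value inside the open set.\<close>
    have hit: "{w \<in> ?D. \<exists>s\<in>{c<..<d}. w s \<in> G} \<in> sets (skorokhod_borel S)" if "0 \<le> c" "open G" for c d G
    proof -
      have "openin (skorokhod_topology S) {w \<in> ?D. \<exists>s\<in>{c<..<d}. w s \<in> G}"
        unfolding openin_skorokhod_topology
      proof (intro conjI ballI)
        show "{w \<in> ?D. \<exists>s\<in>{c<..<d}. w s \<in> G} \<subseteq> ?D" by blast
        fix w assume "w \<in> {w \<in> ?D. \<exists>s\<in>{c<..<d}. w s \<in> G}"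
        then obtain s where w: "w \<in> ?D" and s: "s \<in> {c<..<d}" "w s \<in> G" by blast
        obtain r where r: "r > 0" "ball (w s) r \<subseteq> G" using \<open>open G\<close> s(2) by (auto simp: open_contains_ball)
        define \<epsilon> where "\<epsilon> = min r (min (s - c) (d - s))"
        have \<epsilon>: "\<epsilon> > 0" "\<epsilon> \<le> r" "\<epsilon> \<le> s - c" "\<epsilon> \<le> d - s" using r s by (auto simp: \<epsilon>_def)
        \<comment> \<open>By time d + 1 the time change has certainly passed s, so the time that it
          sends to s lies within the horizon of the neighbourhood.\<close>
        have "skorokhod_nbhd S w (d + 1) \<epsilon> \<subseteq> {w \<in> ?D. \<exists>s\<in>{c<..<d}. w s \<in> G}"
        proof
          fix w' assume "w' \<in> skorokhod_nbhd S w (d + 1) \<epsilon>"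
          then obtain l where l: "w' \<in> ?D" "strict_mono_on {0..} l" "l ` {0..} = {0..}"
            "\<And>t. t \<in> {0..d+1} \<Longrightarrow> \<bar>l t - t\<bar> < \<epsilon> \<and> dist (w' t) (w (l t)) < \<epsilon>"
            unfolding skorokhod_nbhd_def by blast
          have "0 \<le> s" "0 \<le> d" using s that by auto
          then have "s \<in> l ` {0..}" using l(3) by simp
          then obtain t where t: "0 \<le> t" "l t = s" by auto
          have "t \<le> d + 1"
          proof (rule ccontr)
            assume "\<not> t \<le> d + 1"
            then have "l (d + 1) < l t" using l(2) \<open>0 \<le> d\<close> t by (auto simp: strict_mono_on_def)
            then show False using l(4)[of "d + 1"] \<open>0 \<le> d\<close> t \<epsilon> s(1) by auto
          qed
          then have lt: "\<bar>s - t\<bar> < \<epsilon>" "dist (w' t) (w s) < \<epsilon>" using l(4)[of t] t by auto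
          then have "w' t \<in> ball (w s) r" using \<epsilon>(2) by (simp add: dist_commute)
          then show "w' \<in> {w \<in> ?D. \<exists>s\<in>{c<..<d}. w s \<in> G}"
            using r l(1) lt(1) \<epsilon> by (auto intro!: bexI[of _ t])
        qed
        then show "\<exists>T>0. \<exists>\<epsilon>>0. skorokhod_nbhd S w T \<epsilon> \<subseteq> {w \<in> ?D. \<exists>s\<in>{c<..<d}. w s \<in> G}"
          using \<epsilon>(1) s that by (intro exI[of _ "d+1"] conjI exI[of _ \<epsilon>]) auto
      qed
      then show ?thesis unfolding ssb by (intro sigma_sets.Basic) simp
    qed
    have ev: "(\<lambda>w. w t) \<in> skorokhod_borel S \<rightarrow>\<^sub>M borel" if t: "0 \<le> t" for t
    proof (rule borel_measurableI)
      fix G :: "'a set" assume G: "open G"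
      show "(\<lambda>w. w t) -` G \<inter> space (skorokhod_borel S) \<in> sets (skorokhod_borel S)"
      proof (cases "G = UNIV")
        case False
        \<comment> \<open>A value lies in G iff, for some k, the path stays out of
          \<open>V k\<close> on some interval to the right. The case G = UNIV is apart because
          \<open>infdist\<close> to the empty set is 0 by convention.\<close>
        define V where "V k = {x. infdist x (- G) < 1 / real (Suc k)}" for k
        have V: "open (V k)" for k unfolding V_def by (intro open_Collect_less continuous_intros)
        have "(\<lambda>w. w t) -` G \<inter> space (skorokhod_borel S) =
          (\<Union>k. \<Union>n. ?D - {w \<in> ?D. \<exists>s\<in>{t<..<t + 1 / real (Suc n)}. w s \<in> V k})" (is "?l = ?r")
        proof (intro equalityI subsetI)
          fix w assume "w \<in> ?l"
          then have w: "w \<in> space (skorokhod_borel S)" "w t \<in> G" by auto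
          then have D: "w \<in> ?D" by (simp add: spb)
          have "infdist (w t) (- G) > 0"
            using w(2) G False by (metis ComplD closed_Compl compl_bot_eq double_compl infdist_pos_not_in_closed)
          moreover have "((\<lambda>s. infdist (w s) (- G)) \<longlongrightarrow> infdist (w t) (- G)) (at_right t)"
            using cadlag_pathsD(2)[OF D t] by (intro tendsto_intros)
          moreover obtain k where k: "1 / real (Suc k) < infdist (w t) (- G)"
            using nat_approx_posE[OF \<open>infdist (w t) (- G) > 0\<close>] by blast
          ultimately obtain b where b: "b > t" "\<And>s. t < s \<Longrightarrow> s < b \<Longrightarrow> 1 / real (Suc k) < infdist (w s) (- G)"
            using order_tendstoD(1)[of _ _ "at_right t" "1 / real (Suc k)"] unfolding eventually_at_right_field by metis
          obtain n where n: "1 / real (Suc n) < b - t" using nat_approx_posE[of "b - t"] b(1) by auto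
          show "w \<in> ?r"
            using D b(2) n by (intro UN_I[of k] UN_I[of n]) (auto simp: V_def not_less intro!: less_imp_le)
        next
          fix w assume "w \<in> ?r"
          then obtain k n where D: "w \<in> ?D" and no: "w \<notin> {w \<in> ?D. \<exists>s\<in>{t<..<t + 1 / real (Suc n)}. w s \<in> V k}"
            by blast
          have "((\<lambda>s. infdist (w s) (- G)) \<longlongrightarrow> infdist (w t) (- G)) (at_right t)"
            using cadlag_pathsD(2)[OF D t] by (intro tendsto_intros)
          moreover have "\<forall>\<^sub>F s in at_right t. 1 / real (Suc k) \<le> infdist (w s) (- G)"
            unfolding eventually_at_right_field
            by (rule exI[of _ "t + 1 / real (Suc n)"]) (use D no in \<open>auto simp: V_def not_less\<close>)
          ultimately have "1 / real (Suc k) \<le> infdist (w t) (- G)"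
            by (rule tendsto_lowerbound) simp
          then have "w t \<in> G" using infdist_zero[of "w t" "- G"] by (cases "w t \<in> G") auto
          then show "w \<in> ?l" using D by (simp add: spb)
        qed
        also have "\<dots> \<in> sets (skorokhod_borel S)"
          using sets.top[of "skorokhod_borel S"] hit[OF t V] by (intro sets.countable_UN sets.Diff) (auto simp: spb)
        finally show ?thesis .
      qed auto
    qed
    have "(\<lambda>w. w) \<in> skorokhod_borel S \<rightarrow>\<^sub>M ?M"
      by (rule measurable_into_path_algebra[OF cadlag_paths_subset]) (use ev in \<open>auto simp: spb\<close>)
    from measurable_sets[OF this] show ?thesis
      using sets.sets_into_space[of _ ?M] by (auto simp: spb sp) (metis Int_absorb2)
  qed
  show "sets (skorokhod_borel S) \<subseteq> sets ?M"
    unfolding ssb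
  proof (rule sets.sigma_sets_subset')
    show "?D \<in> sets ?M" using sets.top[of ?M] by (simp add: sp)
    show "{U. openin (skorokhod_topology S) U} \<subseteq> sets ?M"
    proof
      fix U assume "U \<in> {U. openin (skorokhod_topology S) U}"
      then have U: "openin (skorokhod_topology S) U" by simp
      define \<sigma> :: "nat \<Rightarrow> (real \<Rightarrow> 'a) \<Rightarrow> nat \<Rightarrow> ereal" where "\<sigma> m = osc_time (1 / real (Suc m))" for m
      define \<Phi> where "\<Phi> m w = (\<lambda>i. (real_of_ereal (\<sigma> m w i), w (real_of_ereal (\<sigma> m w i))))" for m and w :: "real \<Rightarrow> 'a"
      \<comment> \<open>All open conditions on the cut data that force a path into U, provided the
        k-th cut is finite and the next one comes after time j. An arbitrary union of open sets is
        open, which takes the place of a countable base of the J1 topology.\<close>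
      define W where "W m k j = \<Union>{V. open V \<and> {w \<in> ?D. \<sigma> m w k < \<infinity> \<and> ereal (real j) < \<sigma> m w (Suc k) \<and> \<Phi> m w \<in> V} \<subseteq> U}" for m k j
      have "U = (\<Union>m. \<Union>k. \<Union>j. {w \<in> ?D. \<sigma> m w k < \<infinity> \<and> ereal (real j) < \<sigma> m w (Suc k) \<and> \<Phi> m w \<in> W m k j})" (is "U = ?r")
      proof
        show "?r \<subseteq> U" unfolding W_def by blast
        show "U \<subseteq> ?r"
        proof
          fix w assume "w \<in> U"
          then obtain T \<epsilon> where T: "T > 0" "\<epsilon> > 0" "skorokhod_nbhd S w T \<epsilon> \<subseteq> U" and w: "w \<in> ?D"
            using U unfolding openin_skorokhod_topology by blast
          define \<epsilon>' where "\<epsilon>' = min \<epsilon> 1"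
          have \<epsilon>': "0 < \<epsilon>'" "\<epsilon>' \<le> 1" "\<epsilon>' \<le> \<epsilon>" using T by (auto simp: \<epsilon>'_def)
          \<comment> \<open>Three errors are added below: the oscillation of each path on its piece
            and the distance between the two values at the cut.\<close>
          obtain m where m: "1 / real (Suc m) < \<epsilon>' / 3" using nat_approx_posE[of "\<epsilon>'/3"] \<epsilon>'(1) by auto
          define \<delta> where "\<delta> = 1 / real (Suc m)"
          have \<delta>: "0 < \<delta>" "\<delta> < \<epsilon>' / 3" using m by (auto simp: \<delta>_def)
          have \<sigma>: "\<sigma> m = osc_time \<delta>" by (simp add: \<sigma>_def \<delta>_def)
          \<comment> \<open>The time change moves points by less than \<epsilon>' \<le> 1, so the
            images of times up to T stay below j.\<close>
          obtain j :: nat where j: "T + 1 < real j" using reals_Archimedean2 by blast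
          define k where "k = (LEAST k. ereal (real j) < \<sigma> m w (Suc k))"
          have ex: "\<exists>k. ereal (real j) < \<sigma> m w (Suc k)"
          proof -
            obtain k where "ereal (real j) < \<sigma> m w k" using osc_time_unbounded[OF w \<delta>(1)] unfolding \<sigma> by blast
            then show ?thesis using osc_time_le_Suc[of \<delta> w k] unfolding \<sigma> by (blast intro: less_le_trans)
          qed
          have k1: "ereal (real j) < \<sigma> m w (Suc k)" unfolding k_def by (rule LeastI_ex[OF ex])
          have k2: "\<sigma> m w k < \<infinity>"
          proof (cases k)
            case (Suc k')
            then have "\<not> ereal (real j) < \<sigma> m w (Suc k')" using not_less_Least[of k' "\<lambda>k. ereal (real j) < \<sigma> m w (Suc k)"] unfolding k_def by auto
            then show ?thesis using Suc by (auto simp: not_less intro: le_less_trans[where y="ereal (real j)"])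
          qed (simp add: \<sigma>)
          \<comment> \<open>Only the coordinates 0 to k are constrained, which makes V open in the
            product topology on sequences.\<close>
          define V where "V = (\<Inter>i\<in>{..k}. {\<phi> :: nat \<Rightarrow> real \<times> 'a. \<bar>fst (\<Phi> m w i) - fst (\<phi> i)\<bar> < \<epsilon>' \<and> dist (snd (\<phi> i)) (snd (\<Phi> m w i)) < \<delta>})"
          have "open V"
            unfolding V_def by (intro open_INT ballI open_Collect_conj open_Collect_less continuous_intros) auto
          moreover have "{w \<in> ?D. \<sigma> m w k < \<infinity> \<and> ereal (real j) < \<sigma> m w (Suc k) \<and> \<Phi> m w \<in> V} \<subseteq> U"
          proof
            fix w' assume "w' \<in> {w \<in> ?D. \<sigma> m w k < \<infinity> \<and> ereal (real j) < \<sigma> m w (Suc k) \<and> \<Phi> m w \<in> V}"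
            then have w': "w' \<in> ?D" "\<sigma> m w' k < \<infinity>" "ereal (real j) < \<sigma> m w' (Suc k)" "\<Phi> m w' \<in> V" by auto
            define a where "a i = real_of_ereal (\<sigma> m w' i)" for i
            define b where "b i = real_of_ereal (\<sigma> m w i)" for i
            have fin: "\<sigma> m w' i < \<infinity>" "\<sigma> m w i < \<infinity>" if "i \<le> k" for i
              using that k2 w'(2) osc_time_mono[OF that, of \<delta>] unfolding \<sigma> by (meson le_less_trans)+
            have a: "\<sigma> m w' i = ereal (a i)" and b: "\<sigma> m w i = ereal (b i)" if "i \<le> k" for i
              using osc_time_real fin[OF that] unfolding \<sigma> a_def b_def by metis+
            have ab: "\<bar>b i - a i\<bar> < \<epsilon>'" "dist (w' (a i)) (w (b i)) < \<delta>" if "i \<le> k" for i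
              using w'(4) that by (auto simp: V_def \<Phi>_def a_def b_def)
            have inc: "a i < a (Suc i)" "b i < b (Suc i)" if "i < k" for i
              using osc_time_less_Suc[OF w'(1) \<delta>(1), of i] osc_time_less_Suc[OF w \<delta>(1), of i] fin[of i] a[of i] a[of "Suc i"]
                b[of i] b[of "Suc i"] that unfolding \<sigma> by (auto simp del: osc_time.simps)
            have "a 0 = 0" "b 0 = 0" by (simp_all add: a_def b_def \<sigma>)
            from time_change_exists[OF \<epsilon>'(1) this inc ab(1)]
            obtain l where l: "strict_mono_on {0..} l" "l ` {0..} = {0..}" "\<And>t. 0 \<le> t \<Longrightarrow> \<bar>l t - t\<bar> < \<epsilon>'"
              "\<And>i. i \<le> k \<Longrightarrow> l (a i) = b i" "\<And>t. a k \<le> t \<Longrightarrow> l t = b k + (t - a k)" by metis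
            have close: "dist (w' t) (w (l t)) < \<epsilon>'" if t: "t \<in> {0..T}" for t
            proof -
              \<comment> \<open>The piece of w' that contains t; as the time change matches the
                cuts, l t lies in the piece of w with the same index.\<close>
              define i where "i = (GREATEST i. i \<le> k \<and> a i \<le> t)"
              have i: "i \<le> k" "a i \<le> t"
                using GreatestI_nat[of "\<lambda>i. i \<le> k \<and> a i \<le> t" 0 k] \<open>a 0 = 0\<close> t unfolding i_def by auto
              have i': "t < a (Suc i)" if "i < k"
                using Greatest_le_nat[of "\<lambda>i. i \<le> k \<and> a i \<le> t" "Suc i" k] that unfolding i_def by force
              have a0: "0 \<le> a i" "0 \<le> t" using t by (auto simp: a_def \<sigma> real_of_ereal_pos osc_time_nonneg)
              have t1: "ereal t < \<sigma> m w' (Suc i)"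
              proof (cases "i < k")
                case True then show ?thesis using i' a[of "Suc i"] by simp
              next
                case False
                then have "i = k" using i by simp
                then show ?thesis using w'(3) t j by (auto intro: less_trans[where y="ereal (real j)"])
              qed
              have mono: "u \<le> v \<Longrightarrow> l u \<le> l v" if "0 \<le> u" for u v
                using strict_mono_onD[OF l(1), of u v] that by (cases "u = v") auto
              have t2: "b i \<le> l t" using l(4)[OF i(1)] mono[OF a0(1) i(2)] by simp
              have t3: "ereal (l t) < \<sigma> m w (Suc i)"
              proof (cases "i < k")
                case True
                then have "l t < l (a (Suc i))" using strict_mono_onD[OF l(1), of t "a (Suc i)"] i'[OF True] a0 by auto
                then show ?thesis using True b[of "Suc i"] l(4)[of "Suc i"] by simp
              next
                case False
                then have "i = k" using i by simp
                moreover have "l t < real j" using l(3)[OF a0(2)] t j \<epsilon>'(2) by auto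
                ultimately show ?thesis using k1 by (auto intro: less_trans[where y="ereal (real j)"])
              qed
              have s1: "\<sigma> m w' i \<le> ereal t" and s2: "\<sigma> m w i \<le> ereal (l t)"
                using a[OF i(1)] b[OF i(1)] i(2) t2 by simp_all
              have "dist (w' t) (w' (a i)) \<le> \<delta>"
                using osc_time_dist[of \<delta> w' i t] t1 s1 \<delta>(1) unfolding a_def \<sigma> by (simp del: osc_time.simps)
              moreover have "dist (w (l t)) (w (b i)) \<le> \<delta>"
                using osc_time_dist[of \<delta> w i "l t"] s2 t3 \<delta>(1) unfolding b_def \<sigma> by (simp del: osc_time.simps)
              moreover have "dist (w' t) (w (l t)) \<le> dist (w' t) (w' (a i)) + dist (w' (a i)) (w (b i)) + dist (w (l t)) (w (b i))"
                using dist_triangle[of "w' t" "w (l t)" "w' (a i)"] dist_triangle2[of "w' (a i)" "w (l t)" "w (b i)"] by linarith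
              ultimately show ?thesis using ab(2)[OF i(1)] \<delta> by linarith
            qed
            have "\<bar>l t - t\<bar> < \<epsilon> \<and> dist (w' t) (w (l t)) < \<epsilon>" if "t \<in> {0..T}" for t
              using close[OF that] l(3)[of t] that \<epsilon>'(3) by auto
            then have "w' \<in> skorokhod_nbhd S w T \<epsilon>"
              unfolding skorokhod_nbhd_def using w'(1) l(1,2) by blast
            then show "w' \<in> U" using T by auto
          qed
          moreover have "\<Phi> m w \<in> V" using \<epsilon>' \<delta> by (auto simp: V_def)
          ultimately have "\<Phi> m w \<in> W m k j" unfolding W_def by blast
          then show "w \<in> ?r" using w k1 k2 by blast
        qed
      qed
      also have "\<dots> \<in> sets ?M"
      proof (intro sets.countable_UN image_subsetI)
        fix m k j
        have [measurable]: "(\<lambda>w. \<sigma> m w i) \<in> borel_measurable ?M" "(\<lambda>w. w (real_of_ereal (\<sigma> m w i))) \<in> ?M \<rightarrow>\<^sub>M borel" for i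
          unfolding \<sigma>_def by (rule measurable_osc_time, simp)+
        have [measurable]: "\<Phi> m \<in> ?M \<rightarrow>\<^sub>M borel"
          unfolding \<Phi>_def by (rule measurable_coordinatewise_then_product) (simp add: borel_prod[symmetric])
        have "open (W m k j)" unfolding W_def by auto
        then have [measurable]: "W m k j \<in> sets borel" by simp
        have "{w \<in> space ?M. \<sigma> m w k < \<infinity> \<and> ereal (real j) < \<sigma> m w (Suc k) \<and> \<Phi> m w \<in> W m k j} \<in> sets ?M"
          by measurable
        then show "{w \<in> ?D. \<sigma> m w k < \<infinity> \<and> ereal (real j) < \<sigma> m w (Suc k) \<and> \<Phi> m w \<in> W m k j} \<in> sets ?M"
          by (simp add: sp)
      qed
      finally show "U \<in> sets ?M" .
    qed
  qed
qed

lemma space_skorokhod_borel: "space (skorokhod_borel S) = cadlag_paths S"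
  unfolding skorokhod_borel_def
  by (rule space_measure_of) (auto simp: openin_skorokhod_topology)

lemma measurable_skorokhod_eval:
  fixes S :: "'a::{metric_space, second_countable_topology} set"
  assumes "0 \<le> t"
  shows "(\<lambda>w. w t) \<in> skorokhod_borel S \<rightarrow>\<^sub>M borel"
  using measurable_path_algebra_eval[OF assms, of "cadlag_paths S"]
  by (simp cong: measurable_cong_sets add: measurable_cong_sets[OF sets_skorokhod_borel refl])

lemma measurable_into_skorokhod:
  fixes S :: "'a::{metric_space, second_countable_topology} set"
  assumes "\<And>x. x \<in> space M \<Longrightarrow> f x \<in> cadlag_paths S"
    and "\<And>t. 0 \<le> t \<Longrightarrow> (\<lambda>x. f x t) \<in> M \<rightarrow>\<^sub>M borel"
  shows "f \<in> M \<rightarrow>\<^sub>M skorokhod_borel S"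
  using measurable_into_path_algebra[OF cadlag_paths_subset assms]
  by (simp add: measurable_cong_sets[OF refl sets_skorokhod_borel])

section \<open>Martingales of the diffusions on the strata\<close>

lemma integrable_bounded_interval:
  fixes F :: "'w \<Rightarrow> real \<Rightarrow> real"
  assumes "finite_measure M"
    and m: "(\<lambda>(w, r). indicator {a..b} r * F w r) \<in> borel_measurable (M \<Otimes>\<^sub>M borel)"
    and bd: "\<And>w r. w \<in> space M \<Longrightarrow> r \<in> {a..b} \<Longrightarrow> \<bar>F w r\<bar> \<le> c"
  shows "integrable (M \<Otimes>\<^sub>M lborel) (\<lambda>(w, r). indicator {a..b} r * F w r)"
proof (rule integrableI_bounded_set[where A="space M \<times> {a..b}" and B="max 0 c"])
  interpret finite_measure M by fact
  show "space M \<times> {a..b} \<in> sets (M \<Otimes>\<^sub>M lborel)" by auto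
  show "(\<lambda>(w, r). indicator {a..b} r * F w r) \<in> borel_measurable (M \<Otimes>\<^sub>M lborel)"
    using m by (simp add: measurable_cong_sets[OF sets_pair_measure_cong[OF refl sets_lborel] refl])
  have "emeasure (M \<Otimes>\<^sub>M lborel) (space M \<times> {a..b}) = emeasure M (space M) * emeasure lborel {a..b}"
    by (intro sigma_finite_measure.emeasure_pair_measure_Times lborel.sigma_finite_measure_axioms) auto
  also have "\<dots> < \<infinity>" by (auto simp: emeasure_lborel_Icc_eq less_top[symmetric] ennreal_mult_eq_top_iff)
  finally show "emeasure (M \<Otimes>\<^sub>M lborel) (space M \<times> {a..b}) < \<infinity>" .
  show "AE x\<in>space M \<times> {a..b} in M \<Otimes>\<^sub>M lborel. norm (case x of (w, r) \<Rightarrow> indicator {a..b} r * F w r) \<le> max 0 c"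
    using bd by (intro AE_I2 impI) (auto split: split_indicator simp: max.coboundedI2)
  show "AE x in M \<Otimes>\<^sub>M lborel. x \<notin> space M \<times> {a..b} \<longrightarrow> (case x of (w, r) \<Rightarrow> indicator {a..b} r * F w r) = 0"
    by (intro AE_I2) (auto simp: space_pair_measure indicator_def)
qed

text \<open>Measurability is asked only of the product with the indicator, because paths carry no
  information at negative times.\<close>

lemma Fubini_interval:
  fixes F :: "'w \<Rightarrow> real \<Rightarrow> real"
  assumes "finite_measure M"
    and m: "(\<lambda>(w, r). indicator {a..b} r * F w r) \<in> borel_measurable (M \<Otimes>\<^sub>M borel)"
    and bd: "\<And>w r. w \<in> space M \<Longrightarrow> r \<in> {a..b} \<Longrightarrow> \<bar>F w r\<bar> \<le> c"
  shows "(\<integral>w. (LINT r:{a..b}|lborel. F w r) \<partial>M) = (LINT r:{a..b}|lborel. (\<integral>w. F w r \<partial>M))"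
    and "integrable M (\<lambda>w. (LINT r:{a..b}|lborel. F w r))"
proof -
  interpret finite_measure M by fact
  interpret pair_sigma_finite M lborel ..
  note int = integrable_bounded_interval[OF assms]
  show "(\<integral>w. (LINT r:{a..b}|lborel. F w r) \<partial>M) = (LINT r:{a..b}|lborel. (\<integral>w. F w r \<partial>M))"
    using Fubini_integral[OF int] by (simp add: set_lebesgue_integral_def)
  show "integrable M (\<lambda>w. (LINT r:{a..b}|lborel. F w r))"
    using integrable_fst'[OF int] by (simp add: set_lebesgue_integral_def)
qed

section \<open>Generators and functions vanishing at infinity\<close>

lemma generator_value_unique:
  assumes "is_generator_value S P f h" "is_generator_value S P f h'"
  shows "h = h'"
proof
  fix x
  show "h x = h' x"
  proof (cases "x \<in> S")
    case True
    have "((\<lambda>t. (P t f x - f x) / t) \<longlongrightarrow> h x) (at_right 0)" "((\<lambda>t. (P t f x - f x) / t) \<longlongrightarrow> h' x) (at_right 0)"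
      using assms True by (auto simp: is_generator_value_def intro: tendsto_uniform_limitI)
    then show ?thesis by (rule tendsto_unique[rotated]) simp
  next
    case False
    then show ?thesis using assms by (auto simp: is_generator_value_def C0_def extensional_def)
  qed
qed

lemma generator_eq: "is_generator_value S P f h \<Longrightarrow> generator S P f = h"
  unfolding generator_def by (blast intro: generator_value_unique)

lemma generator_value_generator:
  "f \<in> generator_domain S P \<Longrightarrow> is_generator_value S P f (generator S P f)"
  using generator_eq[of S P f] by (auto simp: generator_domain_def)

lemma C0_vanish: "f \<in> C0 S \<Longrightarrow> 0 < \<epsilon> \<Longrightarrow> \<exists>K\<subseteq>S. compact K \<and> (\<forall>x\<in>S - K. \<bar>f x\<bar> < \<epsilon>)"
  by (simp add: C0_def)

lemma C0_bounded:
  assumes "f \<in> C0 S"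
  obtains c where "\<And>x. x \<in> S \<Longrightarrow> \<bar>f x\<bar> \<le> c"
proof -
  obtain K where K: "K \<subseteq> S" "compact K" "\<And>x. x \<in> S - K \<Longrightarrow> \<bar>f x\<bar> < 1"
    using C0_vanish[OF assms zero_less_one] by auto
  have "continuous_on K f" using assms K(1) by (auto simp: C0_def intro: continuous_on_subset)
  then have "bounded (f ` K)" using K(2) by (intro compact_imp_bounded compact_continuous_image)
  then obtain c where c: "\<And>x. x \<in> K \<Longrightarrow> \<bar>f x\<bar> \<le> c" by (auto simp: bounded_iff)
  show ?thesis
  proof (rule that)
    fix x assume "x \<in> S" then show "\<bar>f x\<bar> \<le> max c 1"
      using c[of x] K(3)[of x] by (cases "x \<in> K") (auto simp: less_imp_le le_max_iff_disj)
  qed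
qed

lemma C0_measurable: "f \<in> C0 S \<Longrightarrow> f \<in> borel_measurable (restrict_space borel S)"
  by (auto simp: C0_def intro: borel_measurable_continuous_on_restrict)

section \<open>Natural filtrations\<close>

lemma space_natural_filtration [simp]: "space (natural_filtration \<Omega> X u) = \<Omega>"
  unfolding natural_filtration_def by (rule space_measure_of) auto

lemma measurable_natural_filtration:
  assumes "f \<in> space M \<rightarrow> \<Omega>" "\<And>s. 0 \<le> s \<Longrightarrow> s \<le> u \<Longrightarrow> (\<lambda>x. X (f x) s) \<in> M \<rightarrow>\<^sub>M borel"
  shows "f \<in> M \<rightarrow>\<^sub>M natural_filtration \<Omega> X u"
  unfolding natural_filtration_def
proof (rule measurable_measure_of)
  fix A assume "A \<in> {(\<lambda>w. X w s) -` B \<inter> \<Omega> |s B. s \<in> {0..u} \<and> B \<in> sets borel}"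
  then obtain s B where A: "A = (\<lambda>w. X w s) -` B \<inter> \<Omega>" "0 \<le> s" "s \<le> u" "B \<in> sets borel" by auto
  have "f -` A \<inter> space M = (\<lambda>x. X (f x) s) -` B \<inter> space M" using assms(1) A(1) by auto
  then show "f -` A \<inter> space M \<in> sets M" using measurable_sets[OF assms(2)[OF A(2,3)] A(4)] by simp
qed (use assms in auto)

lemma measurable_natural_filtration_at:
  assumes "0 \<le> s" "s \<le> u"
  shows "(\<lambda>w. X w s) \<in> natural_filtration \<Omega> X u \<rightarrow>\<^sub>M borel"
proof (rule measurableI)
  fix B :: "'b set" assume "B \<in> sets borel"
  then have "(\<lambda>w. X w s) -` B \<inter> \<Omega> \<in> {(\<lambda>w. X w s) -` B \<inter> \<Omega> |s B. s \<in> {0..u} \<and> B \<in> sets borel}"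
    using assms by auto
  then show "(\<lambda>w. X w s) -` B \<inter> space (natural_filtration \<Omega> X u) \<in> sets (natural_filtration \<Omega> X u)"
    unfolding space_natural_filtration unfolding natural_filtration_def by (subst sets_measure_of) auto
qed simp

lemma subalgebra_natural_filtration:
  assumes "space M = \<Omega>" "\<And>s. 0 \<le> s \<Longrightarrow> s \<le> u \<Longrightarrow> (\<lambda>w. X w s) \<in> M \<rightarrow>\<^sub>M borel"
  shows "subalgebra M (natural_filtration \<Omega> X u)"
proof -
  have "(\<lambda>w. w) \<in> M \<rightarrow>\<^sub>M natural_filtration \<Omega> X u"
    using assms by (intro measurable_natural_filtration) auto
  then show ?thesis
    using assms(1) sets.sets_into_space[of _ "natural_filtration \<Omega> X u"]
    by (auto simp: subalgebra_def measurable_def Int_absorb2)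
qed

section \<open>Semigroup calculus, the Markov property and Dynkin's formula on one stratum\<close>

locale feller_diffusion =
  fixes S :: "'a::{metric_space, second_countable_topology} set" and Q :: "'a \<Rightarrow> (real \<Rightarrow> 'a) measure"
  assumes S_borel: "S \<in> sets borel"
    and markov: "markov_family S Q"
    and kernel: "Q \<in> restrict_space borel S \<rightarrow>\<^sub>M prob_algebra (skorokhod_borel S)"
    and start: "\<And>x. x \<in> S \<Longrightarrow> AE w in Q x. w 0 = x"
    and semigroup: "C0_contraction_semigroup S (transition_op S Q)"
begin

abbreviation "P \<equiv> transition_op S Q"

lemma Q_prob: "x \<in> S \<Longrightarrow> prob_space (Q x)" and sets_Q: "x \<in> S \<Longrightarrow> sets (Q x) = sets (skorokhod_borel S)"
  using markov by (auto simp: markov_family_def space_prob_algebra)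

lemma space_Q: "x \<in> S \<Longrightarrow> space (Q x) = cadlag_paths S"
  using sets_eq_imp_space_eq[OF sets_Q] by (simp add: space_skorokhod_borel)

lemma eval_Q: "x \<in> S \<Longrightarrow> 0 \<le> t \<Longrightarrow> (\<lambda>w. w t) \<in> Q x \<rightarrow>\<^sub>M borel"
  using measurable_skorokhod_eval[of t S] by (simp add: measurable_cong_sets[OF sets_Q refl])

text \<open>By linearity, contractivity compares \<open>P t f\<close> with \<open>P t h\<close>; the
  step \<open>in_C0\<close> supplies closure of C0 under linear combinations.\<close>

lemma P_diff_le:
  assumes f: "f \<in> C0 S" and h: "h \<in> C0 S" and t: "0 \<le> t" and c: "\<And>x. x \<in> S \<Longrightarrow> \<bar>a * f x + b * h x\<bar> \<le> c" and x: "x \<in> S"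
  shows "\<bar>a * P t f x + b * P t h x\<bar> \<le> c"
proof -
  have in_C0: "(\<lambda>x\<in>S. a * f x + b * h x) \<in> C0 S"
    unfolding C0_def mem_Collect_eq
  proof (intro conjI allI impI)
    show "continuous_on S (\<lambda>x\<in>S. a * f x + b * h x)"
      using f h by (auto simp: C0_def cong: continuous_on_cong intro!: continuous_intros)
    fix \<epsilon> :: real assume e: "0 < \<epsilon>"
    \<comment> \<open>Chosen so that (\<bar>a\<bar> + \<bar>b\<bar>) e' < \<epsilon>; the summand 1
      avoids a division by zero.\<close>
    define e' where "e' = \<epsilon> / (\<bar>a\<bar> + \<bar>b\<bar> + 1)"
    have e': "0 < e'" using e by (simp add: e'_def add_nonneg_pos)
    obtain K where K: "K \<subseteq> S" "compact K" "\<And>x. x \<in> S - K \<Longrightarrow> \<bar>f x\<bar> < e'"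
      using C0_vanish[OF f e'] by auto
    obtain K' where K': "K' \<subseteq> S" "compact K'" "\<And>x. x \<in> S - K' \<Longrightarrow> \<bar>h x\<bar> < e'"
      using C0_vanish[OF h e'] by auto
    have "\<bar>(\<lambda>x\<in>S. a * f x + b * h x) x\<bar> < \<epsilon>" if x: "x \<in> S - (K \<union> K')" for x
    proof -
      have "\<bar>a * f x + b * h x\<bar> \<le> \<bar>a\<bar> * \<bar>f x\<bar> + \<bar>b\<bar> * \<bar>h x\<bar>"
        using abs_triangle_ineq[of "a * f x" "b * h x"] by (simp add: abs_mult)
      also have "\<dots> \<le> \<bar>a\<bar> * e' + \<bar>b\<bar> * e'"
        using K(3)[of x] K'(3)[of x] x by (intro add_mono mult_left_mono) auto
      also have "\<dots> < (\<bar>a\<bar> + \<bar>b\<bar> + 1) * e'" using e' by (simp add: algebra_simps)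
      also have "\<dots> = \<epsilon>" by (simp add: e'_def add_nonneg_pos order_less_imp_not_eq2)
      finally show ?thesis using x by simp
    qed
    then show "\<exists>K\<subseteq>S. compact K \<and> (\<forall>x\<in>S - K. \<bar>(\<lambda>x\<in>S. a * f x + b * h x) x\<bar> < \<epsilon>)"
      using K K' by (intro exI[of _ "K \<union> K'"]) (auto intro: compact_Un)
  qed simp
  have lin: "P t (\<lambda>x\<in>S. a * f x + b * h x) = (\<lambda>x\<in>S. a * P t f x + b * P t h x)"
    using semigroup f h t unfolding C0_contraction_semigroup_def by blast
  have "\<forall>x\<in>S. \<bar>P t (\<lambda>x\<in>S. a * f x + b * h x) x\<bar> \<le> c"
    using semigroup in_C0 t c unfolding C0_contraction_semigroup_def by simp
  then show ?thesis using x unfolding lin by simp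
qed

lemma P_C0: "f \<in> C0 S \<Longrightarrow> 0 \<le> t \<Longrightarrow> P t f \<in> C0 S"
  and P_add: "f \<in> C0 S \<Longrightarrow> 0 \<le> s \<Longrightarrow> 0 \<le> t \<Longrightarrow> P (s + t) f = P s (P t f)"
  and P_0: "f \<in> C0 S \<Longrightarrow> P 0 f = f"
  and P_lim: "f \<in> C0 S \<Longrightarrow> uniform_limit S (\<lambda>t. P t f) f (at_right 0)"
  using semigroup unfolding C0_contraction_semigroup_def by blast+

text \<open>Continuity at time 0, uniform in space, spreads to all times: \<open>P t h\<close> -
  \<open>P s h\<close> is \<open>P s\<close> applied to \<open>P (t - s) h\<close> - h, and
  \<open>P s\<close> is a contraction.\<close>

lemma P_near:
  assumes h: "h \<in> C0 S" and "0 < \<delta>"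
  shows "\<exists>e>0. \<forall>x\<in>S. \<forall>s\<ge>0. \<forall>t\<ge>0. \<bar>s - t\<bar> < e \<longrightarrow> \<bar>P s h x - P t h x\<bar> \<le> \<delta>"
proof -
  have "\<forall>\<^sub>F r in at_right 0. \<forall>x\<in>S. dist (P r h x) (h x) < \<delta>"
    using P_lim[OF h] \<open>0 < \<delta>\<close> by (rule uniform_limitD)
  then obtain e where e: "e > 0" "\<And>r x. 0 < r \<Longrightarrow> r < e \<Longrightarrow> x \<in> S \<Longrightarrow> \<bar>P r h x - h x\<bar> < \<delta>"
    unfolding eventually_at_right_field by (auto simp: dist_real_def)
  have 1: "\<bar>P t h x - P s h x\<bar> \<le> \<delta>" if "x \<in> S" "0 \<le> s" "s < t" "t - s < e" for x s t
  proof -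
    have "\<bar>1 * P s (P (t - s) h) x + (-1) * P s h x\<bar> \<le> \<delta>"
      using e(2)[of "t - s"] that h by (intro P_diff_le P_C0) (auto intro: less_imp_le)
    then show ?thesis using P_add[OF h, of s "t - s"] that by simp
  qed
  have "\<bar>P s h x - P t h x\<bar> \<le> \<delta>" if "x \<in> S" "0 \<le> s" "0 \<le> t" "\<bar>s - t\<bar> < e" for x s t
  proof (cases s t rule: linorder_cases)
    case less then show ?thesis using 1[of x s t] that by (simp add: abs_minus_commute)
  next
    case greater then show ?thesis using 1[of x t s] that by simp
  qed (use \<open>0 < \<delta>\<close> in simp)
  then show ?thesis using e(1) by blast
qed

lemma P_continuous:
  assumes h: "h \<in> C0 S" and x: "x \<in> S"
  shows "continuous_on {0..} (\<lambda>t. P t h x)"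
  unfolding continuous_on_iff
proof (intro ballI allI impI)
  fix t \<delta> :: real assume "t \<in> {0..}" "0 < \<delta>"
  then obtain e where e: "e > 0" "\<forall>x\<in>S. \<forall>s\<ge>0. \<forall>t\<ge>0. \<bar>s - t\<bar> < e \<longrightarrow> \<bar>P s h x - P t h x\<bar> \<le> \<delta>/2"
    using P_near[OF h, of "\<delta>/2"] by auto
  show "\<exists>d>0. \<forall>s\<in>{0..}. dist s t < d \<longrightarrow> dist (P s h x) (P t h x) < \<delta>"
  proof (intro exI[of _ e] conjI ballI impI)
    fix s assume "s \<in> {0..}" "dist s t < e"
    then have "\<bar>P s h x - P t h x\<bar> \<le> \<delta>/2" using e(2) x \<open>t \<in> {0..}\<close> by (auto simp: dist_real_def)
    then show "dist (P s h x) (P t h x) < \<delta>" using \<open>0 < \<delta>\<close> by (simp add: dist_real_def)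
  qed (rule e(1))
qed

text \<open>The fundamental theorem of calculus for s \<mapsto> \<open>P s f x\<close>, whose
  derivative is \<open>P s h x\<close>. The definition of the generator gives right derivatives
  only; a left difference is read as a forward difference from the earlier time, corrected by
  \<open>P_near\<close>.\<close>

lemma semigroup_integral:
  assumes gen: "is_generator_value S P f h" and x: "x \<in> S" and t: "0 \<le> t"
  shows "(LINT r:{0..t}|lborel. P r h x) = P t f x - f x"
proof -
  have f: "f \<in> C0 S" and h: "h \<in> C0 S" using gen by (auto simp: is_generator_value_def)
  have deriv: "((\<lambda>s. P s f x) has_vector_derivative P u h x) (at u within {0..t})" if u: "0 \<le> u" "u \<le> t" for u
    unfolding has_vector_derivative_def has_derivative_within_alt
  proof (intro conjI allI impI)
    show "bounded_linear (\<lambda>d. d *\<^sub>R P u h x)" by (rule bounded_linear_scaleR_left)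
    fix \<delta>' :: real assume "0 < \<delta>'"
    \<comment> \<open>Differences to the left incur two errors: the forward estimate and the change
      of \<open>P y h\<close> to \<open>P u h\<close>.\<close>
    define \<delta> where "\<delta> = \<delta>' / 2"
    have \<delta>: "0 < \<delta>" using \<open>0 < \<delta>'\<close> by (simp add: \<delta>_def)
    obtain e1 where e1: "e1 > 0" "\<And>s t. 0 \<le> s \<Longrightarrow> 0 \<le> t \<Longrightarrow> \<bar>s - t\<bar> < e1 \<Longrightarrow> \<bar>P s h x - P t h x\<bar> \<le> \<delta>"
      using P_near[OF h \<delta>] x by blast
    have "\<forall>\<^sub>F r in at_right 0. \<forall>x\<in>S. dist ((P r f x - f x) / r) (h x) < \<delta>"
      using gen \<delta> by (auto simp: is_generator_value_def intro: uniform_limitD)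
    then obtain e2 where e2: "e2 > 0" "\<And>r y. 0 < r \<Longrightarrow> r < e2 \<Longrightarrow> y \<in> S \<Longrightarrow> \<bar>(P r f y - f y) / r - h y\<bar> < \<delta>"
      unfolding eventually_at_right_field by (auto simp: dist_real_def)
    \<comment> \<open>\<open>P s\<close> is applied to P r f - f - r h, which is at most r\<delta>
      uniformly in space.\<close>
    have fwd: "\<bar>P (s + r) f x - P s f x - r * P s h x\<bar> \<le> r * \<delta>" if "0 \<le> s" "0 < r" "r < e2" for s r
    proof -
      have pt: "\<bar>P r f y - f y - r * h y\<bar> \<le> r * \<delta>" if "y \<in> S" for y
      proof -
        have "\<bar>P r f y - f y - r * h y\<bar> = r * \<bar>(P r f y - f y) / r - h y\<bar>"
        proof -
          have "P r f y - f y - r * h y = r * ((P r f y - f y) / r - h y)" using \<open>0 < r\<close> by (simp add: field_simps)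
          then show ?thesis using \<open>0 < r\<close> by (simp only: abs_mult abs_of_pos)
        qed
        also have "\<dots> \<le> r * \<delta>" using e2(2)[of r y] that \<open>0 < r\<close> \<open>r < e2\<close> by (intro mult_left_mono) auto
        finally show ?thesis .
      qed
      \<comment> \<open>f + r h is packed into one function because \<open>P_diff_le\<close>
        compares only two.\<close>
      define k where "k = (\<lambda>x\<in>S. 1 * f x + r * h x)"
      have kC: "k \<in> C0 S \<and> P s k = (\<lambda>x\<in>S. 1 * P s f x + r * P s h x)"
      proof
        show "P s k = (\<lambda>x\<in>S. 1 * P s f x + r * P s h x)"
          unfolding k_def using semigroup f h \<open>0 \<le> s\<close> unfolding C0_contraction_semigroup_def by blast
        show "k \<in> C0 S"
          unfolding C0_def mem_Collect_eq
        proof (intro conjI allI impI)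
          show "k \<in> extensional S" by (simp add: k_def)
          show "continuous_on S k"
            unfolding k_def using f h by (auto simp: C0_def cong: continuous_on_cong intro!: continuous_intros)
          fix \<epsilon> :: real assume e: "0 < \<epsilon>"
          obtain K where K: "K \<subseteq> S" "compact K" "\<And>x. x \<in> S - K \<Longrightarrow> \<bar>f x\<bar> < \<epsilon>/2"
            using C0_vanish[OF f half_gt_zero[OF e]] by auto
          obtain K' where K': "K' \<subseteq> S" "compact K'" "\<And>x. x \<in> S - K' \<Longrightarrow> \<bar>h x\<bar> < \<epsilon>/2/r"
            using C0_vanish[OF h divide_pos_pos[OF half_gt_zero[OF e] \<open>0 < r\<close>]] by auto
          have "\<bar>k x\<bar> < \<epsilon>" if xx: "x \<in> S - (K \<union> K')" for x
          proof -
            have "\<bar>h x\<bar> * r < \<epsilon>/2" using K'(3)[of x] xx \<open>0 < r\<close> by (simp add: field_simps)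
            then have "\<bar>r * h x\<bar> < \<epsilon>/2" using \<open>0 < r\<close> by (simp add: abs_mult mult.commute)
            then show ?thesis using K(3)[of x] xx abs_triangle_ineq[of "f x" "r * h x"] by (simp add: k_def)
          qed
          then show "\<exists>K\<subseteq>S. compact K \<and> (\<forall>x\<in>S - K. \<bar>k x\<bar> < \<epsilon>)"
            using K K' by (intro exI[of _ "K \<union> K'"]) (auto intro: compact_Un)
        qed
      qed
      have "\<bar>1 * P s (P r f) x + (-1) * P s k x\<bar> \<le> r * \<delta>"
        using pt kC f x \<open>0 \<le> s\<close> \<open>0 < r\<close>
        by (intro P_diff_le P_C0) (auto simp: k_def algebra_simps)
      then show ?thesis using P_add[OF f, of s r] kC that x by (simp add: algebra_simps)
    qed
    have "\<bar>P y f x - P u f x - (y - u) * P u h x\<bar> \<le> \<delta>' * \<bar>y - u\<bar>"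
      if y: "0 \<le> y" "\<bar>y - u\<bar> < min e1 e2" for y
    proof (cases y u rule: linorder_cases)
      case greater
      have "\<bar>P y f x - P u f x - (y - u) * P u h x\<bar> \<le> (y - u) * \<delta>"
        using fwd[of u "y - u"] u y greater by simp
      also have "\<dots> \<le> \<delta>' * \<bar>y - u\<bar>" using greater \<delta> by (simp add: \<delta>_def)
      finally show ?thesis .
    next
      case less
      have 1: "\<bar>P u f x - P y f x - (u - y) * P y h x\<bar> \<le> (u - y) * \<delta>"
        using fwd[of y "u - y"] u y less by simp
      have "(u - y) * \<bar>P y h x - P u h x\<bar> \<le> (u - y) * \<delta>"
        using e1(2)[of y u] u y less by (intro mult_left_mono) auto
      then have 2: "\<bar>(u - y) * (P y h x - P u h x)\<bar> \<le> (u - y) * \<delta>" using less by (simp add: abs_mult)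
      have "\<bar>P y f x - P u f x - (y - u) * P u h x\<bar>
        = \<bar>(P u f x - P y f x - (u - y) * P y h x) + (u - y) * (P y h x - P u h x)\<bar>"
        by (subst abs_minus_cancel[symmetric]) (simp add: algebra_simps)
      also have "\<dots> \<le> (u - y) * \<delta> + (u - y) * \<delta>" using 1 2 by linarith
      also have "\<dots> = \<delta>' * \<bar>y - u\<bar>" using less by (simp add: \<delta>_def)
      finally show ?thesis .
    qed simp
    then show "\<exists>d>0. \<forall>y\<in>{0..t}. norm (y - u) < d \<longrightarrow> norm (P y f x - P u f x - (y - u) *\<^sub>R P u h x) \<le> \<delta>' * norm (y - u)"
      using e1 e2 by (intro exI[of _ "min e1 e2"]) auto
  qed
  have "continuous_on {0..t} (\<lambda>t. P t h x)"
    by (rule continuous_on_subset[OF P_continuous[OF h x]]) auto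
  from integral_FTC_Icc[OF t deriv this] show ?thesis using P_0[OF f] by (simp add: set_lebesgue_integral_def)
qed

text \<open>\<open>markov_family\<close> speaks of indicators of shifted events. Passing to bounded
  g amounts to an equality of two measures on the state space: the law of w (u + t) on the event B,
  and the mixture over w u of the time-t laws \<kappa>.\<close>

lemma markov_integral:
  fixes g :: "'a \<Rightarrow> real"
  assumes x: "x \<in> S" and u: "0 \<le> u" and t: "0 \<le> t"
    and B: "B \<in> sets (natural_filtration (cadlag_paths S) (\<lambda>w. w) u)"
    and g: "g \<in> borel_measurable (restrict_space borel S)" "\<And>x. x \<in> S \<Longrightarrow> \<bar>g x\<bar> \<le> c"
  shows "(\<integral>w. indicator B w * g (w (u + t)) \<partial>Q x) = (\<integral>w. indicator B w * P t g (w u) \<partial>Q x)"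
proof -
  let ?D = "cadlag_paths S" and ?F = "natural_filtration (cadlag_paths S) (\<lambda>w. w) u"
  interpret Q: prob_space "Q x" by (rule Q_prob[OF x])
  have sub: "subalgebra (Q x) ?F"
    using eval_Q[OF x] by (intro subalgebra_natural_filtration) (auto simp: space_Q x)
  have BQ[measurable]: "B \<in> sets (Q x)" using B sub by (auto simp: subalgebra_def)
  interpret sigma_finite_subalgebra "Q x" ?F
    by (intro finite_measure_subalgebra_is_sigma_finite finite_measure_subalgebra.intro
        finite_measure_subalgebra_axioms.intro sub Q.finite_measure_axioms)
  have [measurable]: "(\<lambda>w. w (u + t)) \<in> Q x \<rightarrow>\<^sub>M borel" "(\<lambda>w. w u) \<in> Q x \<rightarrow>\<^sub>M borel"
    using u t by (auto intro!: eval_Q x)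
  have at_u: "(\<lambda>w. w u) \<in> Q x \<rightarrow>\<^sub>M restrict_space borel S"
    by (rule measurable_restrict_space2) (auto simp: space_Q x dest: cadlag_pathsD(4)[OF _ u])
  define \<kappa> where "\<kappa> y = distr (Q y) borel (\<lambda>w. w t)" for y
  have \<kappa>: "\<kappa> \<in> restrict_space borel S \<rightarrow>\<^sub>M subprob_algebra borel"
    unfolding \<kappa>_def
    by (rule measurable_compose[OF measurable_prob_algebraD[OF kernel] measurable_distr[OF measurable_skorokhod_eval[OF t]]])
  have \<kappa>u: "(\<lambda>w. \<kappa> (w u)) \<in> Q x \<rightarrow>\<^sub>M subprob_algebra borel"
    by (rule measurable_compose[OF at_u \<kappa>])
  \<comment> \<open>The restriction of \<open>Q x\<close> to B as a density, so that conditioning on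
    B becomes plain integration.\<close>
  define M where "M = density (Q x) (indicator B)"
  have M: "finite_measure M" "space M \<noteq> {}" "sets M = sets (Q x)"
    using Q.not_empty by (auto simp: M_def emeasure_density intro!: finite_measureI)
  \<comment> \<open>Paths stay in S, so extending g by 0 changes no integral and makes it Borel on
    the whole space.\<close>
  define g' where "g' y = (if y \<in> S then g y else 0)" for y
  have g'[measurable]: "g' \<in> borel_measurable borel"
  proof -
    have "g' = (\<lambda>x. indicator S x *\<^sub>R g x)" by (auto simp: g'_def fun_eq_iff)
    then show ?thesis using g(1) S_borel by (simp add: borel_measurable_restrict_space_iff)
  qed
  have g'_bd: "\<bar>g' y\<bar> \<le> max c 0" for y using g(2)[of y] by (auto simp: g'_def)
  have \<kappa>M: "(\<lambda>w. \<kappa> (w u)) \<in> M \<rightarrow>\<^sub>M subprob_algebra borel"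
    using \<kappa>u by (simp add: measurable_cong_sets[OF M(3) refl])
  have emM: "emeasure M A = emeasure (Q x) (B \<inter> A)" if [measurable]: "A \<in> sets (Q x)" for A
    unfolding M_def by (subst emeasure_density)
      (auto simp: nn_integral_indicator[symmetric] simp del: nn_integral_indicator intro!: nn_integral_cong split: split_indicator)
  have eq: "distr M borel (\<lambda>w. w (u + t)) = bind M (\<lambda>w. \<kappa> (w u))"
  proof (rule measure_eqI)
    show "sets (distr M borel (\<lambda>w. w (u + t))) = sets (bind M (\<lambda>w. \<kappa> (w u)))"
      using sets_bind[of M "\<lambda>w. \<kappa> (w u)" borel] sets_kernel[OF \<kappa>M] M(2) by simp
    fix A assume "A \<in> sets (distr M borel (\<lambda>w. w (u + t)))"
    then have A[measurable]: "A \<in> sets borel" by simp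
    define \<Gamma> where "\<Gamma> = {w \<in> ?D. w t \<in> A}"
    have \<Gamma>: "\<Gamma> \<in> sets (skorokhod_borel S)"
      using measurable_sets[OF measurable_skorokhod_eval[OF t, of S] A]
      by (simp add: \<Gamma>_def space_skorokhod_borel vimage_def Int_def conj_commute)
    have sh: "{w \<in> ?D. shift_path u w \<in> \<Gamma>} = {w \<in> ?D. w (u + t) \<in> A}"
    proof -
      have "shift_path u w \<in> ?D" if w: "w \<in> ?D" for w
        unfolding cadlag_paths_def mem_Collect_eq
      proof (intro conjI allI impI)
        show "shift_path u w \<in> {0..} \<rightarrow>\<^sub>E S"
          using u cadlag_pathsD(4)[OF w] by (auto simp: shift_path_def)
        fix s :: real assume s: "0 \<le> s"
        have "filterlim (\<lambda>r. u + r) (at_right (u + s)) (at_right s)"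
          by (rule filterlim_at_withinI) (auto intro!: tendsto_intros simp: eventually_at_right_field intro: exI[of _ "s+1"])
        then have "((\<lambda>r. w (u + r)) \<longlongrightarrow> w (u + s)) (at_right s)"
          using filterlim_compose[OF cadlag_pathsD(2)[OF w, of "u + s"]] u s by simp
        moreover have "\<forall>\<^sub>F r in at_right s. w (u + r) = shift_path u w r"
          using s by (auto simp: eventually_at_right_field shift_path_def intro!: exI[of _ "s+1"])
        ultimately have "(shift_path u w \<longlongrightarrow> w (u + s)) (at_right s)"
          by (rule Lim_transform_eventually)
        then show "(shift_path u w \<longlongrightarrow> shift_path u w s) (at_right s)"
          using s by (simp add: shift_path_def)
        assume s': "0 < s"
        obtain l where l: "l \<in> S" "(w \<longlongrightarrow> l) (at_left (u + s))"
          using cadlag_pathsD(3)[OF w, of "u + s"] u s' by auto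
        have "filterlim (\<lambda>r. u + r) (at_left (u + s)) (at_left s)"
          by (rule filterlim_at_withinI) (auto intro!: tendsto_intros simp: eventually_at_left_field intro: exI[of _ "s-1"])
        then have "((\<lambda>r. w (u + r)) \<longlongrightarrow> l) (at_left s)" by (rule filterlim_compose[OF l(2)])
        moreover have "\<forall>\<^sub>F r in at_left s. w (u + r) = shift_path u w r"
          using s' by (auto simp: eventually_at_left_field shift_path_def intro!: exI[of _ 0])
        ultimately show "\<exists>l\<in>S. (shift_path u w \<longlongrightarrow> l) (at_left s)"
          using l(1) Lim_transform_eventually by blast
      qed
      then show ?thesis using t by (auto simp: \<Gamma>_def shift_path_def)
    qed
    have "{w \<in> ?D. w (u + t) \<in> A} = (\<lambda>w. w (u + t)) -` A \<inter> space (Q x)" by (auto simp: space_Q x)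
    then have shm[measurable]: "{w \<in> ?D. w (u + t) \<in> A} \<in> sets (Q x)" by simp
    have meas: "measure (Q (w u)) \<Gamma> = measure (\<kappa> (w u)) A" if "w \<in> ?D" for w
      unfolding \<kappa>_def using cadlag_pathsD(4)[OF that u] t
      by (subst measure_distr) (auto intro!: eval_Q simp: space_Q \<Gamma>_def vimage_def Int_def conj_commute)
    have "AE w in Q x. real_cond_exp (Q x) ?F (indicator {w \<in> ?D. shift_path u w \<in> \<Gamma>}) w = measure (Q (w u)) \<Gamma>"
      using markov x u \<Gamma> unfolding markov_family_def by blast
    then have AE: "AE w in Q x. real_cond_exp (Q x) ?F (indicator {w \<in> ?D. w (u + t) \<in> A}) w = measure (\<kappa> (w u)) A"
      unfolding sh using AE_space by eventually_elim (simp add: meas space_Q x)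
    have [measurable]: "(\<lambda>w. measure (\<kappa> (w u)) A) \<in> borel_measurable (Q x)"
      using measurable_compose[OF \<kappa>u measurable_measure_subprob_algebra[OF A]] .
    have "measure (Q x) (B \<inter> {w \<in> ?D. w (u + t) \<in> A}) = (\<integral>w\<in>B. indicator {w \<in> ?D. w (u + t) \<in> A} w \<partial>Q x)"
      by (simp add: set_lebesgue_integral_def indicator_inter_arith[symmetric])
    also have "\<dots> = (\<integral>w\<in>B. real_cond_exp (Q x) ?F (indicator {w \<in> ?D. w (u + t) \<in> A}) w \<partial>Q x)"
      by (rule real_cond_exp_intA[OF _ B]) (simp add: Q.emeasure_finite less_top[symmetric])
    also have "\<dots> = (\<integral>w. indicator B w * measure (\<kappa> (w u)) A \<partial>Q x)"
      unfolding set_lebesgue_integral_def using AE by (intro integral_cong_AE) auto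
    finally have *: "measure (Q x) (B \<inter> {w \<in> ?D. w (u + t) \<in> A}) = (\<integral>w. indicator B w * measure (\<kappa> (w u)) A \<partial>Q x)" .
    have \<kappa>_fin: "emeasure (\<kappa> (w u)) A = ennreal (measure (\<kappa> (w u)) A)" and \<kappa>_le: "measure (\<kappa> (w u)) A \<le> 1" if "w \<in> space (Q x)" for w
    proof -
      interpret subprob_space "\<kappa> (w u)" using subprob_space_kernel[OF \<kappa>u that] .
      show "emeasure (\<kappa> (w u)) A = ennreal (measure (\<kappa> (w u)) A)" "measure (\<kappa> (w u)) A \<le> 1"
        by (auto simp: emeasure_eq_measure subprob_measure_le_1)
    qed
    have "emeasure (distr M borel (\<lambda>w. w (u + t))) A = emeasure (Q x) (B \<inter> {w \<in> ?D. w (u + t) \<in> A})"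
    proof -
      have "(\<lambda>w. w (u + t)) -` A \<inter> space M = {w \<in> ?D. w (u + t) \<in> A}" by (auto simp: M_def space_Q x)
      then show ?thesis by (subst emeasure_distr) (simp_all add: emM measurable_cong_sets[OF M(3) refl])
    qed
    also have "\<dots> = ennreal (\<integral>w. indicator B w * measure (\<kappa> (w u)) A \<partial>Q x)"
      by (simp add: Q.emeasure_eq_measure *)
    also have "\<dots> = (\<integral>\<^sup>+w. ennreal (indicator B w * measure (\<kappa> (w u)) A) \<partial>Q x)"
      by (rule nn_integral_eq_integral[symmetric])
        (auto intro!: Q.integrable_const_bound[where B=1] simp: \<kappa>_le split: split_indicator)
    also have "\<dots> = (\<integral>\<^sup>+w. indicator B w * emeasure (\<kappa> (w u)) A \<partial>Q x)"
      by (intro nn_integral_cong) (auto simp: \<kappa>_fin split: split_indicator)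
    also have "\<dots> = (\<integral>\<^sup>+w. emeasure (\<kappa> (w u)) A \<partial>M)"
      unfolding M_def by (rule nn_integral_density[symmetric])
        (use measurable_emeasure_kernel[OF \<kappa>u A] in auto)
    also have "\<dots> = emeasure (bind M (\<lambda>w. \<kappa> (w u))) A"
      by (rule emeasure_bind[symmetric, OF M(2) \<kappa>M A])
    finally show "emeasure (distr M borel (\<lambda>w. w (u + t))) A = emeasure (bind M (\<lambda>w. \<kappa> (w u))) A" .
  qed
  have "(\<integral>w. indicator B w * g (w (u + t)) \<partial>Q x) = (\<integral>w. indicator B w * g' (w (u + t)) \<partial>Q x)"
    using cadlag_pathsD(4)[of _ S "u + t"] u t by (intro Bochner_Integration.integral_cong) (auto simp: space_Q x g'_def)
  also have "\<dots> = (\<integral>w. g' (w (u + t)) \<partial>M)"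
    unfolding M_def ennreal_indicator[symmetric] by (subst integral_density) auto
  also have "\<dots> = (\<integral>y. g' y \<partial>distr M borel (\<lambda>w. w (u + t)))"
    by (subst integral_distr) (auto simp: M_def)
  also have "\<dots> = (\<integral>w. (\<integral>y. g' y \<partial>\<kappa> (w u)) \<partial>M)"
    unfolding eq using g'_bd M(1,2) \<kappa>u
    by (intro integral_bind[where K=borel and B="max c 0" and B'=1])
      (auto simp: measurable_cong_sets[OF M(3) refl] intro!: AE_I2 subprob_space.subprob_emeasure_le_1 subprob_space_kernel[OF \<kappa>M])
  also have "\<dots> = (\<integral>w. indicator B w * (\<integral>y. g' y \<partial>\<kappa> (w u)) \<partial>Q x)"
    unfolding M_def ennreal_indicator[symmetric]
    by (subst integral_density) (use measurable_compose[OF \<kappa>u integral_measurable_subprob_algebra[OF g']] in auto)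
  also have "\<dots> = (\<integral>w. indicator B w * P t g (w u) \<partial>Q x)"
  proof (intro Bochner_Integration.integral_cong refl arg_cong2[where f="(*)"])
    fix w assume "w \<in> space (Q x)"
    then have y: "w u \<in> S" using cadlag_pathsD(4)[OF _ u] by (auto simp: space_Q x)
    have "(\<integral>z. g' z \<partial>\<kappa> (w u)) = (\<integral>\<eta>. g' (\<eta> t) \<partial>Q (w u))"
      unfolding \<kappa>_def by (rule integral_distr[OF eval_Q[OF y t] g'])
    also have "\<dots> = (\<integral>\<eta>. g (\<eta> t) \<partial>Q (w u))"
      using cadlag_pathsD(4)[of _ S t] t by (intro Bochner_Integration.integral_cong) (auto simp: space_Q y g'_def)
    finally show "(\<integral>z. g' z \<partial>\<kappa> (w u)) = P t g (w u)" using y by (simp add: transition_op_def)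
  qed
  finally show ?thesis .
qed

text \<open>The Markov property at u turns f (w v) into \<open>P (v - u) f (w u)\<close>, the
  semigroup formula writes the increment as an integral of \<open>P r h (w u)\<close>, and the
  Markov property turns each of these back into h (w (u + r)).\<close>

lemma dynkin:
  assumes x: "x \<in> S" and u: "0 \<le> u" "u \<le> v"
    and B: "B \<in> sets (natural_filtration (cadlag_paths S) (\<lambda>w. w) u)"
    and gen: "is_generator_value S P f h"
  shows "(\<integral>w. indicator B w * (f (w v) - f (w u) - (LINT r:{u..v}|lborel. h (w r))) \<partial>Q x) = 0"
proof -
  have f: "f \<in> C0 S" and h: "h \<in> C0 S" using gen by (auto simp: is_generator_value_def)
  interpret Q: prob_space "Q x" by (rule Q_prob[OF x])
  obtain cf where cf: "\<And>y. y \<in> S \<Longrightarrow> \<bar>f y\<bar> \<le> cf" using C0_bounded[OF f] by blast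
  obtain ch where ch: "\<And>y. y \<in> S \<Longrightarrow> \<bar>h y\<bar> \<le> ch" using C0_bounded[OF h] by blast
  have ch': "\<bar>P r h y\<bar> \<le> ch" if "y \<in> S" "0 \<le> r" for y r
    using P_diff_le[OF h h that(2), of 1 0 ch y] ch that(1) by simp
  have sub: "subalgebra (Q x) (natural_filtration (cadlag_paths S) (\<lambda>w. w) u)"
    using eval_Q[OF x] by (intro subalgebra_natural_filtration) (auto simp: space_Q x)
  have BQ[measurable]: "B \<in> sets (Q x)" using B sub by (auto simp: subalgebra_def)
  have inS: "w r \<in> S" if "w \<in> space (Q x)" "0 \<le> r" for w r
    using that cadlag_pathsD(4)[of w S r] by (simp add: space_Q x)
  have at_r: "(\<lambda>w. w r) \<in> Q x \<rightarrow>\<^sub>M restrict_space borel S" if "0 \<le> r" for r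
    by (rule measurable_restrict_space2) (auto intro: inS[OF _ that] eval_Q[OF x that])
  have fm: "(\<lambda>w. f (w r)) \<in> borel_measurable (Q x)" "(\<lambda>w. h (w r)) \<in> borel_measurable (Q x)" if "0 \<le> r" for r
    using C0_measurable[OF f] C0_measurable[OF h] by (auto intro: measurable_compose[OF at_r[OF that]])
  have Pm: "(\<lambda>w. P r h (w u)) \<in> borel_measurable (Q x)" if "0 \<le> r" for r
    using C0_measurable[OF P_C0[OF h that]] by (rule measurable_compose[OF at_r[OF u(1)]])
  have if_: "integrable (Q x) (\<lambda>w. indicator B w * f (w r))" if "0 \<le> r" for r
    using cf inS[OF _ that] fm(1)[OF that] order_trans[OF abs_ge_zero cf[OF inS[OF _ that]]]
    by (intro Q.integrable_const_bound[where B=cf]) (auto split: split_indicator)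
  \<comment> \<open>Joint measurability comes from the lemma on right-continuous processes, applied
    to the real-valued process r \<mapsto> \<open>P r h (w u)\<close>.\<close>
  have m1: "(\<lambda>(w, r). indicator {0..v-u} r * (indicator B w * P r h (w u))) \<in> borel_measurable (Q x \<Otimes>\<^sub>M borel)"
  proof -
    have "((\<lambda>r. P r h (w u)) \<longlongrightarrow> P t h (w u)) (at_right t)" if "w \<in> space (Q x)" "0 \<le> t" for w t
    proof -
      have "continuous_on {0..} (\<lambda>r. P r h (w u))" by (rule P_continuous[OF h inS[OF that(1) u(1)]])
      then have "((\<lambda>r. P r h (w u)) \<longlongrightarrow> P t h (w u)) (at t within {0..})" using that by (simp add: continuous_on_def)
      then show ?thesis by (rule tendsto_within_subset) (use that in auto)
    qed
    then have [measurable]: "(\<lambda>(w, r). P (max 0 r) h (w u)) \<in> borel_measurable (Q x \<Otimes>\<^sub>M borel)"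
      using measurable_right_continuous_process[of "Q x" "\<lambda>w r. P r h (w u)"] Pm by blast
    have "(\<lambda>(w, r). indicator {0..v-u} r * (indicator B w * P (max 0 r) h (w u))) \<in> borel_measurable (Q x \<Otimes>\<^sub>M borel)"
      by measurable
    then show ?thesis by (rule measurable_cong[THEN iffD1, rotated]) (auto split: split_indicator)
  qed
  have cadr: "\<And>w t. w \<in> space (Q x) \<Longrightarrow> 0 \<le> t \<Longrightarrow> (w \<longlongrightarrow> w t) (at_right t)"
    by (rule cadlag_pathsD(2)) (simp add: space_Q x)
  have m2: "(\<lambda>(w, r). indicator {u..v} r * (indicator B w * h (w r))) \<in> borel_measurable (Q x \<Otimes>\<^sub>M borel)"
  proof -
    have "(\<lambda>(w, t). w (max 0 t)) \<in> Q x \<Otimes>\<^sub>M borel \<rightarrow>\<^sub>M borel"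
      by (rule measurable_right_continuous_process[of "Q x" "\<lambda>w. w", OF cadr eval_Q[OF x]])
    then have "(\<lambda>(w, t). w (max 0 t)) \<in> Q x \<Otimes>\<^sub>M borel \<rightarrow>\<^sub>M restrict_space borel S"
      by (intro measurable_restrict_space2) (auto simp: space_pair_measure inS)
    from measurable_compose[OF this C0_measurable[OF h]]
    have [measurable]: "(\<lambda>(w, t). h (w (max 0 t))) \<in> borel_measurable (Q x \<Otimes>\<^sub>M borel)" by (simp add: split_beta')
    have "(\<lambda>(w, r). indicator {u..v} r * (indicator B w * h (w (max 0 r)))) \<in> borel_measurable (Q x \<Otimes>\<^sub>M borel)"
      by measurable
    then show ?thesis by (rule measurable_cong[THEN iffD1, rotated]) (use u in \<open>auto split: split_indicator\<close>)
  qed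
  have bd1: "\<bar>indicator B w * P r h (w u)\<bar> \<le> ch" if "w \<in> space (Q x)" "r \<in> {0..v-u}" for w r
    using ch'[OF inS[OF that(1) u(1)], of r] that by (auto split: split_indicator)
  have bd2: "\<bar>indicator B w * h (w r)\<bar> \<le> ch" if "w \<in> space (Q x)" "r \<in> {u..v}" for w r
    using ch[OF inS[OF that(1), of r]] that u by (auto split: split_indicator)
  note fub1 = Fubini_interval[OF Q.finite_measure_axioms m1 bd1]
  note fub2 = Fubini_interval[OF Q.finite_measure_axioms m2 bd2]
  have "(\<integral>w. indicator B w * f (w v) \<partial>Q x) - (\<integral>w. indicator B w * f (w u) \<partial>Q x)
      = (\<integral>w. indicator B w * P (v - u) f (w u) \<partial>Q x) - (\<integral>w. indicator B w * f (w u) \<partial>Q x)"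
    using markov_integral[OF x u(1), of "v - u" B f cf] B C0_measurable[OF f] cf u by simp
  also have "\<dots> = (\<integral>w. indicator B w * (P (v - u) f (w u) - f (w u)) \<partial>Q x)"
  proof -
    have "integrable (Q x) (\<lambda>w. indicator B w * P (v - u) f (w u))"
    proof (rule Q.integrable_const_bound[where B=cf])
      have "\<forall>y\<in>S. \<bar>P (v - u) f y\<bar> \<le> cf"
        using P_diff_le[OF f f, of "v - u" 1 0 cf] cf u by simp
      then show "AE w in Q x. norm (indicator B w * P (v - u) f (w u)) \<le> cf"
        using inS[OF _ u(1)] order_trans[OF abs_ge_zero cf[OF inS[OF _ u(1)]]]
        by (intro AE_I2) (auto split: split_indicator)
      have "(\<lambda>w. P (v - u) f (w u)) \<in> borel_measurable (Q x)"
        using C0_measurable[OF P_C0[OF f, of "v - u"]] u by (intro measurable_compose[OF at_r[OF u(1)]]) auto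
      then show "(\<lambda>w. indicator B w * P (v - u) f (w u)) \<in> borel_measurable (Q x)" by measurable
    qed
    from Bochner_Integration.integral_diff[OF this if_[OF u(1)]] show ?thesis by (simp add: right_diff_distrib)
  qed
  also have "\<dots> = (\<integral>w. (LINT r:{0..v-u}|lborel. indicator B w * P r h (w u)) \<partial>Q x)"
    using semigroup_integral[OF gen inS[OF _ u(1)], of _ "v - u"] u
    by (intro Bochner_Integration.integral_cong) (auto simp: set_integral_mult_right)
  also have "\<dots> = (LINT r:{0..v-u}|lborel. (\<integral>w. indicator B w * P r h (w u) \<partial>Q x))"
    by (rule fub1(1))
  also have "\<dots> = (LINT r:{0..v-u}|lborel. (\<integral>w. indicator B w * h (w (u + r)) \<partial>Q x))"
    using markov_integral[OF x u(1) _ B C0_measurable[OF h] ch] by (intro set_lebesgue_integral_cong) auto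
  also have "\<dots> = (\<integral>r. indicator {u..v} (u + r) * (\<integral>w. indicator B w * h (w (u + r)) \<partial>Q x) \<partial>lborel)"
    unfolding set_lebesgue_integral_def by (intro Bochner_Integration.integral_cong) (auto split: split_indicator)
  also have "\<dots> = (\<integral>r. indicator {u..v} r * (\<integral>w. indicator B w * h (w r) \<partial>Q x) \<partial>lborel)"
    by (subst lborel_integral_real_affine[where c=1 and t=u]) auto
  also have "\<dots> = (LINT r:{u..v}|lborel. (\<integral>w. indicator B w * h (w r) \<partial>Q x))"
    by (simp add: set_lebesgue_integral_def)
  also have "\<dots> = (\<integral>w. (LINT r:{u..v}|lborel. indicator B w * h (w r)) \<partial>Q x)"
    by (rule fub2(1)[symmetric])
  finally have *: "(\<integral>w. indicator B w * f (w v) \<partial>Q x) - (\<integral>w. indicator B w * f (w u) \<partial>Q x)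
      = (\<integral>w. (LINT r:{u..v}|lborel. indicator B w * h (w r)) \<partial>Q x)" .
  have "(\<integral>w. indicator B w * (f (w v) - f (w u) - (LINT r:{u..v}|lborel. h (w r))) \<partial>Q x)
     = (\<integral>w. indicator B w * f (w v) - indicator B w * f (w u) - (LINT r:{u..v}|lborel. indicator B w * h (w r)) \<partial>Q x)"
    by (intro Bochner_Integration.integral_cong) (auto simp: set_integral_mult_right algebra_simps)
  also have "\<dots> = 0"
    using if_[of v] if_[of u] u fub2(2) * by simp
  finally show ?thesis .
qed

end

section \<open>Exponential clocks with a bounded hazard rate\<close>

lemma set_integrable_bounded_Icc:
  fixes f :: "real \<Rightarrow> real"
  assumes "f \<in> borel_measurable borel" "\<And>r. r \<in> {a..b} \<Longrightarrow> \<bar>f r\<bar> \<le> c"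
  shows "set_integrable lborel {a..b} f"
  unfolding set_integrable_def
proof (rule integrableI_bounded_set[where A="{a..b}" and B=c])
  show "AE x\<in>{a..b} in lborel. norm (indicator {a..b} x *\<^sub>R f x) \<le> c"
    using assms(2) by (intro AE_I2) auto
qed (use assms in \<open>auto simp: emeasure_lborel_Icc_eq\<close>)

lemma set_integral_Icc_split:
  fixes f :: "real \<Rightarrow> real"
  assumes f: "set_integrable lborel {a..c} f" and "a \<le> b" "b \<le> c"
  shows "(LINT r:{a..c}|lborel. f r) = (LINT r:{a..b}|lborel. f r) + (LINT r:{b..c}|lborel. f r)"
proof -
  have i: "set_integrable lborel {a..b} f" "set_integrable lborel {b..c} f"
    using assms by (auto intro: set_integrable_subset[OF f])
  have "(LINT r:{a..c}|lborel. f r) = (\<integral>r. indicator {a..b} r *\<^sub>R f r + indicator {b..c} r *\<^sub>R f r \<partial>lborel)"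
    unfolding set_lebesgue_integral_def
  proof (rule integral_cong_AE)
    show "AE r in lborel. indicator {a..c} r *\<^sub>R f r = indicator {a..b} r *\<^sub>R f r + indicator {b..c} r *\<^sub>R f r"
      using AE_lborel_singleton[of b] by eventually_elim (use assms in \<open>auto split: split_indicator\<close>)
  qed (use f i in \<open>auto simp: set_integrable_def dest: borel_measurable_integrable\<close>)
  also have "\<dots> = (LINT r:{a..b}|lborel. f r) + (LINT r:{b..c}|lborel. f r)"
    using i unfolding set_integrable_def set_lebesgue_integral_def by (rule Bochner_Integration.integral_add)
  finally show ?thesis .
qed

lemma set_integral_Icc_le:
  fixes f :: "real \<Rightarrow> real"
  assumes "f \<in> borel_measurable borel" "\<And>r. r \<in> {a..b} \<Longrightarrow> \<bar>f r\<bar> \<le> c" "a \<le> b"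
  shows "\<bar>LINT r:{a..b}|lborel. f r\<bar> \<le> c * (b - a)"
proof -
  have "norm (LINT r:{a..b}|lborel. f r) \<le> (LINT r:{a..b}|lborel. norm (f r))"
    by (rule set_integral_norm_bound[OF set_integrable_bounded_Icc[OF assms(1,2)]])
  also have "\<dots> \<le> (LINT r:{a..b}|lborel. c)"
    using assms by (intro set_integral_mono set_integrable_norm set_integrable_bounded_Icc[where c=c] set_integrable_bounded_Icc[where c="\<bar>c\<bar>"]) auto
  also have "\<dots> = c * (b - a)" using assms(3) by (simp add: set_lebesgue_integral_def)
  finally show ?thesis by simp
qed

text \<open>The rate l is merely measurable, so H need not be differentiable everywhere and the
  usual rule for exp(-H) is not at hand. Instead the sum G of both sides has increments of order (t
  - s) squared; its derivative is therefore 0 and G is constant.\<close>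

lemma exp_hazard_integral:
  fixes l :: "real \<Rightarrow> real"
  assumes l[measurable]: "l \<in> borel_measurable borel" and l0: "\<And>r. 0 \<le> l r" and lc: "\<And>r. l r \<le> c"
    and H_def: "\<And>t. H t = (LINT r:{0..t}|lborel. l r)"
    and uv: "0 \<le> u" "u \<le> v"
  shows "(LINT r:{u..v}|lborel. l r * exp (- H r)) = exp (- H u) - exp (- H v)"
    and "continuous_on {0..} H" and "\<And>s t. 0 \<le> s \<Longrightarrow> s \<le> t \<Longrightarrow> H s \<le> H t" and "\<And>t. 0 \<le> H t"
proof -
  have c0: "0 \<le> c" using l0[of 0] lc[of 0] by simp
  have il: "set_integrable lborel {a..b} l" for a b
    using l0 lc by (intro set_integrable_bounded_Icc[where c=c]) auto
  have split: "H t = H s + (LINT r:{s..t}|lborel. l r)" if "0 \<le> s" "s \<le> t" for s t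
    unfolding H_def by (rule set_integral_Icc_split[OF il that])
  have d: "0 \<le> (LINT r:{s..t}|lborel. l r)" "(LINT r:{s..t}|lborel. l r) \<le> c * (t - s)" if "s \<le> t" for s t
  proof -
    show "0 \<le> (LINT r:{s..t}|lborel. l r)"
      unfolding set_lebesgue_integral_def using l0 by (intro Bochner_Integration.integral_nonneg) auto
    show "(LINT r:{s..t}|lborel. l r) \<le> c * (t - s)"
      using set_integral_Icc_le[of l s t c] l0 lc that by auto
  qed
  show mono: "H s \<le> H t" if "0 \<le> s" "s \<le> t" for s t using split[OF that] d(1)[OF that(2)] by simp
  show nn: "0 \<le> H t" for t
    unfolding H_def set_lebesgue_integral_def using l0 by (intro Bochner_Integration.integral_nonneg) auto
  have lip: "\<bar>H s - H t\<bar> \<le> c * \<bar>s - t\<bar>" if "0 \<le> s" "0 \<le> t" for s t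
  proof (cases "s \<le> t")
    case True then show ?thesis using split[of s t] d[of s t] that by auto
  next
    case False then show ?thesis using split[of t s] d[of t s] that by auto
  qed
  show "continuous_on {0..} H"
    by (rule lipschitz_on_continuous_on[of c]) (use lip c0 in \<open>auto simp: lipschitz_on_def dist_real_def\<close>)
  have "H \<in> borel_measurable borel"
  proof -
    have "(\<lambda>t. \<integral>r. indicator {p. 0 \<le> snd p \<and> snd p \<le> fst p} (t, r) * l r \<partial>lborel) \<in> borel_measurable borel"
      by (rule lborel.borel_measurable_lebesgue_integral) measurable
    then show ?thesis by (rule measurable_cong[THEN iffD1, rotated])
        (auto simp: H_def set_lebesgue_integral_def intro!: Bochner_Integration.integral_cong split: split_indicator)
  qed
  note [measurable] = this
  have bd: "\<bar>l r * exp (- H r)\<bar> \<le> c" for r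
    using mult_mono[of "l r" c "exp (- H r)" 1] l0 lc nn c0 by (simp add: abs_mult)
  have ile: "set_integrable lborel {a..b} (\<lambda>r. l r * exp (- H r))" for a b
    using bd by (intro set_integrable_bounded_Icc[where c=c]) auto
  define G where "G t = exp (- H t) + (LINT r:{0..t}|lborel. l r * exp (- H r))" for t
  have G1: "\<bar>G t - G s\<bar> \<le> c\<^sup>2 * (t - s)\<^sup>2" if st: "0 \<le> s" "s \<le> t" for s t
  proof -
    \<comment> \<open>With D the increment of H, the integral I lies between D exp(-H t) and D
      exp(-H s); the first-order terms cancel and remainders of order D squared are left.\<close>
    define D where "D = (LINT r:{s..t}|lborel. l r)"
    define I where "I = (LINT r:{s..t}|lborel. l r * exp (- H r))"
    have Ht: "H t = H s + D" unfolding D_def by (rule split[OF st])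
    have D: "0 \<le> D" "D \<le> c * (t - s)" unfolding D_def using d[OF st(2)] by auto
    have I1: "I \<le> D * exp (- H s)"
    proof -
      have "I \<le> (LINT r:{s..t}|lborel. l r * exp (- H s))" unfolding I_def
        using mono[of s] st l0 by (intro set_integral_mono ile set_integrable_mult_left il) (auto intro!: mult_left_mono)
      then show ?thesis by (simp add: D_def)
    qed
    have I2: "D * exp (- H t) \<le> I"
    proof -
      have "(LINT r:{s..t}|lborel. l r * exp (- H t)) \<le> I" unfolding I_def
        using mono[of _ t] st l0 by (intro set_integral_mono ile set_integrable_mult_left il) (auto intro!: mult_left_mono)
      then show ?thesis by (simp add: D_def)
    qed
    have "G t - G s = exp (- H t) - exp (- H s) + I"
      using set_integral_Icc_split[OF ile st] by (simp add: G_def I_def)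
    moreover have e: "exp (- H t) = exp (- H s) * exp (- D)" by (simp add: Ht exp_add[symmetric])
    moreover have e1: "0 \<le> exp (- H s)" "exp (- H s) \<le> 1" using nn by auto
    moreover have "1 - D \<le> exp (- D)" using exp_ge_add_one_self[of "- D"] by simp
    \<comment> \<open>From exp(-D) \<le> 1/(1+D) and (1 - D + D^2)(1 + D) = 1 + D^3.\<close>
    moreover have D2: "exp (- D) - 1 + D \<le> D\<^sup>2"
    proof -
      have "exp (- D) * (1 + D) \<le> exp (- D) * exp D" by (intro mult_left_mono) auto
      then have "exp (- D) * (1 + D) \<le> 1" by (simp add: exp_minus)
      then have "exp (- D) \<le> 1 / (1 + D)" using D by (simp add: pos_le_divide_eq)
      moreover have "1 / (1 + D) \<le> 1 - D + D\<^sup>2"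
      proof -
        have "(1 - D + D\<^sup>2) * (1 + D) = 1 + D ^ 3" by (simp add: power2_eq_square power3_eq_cube algebra_simps)
        then have "1 \<le> (1 - D + D\<^sup>2) * (1 + D)" using D by simp
        then show ?thesis using D by (simp add: pos_divide_le_eq)
      qed
      ultimately show ?thesis by simp
    qed
    moreover have D3: "1 - exp (- D) - D * exp (- D) \<le> D\<^sup>2"
    proof -
      have "(1 + D) * (1 - D) \<le> (1 + D) * exp (- D)" using \<open>1 - D \<le> exp (- D)\<close> D by (intro mult_left_mono) auto
      then show ?thesis by (simp add: algebra_simps power2_eq_square)
    qed
    ultimately have up: "G t - G s \<le> exp (- H s) * (exp (- D) - 1 + D)"
      and lo: "G t - G s \<ge> - (exp (- H s) * (1 - exp (- D) - D * exp (- D)))"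
      using I1 I2 by (auto simp: algebra_simps)
    have "exp (- H s) * (exp (- D) - 1 + D) \<le> 1 * D\<^sup>2"
      using e1 D2 \<open>1 - D \<le> exp (- D)\<close> by (intro mult_mono) auto
    moreover have "exp (- H s) * (1 - exp (- D) - D * exp (- D)) \<le> 1 * D\<^sup>2"
    proof (cases "0 \<le> 1 - exp (- D) - D * exp (- D)")
      case True then show ?thesis using e1 D3 by (intro mult_mono) auto
    next
      case False
      then have "exp (- H s) * (1 - exp (- D) - D * exp (- D)) \<le> 0" by (intro mult_nonneg_nonpos) auto
      then show ?thesis using zero_le_power2[of D] by linarith
    qed
    ultimately have "\<bar>G t - G s\<bar> \<le> D\<^sup>2" using up lo by linarith
    also have "\<dots> \<le> (c * (t - s))\<^sup>2" using D by (rule power_mono[rotated])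
    finally show ?thesis by (simp add: power_mult_distrib)
  qed
  have G2: "\<bar>G y - G x\<bar> \<le> c\<^sup>2 * (y - x)\<^sup>2" if "0 \<le> x" "0 \<le> y" for x y
    using G1[of x y] G1[of y x] that by (cases "x \<le> y") (auto simp: abs_minus_commute power2_commute)
  have "(G has_derivative (\<lambda>h. 0)) (at x within {0..})" if x: "x \<in> {0..}" for x
    unfolding has_derivative_within_alt
  proof (intro conjI allI impI)
    fix e :: real assume e: "0 < e"
    have "norm (G y - G x - 0) \<le> e * norm (y - x)" if y: "y \<in> {0..}" "norm (y - x) < e / (c\<^sup>2 + 1)" for y
    proof -
      have "c\<^sup>2 * \<bar>y - x\<bar> \<le> (c\<^sup>2 + 1) * \<bar>y - x\<bar>" by (intro mult_right_mono) auto
      also have "\<dots> \<le> e" using y(2) by (simp add: pos_less_divide_eq add_nonneg_pos mult.commute)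
      finally have "c\<^sup>2 * \<bar>y - x\<bar> * \<bar>y - x\<bar> \<le> e * \<bar>y - x\<bar>" by (intro mult_right_mono) auto
      then show ?thesis using G2[of x y] x y(1) by (simp add: power2_eq_square abs_mult_self_eq mult.assoc)
    qed
    then show "\<exists>d>0. \<forall>y\<in>{0..}. norm (y - x) < d \<longrightarrow> norm (G y - G x - 0) \<le> e * norm (y - x)"
      using e by (intro exI[of _ "e / (c\<^sup>2 + 1)"]) (auto simp: add_nonneg_pos)
  qed simp
  from has_derivative_zero_constant[OF _ this] have "G u = G v" using uv by (force simp: convex_real_interval)
  then show "(LINT r:{u..v}|lborel. l r * exp (- H r)) = exp (- H u) - exp (- H v)"
    using set_integral_Icc_split[OF ile uv] by (simp add: G_def)
qed

text \<open>The total mass is the limit of 1 - exp(-H v). It is below 1 when the total hazard is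
  finite: the clock may never ring.\<close>

lemma nn_integral_exp_hazard_Ioc:
  fixes l :: "real \<Rightarrow> real"
  assumes l[measurable]: "l \<in> borel_measurable borel" and l0: "\<And>r. 0 \<le> l r" and lc: "\<And>r. l r \<le> c"
    and H_def: "\<And>t. H t = (LINT r:{0..t}|lborel. l r)"
    and Hm[measurable]: "H \<in> borel_measurable borel" and v: "0 \<le> v"
  shows "(\<integral>\<^sup>+r. ennreal (l r * exp (- H r)) * indicator {0<..v} r \<partial>lborel) = ennreal (1 - exp (- H v))"
    and "(\<integral>\<^sup>+r. ennreal (l r * exp (- H r)) * indicator {0<..} r \<partial>lborel) \<le> 1"
proof -
  note hz = exp_hazard_integral[where H=H, OF l l0 lc H_def]
  have nn: "0 \<le> H t" for t using hz(4)[of 0 0 t] by simp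
  have H0: "H 0 = 0"
    using set_integral_Icc_le[of l 0 0 c] l0 lc by (simp add: H_def)
  have *: "(\<integral>\<^sup>+r. ennreal (l r * exp (- H r)) * indicator {0<..v} r \<partial>lborel) = ennreal (1 - exp (- H v))"
    if v: "0 \<le> v" for v
  proof -
    have "\<bar>l r * exp (- H r)\<bar> \<le> c" for r
      using mult_mono[of "l r" c "exp (- H r)" 1] l0 lc nn order_trans[OF l0 lc] by (simp add: abs_mult)
    then have int: "set_integrable lborel {0..v} (\<lambda>r. l r * exp (- H r))"
      by (intro set_integrable_bounded_Icc[where c=c]) auto
    have "(\<integral>\<^sup>+r. ennreal (l r * exp (- H r)) * indicator {0<..v} r \<partial>lborel)
        = (\<integral>\<^sup>+r. ennreal (indicator {0..v} r *\<^sub>R (l r * exp (- H r))) \<partial>lborel)"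
    proof (rule nn_integral_cong_AE)
      show "AE r in lborel. ennreal (l r * exp (- H r)) * indicator {0<..v} r = ennreal (indicator {0..v} r *\<^sub>R (l r * exp (- H r)))"
        using AE_lborel_singleton[of 0] by eventually_elim (auto split: split_indicator)
    qed
    also have "\<dots> = ennreal (LINT r:{0..v}|lborel. l r * exp (- H r))"
      using int l0 unfolding set_integrable_def set_lebesgue_integral_def by (intro nn_integral_eq_integral) auto
    also have "\<dots> = ennreal (1 - exp (- H v))" using hz(1)[of 0 v] v H0 by simp
    finally show ?thesis .
  qed
  show "(\<integral>\<^sup>+r. ennreal (l r * exp (- H r)) * indicator {0<..v} r \<partial>lborel) = ennreal (1 - exp (- H v))"
    by (rule *[OF v])
  let ?D = "density lborel (\<lambda>r. ennreal (l r * exp (- H r)))"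
  have eD: "emeasure ?D A = (\<integral>\<^sup>+r. ennreal (l r * exp (- H r)) * indicator A r \<partial>lborel)" if "A \<in> sets borel" for A
    using that by (subst emeasure_density) auto
  have U: "{0<..} = (\<Union>n::nat. {0<..real n})"
    using real_arch_simple by (auto simp: set_eq_iff)
  have "emeasure ?D {0<..} = (SUP n::nat. emeasure ?D {0<..real n})"
    unfolding U by (rule SUP_emeasure_incseq[symmetric]) (auto intro!: incseq_SucI)
  also have "\<dots> \<le> 1" using *[of "real _"] by (intro SUP_least) (auto simp: eD ennreal_le_1)
  finally show "(\<integral>\<^sup>+r. ennreal (l r * exp (- H r)) * indicator {0<..} r \<partial>lborel) \<le> 1" by (simp add: eD)
qed

section \<open>One stage of the construction\<close>

text \<open>Clamping the time gives an evaluation that is jointly measurable over all real times;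
  clocks do take nonpositive values.\<close>

definition ev :: "(real \<Rightarrow> 'a) \<Rightarrow> real \<Rightarrow> 'a" where
  "ev \<eta> t = \<eta> (max 0 t)"

lemma ev_nonneg: "0 \<le> t \<Longrightarrow> ev \<eta> t = \<eta> t"
  by (simp add: ev_def)

definition stop_path :: "real \<Rightarrow> (real \<Rightarrow> 'a) \<Rightarrow> real \<Rightarrow> 'a" where
  "stop_path u \<eta> = (\<lambda>t\<in>{0..}. \<eta> (min t u))"

text \<open>The process frozen at t is right-continuous and uses only times up to t, so the lemma on
  joint measurability applies with the information available at time t.\<close>

lemma measurable_integral_adapted:
  fixes X :: "'w \<Rightarrow> real \<Rightarrow> 'a::metric_space" and g :: "'a \<Rightarrow> real"
  assumes rc: "\<And>w s. w \<in> space M \<Longrightarrow> 0 \<le> s \<Longrightarrow> (X w \<longlongrightarrow> X w s) (at_right s)"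
    and m: "\<And>s. 0 \<le> s \<Longrightarrow> s \<le> t \<Longrightarrow> (\<lambda>w. X w s) \<in> M \<rightarrow>\<^sub>M borel"
    and g: "g \<in> borel_measurable borel" and a: "0 \<le> a"
  shows "(\<lambda>w. LINT s:{a..t}|lborel. g (X w s)) \<in> borel_measurable M"
proof (cases "0 \<le> t")
  case True
  have "((\<lambda>s. X w (min s t)) \<longlongrightarrow> X w (min s t)) (at_right s)" if "w \<in> space M" "0 \<le> s" for w s
  proof (cases "s < t")
    case True
    then have "\<forall>\<^sub>F r in at_right s. X w r = X w (min r t)"
      by (auto simp: eventually_at_right_field min_def intro!: exI[of _ t])
    from Lim_transform_eventually[OF rc[OF that] this] show ?thesis using True by simp
  next
    case False
    then have "\<forall>\<^sub>F r in at_right s. X w t = X w (min r t)"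
      by (auto simp: eventually_at_right_field min_def intro!: exI[of _ "s+1"])
    from Lim_transform_eventually[OF tendsto_const this] show ?thesis using False by (simp add: min.absorb2)
  qed
  from measurable_right_continuous_process[where X="\<lambda>w s. X w (min s t)" and M=M, OF this]
  have j: "(\<lambda>(w, s). X w (min (max 0 s) t)) \<in> M \<Otimes>\<^sub>M borel \<rightarrow>\<^sub>M borel"
    using m True by auto
  from measurable_compose[OF j g]
  have [measurable]: "(\<lambda>p. g (X (fst p) (min (max 0 (snd p)) t))) \<in> borel_measurable (M \<Otimes>\<^sub>M borel)"
    by (simp add: split_beta')
  have "(\<lambda>w. \<integral>s. indicator {a..t} s * g (X w (min (max 0 s) t)) \<partial>lborel) \<in> borel_measurable M"
    by (rule lborel.borel_measurable_lebesgue_integral) (simp add: split_beta', measurable)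
  then show ?thesis
    by (rule measurable_cong[THEN iffD1, rotated])
      (use a in \<open>auto simp: set_lebesgue_integral_def intro!: Bochner_Integration.integral_cong split: split_indicator\<close>)
next
  case False
  then have "{a..t} = {}" using a by auto
  then show ?thesis by (simp add: set_lebesgue_integral_def)
qed

text \<open>The strata are abstracted away: one path set, one kernel of path laws on the whole
  space, a bounded total rate and one kernel for edge and landing point together. Closure of the
  path set under stopping allows the observed part of a path to be a path again; constant paths fill
  the component 0 of a sample.\<close>

locale jump_diffusion =
  fixes \<Omega> :: "(real \<Rightarrow> 'a::{metric_space, second_countable_topology}) set"
    and Q :: "'a \<Rightarrow> (real \<Rightarrow> 'a) measure"
    and \<Lambda> :: "'a \<Rightarrow> real" and \<Lambda>max :: real
    and E :: "'e set" and \<pi> :: "'a \<Rightarrow> ('e \<times> 'a) measure"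
  assumes \<Omega>: "\<Omega> \<subseteq> cadlag_paths UNIV"
    and \<Omega>_stop: "\<And>\<eta> u. \<eta> \<in> \<Omega> \<Longrightarrow> 0 \<le> u \<Longrightarrow> stop_path u \<eta> \<in> \<Omega>"
    and \<Omega>_const: "\<And>x. (\<lambda>t\<in>{0..}. x) \<in> \<Omega>"
    and Q[measurable]: "Q \<in> borel \<rightarrow>\<^sub>M prob_algebra (path_algebra \<Omega>)"
    and Q_start: "\<And>x. AE \<eta> in Q x. \<eta> 0 = x"
    and \<Lambda>_measurable[measurable]: "\<Lambda> \<in> borel_measurable borel"
    and \<Lambda>_nonneg: "\<And>x. 0 \<le> \<Lambda> x" and \<Lambda>_le: "\<And>x. \<Lambda> x \<le> \<Lambda>max"
    and E_countable: "countable E"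
    and \<pi>[measurable]: "\<pi> \<in> borel \<rightarrow>\<^sub>M prob_algebra (count_space E \<Otimes>\<^sub>M borel)"
begin

abbreviation N where "N \<equiv> path_algebra \<Omega>"
abbreviation EM where "EM \<equiv> count_space E \<Otimes>\<^sub>M (borel :: 'a measure)"
abbreviation St where "St \<equiv> N \<Otimes>\<^sub>M ((borel :: real measure) \<Otimes>\<^sub>M EM)"

lemma \<Omega>_PiE: "\<Omega> \<subseteq> {0..} \<rightarrow>\<^sub>E UNIV" using \<Omega> cadlag_paths_subset by blast

lemma space_N [simp]: "space N = \<Omega>" by (rule space_path_algebra[OF \<Omega>_PiE])

lemma right_cont: "\<eta> \<in> \<Omega> \<Longrightarrow> 0 \<le> t \<Longrightarrow> (\<eta> \<longlongrightarrow> \<eta> t) (at_right t)"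
  using \<Omega> by (auto intro: cadlag_pathsD(2))

lemma measurable_ev_pair: "(\<lambda>(\<eta>, t). ev \<eta> t) \<in> N \<Otimes>\<^sub>M borel \<rightarrow>\<^sub>M borel"
  unfolding ev_def
  by (rule measurable_right_continuous_process) (auto intro: right_cont measurable_path_algebra_eval)

lemma measurable_ev [measurable (raw)]:
  "f \<in> M \<rightarrow>\<^sub>M N \<Longrightarrow> g \<in> borel_measurable M \<Longrightarrow> (\<lambda>x. ev (f x) (g x)) \<in> M \<rightarrow>\<^sub>M borel"
  using measurable_compose[OF measurable_Pair measurable_ev_pair, of f M g] by simp

lemma prob_Q: "prob_space (Q x)" and sets_Q [simp]: "sets (Q x) = sets N"
  using measurable_space[OF Q, of x] by (auto simp: space_prob_algebra)
lemma space_Q [simp]: "space (Q x) = \<Omega>" using sets_eq_imp_space_eq[OF sets_Q] by simp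
lemma prob_\<pi>: "prob_space (\<pi> x)" and sets_\<pi> [simp]: "sets (\<pi> x) = sets EM"
  using measurable_space[OF \<pi>, of x] by (auto simp: space_prob_algebra)

text \<open>The cumulative hazard: exp(-H) is the probability, given the path, that the clock has
  not rung yet.\<close>

definition H :: "(real \<Rightarrow> 'a) \<Rightarrow> real \<Rightarrow> real" where
  "H \<eta> t = (LINT r:{0..t}|lborel. \<Lambda> (ev \<eta> r))"

lemma measurable_H [measurable (raw)]:
  assumes [measurable]: "f \<in> M \<rightarrow>\<^sub>M N" "g \<in> borel_measurable M"
  shows "(\<lambda>x. H (f x) (g x)) \<in> borel_measurable M"
proof -
  have "(\<lambda>x. \<integral>r. indicator {p. 0 \<le> snd p \<and> snd p \<le> g (fst p)} (x, r) * \<Lambda> (ev (f x) r) \<partial>lborel) \<in> borel_measurable M"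
    by (rule lborel.borel_measurable_lebesgue_integral) measurable
  then show ?thesis by (rule measurable_cong[THEN iffD1, rotated])
      (auto simp: H_def set_lebesgue_integral_def intro!: Bochner_Integration.integral_cong split: split_indicator)
qed

lemma measurable_ev_path: "\<eta> \<in> \<Omega> \<Longrightarrow> (\<lambda>r. ev \<eta> r) \<in> borel \<rightarrow>\<^sub>M borel"
  by (rule measurable_ev) auto

text \<open>The density of the ringing time given the path.\<close>

definition haz :: "(real \<Rightarrow> 'a) \<Rightarrow> real \<Rightarrow> real" where
  "haz \<eta> r = \<Lambda> (ev \<eta> r) * exp (- H \<eta> r)"

lemma measurable_haz [measurable (raw)]:
  assumes [measurable]: "f \<in> M \<rightarrow>\<^sub>M N" "g \<in> borel_measurable M"
  shows "(\<lambda>x. haz (f x) (g x)) \<in> borel_measurable M"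
  unfolding haz_def by measurable

text \<open>
  The clock of a stage is a real number \<open>r\<close>, which rings at time \<open>r\<close> if \<open>r > 0\<close> and never if
  \<open>r \<le> 0\<close>; the probability of the latter event is spread uniformly over \<open>[-1, 0]\<close>.
\<close>

definition clock_density :: "(real \<Rightarrow> 'a) \<Rightarrow> real \<Rightarrow> ennreal" where
  "clock_density \<eta> r = ennreal (haz \<eta> r) * indicator {0<..} r +
     (1 - (\<integral>\<^sup>+s. ennreal (haz \<eta> s) * indicator {0<..} s \<partial>lborel)) * indicator {-1..0} r"

definition clock :: "(real \<Rightarrow> 'a) \<Rightarrow> real measure" where
  "clock \<eta> = density lborel (clock_density \<eta>)"

lemma measurable_clock_density [measurable (raw)]:
  assumes [measurable]: "f \<in> M \<rightarrow>\<^sub>M N" "g \<in> borel_measurable M"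
  shows "(\<lambda>x. clock_density (f x) (g x)) \<in> borel_measurable M"
proof -
  have "(\<lambda>x. (\<integral>\<^sup>+s. ennreal (haz (f x) s) * indicator {0<..} s \<partial>lborel)) \<in> borel_measurable M"
    by (rule lborel.borel_measurable_nn_integral) measurable
  note [measurable] = this
  show ?thesis unfolding clock_density_def by measurable
qed

lemma hazard_facts:
  assumes \<eta>: "\<eta> \<in> \<Omega>"
  shows "0 \<le> u \<Longrightarrow> u \<le> v \<Longrightarrow> (LINT r:{u..v}|lborel. haz \<eta> r) = exp (- H \<eta> u) - exp (- H \<eta> v)"
    and "0 \<le> H \<eta> t"
    and "0 \<le> v \<Longrightarrow> (\<integral>\<^sup>+r. ennreal (haz \<eta> r) * indicator {0<..v} r \<partial>lborel) = ennreal (1 - exp (- H \<eta> v))"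
    and "(\<integral>\<^sup>+r. ennreal (haz \<eta> r) * indicator {0<..} r \<partial>lborel) \<le> 1"
proof -
  have [measurable]: "(\<lambda>r. ev \<eta> r) \<in> borel \<rightarrow>\<^sub>M borel" by (rule measurable_ev_path[OF \<eta>])
  have m: "(\<lambda>r. \<Lambda> (ev \<eta> r)) \<in> borel_measurable borel" by measurable
  have Hm: "H \<eta> \<in> borel_measurable borel"
    using measurable_H[of "\<lambda>_. \<eta>" borel "\<lambda>t. t"] \<eta> by simp
  note 1 = exp_hazard_integral[where H="H \<eta>", OF m \<Lambda>_nonneg \<Lambda>_le H_def]
  note 2 = nn_integral_exp_hazard_Ioc[where H="H \<eta>", OF m \<Lambda>_nonneg \<Lambda>_le H_def Hm]
  show "0 \<le> u \<Longrightarrow> u \<le> v \<Longrightarrow> (LINT r:{u..v}|lborel. haz \<eta> r) = exp (- H \<eta> u) - exp (- H \<eta> v)"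
    unfolding haz_def by (rule 1(1))
  show "0 \<le> H \<eta> t" by (rule 1(4)[of 0 0]) auto
  show "0 \<le> v \<Longrightarrow> (\<integral>\<^sup>+r. ennreal (haz \<eta> r) * indicator {0<..v} r \<partial>lborel) = ennreal (1 - exp (- H \<eta> v))"
    unfolding haz_def by (rule 2(1))
  show "(\<integral>\<^sup>+r. ennreal (haz \<eta> r) * indicator {0<..} r \<partial>lborel) \<le> 1"
    unfolding haz_def by (rule 2(2)[of 0]) simp
qed

lemma sets_clock [simp]: "sets (clock \<eta>) = sets borel" and space_clock [simp]: "space (clock \<eta>) = UNIV"
  by (auto simp: clock_def)

lemma emeasure_clock:
  assumes "\<eta> \<in> \<Omega>" "A \<in> sets borel"
  shows "emeasure (clock \<eta>) A = (\<integral>\<^sup>+r. clock_density \<eta> r * indicator A r \<partial>lborel)"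
proof -
  have "clock_density \<eta> \<in> borel_measurable borel"
    using measurable_clock_density[of "\<lambda>_. \<eta>" borel "\<lambda>t. t"] assms by simp
  then show ?thesis unfolding clock_def using assms by (subst emeasure_density) auto
qed

lemma prob_clock:
  assumes \<eta>: "\<eta> \<in> \<Omega>"
  shows "prob_space (clock \<eta>)"
proof (rule prob_spaceI)
  have [measurable]: "haz \<eta> \<in> borel_measurable borel"
    using measurable_haz[of "\<lambda>_. \<eta>" borel "\<lambda>t. t"] \<eta> by simp
  let ?m = "(\<integral>\<^sup>+s. ennreal (haz \<eta> s) * indicator {0<..} s \<partial>lborel)"
  have "emeasure (clock \<eta>) (space (clock \<eta>)) = (\<integral>\<^sup>+r. clock_density \<eta> r \<partial>lborel)"
    using emeasure_clock[OF \<eta>, of UNIV] by simp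
  also have "\<dots> = ?m + (\<integral>\<^sup>+r. (1 - ?m) * indicator {-1..0::real} r \<partial>lborel)"
    unfolding clock_density_def by (rule nn_integral_add) auto
  also have "(\<integral>\<^sup>+r. (1 - ?m) * indicator {-1..0::real} r \<partial>lborel) = 1 - ?m"
    by (subst nn_integral_cmult_indicator) auto
  also have "?m + (1 - ?m) = 1" using diff_add_cancel_ennreal[OF hazard_facts(4)[OF \<eta>]] by (simp add: add.commute)
  finally show "emeasure (clock \<eta>) (space (clock \<eta>)) = 1" .
qed

lemma clock_Ioc:
  assumes \<eta>: "\<eta> \<in> \<Omega>" and v: "0 \<le> v"
  shows "measure (clock \<eta>) {0<..v} = 1 - exp (- H \<eta> v)"
proof -
  have "emeasure (clock \<eta>) {0<..v} = (\<integral>\<^sup>+r. ennreal (haz \<eta> r) * indicator {0<..v} r \<partial>lborel)"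
    by (subst emeasure_clock[OF \<eta>]) (auto simp: clock_density_def intro!: nn_integral_cong split: split_indicator)
  then show ?thesis
    using hazard_facts(3)[OF \<eta> v] hazard_facts(2)[OF \<eta>, of v] by (simp add: measure_def)
qed

text \<open>Not yet rung at elapsed time q, with the ringing instant itself counted as rung; this
  makes the state right-continuous. Clocks r \<le> 0 never ring and are always alive.\<close>

definition alive :: "real \<Rightarrow> real \<Rightarrow> bool" where
  "alive q r \<longleftrightarrow> \<not> (0 < r \<and> r \<le> q)"

lemma alive_antimono: "q \<le> q' \<Longrightarrow> alive q' r \<Longrightarrow> alive q r"
  by (auto simp: alive_def)

lemma measurable_alive [measurable (raw)]:
  assumes [measurable]: "f \<in> borel_measurable M" "g \<in> borel_measurable M"
  shows "Measurable.pred M (\<lambda>x. alive (f x) (g x))"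
  unfolding alive_def by measurable

lemma integral_clock_alive:
  assumes \<eta>: "\<eta> \<in> \<Omega>" and q: "0 \<le> q"
  shows "(\<integral>r. of_bool (alive q r) \<partial>clock \<eta>) = exp (- H \<eta> q)"
proof -
  interpret prob_space "clock \<eta>" by (rule prob_clock[OF \<eta>])
  have "(\<integral>r. of_bool (alive q r) \<partial>clock \<eta>) = (\<integral>r. indicator (UNIV - {0<..q}) r \<partial>clock \<eta>)"
    by (intro Bochner_Integration.integral_cong) (auto simp: alive_def split: split_indicator)
  also have "\<dots> = prob (UNIV - {0<..q})" by simp
  also have "\<dots> = exp (- H \<eta> q)" using clock_Ioc[OF \<eta> q] prob_compl[of "{0<..q}"] by simp
  finally show ?thesis .
qed

lemma integral_clock_Ioc:
  fixes F :: "real \<Rightarrow> real"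
  assumes \<eta>: "\<eta> \<in> \<Omega>" and [measurable]: "F \<in> borel_measurable borel" and u: "0 \<le> u"
  shows "(\<integral>r. indicator {u<..v} r * F r \<partial>clock \<eta>) = (LINT r:{u..v}|lborel. haz \<eta> r * F r)"
proof -
  have [measurable]: "haz \<eta> \<in> borel_measurable borel"
    using measurable_haz[of "\<lambda>_. \<eta>" borel "\<lambda>t. t"] \<eta> by simp
  have haz0: "0 \<le> haz \<eta> r" for r using \<Lambda>_nonneg by (simp add: haz_def)
  have cm: "clock_density \<eta> \<in> borel_measurable borel"
    using measurable_clock_density[of "\<lambda>_. \<eta>" borel "\<lambda>t. t"] \<eta> by simp
  let ?p = "enn2real (1 - (\<integral>\<^sup>+s. ennreal (haz \<eta> s) * indicator {0<..} s \<partial>lborel))"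
  have "(1 - (\<integral>\<^sup>+s. ennreal (haz \<eta> s) * indicator {0<..} s \<partial>lborel)) = ennreal ?p"
    by (subst ennreal_enn2real) (auto simp: less_top[symmetric] ennreal_minus_eq_top)
  then have cd: "clock_density \<eta> r = ennreal (haz \<eta> r * indicator {0<..} r + ?p * indicator {-1..0} r)" for r
    using haz0 by (auto simp: clock_density_def split: split_indicator)
  have "(\<integral>r. indicator {u<..v} r * F r \<partial>clock \<eta>)
    = (\<integral>r. (haz \<eta> r * indicator {0<..} r + ?p * indicator {-1..0} r) * (indicator {u<..v} r * F r) \<partial>lborel)"
    unfolding clock_def cd using haz0 by (subst integral_density) auto
  also have "\<dots> = (LINT r:{u..v}|lborel. haz \<eta> r * F r)"
    unfolding set_lebesgue_integral_def
  proof (rule integral_cong_AE)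
    show "AE r in lborel. (haz \<eta> r * indicator {0<..} r + ?p * indicator {-1..0} r) * (indicator {u<..v} r * F r)
        = indicator {u..v} r *\<^sub>R (haz \<eta> r * F r)"
      using AE_lborel_singleton[of u] by eventually_elim (use u in \<open>auto split: split_indicator\<close>)
  qed auto
  finally show ?thesis .
qed

lemma measurable_clock [measurable]: "clock \<in> N \<rightarrow>\<^sub>M prob_algebra borel"
proof (rule measurable_prob_algebraI)
  show p: "prob_space (clock \<eta>)" if "\<eta> \<in> space N" for \<eta> using that by (simp add: prob_clock)
  show "clock \<in> N \<rightarrow>\<^sub>M subprob_algebra borel"
  proof (rule measurable_subprob_algebra)
    fix A :: "real set" assume A[measurable]: "A \<in> sets borel"
    have "(\<lambda>\<eta>. \<integral>\<^sup>+r. clock_density \<eta> r * indicator A r \<partial>lborel) \<in> borel_measurable N"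
      by (rule lborel.borel_measurable_nn_integral) measurable
    then show "(\<lambda>\<eta>. emeasure (clock \<eta>) A) \<in> borel_measurable N"
      by (rule measurable_cong[THEN iffD1, rotated]) (simp add: emeasure_clock)
  qed (use p in \<open>auto intro: prob_space_imp_subprob_space\<close>)
qed

text \<open>A mark is drawn even if the clock never rings; it is then drawn at
  \<open>ev \<eta> r\<close> = \<open>\<eta> 0\<close> and belongs to a jump at time infinity, so
  the process never shows it.\<close>

definition jump_given :: "(real \<Rightarrow> 'a) \<Rightarrow> real \<Rightarrow> ((real \<Rightarrow> 'a) \<times> real \<times> 'e \<times> 'a) measure" where
  "jump_given \<eta> r = \<pi> (ev \<eta> r) \<bind> (\<lambda>p. return St (\<eta>, r, p))"

definition stage_given :: "(real \<Rightarrow> 'a) \<Rightarrow> ((real \<Rightarrow> 'a) \<times> real \<times> 'e \<times> 'a) measure" where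
  "stage_given \<eta> = clock \<eta> \<bind> jump_given \<eta>"

definition stage :: "'a \<Rightarrow> ((real \<Rightarrow> 'a) \<times> real \<times> 'e \<times> 'a) measure" where
  "stage y = Q y \<bind> stage_given"

lemma measurable_jump_given: "(\<lambda>(\<eta>, r). jump_given \<eta> r) \<in> N \<Otimes>\<^sub>M borel \<rightarrow>\<^sub>M prob_algebra St"
proof -
  have "(\<lambda>x. \<pi> (ev (fst x) (snd x)) \<bind> (\<lambda>p. return St (fst x, snd x, p))) \<in> N \<Otimes>\<^sub>M borel \<rightarrow>\<^sub>M prob_algebra St"
    by (rule measurable_bind_prob_space2[where N=EM])
      (auto intro!: measurable_compose[OF _ measurable_return_prob_space] measurable_compose[OF _ \<pi>])
  then show ?thesis by (simp add: jump_given_def split_beta')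
qed

lemma measurable_stage_given [measurable]: "stage_given \<in> N \<rightarrow>\<^sub>M prob_algebra St"
  unfolding stage_given_def[abs_def]
  by (rule measurable_bind_prob_space2[OF measurable_clock measurable_jump_given])

lemma measurable_stage [measurable]: "stage \<in> borel \<rightarrow>\<^sub>M prob_algebra St"
  unfolding stage_def[abs_def] by (rule measurable_bind_prob_space[OF Q measurable_stage_given])

lemma prob_stage: "prob_space (stage y)" and sets_stage [simp]: "sets (stage y) = sets St"
  using measurable_space[OF measurable_stage, of y] by (auto simp: space_prob_algebra)

lemma measurable_jump_given': "\<eta> \<in> \<Omega> \<Longrightarrow> jump_given \<eta> \<in> borel \<rightarrow>\<^sub>M prob_algebra St"
  using measurable_compose[OF _ measurable_jump_given, of "\<lambda>r. (\<eta>, r)" borel] by simp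

lemma measurable_return_path:
  "\<eta> \<in> \<Omega> \<Longrightarrow> (\<lambda>p. return St (\<eta>, r, p)) \<in> EM \<rightarrow>\<^sub>M prob_algebra St"
  by (auto intro!: measurable_compose[OF _ measurable_return_prob_space])

lemma kernel_le_1:
  "f \<in> M \<rightarrow>\<^sub>M prob_algebra K \<Longrightarrow> AE x in M. emeasure (f x) (space (f x)) \<le> ennreal 1"
  by (intro AE_I2) (auto dest!: measurable_space simp: space_prob_algebra prob_space.emeasure_space_1)

lemma integral_stage:
  fixes f :: "_ \<Rightarrow> real"
  assumes f[measurable]: "f \<in> borel_measurable St" and bd: "\<And>x. \<bar>f x\<bar> \<le> B"
  shows "(\<integral>z. f z \<partial>stage y) = (\<integral>\<eta>. \<integral>r. \<integral>p. f (\<eta>, r, p) \<partial>\<pi> (ev \<eta> r) \<partial>clock \<eta> \<partial>Q y)"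
proof -
  have Q': "finite_measure (Q y)" "space (Q y) \<noteq> {}"
    using prob_Q[of y] prob_space.not_empty[OF prob_Q[of y]] by (auto simp: prob_space_def)
  have "(\<integral>z. f z \<partial>stage y) = (\<integral>\<eta>. \<integral>z. f z \<partial>stage_given \<eta> \<partial>Q y)"
    unfolding stage_def using bd Q' measurable_stage_given
    by (intro integral_bind[where K=St and B=B and B'=1] f kernel_le_1[where K=St])
      (auto simp: measurable_cong_sets[OF sets_Q refl] intro: measurable_prob_algebraD)
  also have "\<dots> = (\<integral>\<eta>. \<integral>r. \<integral>p. f (\<eta>, r, p) \<partial>\<pi> (ev \<eta> r) \<partial>clock \<eta> \<partial>Q y)"
  proof (intro Bochner_Integration.integral_cong refl)
    fix \<eta> assume "\<eta> \<in> space (Q y)"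
    then have \<eta>: "\<eta> \<in> \<Omega>" by simp
    have c: "finite_measure (clock \<eta>)" using prob_clock[OF \<eta>] by (simp add: prob_space_def)
    have "(\<integral>z. f z \<partial>stage_given \<eta>) = (\<integral>r. \<integral>z. f z \<partial>jump_given \<eta> r \<partial>clock \<eta>)"
      unfolding stage_given_def using bd c measurable_jump_given'[OF \<eta>]
      by (intro integral_bind[where K=St and B=B and B'=1] f kernel_le_1[where K=St])
        (auto simp: measurable_cong_sets[OF sets_clock refl] intro: measurable_prob_algebraD)
    also have "\<dots> = (\<integral>r. \<integral>p. f (\<eta>, r, p) \<partial>\<pi> (ev \<eta> r) \<partial>clock \<eta>)"
    proof (intro Bochner_Integration.integral_cong refl)
      fix r
      have p: "finite_measure (\<pi> (ev \<eta> r))" "space (\<pi> (ev \<eta> r)) \<noteq> {}"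
        using prob_\<pi> prob_space.not_empty[OF prob_\<pi>] by (auto simp: prob_space_def)
      have "(\<integral>z. f z \<partial>jump_given \<eta> r) = (\<integral>p. \<integral>z. f z \<partial>return St (\<eta>, r, p) \<partial>\<pi> (ev \<eta> r))"
        unfolding jump_given_def using bd p measurable_return_path[OF \<eta>]
        by (intro integral_bind[where K=St and B=B and B'=1] f kernel_le_1[where K=St])
          (auto simp: measurable_cong_sets[OF sets_\<pi> refl] intro: measurable_prob_algebraD)
      also have "\<dots> = (\<integral>p. f (\<eta>, r, p) \<partial>\<pi> (ev \<eta> r))"
        using \<eta> by (intro Bochner_Integration.integral_cong refl integral_return)
          (auto simp: space_pair_measure sets_eq_imp_space_eq[OF sets_\<pi>])
      finally show "(\<integral>z. f z \<partial>jump_given \<eta> r) = (\<integral>p. f (\<eta>, r, p) \<partial>\<pi> (ev \<eta> r))" .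
    qed
    finally show "(\<integral>z. f z \<partial>stage_given \<eta>) = (\<integral>r. \<integral>p. f (\<eta>, r, p) \<partial>\<pi> (ev \<eta> r) \<partial>clock \<eta>)" .
  qed
  finally show ?thesis .
qed

lemma AE_stage_iff:
  assumes P[measurable]: "Measurable.pred St P"
  shows "(AE z in stage y. P z) \<longleftrightarrow> (AE \<eta> in Q y. AE r in clock \<eta>. AE p in \<pi> (ev \<eta> r). P (\<eta>, r, p))"
proof -
  have "(AE z in stage y. P z) \<longleftrightarrow> (AE \<eta> in Q y. AE z in stage_given \<eta>. P z)"
    unfolding stage_def using measurable_stage_given
    by (intro AE_bind[OF _ P]) (auto simp: measurable_cong_sets[OF sets_Q refl] intro: measurable_prob_algebraD)
  also have "\<dots> \<longleftrightarrow> (AE \<eta> in Q y. AE r in clock \<eta>. AE z in jump_given \<eta> r. P z)"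
    unfolding stage_given_def
    by (intro AE_cong AE_bind[OF _ P])
      (auto simp: measurable_cong_sets[OF sets_clock refl] intro: measurable_prob_algebraD measurable_jump_given')
  also have "\<dots> \<longleftrightarrow> (AE \<eta> in Q y. AE r in clock \<eta>. AE p in \<pi> (ev \<eta> r). AE z in return St (\<eta>, r, p). P z)"
    unfolding jump_given_def
    by (intro AE_cong AE_bind[OF _ P])
      (auto simp: measurable_cong_sets[OF sets_\<pi> refl] intro!: measurable_prob_algebraD measurable_return_path)
  also have "\<dots> \<longleftrightarrow> (AE \<eta> in Q y. AE r in clock \<eta>. AE p in \<pi> (ev \<eta> r). P (\<eta>, r, p))"
    by (intro AE_cong AE_return[OF _ P]) (auto simp: space_pair_measure sets_eq_imp_space_eq[OF sets_\<pi>])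
  finally show ?thesis .
qed

text \<open>Given the path, the discount is the probability that the clock rings before an
  independent standard exponential one. The earlier of the two rings with hazard 1 + \<Lambda>, and
  the share of \<Lambda> in this hazard is at most
  \<open>\<Lambda>max / (1 + \<Lambda>max)\<close>.\<close>

lemma stage_discount:
  "(\<integral>z. (if 0 < fst (snd z) then exp (- fst (snd z)) else 0) \<partial>stage y) \<le> \<Lambda>max / (1 + \<Lambda>max)"
proof -
  have c0: "0 \<le> \<Lambda>max" using order_trans[OF \<Lambda>_nonneg \<Lambda>_le] .
  let ?q = "\<Lambda>max / (1 + \<Lambda>max)"
  have q: "0 \<le> ?q" using c0 by simp
  define ec :: "real \<Rightarrow> real" where "ec r = (if 0 < r then exp (- r) else 0)" for r
  have [measurable]: "ec \<in> borel_measurable borel" unfolding ec_def[abs_def] by measurable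
  have ec01: "0 \<le> ec r" "ec r \<le> 1" for r by (auto simp: ec_def)
  have le: "(\<integral>r. ec r \<partial>clock \<eta>) \<le> ?q" if \<eta>: "\<eta> \<in> \<Omega>" for \<eta>
  proof -
    have [measurable]: "haz \<eta> \<in> borel_measurable borel" "clock_density \<eta> \<in> borel_measurable borel" "(\<lambda>r. ev \<eta> r) \<in> borel \<rightarrow>\<^sub>M borel"
      using measurable_haz[of "\<lambda>_. \<eta>" borel "\<lambda>t. t"] measurable_clock_density[of "\<lambda>_. \<eta>" borel "\<lambda>t. t"] measurable_ev_path[OF \<eta>] \<eta> by simp_all
    \<comment> \<open>The hazard of the competing pair of clocks, with cumulative hazard G t = t + H
      t.\<close>
    define l where "l r = 1 + \<Lambda> (ev \<eta> r)" for r
    have l[measurable]: "l \<in> borel_measurable borel" unfolding l_def by measurable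
    have l0: "0 \<le> l r" and lc: "l r \<le> 1 + \<Lambda>max" for r using \<Lambda>_nonneg \<Lambda>_le by (auto simp: l_def add_nonneg_nonneg)
    define G where "G t = (LINT r:{0..t}|lborel. l r)" for t
    have G: "G t = t + H \<eta> t" if "0 \<le> t" for t
    proof -
      have "set_integrable lborel {0..t} (\<lambda>r. 1::real)" "set_integrable lborel {0..t} (\<lambda>r. \<Lambda> (ev \<eta> r))"
        using \<Lambda>_nonneg \<Lambda>_le by (auto intro: set_integrable_bounded_Icc[where c=1]) (auto intro!: set_integrable_bounded_Icc[where c=\<Lambda>max])
      from set_integral_add(2)[OF this] that show ?thesis
        by (simp add: G_def l_def H_def) (simp add: set_lebesgue_integral_def)
    qed
    have Gm[measurable]: "G \<in> borel_measurable borel"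
    proof -
      have "(\<lambda>t. if 0 \<le> t then t + H \<eta> t else 0) \<in> borel_measurable borel"
        using measurable_H[of "\<lambda>_. \<eta>" borel "\<lambda>t. t"] \<eta> by simp
      moreover have "G t = 0" if "t < 0" for t using that by (simp add: G_def set_lebesgue_integral_def)
      then have "(\<lambda>t. if 0 \<le> t then t + H \<eta> t else 0) = G" using G by (auto simp: fun_eq_iff)
      ultimately show ?thesis by simp
    qed
    have "(\<integral>\<^sup>+r. ennreal (ec r) \<partial>clock \<eta>) = (\<integral>\<^sup>+r. clock_density \<eta> r * ennreal (ec r) \<partial>lborel)"
      unfolding clock_def by (rule nn_integral_density) auto
    also have "\<dots> \<le> (\<integral>\<^sup>+r. ennreal ?q * (ennreal (l r * exp (- G r)) * indicator {0<..} r) \<partial>lborel)"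
    proof (rule nn_integral_mono)
      fix r
      show "clock_density \<eta> r * ennreal (ec r) \<le> ennreal ?q * (ennreal (l r * exp (- G r)) * indicator {0<..} r)"
      proof (cases "0 < r")
        case True
        have "\<Lambda> (ev \<eta> r) \<le> ?q * l r"
          using \<Lambda>_nonneg[of "ev \<eta> r"] \<Lambda>_le[of "ev \<eta> r"] c0 by (simp add: l_def field_simps)
        then have "\<Lambda> (ev \<eta> r) * exp (- G r) \<le> ?q * l r * exp (- G r)" by (intro mult_right_mono) auto
        moreover have "exp (- G r) = exp (- H \<eta> r) * exp (- r)" using True by (simp add: G exp_add[symmetric])
        ultimately have *: "haz \<eta> r * exp (- r) \<le> ?q * (l r * exp (- G r))" by (simp add: haz_def mult.assoc)
        have "clock_density \<eta> r * ennreal (ec r) = ennreal (haz \<eta> r * exp (- r))"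
          using True \<Lambda>_nonneg by (simp add: clock_density_def ec_def ennreal_mult[symmetric] haz_def)
        also have "\<dots> \<le> ennreal (?q * (l r * exp (- G r)))" by (rule ennreal_leI[OF *])
        also have "\<dots> = ennreal ?q * (ennreal (l r * exp (- G r)) * indicator {0<..} r)"
          using True ennreal_mult[OF q, of "l r * exp (- G r)"] l0 by simp
        finally show ?thesis .
      next
        case False
        then show ?thesis by (simp add: ec_def)
      qed
    qed
    also have "\<dots> = ennreal ?q * (\<integral>\<^sup>+r. ennreal (l r * exp (- G r)) * indicator {0<..} r \<partial>lborel)"
      by (rule nn_integral_cmult) auto
    also have "\<dots> \<le> ennreal ?q * 1"
      by (intro mult_left_mono nn_integral_exp_hazard_Ioc(2)[where H=G, OF l l0 lc G_def Gm, of 0]) auto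
    finally have nn: "(\<integral>\<^sup>+r. ennreal (ec r) \<partial>clock \<eta>) \<le> ennreal ?q" by simp
    have "(\<integral>r. ec r \<partial>clock \<eta>) = enn2real (\<integral>\<^sup>+r. ennreal (ec r) \<partial>clock \<eta>)"
      by (rule integral_eq_nn_integral) (auto simp: measurable_cong_sets[OF sets_clock refl] ec01)
    also have "\<dots> \<le> enn2real (ennreal ?q)" by (rule enn2real_mono[OF nn]) simp
    finally show ?thesis using q by simp
  qed
  interpret Q: prob_space "Q y" by (rule prob_Q)
  have "(\<integral>z. (if 0 < fst (snd z) then exp (- fst (snd z)) else 0) \<partial>stage y) = (\<integral>z. ec (fst (snd z)) \<partial>stage y)"
    by (simp add: ec_def)
  also have "\<dots> = (\<integral>\<eta>. \<integral>r. \<integral>p. ec r \<partial>\<pi> (ev \<eta> r) \<partial>clock \<eta> \<partial>Q y)"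
    by (subst integral_stage[where B=1]) (use ec01 in auto)
  also have "\<dots> = (\<integral>\<eta>. \<integral>r. ec r \<partial>clock \<eta> \<partial>Q y)"
    by (simp add: prob_space.prob_space[OF prob_\<pi>])
  also have "\<dots> \<le> ?q"
  proof (rule Q.integral_le_const)
    have "(\<lambda>\<eta>. \<integral>r. ec r \<partial>clock \<eta>) \<in> borel_measurable (Q y)"
      unfolding measurable_cong_sets[OF sets_Q refl]
      by (rule measurable_compose[OF measurable_prob_algebraD[OF measurable_clock] integral_measurable_subprob_algebra]) measurable
    moreover have "\<bar>\<integral>r. ec r \<partial>clock \<eta>\<bar> \<le> ?q" if "\<eta> \<in> \<Omega>" for \<eta>
    proof -
      have "0 \<le> (\<integral>r. ec r \<partial>clock \<eta>)" by (rule Bochner_Integration.integral_nonneg) (rule ec01)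
      then show ?thesis using le[OF that] by simp
    qed
    ultimately show "integrable (Q y) (\<lambda>\<eta>. \<integral>r. ec r \<partial>clock \<eta>)"
      by (intro Q.integrable_const_bound[where B="?q"]) auto
    show "AE \<eta> in Q y. (\<integral>r. ec r \<partial>clock \<eta>) \<le> ?q" using le by (intro AE_I2) simp
  qed
  finally show ?thesis .
qed

lemma AE_stage_start: "AE z in stage y. fst z 0 = y"
proof -
  have [measurable]: "(\<lambda>z. fst z 0) \<in> St \<rightarrow>\<^sub>M borel"
    using measurable_compose[OF measurable_fst measurable_path_algebra_eval[of 0 \<Omega>]] by simp
  have "Measurable.pred St (\<lambda>z. fst z 0 = y)" by measurable
  then show ?thesis
    by (subst AE_stage_iff) (use Q_start[of y] in \<open>auto simp: AE_iff_measurable\<close>)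
qed

text \<open>The clock rings only while the rate is positive.\<close>

lemma AE_stage_jump:
  assumes R[measurable]: "Measurable.pred (borel \<Otimes>\<^sub>M EM) (\<lambda>(y, p). R y p)"
    and "\<And>y. 0 < \<Lambda> y \<Longrightarrow> AE p in \<pi> y. R y p"
  shows "AE z in stage y. 0 < fst (snd z) \<longrightarrow> R (fst z (fst (snd z))) (snd (snd z))"
proof -
  let ?P = "\<lambda>z::(real \<Rightarrow> 'a) \<times> real \<times> 'e \<times> 'a. 0 < fst (snd z) \<longrightarrow> R (ev (fst z) (fst (snd z))) (snd (snd z))"
  have "Measurable.pred St (\<lambda>z. R (ev (fst z) (fst (snd z))) (snd (snd z)))"
    using measurable_compose[OF _ R, of "\<lambda>z. (ev (fst z) (fst (snd z)), snd (snd z))" St] by simp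
  then have m: "Measurable.pred St ?P" by measurable
  have "AE \<eta> in Q y. AE r in clock \<eta>. AE p in \<pi> (ev \<eta> r). ?P (\<eta>, r, p)"
  proof (rule AE_I2)
    fix \<eta> assume "\<eta> \<in> space (Q y)"
    then have \<eta>: "\<eta> \<in> \<Omega>" by simp
    have cm: "clock_density \<eta> \<in> borel_measurable lborel"
      using measurable_clock_density[of "\<lambda>_. \<eta>" borel "\<lambda>t. t"] \<eta> by simp
    \<comment> \<open>Only points of positive clock density count, and for r > 0 positive density
      forces a positive rate at the place of ringing.\<close>
    have "AE r in lborel. 0 < clock_density \<eta> r \<longrightarrow> (AE p in \<pi> (ev \<eta> r). 0 < r \<longrightarrow> R (ev \<eta> r) p)"
    proof (rule AE_I2, rule impI)
      fix r assume r: "0 < clock_density \<eta> r"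
      show "AE p in \<pi> (ev \<eta> r). 0 < r \<longrightarrow> R (ev \<eta> r) p"
      proof (cases "0 < r")
        case True
        then have "0 < haz \<eta> r" using r by (simp add: clock_density_def)
        then have "0 < \<Lambda> (ev \<eta> r)" by (simp add: haz_def zero_less_mult_iff)
        from assms(2)[OF this] show ?thesis by eventually_elim simp
      qed simp
    qed
    then show "AE r in clock \<eta>. AE p in \<pi> (ev \<eta> r). ?P (\<eta>, r, p)"
      unfolding clock_def by (subst AE_density[OF cm]) simp
  qed
  then have "AE z in stage y. ?P z" using AE_stage_iff[OF m] by blast
  then show ?thesis by (rule AE_mp) (auto intro!: AE_I2 simp: ev_nonneg)
qed

end

section \<open>The martingale of one stage\<close>

text \<open>Here a is the observed function of the state, l its drift along the diffusion and d what
  a mark adds at a jump. Right continuity of a is asked along paths only, because functions of the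
  operator's domain are continuous stratum by stratum.\<close>

locale jump_martingale = jump_diffusion \<Omega> Q \<Lambda> \<Lambda>max E \<pi>
  for \<Omega> :: "(real \<Rightarrow> 'a::{metric_space, second_countable_topology}) set"
    and Q \<Lambda> \<Lambda>max and E :: "'e set" and \<pi> +
  fixes a l :: "'a \<Rightarrow> real" and d :: "'e \<times> 'a \<Rightarrow> real" and C :: real
  assumes a_measurable[measurable]: "a \<in> borel_measurable borel"
    and l_measurable[measurable]: "l \<in> borel_measurable borel"
    and d_measurable[measurable]: "d \<in> borel_measurable (count_space E \<Otimes>\<^sub>M borel)"
    and a_bound: "\<And>x. \<bar>a x\<bar> \<le> C" and l_bound: "\<And>x. \<bar>l x\<bar> \<le> C" and d_bound: "\<And>p. \<bar>d p\<bar> \<le> C"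
    and a_right_cont: "\<And>\<eta> t. \<eta> \<in> \<Omega> \<Longrightarrow> 0 \<le> t \<Longrightarrow> ((\<lambda>s. a (\<eta> s)) \<longlongrightarrow> a (\<eta> t)) (at_right t)"
    and dynkin: "\<And>y u v B. 0 \<le> u \<Longrightarrow> u \<le> v \<Longrightarrow> B \<in> sets (natural_filtration \<Omega> (\<lambda>\<eta>. \<eta>) u) \<Longrightarrow>
      (\<integral>\<eta>. indicator B \<eta> * (a (\<eta> v) - a (\<eta> u) - (LINT r:{u..v}|lborel. l (\<eta> r))) \<partial>Q y) = 0"
begin

abbreviation Fil where "Fil \<equiv> natural_filtration \<Omega> (\<lambda>\<eta>::real \<Rightarrow> 'a. \<eta>)"

lemma C_nonneg: "0 \<le> C" using order_trans[OF abs_ge_zero a_bound] .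
lemma \<Lambda>max_nonneg: "0 \<le> \<Lambda>max" using order_trans[OF \<Lambda>_nonneg \<Lambda>_le] .

lemma subalgebra_Fil: "subalgebra (Q y) (Fil u)"
  by (rule subalgebra_natural_filtration)
    (auto simp: measurable_cong_sets[OF sets_Q refl] intro: measurable_path_algebra_eval)

lemma measurable_Fil_ev: "0 \<le> s \<Longrightarrow> s \<le> u \<Longrightarrow> (\<lambda>\<eta>. ev \<eta> s) \<in> Fil u \<rightarrow>\<^sub>M borel"
  by (simp add: measurable_natural_filtration_at[where X="\<lambda>\<eta>. \<eta>"] ev_nonneg)

lemma measurable_Fil_integral:
  fixes g :: "'a \<Rightarrow> real"
  assumes "g \<in> borel_measurable borel" "0 \<le> u" "v \<le> z"
  shows "(\<lambda>\<eta>. LINT r:{u..v}|lborel. g (ev \<eta> r)) \<in> borel_measurable (Fil z)"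
proof -
  have "(\<lambda>\<eta>. LINT r:{u..v}|lborel. g (\<eta> r)) \<in> borel_measurable (Fil z)"
    by (rule measurable_integral_adapted[where X="\<lambda>\<eta>. \<eta>"])
      (use assms in \<open>auto intro: right_cont measurable_natural_filtration_at[where X="\<lambda>\<eta>. \<eta>"]\<close>)
  also have "(\<lambda>\<eta>. LINT r:{u..v}|lborel. g (\<eta> r)) = (\<lambda>\<eta>. LINT r:{u..v}|lborel. g (ev \<eta> r))"
    using assms(2) by (intro ext set_lebesgue_integral_cong) (auto simp: ev_nonneg)
  finally show ?thesis .
qed

lemma set_integrable_path:
  fixes g :: "'a \<Rightarrow> real"
  assumes "\<eta> \<in> \<Omega>" "g \<in> borel_measurable borel" "\<And>x. \<bar>g x\<bar> \<le> K"
  shows "set_integrable lborel {u..v} (\<lambda>r. g (ev \<eta> r))"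
  using measurable_compose[OF measurable_ev_path[OF assms(1)] assms(2)] assms(3)
  by (intro set_integrable_bounded_Icc[where c=K]) auto

lemma path_integral_bound:
  fixes g :: "'a \<Rightarrow> real"
  assumes "\<eta> \<in> \<Omega>" "g \<in> borel_measurable borel" "\<And>x. \<bar>g x\<bar> \<le> K" "u \<le> v"
  shows "\<bar>LINT r:{u..v}|lborel. g (ev \<eta> r)\<bar> \<le> K * (v - u)"
  using measurable_compose[OF measurable_ev_path[OF assms(1)] assms(2)] assms(3,4)
  by (intro set_integral_Icc_le) auto

text \<open>Tested on all events up to time u, Dynkin's formula says that the conditional
  expectation of the compensated increment vanishes; a bounded weight known at time u can then be
  pulled out.\<close>

lemma dynkin_weighted:
  assumes u: "0 \<le> u" "u \<le> v" and W: "W \<in> borel_measurable (Fil u)" "\<And>\<eta>. \<eta> \<in> \<Omega> \<Longrightarrow> \<bar>W \<eta>\<bar> \<le> K"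
  shows "(\<integral>\<eta>. W \<eta> * (a (ev \<eta> v) - a (ev \<eta> u)) \<partial>Q y) = (\<integral>\<eta>. W \<eta> * (LINT r:{u..v}|lborel. l (ev \<eta> r)) \<partial>Q y)"
proof -
  interpret Q: prob_space "Q y" by (rule prob_Q)
  interpret sigma_finite_subalgebra "Q y" "Fil u"
    by (intro finite_measure_subalgebra_is_sigma_finite finite_measure_subalgebra.intro
        finite_measure_subalgebra_axioms.intro subalgebra_Fil Q.finite_measure_axioms)
  define L where "L \<eta> = (LINT r:{u..v}|lborel. l (ev \<eta> r))" for \<eta>
  define D where "D \<eta> = a (ev \<eta> v) - a (ev \<eta> u) - L \<eta>" for \<eta>
  have [measurable]: "(\<lambda>\<eta>. ev \<eta> s) \<in> Q y \<rightarrow>\<^sub>M borel" for s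
    by (simp add: measurable_cong_sets[OF sets_Q refl])
  have Lm[measurable]: "L \<in> borel_measurable (Q y)"
    using measurable_from_subalg[OF subalgebra_Fil measurable_Fil_integral[OF l_measurable u(1), of v v]] by (simp add: L_def[abs_def])
  have Wm[measurable]: "W \<in> borel_measurable (Q y)" using measurable_from_subalg[OF subalgebra_Fil W(1)] .
  have Lb: "\<bar>L \<eta>\<bar> \<le> C * (v - u)" if "\<eta> \<in> \<Omega>" for \<eta>
    unfolding L_def by (rule path_integral_bound[OF that l_measurable l_bound u(2)])
  have K0: "0 \<le> K" using W(2)[OF \<Omega>_const] abs_ge_zero order_trans by blast
  have Db: "\<bar>D \<eta>\<bar> \<le> 2 * C + C * (v - u)" if "\<eta> \<in> \<Omega>" for \<eta>
    using Lb[OF that] a_bound[of "ev \<eta> v"] a_bound[of "ev \<eta> u"] by (simp add: D_def)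
  have D_int: "integrable (Q y) D"
    by (rule Q.integrable_const_bound[where B="2 * C + C * (v - u)"]) (use Db in \<open>auto simp: D_def[abs_def]\<close>)
  have WD_int: "integrable (Q y) (\<lambda>\<eta>. W \<eta> * D \<eta>)"
  proof (rule Q.integrable_const_bound[where B="K * (2 * C + C * (v - u))"])
    show "AE \<eta> in Q y. norm (W \<eta> * D \<eta>) \<le> K * (2 * C + C * (v - u))"
      using W(2) Db K0 by (intro AE_I2) (auto simp: abs_mult intro!: mult_mono)
  qed (simp add: D_def[abs_def])
  have "AE \<eta> in Q y. real_cond_exp (Q y) (Fil u) D \<eta> = 0"
  proof (rule real_cond_exp_charact)
    fix A assume A: "A \<in> sets (Fil u)"
    have "(\<integral>\<eta>\<in>A. D \<eta> \<partial>Q y) = (\<integral>\<eta>. indicator A \<eta> * (a (\<eta> v) - a (\<eta> u) - (LINT r:{u..v}|lborel. l (\<eta> r))) \<partial>Q y)"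
    proof -
      have "L \<eta> = (LINT r:{u..v}|lborel. l (\<eta> r))" for \<eta>
        unfolding L_def using u by (intro set_lebesgue_integral_cong) (auto simp: ev_nonneg)
      then show ?thesis using u by (simp add: set_lebesgue_integral_def[where M="Q y"] D_def ev_nonneg)
    qed
    also have "\<dots> = 0" by (rule dynkin[OF u A])
    finally show "(\<integral>\<eta>\<in>A. D \<eta> \<partial>Q y) = (\<integral>\<eta>\<in>A. 0 \<partial>Q y)" by simp
  qed (use D_int in auto)
  then have "(\<integral>\<eta>. W \<eta> * real_cond_exp (Q y) (Fil u) D \<eta> \<partial>Q y) = (\<integral>\<eta>. 0 \<partial>Q y)"
    by (intro integral_cong_AE) auto
  then have 0: "(\<integral>\<eta>. W \<eta> * D \<eta> \<partial>Q y) = 0"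
    using real_cond_exp_intg(2)[OF WD_int W(1)] D_int by (auto simp: borel_measurable_integrable)
  have "(\<integral>\<eta>. W \<eta> * (a (ev \<eta> v) - a (ev \<eta> u)) \<partial>Q y) = (\<integral>\<eta>. W \<eta> * D \<eta> + W \<eta> * L \<eta> \<partial>Q y)"
    by (intro Bochner_Integration.integral_cong) (auto simp: D_def algebra_simps)
  also have "\<dots> = (\<integral>\<eta>. W \<eta> * D \<eta> \<partial>Q y) + (\<integral>\<eta>. W \<eta> * L \<eta> \<partial>Q y)"
  proof (rule Bochner_Integration.integral_add[OF WD_int])
    show "integrable (Q y) (\<lambda>\<eta>. W \<eta> * L \<eta>)"
    proof (rule Q.integrable_const_bound[where B="K * (C * (v - u))"])
      show "AE \<eta> in Q y. norm (W \<eta> * L \<eta>) \<le> K * (C * (v - u))"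
        using W(2) Lb K0 by (intro AE_I2) (auto simp: abs_mult intro!: mult_mono)
    qed simp
  qed
  finally show ?thesis using 0 by (simp add: L_def)
qed

definition b :: "'e \<times> 'a \<Rightarrow> real" where "b p = a (snd p) + d p"
definition \<beta> :: "'a \<Rightarrow> real" where "\<beta> y = (\<integral>p. b p \<partial>\<pi> y)"
text \<open>The full drift: that of the diffusion plus rate times mean change at a jump. It becomes
  \<open>A f\<close> in one instance and the intensity of jumps of a given type in the
  other.\<close>

definition cc :: "'a \<Rightarrow> real" where "cc y = l y + \<Lambda> y * (\<beta> y - a y)"
text \<open>\<bar>l\<bar> \<le> C, and \<bar>\<beta> - a\<bar> \<le> 2C + C.\<close>

definition Cc :: real where "Cc = C + \<Lambda>max * (3 * C)"

lemma b_measurable[measurable]: "b \<in> borel_measurable (count_space E \<Otimes>\<^sub>M borel)"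
  unfolding b_def[abs_def] by measurable

lemma b_bound: "\<bar>b p\<bar> \<le> 2 * C"
  using a_bound[of "snd p"] d_bound[of p] by (simp add: b_def)

lemma \<beta>_measurable[measurable]: "\<beta> \<in> borel_measurable borel"
  unfolding \<beta>_def[abs_def]
  by (rule measurable_compose[OF measurable_prob_algebraD[OF \<pi>] integral_measurable_subprob_algebra[OF b_measurable]])

lemma \<beta>_bound: "\<bar>\<beta> y\<bar> \<le> 2 * C"
proof -
  interpret prob_space "\<pi> y" by (rule prob_\<pi>)
  have "integrable (\<pi> y) b"
    by (rule integrable_const_bound[where B="2 * C"]) (use b_bound in \<open>auto simp: measurable_cong_sets[OF sets_\<pi> refl]\<close>)
  then show ?thesis
    unfolding \<beta>_def using b_bound by (intro abs_leI) 
      (auto intro!: integral_le_const integral_ge_const AE_I2 simp: abs_le_iff minus_le_iff)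
qed

lemma cc_measurable[measurable]: "cc \<in> borel_measurable borel"
  unfolding cc_def[abs_def] by measurable

lemma cc_bound: "\<bar>cc y\<bar> \<le> Cc"
proof -
  have "\<bar>\<Lambda> y * (\<beta> y - a y)\<bar> \<le> \<Lambda>max * (3 * C)"
    unfolding abs_mult using \<Lambda>_nonneg[of y] \<Lambda>_le[of y] \<beta>_bound[of y] a_bound[of y] C_nonneg by (intro mult_mono) auto
  then show ?thesis using l_bound[of y] by (simp add: cc_def Cc_def)
qed

lemma exp_l_bound: "\<eta> \<in> \<Omega> \<Longrightarrow> \<bar>exp (- H \<eta> q) * l x\<bar> \<le> C"
  using mult_mono[of "exp (- H \<eta> q)" 1 "\<bar>l x\<bar>" C] hazard_facts(2)[of \<eta> q] l_bound[of x] by (simp add: abs_mult)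

lemma Cc_nonneg: "0 \<le> Cc" using C_nonneg \<Lambda>max_nonneg by (simp add: Cc_def)

text \<open>The compensated increment over elapsed times u to v of a single stage: once the clock
  has rung the value is frozen at \<open>b\<close> of the mark and the drift is switched off, and
  nothing moves if it had rung by u.\<close>

definition stage_incr :: "real \<Rightarrow> real \<Rightarrow> (real \<Rightarrow> 'a) \<times> real \<times> 'e \<times> 'a \<Rightarrow> real" where
  "stage_incr u v z = (let \<eta> = fst z; r = fst (snd z) in
     if alive u r then (if alive v r then a (ev \<eta> v) else b (snd (snd z))) - a (ev \<eta> u)
       - (LINT q:{u..v}|lborel. of_bool (alive q r) * cc (ev \<eta> q)) else 0)"

lemma measurable_stage_incr [measurable (raw)]:
  assumes [measurable]: "f \<in> borel_measurable M" "g \<in> borel_measurable M" "h \<in> M \<rightarrow>\<^sub>M St"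
  shows "(\<lambda>x. stage_incr (f x) (g x) (h x)) \<in> borel_measurable M"
proof -
  have "(\<lambda>x. \<integral>q. indicator {p. f (fst p) \<le> snd p \<and> snd p \<le> g (fst p)} (x, q) *
      (of_bool (alive q (fst (snd (h x)))) * cc (ev (fst (h x)) q)) \<partial>lborel) \<in> borel_measurable M"
    by (rule lborel.borel_measurable_lebesgue_integral) measurable
  then have "(\<lambda>x. LINT q:{f x..g x}|lborel. of_bool (alive q (fst (snd (h x)))) * cc (ev (fst (h x)) q)) \<in> borel_measurable M"
    by (rule measurable_cong[THEN iffD1, rotated])
      (auto simp: set_lebesgue_integral_def intro!: Bochner_Integration.integral_cong split: split_indicator)
  note [measurable] = this
  show ?thesis unfolding stage_incr_def Let_def by measurable
qed

lemma measurable_alive_cc: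
  assumes "\<eta> \<in> \<Omega>"
  shows "(\<lambda>q. of_bool (alive q r) * cc (ev \<eta> q)) \<in> borel_measurable borel"
proof -
  have [measurable]: "(\<lambda>q. ev \<eta> q) \<in> borel \<rightarrow>\<^sub>M borel" by (rule measurable_ev_path[OF assms])
  show ?thesis by measurable
qed

lemma alive_cc_bound: "\<bar>of_bool (alive q r) * cc (ev \<eta> q)\<bar> \<le> Cc"
  using cc_bound Cc_nonneg by auto

lemma stage_incr_bound:
  assumes "fst z \<in> \<Omega>" "u \<le> v"
  shows "\<bar>stage_incr u v z\<bar> \<le> 3 * C + Cc * (v - u)"
proof -
  have "\<bar>LINT q:{u..v}|lborel. of_bool (alive q (fst (snd z))) * cc (ev (fst z) q)\<bar> \<le> Cc * (v - u)"
    by (rule set_integral_Icc_le[OF measurable_alive_cc[OF assms(1)] alive_cc_bound assms(2)])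
  moreover have "0 \<le> Cc * (v - u)" using Cc_nonneg assms by simp
  ultimately show ?thesis
    using a_bound[of "ev (fst z) v"] a_bound[of "ev (fst z) u"] b_bound[of "snd (snd z)"] C_nonneg
    by (auto simp: stage_incr_def Let_def abs_le_iff)
qed

text \<open>For a fixed path, the mean gain from ringing and the \<beta>-part of the compensator
  cancel, and survival up to q contributes the weight exp(-H q).\<close>

lemma stage_incr_given_path:
  assumes \<eta>: "\<eta> \<in> \<Omega>" and u: "0 \<le> u" "u \<le> v"
  shows "(\<integral>r. \<integral>p. stage_incr u v (\<eta>, r, p) \<partial>\<pi> (ev \<eta> r) \<partial>clock \<eta>) =
    exp (- H \<eta> u) * (a (ev \<eta> v) - a (ev \<eta> u)) - (LINT q:{u..v}|lborel. haz \<eta> q * (a (ev \<eta> v) - a (ev \<eta> q)))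
      - (LINT q:{u..v}|lborel. exp (- H \<eta> q) * l (ev \<eta> q))"
proof -
  let ?l = "LINT q:{u..v}|lborel. exp (- H \<eta> q) * l (ev \<eta> q)"
    and ?a = "LINT q:{u..v}|lborel. haz \<eta> q * a (ev \<eta> q)"
    and ?b = "LINT q:{u..v}|lborel. haz \<eta> q * \<beta> (ev \<eta> q)"
    and ?c = "\<lambda>q. \<integral>r. of_bool (alive q r) * cc (ev \<eta> q) \<partial>clock \<eta>"
    and ?J = "\<integral>r. \<integral>p. stage_incr u v (\<eta>, r, p) \<partial>\<pi> (ev \<eta> r) \<partial>clock \<eta>"
  interpret c: prob_space "clock \<eta>" by (rule prob_clock[OF \<eta>])
  have [measurable]: "(\<lambda>q. ev \<eta> q) \<in> borel \<rightarrow>\<^sub>M borel" by (rule measurable_ev_path[OF \<eta>])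
  have [measurable]: "haz \<eta> \<in> borel_measurable borel" "H \<eta> \<in> borel_measurable borel"
    using measurable_haz[of "\<lambda>_. \<eta>" borel "\<lambda>t. t"] measurable_H[of "\<lambda>_. \<eta>" borel "\<lambda>t. t"] \<eta> by simp_all
  note [measurable_cong] = sets_clock[of \<eta>]
  define L where "L r = (LINT q:{u..v}|lborel. of_bool (alive q r) * cc (ev \<eta> q))" for r
  have m: "(\<lambda>(r, q). indicator {u..v} q * (of_bool (alive q r) * cc (ev \<eta> q))) \<in> borel_measurable (clock \<eta> \<Otimes>\<^sub>M borel)"
    by (simp add: split_beta', measurable)
  note fub = Fubini_interval[OF c.finite_measure_axioms m alive_cc_bound]
  have Lm: "integrable (clock \<eta>) L" unfolding L_def by (rule fub(2))
  have inner: "(\<integral>p. stage_incr u v (\<eta>, r, p) \<partial>\<pi> (ev \<eta> r)) =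
     of_bool (alive v r) * a (ev \<eta> v) + indicator {u<..v} r * \<beta> (ev \<eta> r) - of_bool (alive u r) * a (ev \<eta> u) - L r" for r
  proof -
    interpret p: prob_space "\<pi> (ev \<eta> r)" by (rule prob_\<pi>)
    have ib: "integrable (\<pi> (ev \<eta> r)) b"
      by (rule p.integrable_const_bound[where B="2 * C"]) (use b_bound in \<open>auto simp: measurable_cong_sets[OF sets_\<pi> refl]\<close>)
    consider "alive v r" | "alive u r" "\<not> alive v r" | "\<not> alive u r" by blast
    then show ?thesis
    proof cases
      case 1
      then have "alive u r" using alive_antimono[OF u(2)] by blast
      then show ?thesis using 1 u by (auto simp: stage_incr_def L_def p.prob_space alive_def)
    next
      case 2
      then have "r \<in> {u<..v}" using u by (auto simp: alive_def)
      then show ?thesis using 2 ib by (simp add: stage_incr_def L_def p.prob_space \<beta>_def)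
    next
      case 3
      then have "\<not> alive v r" "r \<notin> {u<..v}" using alive_antimono[OF u(2)] by (auto simp: alive_def)
      moreover have "L r = 0"
        unfolding L_def set_lebesgue_integral_def
        by (intro integral_eq_zero_AE AE_I2) (use 3 alive_antimono in \<open>auto split: split_indicator\<close>)
      ultimately show ?thesis using 3 by (simp add: stage_incr_def)
    qed
  qed
  have iF: "set_integrable lborel {u..v} F" if "F \<in> borel_measurable borel" "\<And>q. \<bar>F q\<bar> \<le> K" for F :: "real \<Rightarrow> real" and K :: real
    using that by (intro set_integrable_bounded_Icc[where c=K]) auto
  have haz0: "0 \<le> haz \<eta> q" and hazb: "haz \<eta> q \<le> \<Lambda>max" and e1: "exp (- H \<eta> q) \<le> 1" for q
  proof -
    show e: "exp (- H \<eta> q) \<le> 1" using hazard_facts(2)[OF \<eta>] by simp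
    show "0 \<le> haz \<eta> q" using \<Lambda>_nonneg by (simp add: haz_def)
    show "haz \<eta> q \<le> \<Lambda>max" unfolding haz_def
      using mult_mono[OF \<Lambda>_le[of "ev \<eta> q"] e] \<Lambda>max_nonneg by simp
  qed
  have i1: "set_integrable lborel {u..v} (\<lambda>q. haz \<eta> q * \<beta> (ev \<eta> q))"
    using haz0 hazb \<beta>_bound \<Lambda>max_nonneg by (intro iF[of _ "\<Lambda>max * (2 * C)"]) (auto simp: abs_mult intro!: mult_mono)
  have i2: "set_integrable lborel {u..v} (\<lambda>q. haz \<eta> q * a (ev \<eta> q))"
    using haz0 hazb a_bound \<Lambda>max_nonneg by (intro iF[of _ "\<Lambda>max * C"]) (auto simp: abs_mult intro!: mult_mono)
  have i3: "set_integrable lborel {u..v} (\<lambda>q. exp (- H \<eta> q) * l (ev \<eta> q))"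
    using exp_l_bound[OF \<eta>] by (intro iF[of _ "C"]) auto
  have i4: "set_integrable lborel {u..v} (haz \<eta>)"
    using haz0 hazb by (intro iF[of _ "\<Lambda>max"]) auto
  have alive_int: "integrable (clock \<eta>) (\<lambda>r. of_bool (alive q r) * K)" for q and K :: real
    by (rule c.integrable_const_bound[where B="\<bar>K\<bar>"]) auto
  have \<beta>_int: "integrable (clock \<eta>) (\<lambda>r. indicator {u<..v} r * \<beta> (ev \<eta> r))"
    using \<beta>_bound C_nonneg by (intro c.integrable_const_bound[where B="2 * C"]) (auto split: split_indicator)
  have "?J =
      exp (- H \<eta> v) * a (ev \<eta> v) + ?b - exp (- H \<eta> u) * a (ev \<eta> u)
        - (LINT q:{u..v}|lborel. ?c q)"
  proof -
    have "?J =
        (\<integral>r. of_bool (alive v r) * a (ev \<eta> v) \<partial>clock \<eta>) + (\<integral>r. indicator {u<..v} r * \<beta> (ev \<eta> r) \<partial>clock \<eta>)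
        - (\<integral>r. of_bool (alive u r) * a (ev \<eta> u) \<partial>clock \<eta>) - (\<integral>r. L r \<partial>clock \<eta>)"
      unfolding inner using alive_int[of v "a (ev \<eta> v)"] alive_int[of u "a (ev \<eta> u)"] \<beta>_int Lm
      by (subst Bochner_Integration.integral_diff, auto simp del: integrable_mult_left_iff integral_mult_left_zero)
    also have "(\<integral>r. L r \<partial>clock \<eta>) = (LINT q:{u..v}|lborel. ?c q)"
      unfolding L_def by (rule fub(1))
    finally show ?thesis
      using integral_clock_alive[OF \<eta>] integral_clock_Ioc[OF \<eta> _ u(1), of "\<lambda>r. \<beta> (ev \<eta> r)" v] u by simp
  qed
  also have "(LINT q:{u..v}|lborel. ?c q)
      = (LINT q:{u..v}|lborel. exp (- H \<eta> q) * l (ev \<eta> q) + haz \<eta> q * \<beta> (ev \<eta> q) - haz \<eta> q * a (ev \<eta> q))"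
  proof (intro set_lebesgue_integral_cong, simp, intro allI impI)
    fix q assume "q \<in> {u..v}"
    then have "?c q = exp (- H \<eta> q) * cc (ev \<eta> q)"
      using integral_clock_alive[OF \<eta>, of q] u by simp
    then show "?c q = exp (- H \<eta> q) * l (ev \<eta> q) + haz \<eta> q * \<beta> (ev \<eta> q) - haz \<eta> q * a (ev \<eta> q)"
      by (simp add: cc_def haz_def algebra_simps)
  qed
  also have "\<dots> = ?l + ?b
      - ?a"
    using i1 i2 i3 by (simp add: set_integral_add set_integral_diff)
  finally have 1: "?J =
      exp (- H \<eta> v) * a (ev \<eta> v) - exp (- H \<eta> u) * a (ev \<eta> u) - ?l
       + ?a" by simp
  \<comment> \<open>Writing exp(-H v) as exp(-H u) minus the integral of \<open>haz\<close> lets a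
    appear only through increments up to v whose weights are known at their starting time, as
    \<open>dynkin_weighted\<close> requires.\<close>
  have "(LINT q:{u..v}|lborel. haz \<eta> q * (a (ev \<eta> v) - a (ev \<eta> q)))
      = (LINT q:{u..v}|lborel. haz \<eta> q) * a (ev \<eta> v) - ?a"
    using i2 i4 by (simp add: right_diff_distrib set_integral_diff)
  then show ?thesis unfolding 1 hazard_facts(1)[OF \<eta> u] by (simp add: algebra_simps)
qed

text \<open>\<open>dynkin_weighted\<close> replaces the increment of a from u to v, and for every q
  the one from q to v weighted by \<open>haz\<close>, by integrals of l. What is left is an identity
  for each single path.\<close>

lemma stage_martingale:
  assumes u: "0 \<le> u" "u \<le> v" and B: "B \<in> sets (Fil u)"
  shows "(\<integral>z. indicator B (fst z) * stage_incr u v z \<partial>stage y) = 0"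
proof -
  let ?L = "\<lambda>\<eta> q. LINT r:{q..v}|lborel. l (ev \<eta> r)"
  let ?d = "\<lambda>\<eta> q. indicator B \<eta> * haz \<eta> q * (a (ev \<eta> v) - a (ev \<eta> q))"
  let ?h = "\<lambda>\<eta> q. indicator B \<eta> * haz \<eta> q * ?L \<eta> q"
  let ?g = "\<lambda>\<eta> q. indicator B \<eta> * (exp (- H \<eta> q) * l (ev \<eta> q))"
  let ?e = "\<lambda>\<eta>. indicator B \<eta> * exp (- H \<eta> u)"
  let ?k = "\<lambda>\<eta> q r. indicator {p. fst p \<le> snd p} (q, r) * (haz \<eta> q * l (ev \<eta> r))"
  let ?J = "\<lambda>\<eta>. \<integral>r. \<integral>p. stage_incr u v (\<eta>, r, p) \<partial>\<pi> (ev \<eta> r) \<partial>clock \<eta>"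
  interpret Q: prob_space "Q y" by (rule prob_Q)
  have BN[measurable]: "B \<in> sets N" using B subalgebra_Fil[of y u] by (auto simp: subalgebra_def)
  note [measurable_cong] = sets_Q[of y]
  define K where "K = 3 * C + Cc * (v - u)"
  \<comment> \<open>\<open>integral_stage\<close> wants a bound at every point, but the increment is
    bounded only for paths in \<Omega>; clipping changes nothing there.\<close>
  let ?c = "\<lambda>z. max (- K) (min K (stage_incr u v z))"
  have K0: "0 \<le> K" using C_nonneg Cc_nonneg u by (simp add: K_def)
  have mQ: "f \<in> borel_measurable (Fil z) \<Longrightarrow> f \<in> borel_measurable (Q y)" for f :: "(real \<Rightarrow> 'a) \<Rightarrow> real" and z
    by (rule measurable_from_subalg[OF subalgebra_Fil])
  have HF: "(\<lambda>\<eta>. H \<eta> q) \<in> borel_measurable (Fil q)" for q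
    unfolding H_def by (rule measurable_Fil_integral) auto
  have Fil_mono: "B \<in> sets (Fil q)" if "u \<le> q" for q
  proof -
    have "(\<lambda>\<eta>. \<eta>) \<in> Fil q \<rightarrow>\<^sub>M Fil u"
      using that by (intro measurable_natural_filtration) (auto intro: measurable_natural_filtration_at)
    from measurable_sets[OF this B] show ?thesis
      using sets.sets_into_space[OF B] by (simp add: Int_absorb2)
  qed
  have haz0: "0 \<le> haz \<eta> q" and hazb: "haz \<eta> q \<le> \<Lambda>max" and e1: "exp (- H \<eta> q) \<le> 1" if \<eta>: "\<eta> \<in> \<Omega>" for q \<eta>
  proof -
    show e: "exp (- H \<eta> q) \<le> 1" using hazard_facts(2)[OF \<eta>] by simp
    show "0 \<le> haz \<eta> q" using \<Lambda>_nonneg by (simp add: haz_def)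
    show "haz \<eta> q \<le> \<Lambda>max" unfolding haz_def
      using mult_mono[OF \<Lambda>_le[of "ev \<eta> q"] e] \<Lambda>max_nonneg by simp
  qed
  have clip: "max (- K) (min K x) = x" if "\<bar>x\<bar> \<le> K" for x
  proof -
    have "x \<le> K" "- K \<le> x" using that by linarith+
    then show ?thesis by (simp add: min.absorb2 max.absorb2)
  qed
  have iB: "\<bar>indicator B \<eta> * x\<bar> \<le> \<bar>x\<bar>" for \<eta> and x :: real by (auto split: split_indicator)
  have "(\<integral>z. indicator B (fst z) * stage_incr u v z \<partial>stage y)
      = (\<integral>z. indicator B (fst z) * ?c z \<partial>stage y)"
  proof (intro Bochner_Integration.integral_cong refl arg_cong2[where f="(*)"])
    fix z assume "z \<in> space (stage y)"
    then have "fst z \<in> \<Omega>" using sets_eq_imp_space_eq[OF sets_stage, of y] by (auto simp: space_pair_measure)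
    from stage_incr_bound[OF this u(2)] show "stage_incr u v z = ?c z"
      by (simp add: clip K_def)
  qed
  also have "\<dots> = (\<integral>\<eta>. \<integral>r. \<integral>p. indicator B (fst (\<eta>, r, p)) * ?c (\<eta>, r, p) \<partial>\<pi> (ev \<eta> r) \<partial>clock \<eta> \<partial>Q y)"
    by (rule integral_stage[where B=K]) (use K0 in \<open>auto split: split_indicator\<close>)
  also have "\<dots> = (\<integral>\<eta>. indicator B \<eta> * ?J \<eta> \<partial>Q y)"
  proof (intro Bochner_Integration.integral_cong refl)
    fix \<eta> assume "\<eta> \<in> space (Q y)"
    then have "\<bar>stage_incr u v (\<eta>, r, p)\<bar> \<le> K" for r p
      using stage_incr_bound[of "(\<eta>, r, p)", OF _ u(2)] by (simp add: K_def)
    then have "?c (\<eta>, r, p) = stage_incr u v (\<eta>, r, p)" for r p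
      by (simp add: clip)
    then show "(\<integral>r. \<integral>p. indicator B (fst (\<eta>, r, p)) * ?c (\<eta>, r, p) \<partial>\<pi> (ev \<eta> r) \<partial>clock \<eta>)
      = indicator B \<eta> * ?J \<eta>" by simp
  qed
  also have "\<dots> = (\<integral>\<eta>. ?e \<eta> * (a (ev \<eta> v) - a (ev \<eta> u))
      - (LINT q:{u..v}|lborel. ?d \<eta> q)
      - (LINT q:{u..v}|lborel. ?g \<eta> q) \<partial>Q y)"
    using u by (intro Bochner_Integration.integral_cong refl)
      (simp only: stage_incr_given_path space_Q right_diff_distrib[where a="indicator B _"] mult.assoc set_integral_mult_right)
  finally have I: "(\<integral>z. indicator B (fst z) * stage_incr u v z \<partial>stage y) = \<dots>" .
  have m2: "(\<lambda>(\<eta>, q). indicator {u..v} q * (?d \<eta> q)) \<in> borel_measurable (Q y \<Otimes>\<^sub>M borel)"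
    by (simp add: split_beta', measurable)
  have b2: "\<bar>?d \<eta> q\<bar> \<le> \<Lambda>max * (2 * C)" if "\<eta> \<in> space (Q y)" for \<eta> q
    unfolding abs_mult using that haz0[of \<eta> q] hazb[of \<eta> q] a_bound[of "ev \<eta> v"] a_bound[of "ev \<eta> q"] \<Lambda>max_nonneg
    by (intro mult_mono) (auto split: split_indicator)
  have m2': "(\<lambda>(\<eta>, q). indicator {u..v} q * (?h \<eta> q)) \<in> borel_measurable (Q y \<Otimes>\<^sub>M borel)"
  proof -
    have "(\<lambda>x. \<integral>r. indicator {p. snd (fst p) \<le> snd p \<and> snd p \<le> v} (x, r) * l (ev (fst x) r) \<partial>lborel) \<in> borel_measurable (Q y \<Otimes>\<^sub>M borel)"
      by (rule lborel.borel_measurable_lebesgue_integral) (simp add: split_beta', measurable)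
    then have "(\<lambda>x. LINT r:{snd x..v}|lborel. l (ev (fst x) r)) \<in> borel_measurable (Q y \<Otimes>\<^sub>M borel)"
      by (rule measurable_cong[THEN iffD1, rotated])
        (auto simp: set_lebesgue_integral_def intro!: Bochner_Integration.integral_cong split: split_indicator)
    note [measurable] = this
    show ?thesis by (simp add: split_beta', measurable)
  qed
  have b2': "\<bar>?h \<eta> q\<bar> \<le> \<Lambda>max * (C * (v - u))"
    if "\<eta> \<in> space (Q y)" "q \<in> {u..v}" for \<eta> q
  proof -
    have "\<bar>?L \<eta> q\<bar> \<le> C * (v - q)"
      using that by (intro path_integral_bound) (auto intro: l_bound)
    also have "\<dots> \<le> C * (v - u)" using that C_nonneg by (intro mult_left_mono) auto
    finally show ?thesis
      unfolding abs_mult using that haz0[of \<eta> q] hazb[of \<eta> q] \<Lambda>max_nonneg by (intro mult_mono) (auto split: split_indicator)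
  qed
  have m3: "(\<lambda>(\<eta>, q). indicator {u..v} q * ?g \<eta> q) \<in> borel_measurable (Q y \<Otimes>\<^sub>M borel)"
    by (simp add: split_beta', measurable)
  have b3: "\<bar>?g \<eta> q\<bar> \<le> C" if "\<eta> \<in> space (Q y)" for \<eta> q
    using that by (intro order_trans[OF iB exp_l_bound]) simp
  note f2 = Fubini_interval[OF Q.finite_measure_axioms m2 b2]
  note f2' = Fubini_interval[OF Q.finite_measure_axioms m2' b2']
  note f3 = Fubini_interval[OF Q.finite_measure_axioms m3 b3]
  have W1: "(\<lambda>\<eta>. ?e \<eta>) \<in> borel_measurable (Fil u)" using HF[of u] B by measurable
  have T1: "(\<integral>\<eta>. ?e \<eta> * (a (ev \<eta> v) - a (ev \<eta> u)) \<partial>Q y)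
    = (\<integral>\<eta>. ?e \<eta> * ?L \<eta> u \<partial>Q y)"
    using e1 by (intro dynkin_weighted[OF u W1, where K=1]) (auto split: split_indicator)
  have "(\<integral>\<eta>. ?d \<eta> q \<partial>Q y)
    = (\<integral>\<eta>. ?h \<eta> q \<partial>Q y)" if q: "q \<in> {u..v}" for q
  proof (rule dynkin_weighted[where K=\<Lambda>max])
    have [measurable]: "B \<in> sets (Fil q)" using Fil_mono q by simp
    have [measurable]: "(\<lambda>\<eta>. H \<eta> q) \<in> borel_measurable (Fil q)" by (rule HF)
    have [measurable]: "(\<lambda>\<eta>. ev \<eta> q) \<in> Fil q \<rightarrow>\<^sub>M borel" using q u by (intro measurable_Fil_ev) auto
    show "(\<lambda>\<eta>. indicator B \<eta> * haz \<eta> q) \<in> borel_measurable (Fil q)" unfolding haz_def by measurable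
  qed (use q u haz0 hazb \<Lambda>max_nonneg in \<open>auto split: split_indicator\<close>)
  note swap = this
  have "(\<integral>\<eta>. (LINT q:{u..v}|lborel. ?d \<eta> q) \<partial>Q y)
      = (LINT q:{u..v}|lborel. (\<integral>\<eta>. ?d \<eta> q \<partial>Q y))"
    by (rule f2(1))
  also have "\<dots> = (LINT q:{u..v}|lborel. (\<integral>\<eta>. ?h \<eta> q \<partial>Q y))"
    by (intro set_lebesgue_integral_cong, simp, intro allI impI, rule swap)
  also have "\<dots> = (\<integral>\<eta>. (LINT q:{u..v}|lborel. ?h \<eta> q) \<partial>Q y)"
    by (rule f2'(1)[symmetric])
  finally have T2: "(\<integral>\<eta>. (LINT q:{u..v}|lborel. ?d \<eta> q) \<partial>Q y)
      = (\<integral>\<eta>. (LINT q:{u..v}|lborel. ?h \<eta> q) \<partial>Q y)" .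
  \<comment> \<open>Integration by parts against the survival probability: integrating first in q
    over [u, r] turns \<open>haz\<close> into exp(-H u) - exp(-H r).\<close>
  have pathwise: "(LINT q:{u..v}|lborel. haz \<eta> q * ?L \<eta> q)
      = exp (- H \<eta> u) * ?L \<eta> u - (LINT q:{u..v}|lborel. exp (- H \<eta> q) * l (ev \<eta> q))"
    if \<eta>: "\<eta> \<in> \<Omega>" for \<eta>
  proof -
    have [measurable]: "(\<lambda>q. ev \<eta> q) \<in> borel \<rightarrow>\<^sub>M borel" by (rule measurable_ev_path[OF \<eta>])
    have [measurable]: "haz \<eta> \<in> borel_measurable borel" "H \<eta> \<in> borel_measurable borel"
      using measurable_haz[of "\<lambda>_. \<eta>" borel "\<lambda>t. t"] measurable_H[of "\<lambda>_. \<eta>" borel "\<lambda>t. t"] \<eta> by simp_all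
    \<comment> \<open>Lebesgue measure on [u, v] as a finite measure, so that the Fubini lemma for
      finite measures applies to a double integral over time.\<close>
    let ?M = "density lborel (\<lambda>q. ennreal (indicator {u..v} q))"
    have fin: "finite_measure ?M"
      by (rule finite_measureI) (simp add: emeasure_density ennreal_indicator emeasure_lborel_Icc_eq)
    have IM: "(\<integral>q. F q \<partial>?M) = (LINT q:{u..v}|lborel. F q)" if "F \<in> borel_measurable borel" for F :: "real \<Rightarrow> real"
      using that by (subst integral_density) (auto simp: set_lebesgue_integral_def)
    have mm: "(\<lambda>(q, r). indicator {u..v} r * ?k \<eta> q r) \<in> borel_measurable (?M \<Otimes>\<^sub>M borel)"
      by (simp add: split_beta', measurable)
    have bb: "\<bar>?k \<eta> q r\<bar> \<le> \<Lambda>max * C" for q r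
    proof -
      have "\<bar>haz \<eta> q * l (ev \<eta> r)\<bar> \<le> \<Lambda>max * C"
        unfolding abs_mult using haz0[OF \<eta>] hazb[OF \<eta>] l_bound \<Lambda>max_nonneg by (intro mult_mono) auto
      then show ?thesis using \<Lambda>max_nonneg C_nonneg by (auto split: split_indicator)
    qed
    have [measurable]: "(\<lambda>q. LINT r:{u..v}|lborel. ?k \<eta> q r) \<in> borel_measurable borel"
      using Fubini_interval(2)[OF fin mm bb] by (auto dest!: borel_measurable_integrable)
    have "(LINT q:{u..v}|lborel. haz \<eta> q * ?L \<eta> q)
       = (LINT q:{u..v}|lborel. (LINT r:{u..v}|lborel. ?k \<eta> q r))"
    proof (intro set_lebesgue_integral_cong, simp, intro allI impI)
      fix q assume q: "q \<in> {u..v}"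
      have "(LINT r:{u..v}|lborel. ?k \<eta> q r) = (LINT r:{q..v}|lborel. haz \<eta> q * l (ev \<eta> r))"
        unfolding set_lebesgue_integral_def
        by (intro Bochner_Integration.integral_cong) (use q in \<open>auto split: split_indicator\<close>)
      then show "haz \<eta> q * ?L \<eta> q = (LINT r:{u..v}|lborel. ?k \<eta> q r)"
        by simp
    qed
    also have "\<dots> = (\<integral>q. (LINT r:{u..v}|lborel. ?k \<eta> q r) \<partial>?M)"
      by (rule IM[symmetric]) measurable
    also have "\<dots> = (LINT r:{u..v}|lborel. (\<integral>q. ?k \<eta> q r \<partial>?M))"
      by (rule Fubini_interval(1)[OF fin mm bb])
    also have "\<dots> = (LINT r:{u..v}|lborel. exp (- H \<eta> u) * l (ev \<eta> r) - exp (- H \<eta> r) * l (ev \<eta> r))"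
    proof (intro set_lebesgue_integral_cong, simp, intro allI impI)
      fix r assume r: "r \<in> {u..v}"
      have "(\<integral>q. ?k \<eta> q r \<partial>?M)
         = (LINT q:{u..v}|lborel. ?k \<eta> q r)"
        by (rule IM) measurable
      also have "\<dots> = (LINT q:{u..r}|lborel. haz \<eta> q * l (ev \<eta> r))"
        unfolding set_lebesgue_integral_def
        by (intro Bochner_Integration.integral_cong) (use r in \<open>auto split: split_indicator\<close>)
      also have "\<dots> = (LINT q:{u..r}|lborel. haz \<eta> q) * l (ev \<eta> r)" by simp
      also have "\<dots> = exp (- H \<eta> u) * l (ev \<eta> r) - exp (- H \<eta> r) * l (ev \<eta> r)"
        using r u by (subst hazard_facts(1)[OF \<eta>]) (auto simp: algebra_simps)
      finally show "(\<integral>q. ?k \<eta> q r \<partial>?M) = exp (- H \<eta> u) * l (ev \<eta> r) - exp (- H \<eta> r) * l (ev \<eta> r)" .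
    qed
    also have "\<dots> = exp (- H \<eta> u) * ?L \<eta> u - (LINT q:{u..v}|lborel. exp (- H \<eta> q) * l (ev \<eta> q))"
    proof -
      have "set_integrable lborel {u..v} (\<lambda>r. exp (- H \<eta> r) * l (ev \<eta> r))"
        using exp_l_bound[OF \<eta>] by (intro set_integrable_bounded_Icc[where c=C]) auto
      then show ?thesis using set_integrable_path[OF \<eta> l_measurable l_bound] by (simp add: set_integral_diff)
    qed
    finally show ?thesis .
  qed
  have W1Q: "(\<lambda>\<eta>. ?e \<eta>) \<in> borel_measurable (Q y)" by (rule mQ[OF W1])
  have WL: "(\<lambda>\<eta>. LINT r:{u..v}|lborel. l (ev \<eta> r)) \<in> borel_measurable (Q y)"
    by (rule mQ[OF measurable_Fil_integral[OF l_measurable u(1) order_refl]])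
  have i1: "integrable (Q y) (\<lambda>\<eta>. ?e \<eta> * ?L \<eta> u)"
  proof (rule Q.integrable_const_bound[where B="1 * (C * (v - u))"])
    show "AE \<eta> in Q y. norm (?e \<eta> * ?L \<eta> u) \<le> 1 * (C * (v - u))"
    proof (intro AE_I2)
      fix \<eta> assume \<eta>: "\<eta> \<in> space (Q y)"
      have "\<bar>?L \<eta> u\<bar> \<le> C * (v - u)"
        using \<eta> by (intro path_integral_bound) (auto intro: l_bound u)
      then show "norm (?e \<eta> * ?L \<eta> u) \<le> 1 * (C * (v - u))"
        unfolding real_norm_def abs_mult[of "?e \<eta>"] using \<eta> e1[of \<eta> u] by (intro mult_mono) (auto split: split_indicator)
    qed
  qed (use W1Q WL in measurable)
  have i0: "integrable (Q y) (\<lambda>\<eta>. ?e \<eta> * (a (ev \<eta> v) - a (ev \<eta> u)))"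
  proof (rule Q.integrable_const_bound[where B="1 * (2 * C)"])
    show "AE \<eta> in Q y. norm (?e \<eta> * (a (ev \<eta> v) - a (ev \<eta> u))) \<le> 1 * (2 * C)"
    proof (intro AE_I2)
      fix \<eta> assume \<eta>: "\<eta> \<in> space (Q y)"
      have "\<bar>a (ev \<eta> v) - a (ev \<eta> u)\<bar> \<le> 2 * C" using a_bound[of "ev \<eta> v"] a_bound[of "ev \<eta> u"] by simp
      then show "norm (?e \<eta> * (a (ev \<eta> v) - a (ev \<eta> u))) \<le> 1 * (2 * C)"
        unfolding real_norm_def abs_mult[of "?e \<eta>"] using \<eta> e1[of \<eta> u] by (intro mult_mono) (auto split: split_indicator)
    qed
  qed (use W1Q in measurable)
  have "(\<integral>\<eta>. (LINT q:{u..v}|lborel. ?h \<eta> q) \<partial>Q y)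
     = (\<integral>\<eta>. ?e \<eta> * ?L \<eta> u
        - (LINT q:{u..v}|lborel. ?g \<eta> q) \<partial>Q y)"
    using pathwise by (intro Bochner_Integration.integral_cong refl) (simp add: mult.assoc right_diff_distrib)
  also have "\<dots> = (\<integral>\<eta>. ?e \<eta> * ?L \<eta> u \<partial>Q y)
      - (\<integral>\<eta>. (LINT q:{u..v}|lborel. ?g \<eta> q) \<partial>Q y)"
    by (rule Bochner_Integration.integral_diff[OF i1 f3(2)])
  finally have T3: "(\<integral>\<eta>. (LINT q:{u..v}|lborel. ?h \<eta> q) \<partial>Q y) = \<dots>" .
  show ?thesis
    unfolding I using i0 f2(2) f3(2) T1 T2 T3
    by (subst Bochner_Integration.integral_diff, simp, simp, subst Bochner_Integration.integral_diff) simp_all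
qed

end

section \<open>The chain of stages\<close>

abbreviation pth :: "'p \<times> real \<times> 'e \<times> 'a \<Rightarrow> 'p" where "pth z \<equiv> fst z"
abbreviation clk :: "'p \<times> real \<times> 'e \<times> 'a \<Rightarrow> real" where "clk z \<equiv> fst (snd z)"
abbreviation mrk :: "'p \<times> real \<times> 'e \<times> 'a \<Rightarrow> 'e \<times> 'a" where "mrk z \<equiv> snd (snd z)"
abbreviation pos :: "'p \<times> real \<times> 'e \<times> 'a \<Rightarrow> 'a" where "pos z \<equiv> snd (snd (snd z))"
abbreviation ety :: "nat \<Rightarrow> (nat \<Rightarrow> 'p \<times> real \<times> 'e \<times> 'a) \<Rightarrow> 'e" where "ety k w \<equiv> fst (mrk (w k))"

text \<open>
  Component \<open>0\<close> of a sample only records the starting point; component \<open>n + 1\<close> is the stage that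
  starts at the landing point of component \<open>n\<close>.
\<close>

primrec jump_time :: "nat \<Rightarrow> (nat \<Rightarrow> 'p \<times> real \<times> 'e \<times> 'a) \<Rightarrow> ereal" where
  "jump_time 0 w = 0"
| "jump_time (Suc n) w = jump_time n w + (if 0 < clk (w (Suc n)) then ereal (clk (w (Suc n))) else \<infinity>)"

lemma jump_time_nonneg: "0 \<le> jump_time n w"
  by (induction n) (auto intro: add_nonneg_nonneg)

lemma jump_time_le_Suc: "jump_time n w \<le> jump_time (Suc n) w"
  using add_left_mono[of 0 _ "jump_time n w"] by auto

lemma jump_time_mono: "m \<le> n \<Longrightarrow> jump_time m w \<le> jump_time n w"
  by (rule lift_Suc_mono_le[of "\<lambda>n. jump_time n w"]) (rule jump_time_le_Suc)

lemma jump_time_real: "jump_time n w < \<infinity> \<Longrightarrow> ereal (real_of_ereal (jump_time n w)) = jump_time n w"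
  using jump_time_nonneg[of n w] by (cases "jump_time n w") auto

lemma real_jump_time_nonneg: "0 \<le> real_of_ereal (jump_time n w)"
  by (rule real_of_ereal_pos[OF jump_time_nonneg])

lemma jump_time_less_Suc: "jump_time n w < \<infinity> \<Longrightarrow> jump_time n w < jump_time (Suc n) w"
  using jump_time_nonneg[of n w] by (cases "jump_time n w") auto

lemma jump_time_Suc_inf: "jump_time n w = \<infinity> \<Longrightarrow> jump_time (Suc n) w = \<infinity>"
  by auto

lemma jump_time_cong: "(\<And>k. k \<le> n \<Longrightarrow> w k = w' k) \<Longrightarrow> jump_time n w = jump_time n w'"
  by (induction n) auto

lemma jump_time_restrict [simp]: "jump_time n (restrict w {0..<Suc n}) = jump_time n w"
  by (rule jump_time_cong) auto

lemma measurable_jump_time: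
  assumes "\<And>k. k \<le> n \<Longrightarrow> (\<lambda>x. f x k) \<in> M \<rightarrow>\<^sub>M A \<Otimes>\<^sub>M (borel \<Otimes>\<^sub>M B)"
  shows "(\<lambda>x. jump_time n (f x)) \<in> borel_measurable M"
  using assms
proof (induction n)
  case (Suc n)
  have [measurable]: "(\<lambda>x. jump_time n (f x)) \<in> borel_measurable M" using Suc by auto
  have [measurable]: "(\<lambda>x. f x (Suc n)) \<in> M \<rightarrow>\<^sub>M A \<Otimes>\<^sub>M (borel \<Otimes>\<^sub>M B)" using Suc.prems by auto
  show ?case unfolding jump_time.simps by measurable
qed simp

context jump_diffusion
begin

definition e0 :: 'e where "e0 = (SOME e. e \<in> E)"

lemma e0: "e0 \<in> E"
proof -
  have "space (\<pi> undefined) \<noteq> {}" using prob_space.not_empty[OF prob_\<pi>] .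
  then have "E \<noteq> {}" using sets_eq_imp_space_eq[OF sets_\<pi>, of undefined] by (auto simp: space_pair_measure)
  then show ?thesis unfolding e0_def by (simp add: some_in_eq)
qed

text \<open>Path, clock and mark are fillers; only the landing point of component 0 is read.\<close>

definition start_pt :: "'a \<Rightarrow> (real \<Rightarrow> 'a) \<times> real \<times> 'e \<times> 'a" where
  "start_pt x = ((\<lambda>t\<in>{0..}. x), 0, e0, x)"

lemma measurable_start_pt [measurable]: "start_pt \<in> borel \<rightarrow>\<^sub>M St"
proof -
  have "(\<lambda>x. (\<lambda>t\<in>{0..}. x)) \<in> borel \<rightarrow>\<^sub>M N"
    by (rule measurable_into_path_algebra[OF \<Omega>_PiE]) (auto intro: \<Omega>_const)
  then show ?thesis unfolding start_pt_def[abs_def] using e0 by (intro measurable_Pair) auto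
qed

definition chain_kernel :: "'a \<Rightarrow> nat \<Rightarrow> ('a, 'e) sample \<Rightarrow> ((real \<Rightarrow> 'a) \<times> real \<times> 'e \<times> 'a) measure" where
  "chain_kernel x n h = (case n of 0 \<Rightarrow> return St (start_pt x) | Suc m \<Rightarrow> stage (pos (h m)))"

abbreviation Hist where "Hist n \<equiv> PiM {0..<n} (\<lambda>_::nat. St)"
abbreviation Full where "Full \<equiv> PiM UNIV (\<lambda>_::nat. St)"

lemma start_pt_space: "start_pt x \<in> space St"
  using measurable_space[OF measurable_start_pt] by simp

lemma measurable_chain_kernel_Suc: "(\<lambda>h. stage (pos (h n))) \<in> Hist (Suc n) \<rightarrow>\<^sub>M prob_algebra St"
  by (rule measurable_compose[OF _ measurable_stage]) measurable

lemma Ionescu_Tulcea_chain: "Ionescu_Tulcea (chain_kernel x) (\<lambda>_::nat. St)"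
proof (rule Ionescu_Tulcea.intro)
  show "chain_kernel x i \<in> Hist i \<rightarrow>\<^sub>M subprob_algebra St" for i
  proof (cases i)
    case 0
    then show ?thesis unfolding chain_kernel_def using start_pt_space[of x]
      by (auto intro!: measurable_const measurable_space[OF measurable_prob_algebraD[OF measurable_return_prob_space]])
  next
    case (Suc m)
    then show ?thesis unfolding chain_kernel_def using measurable_prob_algebraD[OF measurable_chain_kernel_Suc] by simp
  qed
  show "prob_space (chain_kernel x i h)" if "h \<in> space (Hist i)" for i h
    unfolding chain_kernel_def using prob_stage start_pt_space by (auto split: nat.split intro: prob_space_return)
qed

sublocale IT: Ionescu_Tulcea "chain_kernel x" "\<lambda>_::nat. St" for x
  by (rule Ionescu_Tulcea_chain)

definition law :: "'a \<Rightarrow> ('a, 'e) sample measure" where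
  "law x = IT.PF.lim x"

text \<open>The law of the components 0 to n - 1; thus \<open>hist x (Suc n)\<close> reaches exactly
  to the n-th landing point.\<close>

definition hist :: "'a \<Rightarrow> nat \<Rightarrow> ('a, 'e) sample measure" where
  "hist x n = IT.C x 0 n (\<lambda>_. undefined)"

lemma sets_law [simp, measurable_cong]: "sets (law x) = sets Full"
  by (simp add: law_def)
lemma space_law [simp]: "space (law x) = space Full"
  by (simp add: law_def)

lemma undef_space: "(\<lambda>_. undefined) \<in> space (Hist 0)" by (simp add: space_PiM)

lemma sets_hist [simp, measurable_cong]: "sets (hist x n) = sets (Hist n)"
  using IT.sets_C[OF undef_space, of x n] by (simp add: hist_def)
lemma space_hist [simp]: "space (hist x n) = space (Hist n)"
  using sets_eq_imp_space_eq[OF sets_hist] .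
lemma prob_hist: "prob_space (hist x n)"
  using IT.prob_space_C[OF undef_space, of x n] by (simp add: hist_def)

lemma measurable_restrict_Full: "(\<lambda>w. restrict w {0..<n}) \<in> Full \<rightarrow>\<^sub>M Hist n"
  by (rule measurable_restrict_subset) simp

lemma distr_law: "distr (law x) (Hist n) (\<lambda>w. restrict w {0..<n}) = hist x n"
proof -
  have "distr (law x) (Hist n) (\<lambda>w. restrict w {0..<n}) = IT.CI x {0..<n}"
    unfolding law_def by (rule IT.distr_lim) simp
  also have "\<dots> = hist x n"
  proof (rule measure_eqI)
    fix X assume "X \<in> sets (IT.CI x {0..<n})"
    then have X: "X \<in> sets (Hist n)" by (simp add: IT.CI_def)
    have "emeasure (IT.CI x {0..<n}) X = emeasure (hist x n) (prod_emb {0..<n} (\<lambda>_. St) {0..<n} X)"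
      unfolding hist_def by (rule IT.emeasure_CI[OF order_refl X])
    also have "prod_emb {0..<n} (\<lambda>_. St) {0..<n} X = X"
      using sets.sets_into_space[OF X] by (auto simp: prod_emb_def space_PiM)
    finally show "emeasure (IT.CI x {0..<n}) X = emeasure (hist x n) X" .
  qed (simp add: IT.CI_def)
  finally show ?thesis .
qed

lemma prob_law: "prob_space (law x)"
proof -
  interpret prob_space "distr (law x) (Hist 0) (\<lambda>w. restrict w {0..<0})"
    unfolding distr_law by (rule prob_hist)
  have r: "(\<lambda>w. restrict w {0..<0}) \<in> law x \<rightarrow>\<^sub>M Hist 0"
    using measurable_restrict_Full[of 0] by (simp add: measurable_cong_sets[OF sets_law refl])
  have "(\<lambda>w. restrict w {0..<0}) -` space (Hist 0) \<inter> space (law x) = space (law x)"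
    using measurable_space[OF r] by blast
  then have "emeasure (law x) (space (law x)) = 1"
    using emeasure_space_1 emeasure_distr[OF r sets.top] by simp
  then show ?thesis by (rule prob_spaceI)
qed

lemma hist_Suc: "hist x (Suc n) = hist x n \<bind> (\<lambda>h. distr (chain_kernel x n h) (Hist (Suc n)) (fun_upd h n))"
  by (simp add: hist_def IT.eP_def[abs_def])

lemma measurable_hist: "(\<lambda>x. hist x n) \<in> borel \<rightarrow>\<^sub>M subprob_algebra (Hist n)"
proof (induction n)
  case 0
  have "hist x 0 = return (Hist 0) (\<lambda>_. undefined)" for x by (simp add: hist_def)
  then show ?case using undef_space by (auto intro!: measurable_const simp: space_subprob_algebra prob_space_imp_subprob_space prob_space_return)
next
  case (Suc n)
  have ck: "(\<lambda>p. chain_kernel (fst p) n (snd p)) \<in> borel \<Otimes>\<^sub>M Hist n \<rightarrow>\<^sub>M subprob_algebra St"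
  proof (cases n)
    case 0
    have "(\<lambda>p. return St (start_pt (fst p))) \<in> borel \<Otimes>\<^sub>M Hist n \<rightarrow>\<^sub>M subprob_algebra St"
      by (rule measurable_compose[OF _ return_measurable]) measurable
    then show ?thesis using 0 by (simp add: chain_kernel_def)
  next
    case (Suc m)
    have "(\<lambda>p. stage (pos (snd p m))) \<in> borel \<Otimes>\<^sub>M Hist (Suc m) \<rightarrow>\<^sub>M subprob_algebra St"
      by (rule measurable_compose[OF measurable_snd measurable_prob_algebraD[OF measurable_chain_kernel_Suc]])
    then show ?thesis using Suc by (simp add: chain_kernel_def)
  qed
  have "(\<lambda>p. distr (chain_kernel (fst p) n (snd p)) (Hist (Suc n)) (fun_upd (snd p) n)) \<in> borel \<Otimes>\<^sub>M Hist n \<rightarrow>\<^sub>M subprob_algebra (Hist (Suc n))"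
    by (rule measurable_distr2[OF _ ck])
      (auto simp: split_beta' intro!: measurable_fun_upd[where J="{0..<n}"])
  then show ?case unfolding hist_Suc
    by (intro measurable_bind[OF Suc]) (simp add: split_beta')
qed

text \<open>Cylinder sets generate the product sigma-algebra and depend on finitely many components,
  whose joint law is measurable in x by induction over the kernels.\<close>

lemma measurable_law: "law \<in> borel \<rightarrow>\<^sub>M prob_algebra Full"
proof (rule measurable_prob_algebraI)
  show "prob_space (law x)" for x by (rule prob_law)
  show "law \<in> borel \<rightarrow>\<^sub>M subprob_algebra Full"
  proof (rule measurable_subprob_algebra_generated[OF sets_PiM Int_stable_prod_algebra prod_algebra_sets_into_space])
    fix A assume "A \<in> prod_algebra UNIV (\<lambda>_::nat. St)"
    then obtain J F where A: "A = prod_emb UNIV (\<lambda>_. St) J (Pi\<^sub>E J F)" "finite J" "\<And>j. j \<in> J \<Longrightarrow> F j \<in> sets St"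
      by (auto elim!: prod_algebraE)
    obtain n where n: "J \<subseteq> {0..<n}" using A(2) by (metis atLeast0LessThan finite_nat_iff_bounded)
    let ?B = "prod_emb {0..<n} (\<lambda>_. St) J (Pi\<^sub>E J F)"
    have B: "?B \<in> sets (Hist n)" using A n by (intro sets_PiM_I) auto
    have "emeasure (law x) A = emeasure (hist x n) ?B" for x
    proof -
      have "A = (\<lambda>w. restrict w {0..<n}) -` ?B \<inter> space (law x)"
        using n by (auto simp: A prod_emb_def space_PiM PiE_def Pi_def extensional_def restrict_def fun_eq_iff subset_eq)
      then show ?thesis unfolding distr_law[symmetric] using B
        by (subst emeasure_distr) (auto intro: measurable_restrict_Full)
    qed
    then show "(\<lambda>x. emeasure (law x) A) \<in> borel_measurable borel"
      using measurable_emeasure_kernel[OF measurable_hist B] by simp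
  next
    have "emeasure (law x) (space Full) = 1" for x
      using prob_space.emeasure_space_1[OF prob_law[of x]] by simp
    then show "(\<lambda>x. emeasure (law x) (\<Pi>\<^sub>E i\<in>UNIV. space St)) \<in> borel_measurable borel"
      by (simp add: space_PiM)
  qed (auto intro: prob_space_imp_subprob_space[OF prob_law])
qed

text \<open>The Markov property of the chain: the history enters the law of the next stage only
  through its last landing point. It comes from splitting off the last component of
  \<open>hist x (Suc (Suc n))\<close>.\<close>

lemma distr_law_pair:
  "distr (law x) (Hist (Suc n) \<Otimes>\<^sub>M St) (\<lambda>w. (restrict w {0..<Suc n}, w (Suc n)))
    = hist x (Suc n) \<bind> (\<lambda>h. distr (stage (pos (h n))) (Hist (Suc n) \<Otimes>\<^sub>M St) (\<lambda>z. (h, z)))"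
proof -
  let ?R = "Hist (Suc n) \<Otimes>\<^sub>M St"
  let ?G = "\<lambda>h. (restrict h {0..<Suc n}, h (Suc n))"
  have G: "?G \<in> Hist (Suc (Suc n)) \<rightarrow>\<^sub>M ?R"
    by (intro measurable_Pair measurable_restrict_subset measurable_component_singleton) auto
  have ne: "space (hist x (Suc n)) \<noteq> {}" using prob_space.not_empty[OF prob_hist] .
  have upd: "fun_upd h (Suc n) \<in> St \<rightarrow>\<^sub>M Hist (Suc (Suc n))" if "h \<in> space (Hist (Suc n))" for h
    using that by (intro measurable_fun_upd[where J="{0..<Suc n}"]) auto
  have e: "(\<lambda>h. distr (stage (pos (h n))) (Hist (Suc (Suc n))) (fun_upd h (Suc n))) \<in> Hist (Suc n) \<rightarrow>\<^sub>M subprob_algebra (Hist (Suc (Suc n)))"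
    using IT.measurable_eP[of x "Suc n"] by (simp add: IT.eP_def[abs_def] chain_kernel_def)
  have "distr (law x) ?R (\<lambda>w. (restrict w {0..<Suc n}, w (Suc n))) = distr (hist x (Suc (Suc n))) ?R ?G"
    unfolding distr_law[symmetric, of x "Suc (Suc n)"]
  proof (subst distr_distr[OF G])
    show "(\<lambda>w. restrict w {0..<Suc (Suc n)}) \<in> law x \<rightarrow>\<^sub>M Hist (Suc (Suc n))"
      using measurable_restrict_Full[of "Suc (Suc n)"] by (simp only: measurable_cong_sets[OF sets_law refl])
  qed (auto intro!: distr_cong simp: comp_def restrict_def fun_eq_iff)
  also have "\<dots> = hist x (Suc n) \<bind> (\<lambda>h. distr (distr (stage (pos (h n))) (Hist (Suc (Suc n))) (fun_upd h (Suc n))) ?R ?G)"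
    unfolding hist_Suc[of x "Suc n"] using e ne
    by (subst distr_bind[OF _ _ G]) (auto simp: chain_kernel_def measurable_cong_sets[OF sets_hist refl])
  also have "\<dots> = hist x (Suc n) \<bind> (\<lambda>h. distr (stage (pos (h n))) ?R (\<lambda>z. (h, z)))"
  proof (intro bind_cong refl)
    fix h assume "h \<in> space (hist x (Suc n))"
    then have h: "h \<in> space (Hist (Suc n))" by simp
    have "distr (distr (stage (pos (h n))) (Hist (Suc (Suc n))) (fun_upd h (Suc n))) ?R ?G = distr (stage (pos (h n))) ?R (?G \<circ> fun_upd h (Suc n))"
      using upd[OF h] by (intro distr_distr[OF G]) (simp add: measurable_cong_sets[OF sets_stage refl])
    also have "?G \<circ> fun_upd h (Suc n) = (\<lambda>z. (h, z))"
      using h by (auto simp: fun_eq_iff space_PiM PiE_def extensional_def restrict_def)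
    finally show "distr (distr (stage (pos (h n))) (Hist (Suc (Suc n))) (fun_upd h (Suc n))) ?R ?G = distr (stage (pos (h n))) ?R (\<lambda>z. (h, z))" .
  qed
  finally show ?thesis .
qed

lemma measurable_pair_kernel:
  "(\<lambda>h. distr (stage (pos (h n))) (Hist (Suc n) \<Otimes>\<^sub>M St) (\<lambda>z. (h, z))) \<in> Hist (Suc n) \<rightarrow>\<^sub>M prob_algebra (Hist (Suc n) \<Otimes>\<^sub>M St)"
  by (rule measurable_distr_prob_space2[OF measurable_chain_kernel_Suc]) measurable

lemma measurable_hist_pair: "(\<lambda>w. (restrict w {0..<Suc n}, w (Suc n))) \<in> Full \<rightarrow>\<^sub>M Hist (Suc n) \<Otimes>\<^sub>M St"
  by (intro measurable_Pair measurable_restrict_Full measurable_component_singleton) auto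

text \<open>Conditioning on the history in integrated form. The bound is required at every point,
  also outside the space, which is why integrands get clipped in later applications.\<close>

lemma integral_law_stage:
  fixes f :: "_ \<Rightarrow> real"
  assumes f[measurable]: "f \<in> borel_measurable (Hist (Suc n) \<Otimes>\<^sub>M St)" and bd: "\<And>p. \<bar>f p\<bar> \<le> B"
  shows "(\<integral>w. f (restrict w {0..<Suc n}, w (Suc n)) \<partial>law x)
    = (\<integral>w. \<integral>z. f (restrict w {0..<Suc n}, z) \<partial>stage (pos (w n)) \<partial>law x)"
proof -
  let ?R = "Hist (Suc n) \<Otimes>\<^sub>M St"
  have h: "finite_measure (hist x (Suc n))" "space (hist x (Suc n)) \<noteq> {}"
    using prob_hist prob_space.not_empty[OF prob_hist] by (auto simp: prob_space_def)
  have "(\<integral>w. f (restrict w {0..<Suc n}, w (Suc n)) \<partial>law x) = (\<integral>p. f p \<partial>distr (law x) ?R (\<lambda>w. (restrict w {0..<Suc n}, w (Suc n))))"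
    using measurable_hist_pair by (subst integral_distr) auto
  also have "\<dots> = (\<integral>h. \<integral>p. f p \<partial>distr (stage (pos (h n))) ?R (\<lambda>z. (h, z)) \<partial>hist x (Suc n))"
    unfolding distr_law_pair using bd h measurable_pair_kernel
    by (intro integral_bind[where K="?R" and B=B and B'=1] f kernel_le_1[where K="?R"])
      (auto simp: measurable_cong_sets[OF sets_hist refl] intro: measurable_prob_algebraD)
  also have "\<dots> = (\<integral>h. \<integral>z. f (h, z) \<partial>stage (pos (h n)) \<partial>hist x (Suc n))"
    by (intro Bochner_Integration.integral_cong refl integral_distr f)
      (simp add: measurable_cong_sets[OF sets_stage refl])
  also have "\<dots> = (\<integral>w. \<integral>z. f (restrict w {0..<Suc n}, z) \<partial>stage (pos (w n)) \<partial>law x)"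
  proof -
    have "(\<lambda>h. \<integral>p. f p \<partial>distr (stage (pos (h n))) ?R (\<lambda>z. (h, z))) \<in> borel_measurable (Hist (Suc n))"
      by (rule measurable_compose[OF measurable_prob_algebraD[OF measurable_pair_kernel] integral_measurable_subprob_algebra[OF f]])
    then have m: "(\<lambda>h. \<integral>z. f (h, z) \<partial>stage (pos (h n))) \<in> borel_measurable (Hist (Suc n))"
      by (rule measurable_cong[THEN iffD1, rotated])
        (auto intro!: integral_distr f simp: measurable_cong_sets[OF sets_stage refl])
    show ?thesis
      unfolding distr_law[symmetric] by (subst integral_distr[OF _ m]) (auto intro: measurable_restrict_Full)
  qed
  finally show ?thesis .
qed

lemma AE_law_stage:
  assumes P: "Measurable.pred (borel \<Otimes>\<^sub>M St) (\<lambda>(y, z). P y z)" and AE: "\<And>y. AE z in stage y. P y z"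
  shows "AE w in law x. P (pos (w n)) (w (Suc n))"
proof -
  let ?R = "Hist (Suc n) \<Otimes>\<^sub>M St"
  have P': "Measurable.pred ?R (\<lambda>p. P (pos (fst p n)) (snd p))"
    using measurable_compose[OF _ P, of "\<lambda>p. (pos (fst p n), snd p)" ?R] by simp
  have "AE p in distr (law x) ?R (\<lambda>w. (restrict w {0..<Suc n}, w (Suc n))). P (pos (fst p n)) (snd p)"
    unfolding distr_law_pair
  proof (subst AE_bind[OF _ P'])
    show "(\<lambda>h. distr (stage (pos (h n))) ?R (\<lambda>z. (h, z))) \<in> hist x (Suc n) \<rightarrow>\<^sub>M subprob_algebra ?R"
      using measurable_prob_algebraD[OF measurable_pair_kernel] by (simp add: measurable_cong_sets[OF sets_hist refl])
    show "AE h in hist x (Suc n). AE p in distr (stage (pos (h n))) ?R (\<lambda>z. (h, z)). P (pos (fst p n)) (snd p)"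
    proof (rule AE_I2)
      fix h assume h: "h \<in> space (hist x (Suc n))"
      have "(\<lambda>z. (h, z)) \<in> stage (pos (h n)) \<rightarrow>\<^sub>M ?R" using h by (simp add: measurable_cong_sets[OF sets_stage refl])
      from AE_distr_iff[OF this] P' AE[of "pos (h n)"]
      show "AE p in distr (stage (pos (h n))) ?R (\<lambda>z. (h, z)). P (pos (fst p n)) (snd p)" by (simp add: pred_def)
    qed
  qed
  then have "AE w in law x. P (pos (fst (restrict w {0..<Suc n}, w (Suc n)) n)) (snd (restrict w {0..<Suc n}, w (Suc n)))"
    by (subst (asm) AE_distr_iff) (use P' measurable_hist_pair in \<open>auto simp: pred_def\<close>)
  then show ?thesis by simp
qed

lemma AE_law_pos0: "AE w in law x. pos (w 0) = x"
proof -
  have [measurable]: "(\<lambda>h::nat \<Rightarrow> (real \<Rightarrow> 'a) \<times> real \<times> 'e \<times> 'a. pos (h 0)) \<in> Hist (Suc 0) \<rightarrow>\<^sub>M borel" by measurable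
  have P: "Measurable.pred (Hist (Suc 0)) (\<lambda>h. pos (h 0) = x)" by measurable
  have h0: "hist x 0 = return (Hist 0) (\<lambda>_. undefined)" by (simp add: hist_def)
  have ck: "chain_kernel x 0 = (\<lambda>h. return St (start_pt x))" by (simp add: chain_kernel_def fun_eq_iff)
  have upd: "fun_upd (\<lambda>_. undefined) 0 \<in> return St (start_pt x) \<rightarrow>\<^sub>M Hist (Suc 0)"
    using measurable_fun_upd[of "{0..<Suc 0}" "{0..<0}" 0 "\<lambda>_. \<lambda>_. undefined" St "\<lambda>_. St" "\<lambda>z. z"] undef_space by simp
  have "hist x (Suc 0) = distr (return St (start_pt x)) (Hist (Suc 0)) (fun_upd (\<lambda>_. undefined) 0)"
    unfolding hist_Suc h0 ck using IT.measurable_eP[of x 0] undef_space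
    by (subst bind_return[where N="Hist (Suc 0)"]) (auto simp: IT.eP_def[abs_def] ck)
  then have "AE h in hist x (Suc 0). pos (h 0) = x"
  proof -
    have "AE z in return St (start_pt x). pos z = x"
      by (subst AE_return[OF start_pt_space]) (auto simp: start_pt_def)
    then show ?thesis unfolding \<open>hist x (Suc 0) = _\<close>
      by (subst AE_distr_iff[OF upd]) (use P in \<open>auto simp: pred_def\<close>)
  qed
  then have "AE w in law x. pos (restrict w {0..<Suc 0} 0) = x"
    unfolding distr_law[symmetric] by (subst (asm) AE_distr_iff) (use P measurable_restrict_Full in \<open>auto simp: pred_def\<close>)
  then show ?thesis by simp
qed

section \<open>Discounted jump times and the exclusion of infinitely many jumps in finite
  time\<close>

lemma measurable_jump_time_Full [measurable]: "jump_time n \<in> borel_measurable Full"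
  by (rule measurable_jump_time[where A=N and B=EM]) measurable

lemma measurable_jump_time_Hist: "n < m \<Longrightarrow> jump_time n \<in> borel_measurable (Hist m)"
  by (rule measurable_jump_time[where A=N and B=EM]) measurable

text \<open>exp(-\<tau>) at the n-th jump time \<tau>, with value 0 if that jump never happens. It
  is multiplicative over the stages.\<close>

definition disc :: "nat \<Rightarrow> ('a, 'e) sample \<Rightarrow> real" where
  "disc n w = (if jump_time n w < \<infinity> then exp (- real_of_ereal (jump_time n w)) else 0)"

definition q :: real where "q = \<Lambda>max / (1 + \<Lambda>max)"

lemma \<Lambda>max_nonneg': "0 \<le> \<Lambda>max" using order_trans[OF \<Lambda>_nonneg \<Lambda>_le] .

lemma q: "0 \<le> q" "q < 1" using \<Lambda>max_nonneg' by (auto simp: q_def)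

lemma disc_restrict: "disc n (restrict w {0..<Suc n}) = disc n w"
  unfolding disc_def by (simp only: jump_time_restrict)

lemma disc_Suc: "disc (Suc n) w = disc n w * (if 0 < clk (w (Suc n)) then exp (- clk (w (Suc n))) else 0)"
  using jump_time_nonneg[of n w] by (cases "jump_time n w") (auto simp: disc_def exp_add[symmetric])

lemma disc_01: "0 \<le> disc n w" "disc n w \<le> 1"
  using real_jump_time_nonneg[of n w] by (auto simp: disc_def)

lemma measurable_disc [measurable]: "disc n \<in> borel_measurable Full"
  unfolding disc_def[abs_def] by measurable

text \<open>Given the history, every further stage multiplies the expected discount by at most
  q.\<close>

lemma integral_disc: "(\<integral>w. disc n w \<partial>law x) \<le> q ^ n"
proof (induction n)
  case 0
  interpret prob_space "law x" by (rule prob_law)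
  show ?case by (simp add: disc_def prob_space del: space_law)
next
  case (Suc n)
  interpret prob_space "law x" by (rule prob_law)
  let ?ec = "\<lambda>z::(real \<Rightarrow> 'a) \<times> real \<times> 'e \<times> 'a. if 0 < clk z then exp (- clk z) else 0"
  have dm: "disc n \<in> borel_measurable (Hist (Suc n))"
    using measurable_jump_time_Hist[of n "Suc n"] unfolding disc_def[abs_def] by measurable
  have di: "integrable (law x) (disc n)"
    by (rule integrable_const_bound[where B=1]) (use disc_01 in auto)
  have "(\<integral>w. disc (Suc n) w \<partial>law x) = (\<integral>w. (\<lambda>(h, z). disc n h * ?ec z) (restrict w {0..<Suc n}, w (Suc n)) \<partial>law x)"
    by (simp only: disc_Suc disc_restrict split)
  also have "\<dots> = (\<integral>w. \<integral>z. (\<lambda>(h, z). disc n h * ?ec z) (restrict w {0..<Suc n}, z) \<partial>stage (pos (w n)) \<partial>law x)"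
  proof (rule integral_law_stage[where B="1 * 1"])
    show "(\<lambda>(h, z). disc n h * ?ec z) \<in> borel_measurable (Hist (Suc n) \<Otimes>\<^sub>M St)"
      using dm by measurable
    show "\<bar>(\<lambda>(h, z). disc n h * ?ec z) p\<bar> \<le> 1 * 1" for p
      using disc_01 by (auto simp: split_beta abs_mult intro!: mult_le_one)
  qed
  also have "\<dots> = (\<integral>w. disc n w * (\<integral>z. ?ec z \<partial>stage (pos (w n))) \<partial>law x)"
    by (simp only: disc_restrict split integral_mult_right_zero)
  also have "\<dots> \<le> (\<integral>w. disc n w * q \<partial>law x)"
  proof (rule integral_mono')
    show "integrable (law x) (\<lambda>w. disc n w * q)" using di by simp
    show "disc n w * (\<integral>z. ?ec z \<partial>stage (pos (w n))) \<le> disc n w * q" for w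
      using stage_discount[of "pos (w n)"] disc_01 by (intro mult_left_mono) (auto simp: q_def)
    show "0 \<le> disc n w * q" for w using disc_01 q by simp
  qed
  also have "\<dots> \<le> q ^ n * q" using Suc q by (simp add: mult_right_mono)
  finally show ?case by (simp add: mult.commute)
qed

text \<open>Markov's inequality for the discount. The geometric decay in n later also makes the sum
  over the stages integrable.\<close>

lemma prob_jump_time_le: "measure (law x) {w \<in> space Full. jump_time n w \<le> ereal t} \<le> exp t * q ^ n"
proof -
  interpret prob_space "law x" by (rule prob_law)
  have di: "integrable (law x) (disc n)"
    by (rule integrable_const_bound[where B=1]) (use disc_01 in auto)
  have "measure (law x) {w \<in> space Full. jump_time n w \<le> ereal t} = (\<integral>w. indicator {w \<in> space Full. jump_time n w \<le> ereal t} w \<partial>law x)"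
    by simp
  also have "\<dots> \<le> (\<integral>w. exp t * disc n w \<partial>law x)"
  proof (rule integral_mono')
    fix w
    show "indicator {w \<in> space Full. jump_time n w \<le> ereal t} w \<le> exp t * disc n w"
    proof (cases "jump_time n w \<le> ereal t")
      case True
      then have "jump_time n w < \<infinity>" by (auto intro: le_less_trans)
      then obtain r where r: "jump_time n w = ereal r" using jump_time_real by metis
      then have "1 \<le> exp t * exp (- r)" using True by (simp add: exp_add[symmetric])
      then show ?thesis using r by (auto simp: disc_def split: split_indicator)
    qed (use disc_01 in \<open>auto split: split_indicator\<close>)
  qed (use di disc_01 in auto)
  also have "\<dots> \<le> exp t * q ^ n" using integral_disc[where n=n and x=x] by simp
  finally show ?thesis .
qed

lemma AE_jump_time_unbounded: "AE w in law x. \<forall>k::nat. \<exists>n. ereal (real k) < jump_time n w"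
  unfolding AE_all_countable
proof
  fix k :: nat
  interpret prob_space "law x" by (rule prob_law)
  let ?A = "{w \<in> space Full. \<forall>n. jump_time n w \<le> ereal (real k)}"
  have m: "?A \<in> sets (law x)" by measurable
  have "measure (law x) ?A \<le> exp (real k) * q ^ n" for n
    by (rule order_trans[OF finite_measure_mono prob_jump_time_le[where x=x and n=n and t="real k"]]) auto
  moreover have "(\<lambda>n. exp (real k) * q ^ n) \<longlonglongrightarrow> exp (real k) * 0"
    using q by (intro tendsto_intros LIMSEQ_realpow_zero) auto
  ultimately have "measure (law x) ?A \<le> 0"
    by (intro LIMSEQ_le_const[where X="\<lambda>n. exp (real k) * q ^ n"]) auto
  then have "emeasure (law x) ?A = 0" by (simp add: emeasure_eq_measure measure_le_0_iff)
  then show "AE w in law x. \<exists>n. ereal (real k) < jump_time n w"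
    by (intro AE_I[where N="?A"]) (use m in \<open>auto simp: not_less\<close>)
qed

text \<open>Samples whose stages fit together and whose jump times exhaust the time axis.
  Restricting to them makes every trajectory cadlag without exception.\<close>

definition good :: "('a, 'e) sample set" where
  "good = {w \<in> space Full. (\<forall>n. pth (w (Suc n)) 0 = pos (w n)) \<and> (\<forall>k::nat. \<exists>n. ereal (real k) < jump_time n w)}"

lemma measurable_path_at:
  assumes "f \<in> M \<rightarrow>\<^sub>M St" "0 \<le> t"
  shows "(\<lambda>x. pth (f x) t) \<in> M \<rightarrow>\<^sub>M borel"
  using measurable_compose[OF measurable_compose[OF assms(1) measurable_fst] measurable_path_algebra_eval[OF assms(2)]] .

lemma good_sets [measurable]: "good \<in> sets Full"
proof -
  \<comment> \<open>Equality of two random points is expressed as distance 0, which is visibly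
    measurable.\<close>
  have "(\<lambda>w. dist (pth (w (Suc n)) 0) (pos (w n))) \<in> borel_measurable Full" for n
    by (intro borel_measurable_dist measurable_path_at[where f="\<lambda>w. w (Suc n)"]) auto
  note [measurable] = this
  have "good = {w \<in> space Full. (\<forall>n. dist (pth (w (Suc n)) 0) (pos (w n)) = 0) \<and> (\<forall>k::nat. \<exists>n. ereal (real k) < jump_time n w)}"
    by (simp add: good_def)
  also have "\<dots> \<in> sets Full" by measurable
  finally show ?thesis .
qed

lemma AE_good: "AE w in law x. w \<in> good"
proof -
  have [measurable]: "(\<lambda>z. pth z 0) \<in> St \<rightarrow>\<^sub>M borel"
    by (rule measurable_path_at[where f="\<lambda>z. z"]) auto
  have "AE w in law x. \<forall>n. pth (w (Suc n)) 0 = pos (w n)"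
    unfolding AE_all_countable
    by (intro allI AE_law_stage[where P="\<lambda>y z. pth z 0 = y"] AE_stage_start) measurable
  then show ?thesis using AE_jump_time_unbounded[of x] AE_space
    by eventually_elim (simp add: good_def)
qed

end

section \<open>The concatenated process\<close>

declare jump_time.simps(2) [simp del]

text \<open>If no stage contains t the value is arbitrary; this does not happen for samples in
  \<open>good\<close> and t \<ge> 0.\<close>

definition stage_idx :: "(nat \<Rightarrow> 'p \<times> real \<times> 'e \<times> 'a) \<Rightarrow> real \<Rightarrow> nat" where
  "stage_idx w t = (LEAST n. ereal t < jump_time (Suc n) w)"

definition proc :: "('a, 'e) sample \<Rightarrow> real \<Rightarrow> 'a" where
  "proc w = (\<lambda>t\<in>{0..}. pth (w (Suc (stage_idx w t))) (t - real_of_ereal (jump_time (stage_idx w t) w)))"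

lemma stage_idx_eq:
  assumes "jump_time n w \<le> ereal t" "ereal t < jump_time (Suc n) w"
  shows "stage_idx w t = n"
  unfolding stage_idx_def
proof (rule Least_equality)
  show "ereal t < jump_time (Suc n) w" by (rule assms(2))
  fix m assume m: "ereal t < jump_time (Suc m) w"
  show "n \<le> m"
  proof (rule ccontr)
    assume "\<not> n \<le> m"
    then have "jump_time (Suc m) w \<le> jump_time n w" by (intro jump_time_mono) auto
    then show False using m assms(1) by auto
  qed
qed

lemma proc_eq:
  assumes "jump_time n w \<le> ereal t" "ereal t < jump_time (Suc n) w"
  shows "proc w t = pth (w (Suc n)) (t - real_of_ereal (jump_time n w))"
proof -
  have "0 \<le> t" using order_trans[OF jump_time_nonneg assms(1)] by simp
  then show ?thesis using stage_idx_eq[OF assms] by (simp add: proc_def)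
qed

lemma stage_exists_before:
  assumes "0 \<le> t" "ereal t < jump_time n w"
  obtains m where "m < n" "jump_time m w \<le> ereal t" "ereal t < jump_time (Suc m) w"
proof -
  have "\<exists>m<n. jump_time m w \<le> ereal t \<and> ereal t < jump_time (Suc m) w"
    using assms(2)
  proof (induction n)
    case (Suc n)
    show ?case
    proof (cases "ereal t < jump_time n w")
      case True then show ?thesis using Suc.IH less_Suc_eq by blast
    next
      case False then show ?thesis using Suc.prems by (intro exI[of _ n]) auto
    qed
  qed (use assms in simp)
  then show ?thesis using that by blast
qed

text \<open>Allows the process before the n-th jump to be read off a finite history instead of the
  full sample.\<close>

lemma proc_cong:
  assumes eq: "\<And>k. k \<le> n \<Longrightarrow> w k = w' k" and t: "0 \<le> t" "ereal t < jump_time n w"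
  shows "proc w t = proc w' t"
proof -
  obtain m where m: "m < n" "jump_time m w \<le> ereal t" "ereal t < jump_time (Suc m) w"
    using stage_exists_before[OF t] .
  have jt: "jump_time k w = jump_time k w'" if "k \<le> n" for k using that eq by (intro jump_time_cong) auto
  then show ?thesis using proc_eq[OF m(2,3)] proc_eq[of m w' t] m jt[of m] jt[of "Suc m"] eq[of "Suc m"] by auto
qed

lemma LINT_shift:
  fixes g :: "real \<Rightarrow> real"
  shows "(LINT s:{c + a..c + b}|lborel. g s) = (LINT s:{a..b}|lborel. g (c + s))"
  unfolding set_lebesgue_integral_def
  by (subst lborel_integral_real_affine[where c=1 and t=c])
    (auto intro!: Bochner_Integration.integral_cong split: split_indicator)

text \<open>The right end has to be spared because the process has already jumped there, while the
  path of the stage has not.\<close>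

lemma LINT_cong_but_end:
  fixes f g :: "real \<Rightarrow> real"
  assumes "\<And>s. a \<le> s \<Longrightarrow> s < b \<Longrightarrow> f s = g s" "f \<in> borel_measurable borel" "g \<in> borel_measurable borel"
  shows "(LINT s:{a..b}|lborel. f s) = (LINT s:{a..b}|lborel. g s)"
  unfolding set_lebesgue_integral_def
proof (rule integral_cong_AE)
  show "AE s in lborel. indicator {a..b} s *\<^sub>R f s = indicator {a..b} s *\<^sub>R g s"
    using AE_lborel_singleton[of b] by eventually_elim (use assms(1) in \<open>auto split: split_indicator\<close>)
qed (use assms in auto)

context jump_diffusion
begin

lemma goodD:
  assumes "w \<in> good"
  shows "w \<in> space Full" "pth (w (Suc n)) 0 = pos (w n)" "pth (w k) \<in> \<Omega>" "w k \<in> space St"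
    "\<exists>n. ereal t < jump_time n w"
proof -
  show 1: "w \<in> space Full" "pth (w (Suc n)) 0 = pos (w n)" using assms by (auto simp: good_def)
  show 2: "w k \<in> space St" using 1(1) by (auto simp: space_PiM)
  then show "pth (w k) \<in> \<Omega>" by (auto simp: space_pair_measure)
  obtain k :: nat where "t < real k" using reals_Archimedean2 by blast
  moreover obtain n where "ereal (real k) < jump_time n w" using assms by (auto simp: good_def)
  ultimately show "\<exists>n. ereal t < jump_time n w" by (meson less_ereal.simps(1) less_trans)
qed

lemma good_stage:
  assumes "w \<in> good" "0 \<le> t"
  obtains n where "jump_time n w \<le> ereal t" "ereal t < jump_time (Suc n) w"
proof -
  obtain m where "ereal t < jump_time m w" using goodD(5)[OF assms(1)] by blast
  from stage_exists_before[OF assms(2) this] that show ?thesis by blast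
qed

text \<open>Left limits need intervals open on the left and closed on the right: if t is itself a
  jump time, the stage that ends at t is the relevant one.\<close>

lemma good_left_stage:
  assumes "w \<in> good" "0 < t"
  obtains n where "jump_time n w < ereal t" "ereal t \<le> jump_time (Suc n) w"
proof -
  obtain n where n: "jump_time n w \<le> ereal t" "ereal t < jump_time (Suc n) w"
    using good_stage[OF assms(1)] assms(2) by (metis less_imp_le)
  show ?thesis
  proof (cases "jump_time n w = ereal t")
    case True
    then obtain m where m: "n = Suc m" using assms(2) by (cases n) auto
    have "jump_time m w \<noteq> \<infinity>" using jump_time_Suc_inf[of m w] True m by auto
    then have "jump_time m w < jump_time n w" using jump_time_less_Suc[of m w] unfolding m by auto
    then show ?thesis using True m that[of m] by simp
  next
    case False
    then show ?thesis using n that[of n] by (simp add: order_less_le)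
  qed
qed

lemma proc_jump:
  assumes "w \<in> good" "jump_time n w < \<infinity>"
  shows "proc w (real_of_ereal (jump_time n w)) = pos (w n)"
  using proc_eq[of n w "real_of_ereal (jump_time n w)"] jump_time_less_Suc[OF assms(2)] goodD(2)[OF assms(1)]
    jump_time_real[OF assms(2)] by simp

lemma proc_0: "w \<in> good \<Longrightarrow> proc w 0 = pos (w 0)"
  using proc_jump[of w 0] by simp

lemma stage_interval:
  assumes "jump_time n w < \<infinity>"
  obtains c where "jump_time n w = ereal c" "0 \<le> c" "real_of_ereal (jump_time n w) = c"
  using jump_time_real[OF assms] real_jump_time_nonneg[of n w] by metis

lemma proc_right_cont:
  assumes w: "w \<in> good" and t: "0 \<le> t"
  shows "(proc w \<longlongrightarrow> proc w t) (at_right t)"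
proof -
  obtain n where n: "jump_time n w \<le> ereal t" "ereal t < jump_time (Suc n) w" using good_stage[OF assms] .
  have "jump_time n w < \<infinity>" using n(1) by (auto intro: le_less_trans)
  then obtain c where c: "jump_time n w = ereal c" "0 \<le> c" "real_of_ereal (jump_time n w) = c" using stage_interval by blast
  obtain b where b: "t < b" "ereal b \<le> jump_time (Suc n) w"
  proof (cases "jump_time (Suc n) w")
    case (real r) then show ?thesis using that[of r] n(2) by auto
  next
    case PInf then show ?thesis using that[of "t + 1"] by auto
  qed (use n in auto)
  have eq: "proc w s = pth (w (Suc n)) (s - c)" if "t \<le> s" "s < b" for s
    using proc_eq[of n w s] n(1) less_le_trans[of "ereal s" "ereal b" "jump_time (Suc n) w"] b(2) that c by simp
  have "filterlim (\<lambda>s. s - c) (at_right (t - c)) (at_right t)"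
    by (rule filterlim_at_withinI) (auto intro!: tendsto_intros simp: eventually_at_right_field intro: exI[of _ "t+1"])
  then have "((\<lambda>s. pth (w (Suc n)) (s - c)) \<longlongrightarrow> pth (w (Suc n)) (t - c)) (at_right t)"
    using n(1) c by (intro filterlim_compose[OF right_cont[OF goodD(3)[OF w]]]) auto
  moreover have "\<forall>\<^sub>F s in at_right t. pth (w (Suc n)) (s - c) = proc w s"
    using b(1) eq by (auto simp: eventually_at_right_field intro!: exI[of _ b])
  ultimately show ?thesis using eq[of t] b(1) by (auto intro: Lim_transform_eventually)
qed

lemma proc_left_limit:
  assumes w: "w \<in> good" and n: "jump_time n w < ereal t" "ereal t \<le> jump_time (Suc n) w"
    and l: "(pth (w (Suc n)) \<longlongrightarrow> l) (at_left (t - real_of_ereal (jump_time n w)))"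
  shows "(proc w \<longlongrightarrow> l) (at_left t)"
proof -
  have "jump_time n w < \<infinity>" using n(1) by (auto intro: less_trans)
  then obtain c where c: "jump_time n w = ereal c" "0 \<le> c" "real_of_ereal (jump_time n w) = c" using stage_interval by blast
  have eq: "proc w s = pth (w (Suc n)) (s - c)" if "c < s" "s < t" for s
    using proc_eq[of n w s] n less_le_trans[of "ereal s" "ereal t" "jump_time (Suc n) w"] that c by simp
  have "filterlim (\<lambda>s. s - c) (at_left (t - c)) (at_left t)"
    by (rule filterlim_at_withinI) (auto intro!: tendsto_intros simp: eventually_at_left_field intro: exI[of _ "t-1"])
  then have "((\<lambda>s. pth (w (Suc n)) (s - c)) \<longlongrightarrow> l) (at_left t)"
    using l c by (auto intro: filterlim_compose)
  moreover have "\<forall>\<^sub>F s in at_left t. pth (w (Suc n)) (s - c) = proc w s"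
    using n(1) c eq by (auto simp: eventually_at_left_field intro!: exI[of _ c])
  ultimately show ?thesis by (rule Lim_transform_eventually)
qed

lemma proc_cadlag:
  assumes w: "w \<in> good"
  shows "proc w \<in> cadlag_paths UNIV"
  unfolding cadlag_paths_def mem_Collect_eq
proof (intro conjI allI impI)
  show "proc w \<in> {0..} \<rightarrow>\<^sub>E UNIV" by (auto simp: proc_def)
  fix t :: real assume t: "0 \<le> t"
  show "(proc w \<longlongrightarrow> proc w t) (at_right t)" by (rule proc_right_cont[OF w t])
  assume "0 < t"
  then obtain n where n: "jump_time n w < ereal t" "ereal t \<le> jump_time (Suc n) w" using good_left_stage[OF w] by blast
  then have "0 < t - real_of_ereal (jump_time n w)" using jump_time_nonneg[of n w] by (cases "jump_time n w") auto
  then obtain l where "(pth (w (Suc n)) \<longlongrightarrow> l) (at_left (t - real_of_ereal (jump_time n w)))"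
    using cadlag_pathsD(3)[of "pth (w (Suc n))" UNIV] goodD(3)[OF w] \<Omega> by blast
  from proc_left_limit[OF w n this] show "\<exists>l\<in>UNIV. (proc w \<longlongrightarrow> l) (at_left t)" by blast
qed

text \<open>Split according to the running stage. Only the components 0 to n are assumed measurable,
  so the lemma serves for full samples and for finite histories.\<close>

lemma proc_before_sets:
  assumes f: "\<And>k. k \<le> n \<Longrightarrow> (\<lambda>x. f x k) \<in> M \<rightarrow>\<^sub>M St" and r: "0 \<le> r" and B[measurable]: "B \<in> sets borel"
  shows "{x \<in> space M. ereal r < jump_time n (f x) \<and> proc (f x) r \<in> B} \<in> sets M"
proof -
  have *: "{x \<in> space M. ereal r < jump_time n (f x) \<and> proc (f x) r \<in> B} =
    (\<Union>m\<in>{..<n}. {x \<in> space M. jump_time m (f x) \<le> ereal r \<and> ereal r < jump_time (Suc m) (f x) \<and>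
       ev (pth (f x (Suc m))) (r - real_of_ereal (jump_time m (f x))) \<in> B})" (is "?l = ?r")
  proof (intro equalityI subsetI)
    fix x assume "x \<in> ?l"
    then have x: "x \<in> space M" "ereal r < jump_time n (f x)" "proc (f x) r \<in> B" by auto
    obtain m where m: "m < n" "jump_time m (f x) \<le> ereal r" "ereal r < jump_time (Suc m) (f x)"
      using stage_exists_before[OF r x(2)] .
    have "0 \<le> r - real_of_ereal (jump_time m (f x))"
      using m(2) jump_time_nonneg[of m "f x"] by (cases "jump_time m (f x)") auto
    then have "ev (pth (f x (Suc m))) (r - real_of_ereal (jump_time m (f x))) = proc (f x) r"
      by (simp add: ev_nonneg proc_eq[OF m(2,3)])
    then show "x \<in> ?r" using x m by auto
  next
    fix x assume "x \<in> ?r"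
    then obtain m where m: "m < n" "jump_time m (f x) \<le> ereal r" "ereal r < jump_time (Suc m) (f x)" "x \<in> space M"
      "ev (pth (f x (Suc m))) (r - real_of_ereal (jump_time m (f x))) \<in> B" by auto
    have "0 \<le> r - real_of_ereal (jump_time m (f x))"
      using m(2) jump_time_nonneg[of m "f x"] by (cases "jump_time m (f x)") auto
    then have "ev (pth (f x (Suc m))) (r - real_of_ereal (jump_time m (f x))) = proc (f x) r"
      by (simp add: ev_nonneg proc_eq[OF m(2,3)])
    moreover have "ereal r < jump_time n (f x)" using m(1,3) jump_time_mono[of "Suc m" n "f x"] by (auto intro: less_le_trans)
    ultimately show "x \<in> ?l" using m by auto
  qed
  show ?thesis unfolding *
  proof (intro sets.finite_UN finite_lessThan)
    fix m assume m: "m \<in> {..<n}"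
    have [measurable]: "(\<lambda>x. jump_time m (f x)) \<in> borel_measurable M" "(\<lambda>x. jump_time (Suc m) (f x)) \<in> borel_measurable M"
      using m by (auto intro!: measurable_jump_time[where A=N and B=EM] f simp del: jump_time.simps)
    have [measurable]: "(\<lambda>x. pth (f x (Suc m))) \<in> M \<rightarrow>\<^sub>M N" using m by (intro measurable_compose[OF f measurable_fst]) auto
    show "{x \<in> space M. jump_time m (f x) \<le> ereal r \<and> ereal r < jump_time (Suc m) (f x) \<and>
       ev (pth (f x (Suc m))) (r - real_of_ereal (jump_time m (f x))) \<in> B} \<in> sets M" by measurable
  qed
qed

lemma measurable_proc:
  assumes r: "0 \<le> r"
  shows "(\<lambda>w. proc w r) \<in> restrict_space Full good \<rightarrow>\<^sub>M borel"
proof (rule measurableI)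
  fix B :: "'a set" assume B: "B \<in> sets borel"
  have "(\<lambda>w. proc w r) -` B \<inter> space (restrict_space Full good) =
    good \<inter> (\<Union>n. {w \<in> space Full. ereal r < jump_time n w \<and> proc w r \<in> B})"
    using goodD(1) goodD(5)[of _ r] by (auto simp: space_restrict_space)
  also have "\<dots> \<in> sets (restrict_space Full good)"
    using proc_before_sets[of _ "\<lambda>w. w" Full r B] r B
    by (subst sets_restrict_space_iff) auto
  finally show "(\<lambda>w. proc w r) -` B \<inter> space (restrict_space Full good) \<in> sets (restrict_space Full good)" .
qed simp

text \<open>
  Before the \<open>(n+1)\<close>-st jump, an event of the marked history up to time \<open>s\<close> is determined by the
  first \<open>n\<close> stages and the path of the running stage, stopped at the elapsed time.
\<close>

definition elapsed :: "real \<Rightarrow> nat \<Rightarrow> ('a, 'e) sample \<Rightarrow> real" where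
  "elapsed s n h = max 0 (s - real_of_ereal (jump_time n h))"

abbreviation view where
  "view s n w \<equiv> (restrict w {0..<Suc n}, stop_path (elapsed s n w) (pth (w (Suc n))))"

definition determined :: "real \<Rightarrow> ('a, 'e) sample set \<Rightarrow> bool" where
  "determined s A \<longleftrightarrow> A \<subseteq> good \<and> (\<forall>n. \<exists>A'\<in>sets (Hist (Suc n) \<Otimes>\<^sub>M N). \<forall>w\<in>good. ereal s < jump_time (Suc n) w \<longrightarrow>
     (w \<in> A \<longleftrightarrow> view s n w \<in> A'))"

lemma elapsed_nonneg: "0 \<le> elapsed s n h" by (simp add: elapsed_def)

lemma elapsed_restrict: "elapsed s n (restrict w {0..<Suc n}) = elapsed s n w"
  unfolding elapsed_def by (simp only: jump_time_restrict)

lemma good_pair_space: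
  assumes w: "w \<in> good"
  shows "view s n w \<in> space (Hist (Suc n) \<Otimes>\<^sub>M N)"
  using goodD(3,4)[OF w] elapsed_nonneg by (auto simp: space_pair_measure space_PiM intro!: \<Omega>_stop)

lemma measurable_stopped_stage:
  assumes u[measurable]: "u \<in> borel_measurable M" "\<And>x. x \<in> space M \<Longrightarrow> 0 \<le> u x" and f[measurable]: "f \<in> M \<rightarrow>\<^sub>M N"
  shows "(\<lambda>x. stop_path (u x) (f x)) \<in> M \<rightarrow>\<^sub>M N"
proof (rule measurable_into_path_algebra[OF \<Omega>_PiE])
  show "stop_path (u x) (f x) \<in> \<Omega>" if "x \<in> space M" for x
    using measurable_space[OF f that] u(2)[OF that] by (intro \<Omega>_stop) auto
  fix r :: real assume r: "0 \<le> r"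
  have "(\<lambda>x. ev (f x) (min r (u x))) \<in> M \<rightarrow>\<^sub>M borel" by measurable
  then show "(\<lambda>x. stop_path (u x) (f x) r) \<in> M \<rightarrow>\<^sub>M borel"
    by (rule measurable_cong[THEN iffD1, rotated]) (use r u(2) in \<open>simp add: stop_path_def ev_nonneg\<close>)
qed

text \<open>On \<open>good\<close> some jump comes after s, so the countably many local descriptions
  assemble to a measurable set.\<close>

lemma determined_sets:
  assumes A: "determined s A" and s: "0 \<le> s"
  shows "A \<in> sets Full"
proof -
  have "\<exists>A'\<in>sets (Hist (Suc n) \<Otimes>\<^sub>M N). \<forall>w\<in>good. ereal s < jump_time (Suc n) w \<longrightarrow>
     (w \<in> A \<longleftrightarrow> view s n w \<in> A')" for n
    using A by (simp add: determined_def)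
  then obtain A' where A'[measurable]: "\<And>n. A' n \<in> sets (Hist (Suc n) \<Otimes>\<^sub>M N)"
    and A'_iff: "\<And>n w. w \<in> good \<Longrightarrow> ereal s < jump_time (Suc n) w \<Longrightarrow>
     (w \<in> A \<longleftrightarrow> view s n w \<in> A' n)"
    by metis
  have Ag: "A \<subseteq> good" using A by (simp add: determined_def)
  have "A = good \<inter> (\<Union>n. {w \<in> space Full. ereal s < jump_time (Suc n) w \<and>
      view s n w \<in> A' n})" (is "A = ?r")
  proof (intro equalityI subsetI)
    fix w assume w: "w \<in> A"
    then have g: "w \<in> good" using Ag by auto
    obtain n where "ereal s < jump_time (Suc n) w" using good_stage[OF g s] by blast
    then show "w \<in> ?r" using A'_iff[OF g] w g goodD(1)[OF g] by auto
  next
    fix w assume "w \<in> ?r"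
    then show "w \<in> A" using A'_iff by auto
  qed
  also have "\<dots> \<in> sets Full"
  proof (intro sets.Int good_sets sets.countable_UN image_subsetI)
    fix n
    have [measurable]: "(\<lambda>w. stop_path (elapsed s n w) (pth (w (Suc n)))) \<in> Full \<rightarrow>\<^sub>M N"
      by (rule measurable_stopped_stage) (auto simp: elapsed_def[abs_def])
    have [measurable]: "(\<lambda>w. restrict w {0..<Suc n}) \<in> Full \<rightarrow>\<^sub>M Hist (Suc n)" by (rule measurable_restrict_Full)
    show "{w \<in> space Full. ereal s < jump_time (Suc n) w \<and>
      view s n w \<in> A' n} \<in> sets Full" by measurable
  qed
  finally show ?thesis .
qed

text \<open>For each n, complements and countable unions are taken on the representing sets A', so
  that only the generators of a filtration need checking.\<close>

lemma sigma_algebra_determined: "sigma_algebra good {A. determined s A}"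
  unfolding sigma_algebra_iff2 mem_Collect_eq
proof (intro conjI allI impI ballI)
  show "{A. determined s A} \<subseteq> Pow good" by (auto simp: determined_def)
  show "determined s {}" by (auto simp: determined_def intro!: bexI[of _ "{}"])
  fix A assume A: "A \<in> {A. determined s A}"
  show "determined s (good - A)"
    unfolding determined_def
  proof (intro conjI allI)
    fix n
    obtain A' where A': "A' \<in> sets (Hist (Suc n) \<Otimes>\<^sub>M N)" "\<And>w. w \<in> good \<Longrightarrow> ereal s < jump_time (Suc n) w \<Longrightarrow>
      (w \<in> A \<longleftrightarrow> view s n w \<in> A')"
      using A unfolding determined_def by blast
    show "\<exists>A'\<in>sets (Hist (Suc n) \<Otimes>\<^sub>M N). \<forall>w\<in>good. ereal s < jump_time (Suc n) w \<longrightarrow>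
     (w \<in> good - A \<longleftrightarrow> view s n w \<in> A')"
      using A' good_pair_space by (intro bexI[of _ "space (Hist (Suc n) \<Otimes>\<^sub>M N) - A'"]) auto
  qed auto
next
  fix A :: "nat \<Rightarrow> _" assume "range A \<subseteq> {A. determined s A}"
  then have A: "determined s (A i)" for i by auto
  show "determined s (\<Union>i. A i)"
    unfolding determined_def
  proof (intro conjI allI)
    show "(\<Union>i. A i) \<subseteq> good" using A by (auto simp: determined_def)
    fix n
    have "\<exists>A'\<in>sets (Hist (Suc n) \<Otimes>\<^sub>M N). \<forall>w\<in>good. ereal s < jump_time (Suc n) w \<longrightarrow>
     (w \<in> A i \<longleftrightarrow> view s n w \<in> A')" for i
      using A[of i] by (simp add: determined_def)
    then obtain A' where "\<And>i. A' i \<in> sets (Hist (Suc n) \<Otimes>\<^sub>M N)" "\<And>i. \<forall>w\<in>good. ereal s < jump_time (Suc n) w \<longrightarrow>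
     (w \<in> A i \<longleftrightarrow> view s n w \<in> A' i)" by metis
    then show "\<exists>A'\<in>sets (Hist (Suc n) \<Otimes>\<^sub>M N). \<forall>w\<in>good. ereal s < jump_time (Suc n) w \<longrightarrow>
     (w \<in> (\<Union>i. A i) \<longleftrightarrow> view s n w \<in> A')"
      by (intro bexI[of _ "\<Union>i. A' i"]) auto
  qed
qed

lemma determined_proc:
  assumes r: "0 \<le> r" "r \<le> s" and B[measurable]: "B \<in> sets borel"
  shows "determined s {w \<in> good. proc w r \<in> B}"
  unfolding determined_def
proof (intro conjI allI)
  fix n
  have [measurable]: "jump_time n \<in> borel_measurable (Hist (Suc n))" by (rule measurable_jump_time_Hist) simp
  \<comment> \<open>Either r precedes the n-th jump and the history gives the value, or r falls into
    the running stage, where stopping at the elapsed time of s \<ge> r leaves the value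
    intact.\<close>
  let ?A = "{p \<in> space (Hist (Suc n) \<Otimes>\<^sub>M N). ereal r < jump_time n (fst p) \<and> proc (fst p) r \<in> B} \<union>
    {p \<in> space (Hist (Suc n) \<Otimes>\<^sub>M N). jump_time n (fst p) \<le> ereal r \<and> ev (snd p) (r - real_of_ereal (jump_time n (fst p))) \<in> B}"
  show "\<exists>A'\<in>sets (Hist (Suc n) \<Otimes>\<^sub>M N). \<forall>w\<in>good. ereal s < jump_time (Suc n) w \<longrightarrow>
     (w \<in> {w \<in> good. proc w r \<in> B} \<longleftrightarrow> view s n w \<in> A')"
  proof (intro bexI[of _ ?A] ballI impI)
    show "?A \<in> sets (Hist (Suc n) \<Otimes>\<^sub>M N)"
    proof (rule sets.Un)
      show "{p \<in> space (Hist (Suc n) \<Otimes>\<^sub>M N). ereal r < jump_time n (fst p) \<and> proc (fst p) r \<in> B} \<in> sets (Hist (Suc n) \<Otimes>\<^sub>M N)"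
        by (rule proc_before_sets[OF _ r(1) B]) measurable
    qed measurable
    fix w assume w: "w \<in> good" and s: "ereal s < jump_time (Suc n) w"
    show "w \<in> {w \<in> good. proc w r \<in> B} \<longleftrightarrow> view s n w \<in> ?A"
    proof (cases "ereal r < jump_time n w")
      case True
      have "proc (restrict w {0..<Suc n}) r = proc w r"
        by (rule proc_cong[symmetric, OF _ r(1) True]) auto
      then show ?thesis using True w good_pair_space[OF w, of n s] by auto
    next
      case False
      then have le: "jump_time n w \<le> ereal r" by simp
      then have "jump_time n w < \<infinity>" by (auto intro: le_less_trans)
      then obtain c where c: "jump_time n w = ereal c" "0 \<le> c" "real_of_ereal (jump_time n w) = c" using stage_interval by blast
      have "proc w r = pth (w (Suc n)) (r - c)"
        using proc_eq[OF le] le_less_trans[of "ereal r" "ereal s" "jump_time (Suc n) w"] s r(2) c by simp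
      moreover have "ev (stop_path (elapsed s n w) (pth (w (Suc n)))) (r - c) = pth (w (Suc n)) (r - c)"
        using le c r by (simp add: ev_nonneg stop_path_def elapsed_def)
      ultimately show ?thesis using False w good_pair_space[OF w, of n s] c by auto
    qed
  qed
qed auto

lemma jump_count_eq:
  assumes w: "w \<in> good" and s: "ereal s < jump_time (Suc n) w" and r: "r \<le> s"
  shows "jump_count proc jump_time ety e B r w
     = (\<Sum>k\<in>{1..n}. of_bool (jump_time k w \<le> ereal r \<and> fst (mrk (w k)) = e \<and> pos (w k) \<in> B))"
proof -
  have "{k. 1 \<le> k \<and> jump_time k w \<le> ereal r \<and> fst (mrk (w k)) = e \<and> proc w (real_of_ereal (jump_time k w)) \<in> B} =
    {k\<in>{1..n}. jump_time k w \<le> ereal r \<and> fst (mrk (w k)) = e \<and> pos (w k) \<in> B}"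
  proof -
    have "k \<le> n" if "jump_time k w \<le> ereal r" for k
    proof (rule ccontr)
      assume "\<not> k \<le> n"
      then have "jump_time (Suc n) w \<le> jump_time k w" by (intro jump_time_mono) auto
      then have "ereal s < ereal r" using s that by (meson less_le_trans)
      then show False using r by simp
    qed
    moreover have "proc w (real_of_ereal (jump_time k w)) = pos (w k)" if "jump_time k w \<le> ereal r" for k
      using proc_jump[OF w le_less_trans[OF that]] by simp
    ultimately show ?thesis by auto
  qed
  then show ?thesis by (simp add: jump_count_def sum.If_cases of_bool_def Int_def conj_commute)
qed

lemma determined_jump_count:
  assumes r: "r \<le> s" and B[measurable]: "B \<in> sets borel" and D[measurable]: "D \<in> sets borel"
  shows "determined s {w \<in> good. jump_count proc jump_time ety e B r w \<in> D}"
  unfolding determined_def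
proof (intro conjI allI)
  fix n
  define g :: "('a, 'e) sample \<Rightarrow> real" where
    "g h = (\<Sum>k\<in>{1..n}. of_bool (jump_time k h \<le> ereal r \<and> fst (mrk (h k)) = e \<and> pos (h k) \<in> B))" for h
  have [measurable]: "g \<in> borel_measurable (Hist (Suc n))"
    unfolding g_def[abs_def]
  proof (rule borel_measurable_sum)
    fix k assume k: "k \<in> {1..n}"
    have [measurable]: "jump_time k \<in> borel_measurable (Hist (Suc n))" using k by (intro measurable_jump_time_Hist) auto
    have [measurable]: "(\<lambda>h. h k) \<in> Hist (Suc n) \<rightarrow>\<^sub>M St" using k by (intro measurable_component_singleton) auto
    have "Measurable.pred (count_space E) (\<lambda>e'. e' = e)" by simp
    then have [measurable]: "Measurable.pred (Hist (Suc n)) (\<lambda>h. fst (mrk (h k)) = e)"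
      by (rule measurable_compose[rotated]) measurable
    show "(\<lambda>h. of_bool (jump_time k h \<le> ereal r \<and> fst (mrk (h k)) = e \<and> pos (h k) \<in> B)) \<in> borel_measurable (Hist (Suc n))"
      by measurable
  qed
  let ?A = "{p \<in> space (Hist (Suc n) \<Otimes>\<^sub>M N). g (fst p) \<in> D}"
  show "\<exists>A'\<in>sets (Hist (Suc n) \<Otimes>\<^sub>M N). \<forall>w\<in>good. ereal s < jump_time (Suc n) w \<longrightarrow>
     (w \<in> {w \<in> good. jump_count proc jump_time ety e B r w \<in> D}
      \<longleftrightarrow> view s n w \<in> A')"
  proof (intro bexI[of _ ?A] ballI impI)
    show "?A \<in> sets (Hist (Suc n) \<Otimes>\<^sub>M N)" by measurable
    fix w assume w: "w \<in> good" and s: "ereal s < jump_time (Suc n) w"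
    have "g (restrict w {0..<Suc n}) = g w"
      unfolding g_def
    proof (rule sum.cong[OF refl])
      fix k assume k: "k \<in> {1..n}"
      have "jump_time k (restrict w {0..<Suc n}) = jump_time k w" using k by (intro jump_time_cong) auto
      then show "of_bool (jump_time k (restrict w {0..<Suc n}) \<le> ereal r \<and> fst (mrk (restrict w {0..<Suc n} k)) = e \<and> pos (restrict w {0..<Suc n} k) \<in> B)
        = (of_bool (jump_time k w \<le> ereal r \<and> fst (mrk (w k)) = e \<and> pos (w k) \<in> B) :: real)" using k by simp
    qed
    then show "w \<in> {w \<in> good. jump_count proc jump_time ety e B r w \<in> D}
      \<longleftrightarrow> view s n w \<in> ?A"
      using jump_count_eq[OF w s r, of e B, folded g_def] w good_pair_space[OF w, of n s] by simp
  qed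
qed auto

text \<open>Reduces the martingale property for the marked filtration to events in the form that the
  one-stage argument can use.\<close>

lemma determined_marked:
  assumes M: "space M = good" and A: "A \<in> sets (marked_filtration M proc Edges jump_time ety s)"
  shows "determined s A"
proof -
  interpret D: sigma_algebra good "{A. determined s A}" by (rule sigma_algebra_determined)
  have nat: "sets (natural_filtration good proc s) \<subseteq> {A. determined s A}"
  proof -
    have "sets (natural_filtration good proc s) = sigma_sets good {(\<lambda>w. proc w r) -` B \<inter> good | r B. r \<in> {0..s} \<and> B \<in> sets borel}"
      unfolding natural_filtration_def by (rule sets_measure_of) auto
    also have "\<dots> \<subseteq> {A. determined s A}"
    proof (rule D.sigma_sets_subset, clarify)
      fix r and B :: "'a set" assume "r \<in> {0..s}" "B \<in> sets borel"
      then have "determined s {w \<in> good. proc w r \<in> B}" by (intro determined_proc) auto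
      then show "determined s ((\<lambda>w. proc w r) -` B \<inter> good)" by (simp add: vimage_def Int_def conj_commute)
    qed
    finally show ?thesis .
  qed
  let ?G = "sets (natural_filtration good proc s) \<union> {jump_count proc jump_time ety e B r -` D \<inter> good | e B r D.
         e \<in> Edges \<and> B \<in> sets borel \<and> r \<in> {0..s} \<and> D \<in> sets borel}"
  have "A \<in> sigma_sets good ?G"
    using A sets.space_closed[of "natural_filtration good proc s"] unfolding marked_filtration_def M
    by (subst (asm) sets_measure_of) auto
  moreover have "sigma_sets good ?G \<subseteq> {A. determined s A}"
  proof (rule D.sigma_sets_subset, rule Un_least[OF nat], clarify)
    fix e r and B :: "'a set" and D :: "real set" assume "B \<in> sets borel" "r \<in> {0..s}" "D \<in> sets borel"
    then have "determined s {w \<in> good. jump_count proc jump_time ety e B r w \<in> D}"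
      by (intro determined_jump_count) auto
    then show "determined s (jump_count proc jump_time ety e B r -` D \<inter> good)"
      by (simp add: vimage_def Int_def conj_commute)
  qed
  ultimately show ?thesis by auto
qed

end

section \<open>The global martingale\<close>

context jump_martingale
begin

text \<open>The share of the stage that starts at the n-th jump time; this stage is component n + 1.
  On \<open>good\<close> only finitely many shares are nonzero at a given time.\<close>

definition J :: "nat \<Rightarrow> real \<Rightarrow> ('a, 'e) sample \<Rightarrow> real" where
  "J n t w = (if jump_time n w \<le> ereal t then stage_incr 0 (t - real_of_ereal (jump_time n w)) (w (Suc n)) else 0)"

definition Z :: "real \<Rightarrow> ('a, 'e) sample \<Rightarrow> real" where
  "Z t w = (\<Sum>n. J n t w)"

lemma J_measurable[measurable]: "J n t \<in> borel_measurable Full"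
  unfolding J_def[abs_def] by measurable

lemma Z_measurable[measurable]: "Z t \<in> borel_measurable Full"
  unfolding Z_def[abs_def] by measurable

lemma J_bound:
  assumes "w \<in> space Full" "0 \<le> t"
  shows "\<bar>J n t w\<bar> \<le> (3 * C + Cc * t) * of_bool (jump_time n w \<le> ereal t)"
proof (cases "jump_time n w \<le> ereal t")
  case True
  then have le: "0 \<le> t - real_of_ereal (jump_time n w)"
    using jump_time_nonneg[of n w] by (cases "jump_time n w") auto
  have "w (Suc n) \<in> space St" using assms(1) by (auto simp: space_PiM)
  then have "pth (w (Suc n)) \<in> \<Omega>" by (auto simp: space_pair_measure)
  from stage_incr_bound[OF this le]
  have "\<bar>J n t w\<bar> \<le> 3 * C + Cc * (t - real_of_ereal (jump_time n w))" using True by (simp add: J_def)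
  also have "\<dots> \<le> 3 * C + Cc * t" using Cc_nonneg real_jump_time_nonneg[of n w] by (simp add: mult_left_mono)
  finally show ?thesis using True by simp
qed (simp add: J_def)

lemma stage_incr_diff:
  assumes "pth z \<in> \<Omega>" and u: "0 \<le> u" "u \<le> v"
  shows "stage_incr 0 v z - stage_incr 0 u z = stage_incr u v z"
proof -
  let ?r = "clk z" and ?\<eta> = "pth z"
  let ?f = "\<lambda>q. of_bool (alive q ?r) * cc (ev ?\<eta> q)"
  have int: "set_integrable lborel {a..b} ?f" for a b
    by (rule set_integrable_bounded_Icc[OF measurable_alive_cc[OF assms(1)] alive_cc_bound])
  have split: "(LINT q:{0..v}|lborel. ?f q) = (LINT q:{0..u}|lborel. ?f q) + (LINT q:{u..v}|lborel. ?f q)"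
    by (rule set_integral_Icc_split[OF int u])
  have a0: "alive 0 ?r" by (simp add: alive_def)
  show ?thesis
  proof (cases "alive u ?r")
    case True
    then show ?thesis using a0 split by (simp add: stage_incr_def Let_def)
  next
    case False
    then have "\<not> alive v ?r" using alive_antimono[OF u(2)] by blast
    moreover have "(LINT q:{u..v}|lborel. ?f q) = 0"
      unfolding set_lebesgue_integral_def
      by (intro integral_eq_zero_AE AE_I2) (use False alive_antimono in \<open>auto split: split_indicator\<close>)
    ultimately show ?thesis using False a0 split by (simp add: stage_incr_def Let_def)
  qed
qed

text \<open>\<open>elapsed\<close> is cut off at 0, which also covers a stage that starts between s
  and t.\<close>

lemma J_diff:
  assumes "w \<in> good" "0 \<le> s" "s \<le> t"
  shows "J n t w - J n s w = (if jump_time n w \<le> ereal t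
     then stage_incr (elapsed s n w) (t - real_of_ereal (jump_time n w)) (w (Suc n)) else 0)"
proof (cases "jump_time n w \<le> ereal t")
  case True
  then have "jump_time n w < \<infinity>" by (auto intro: le_less_trans)
  then obtain c where c: "jump_time n w = ereal c" "0 \<le> c" "real_of_ereal (jump_time n w) = c" using stage_interval by blast
  show ?thesis
  proof (cases "c \<le> s")
    case T: True
    then show ?thesis using True c assms stage_incr_diff[OF goodD(3)[OF assms(1)], of "s - c" "t - c" "Suc n"]
      by (simp add: J_def elapsed_def)
  next
    case False
    then show ?thesis using True c by (simp add: J_def elapsed_def)
  qed
next
  case False
  then have "\<not> jump_time n w \<le> ereal s" using assms(3) by (meson ereal_less_eq(3) order_trans)
  then show ?thesis using False by (simp add: J_def)
qed

text \<open>If the running clock is alive at the elapsed time, then s lies before the next jump and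
  A is a condition on the history and the stopped path; otherwise the increment vanishes. Given the
  history, that condition is an event of the path up to the elapsed time, and
  \<open>stage_martingale\<close> applies.\<close>

lemma determined_increment_eq_0:
  assumes A: "determined s A" and st: "0 \<le> s" "s \<le> t"
  shows "(\<integral>w. indicator A w * (J n t w - J n s w) \<partial>law x) = 0"
proof -
  obtain A' where A'[measurable]: "A' \<in> sets (Hist (Suc n) \<Otimes>\<^sub>M N)" and A'_iff: "\<And>w. w \<in> good \<Longrightarrow> ereal s < jump_time (Suc n) w \<Longrightarrow>
      (w \<in> A \<longleftrightarrow> view s n w \<in> A')"
    using A unfolding determined_def by blast
  have Ag: "A \<subseteq> good" using A by (simp add: determined_def)
  define K where "K = 3 * C + Cc * t"
  have K0: "0 \<le> K" using C_nonneg Cc_nonneg st by (simp add: K_def)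
  \<comment> \<open>The integrand as a function of history and next stage, with A replaced by A' and
    the increment clipped so as to be bounded everywhere.\<close>
  define F where "F = (\<lambda>(h, z). of_bool (jump_time n h \<le> ereal t) * (indicator A' (h, stop_path (elapsed s n h) (pth z)) *
     max (- K) (min K (stage_incr (elapsed s n h) (t - real_of_ereal (jump_time n h)) z))))"
  have clip: "max (- K) (min K x) = x" if "\<bar>x\<bar> \<le> K" for x
  proof -
    have "x \<le> K" "- K \<le> x" using that by linarith+
    then show ?thesis by (simp add: min.absorb2 max.absorb2)
  qed
  have [measurable]: "jump_time n \<in> borel_measurable (Hist (Suc n))" by (rule measurable_jump_time_Hist) simp
  have [measurable]: "elapsed s n \<in> borel_measurable (Hist (Suc n))" unfolding elapsed_def[abs_def] by measurable
  have sp[measurable]: "(\<lambda>p. stop_path (elapsed s n (fst p)) (pth (snd p))) \<in> Hist (Suc n) \<Otimes>\<^sub>M St \<rightarrow>\<^sub>M N"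
    by (rule measurable_stopped_stage) (auto simp: elapsed_nonneg)
  have ub: "elapsed s n h \<le> t - real_of_ereal (jump_time n h)" if h: "jump_time n h \<le> ereal t" for h
  proof -
    obtain c where c: "jump_time n h = ereal c" "0 \<le> c" "real_of_ereal (jump_time n h) = c"
      using stage_interval[OF le_less_trans[OF h]] by auto
    then show ?thesis using h st by (auto simp: elapsed_def)
  qed
  have bnd: "\<bar>stage_incr (elapsed s n h) (t - real_of_ereal (jump_time n h)) z\<bar> \<le> K"
    if z: "pth z \<in> \<Omega>" and h: "jump_time n h \<le> ereal t" for h z
  proof -
    have "Cc * (t - real_of_ereal (jump_time n h) - elapsed s n h) \<le> Cc * t"
      using real_jump_time_nonneg[of n h] elapsed_nonneg[of s n h] Cc_nonneg by (intro mult_left_mono) auto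
    then show ?thesis using stage_incr_bound[OF z ub[OF h]] by (simp add: K_def)
  qed
  have Fm[measurable]: "F \<in> borel_measurable (Hist (Suc n) \<Otimes>\<^sub>M St)"
    unfolding F_def split_beta' by measurable
  have "(\<integral>w. indicator A w * (J n t w - J n s w) \<partial>law x) = (\<integral>w. F (restrict w {0..<Suc n}, w (Suc n)) \<partial>law x)"
  proof (rule integral_cong_AE)
    show eq: "AE w in law x. indicator A w * (J n t w - J n s w) = F (restrict w {0..<Suc n}, w (Suc n))"
      using AE_good[of x]
    proof eventually_elim
      fix w assume w: "w \<in> good"
      show "indicator A w * (J n t w - J n s w) = F (restrict w {0..<Suc n}, w (Suc n))"
      \<comment> \<open>A' describes A only before the next jump; in the complementary case both
        sides are 0, whatever A' says.\<close>
      proof (cases "jump_time n w \<le> ereal t \<and> alive (elapsed s n w) (clk (w (Suc n)))")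
        case True
        then have "jump_time n w < \<infinity>" by (auto intro: le_less_trans)
        then obtain c where c: "jump_time n w = ereal c" "0 \<le> c" "real_of_ereal (jump_time n w) = c" using stage_interval by blast
        have "ereal s < jump_time (Suc n) w" using True c by (auto simp: jump_time.simps(2) alive_def elapsed_def max_def split: if_splits)
        then have "w \<in> A \<longleftrightarrow> view s n w \<in> A'" by (rule A'_iff[OF w])
        then show ?thesis
          using True bnd[OF goodD(3)[OF w], of w "Suc n"] unfolding J_diff[OF w st] F_def split elapsed_restrict jump_time_restrict
          by (simp add: clip del: jump_time.simps split: split_indicator)
      next
        case False
        then show ?thesis
          unfolding J_diff[OF w st] F_def split elapsed_restrict jump_time_restrict using K0
          by (auto simp: stage_incr_def Let_def)
      qed
    qed
    show Fm': "(\<lambda>w. F (restrict w {0..<Suc n}, w (Suc n))) \<in> borel_measurable (law x)"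
      using measurable_compose[OF measurable_hist_pair Fm] by (simp add: measurable_cong_sets[OF sets_law refl])
    have [measurable]: "A \<in> sets Full" by (rule determined_sets[OF A st(1)])
    show "(\<lambda>w. indicator A w * (J n t w - J n s w)) \<in> borel_measurable (law x)" by measurable
  qed
  also have "\<dots> = (\<integral>w. \<integral>z. F (restrict w {0..<Suc n}, z) \<partial>stage (pos (w n)) \<partial>law x)"
    by (rule integral_law_stage[OF Fm, where B=K]) (use K0 in \<open>auto simp: F_def split: split_indicator\<close>)
  also have "\<dots> = (\<integral>w. 0 \<partial>law x)"
  proof (intro Bochner_Integration.integral_cong refl)
    fix w assume "w \<in> space (law x)"
    let ?h = "restrict w {0..<Suc n}"
    have h: "?h \<in> space (Hist (Suc n))" using \<open>w \<in> space (law x)\<close> measurable_space[OF measurable_restrict_Full] by auto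
    show "(\<integral>z. F (?h, z) \<partial>stage (pos (w n))) = 0"
    proof (cases "jump_time n ?h \<le> ereal t")
      case True
      let ?u = "elapsed s n ?h" and ?v = "t - real_of_ereal (jump_time n ?h)"
      \<comment> \<open>An event of the path up to \<open>?u\<close>, because stopping at
        \<open>?u\<close> reads only coordinates up to \<open>?u\<close>.\<close>
      define B where "B = {\<eta> \<in> \<Omega>. (?h, stop_path ?u \<eta>) \<in> A'}"
      have "stop_path ?u \<in> Fil ?u \<rightarrow>\<^sub>M N"
      proof (rule measurable_into_path_algebra[OF \<Omega>_PiE])
        show "stop_path ?u \<eta> \<in> \<Omega>" if "\<eta> \<in> space (Fil ?u)" for \<eta> using that by (auto intro: \<Omega>_stop elapsed_nonneg)
        fix r :: real assume "0 \<le> r"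
        then show "(\<lambda>\<eta>. stop_path ?u \<eta> r) \<in> Fil ?u \<rightarrow>\<^sub>M borel"
          using measurable_natural_filtration_at[of "min r ?u" ?u "\<lambda>\<eta>. \<eta>" \<Omega>] elapsed_nonneg[of s n ?h] by (simp add: stop_path_def)
      qed
      then have "(\<lambda>\<eta>. (?h, stop_path ?u \<eta>)) \<in> Fil ?u \<rightarrow>\<^sub>M Hist (Suc n) \<Otimes>\<^sub>M N" using h by measurable
      from measurable_sets[OF this A'] have B: "B \<in> sets (Fil ?u)"
        by (simp add: B_def vimage_def Int_def conj_commute)
      have "(\<integral>z. F (?h, z) \<partial>stage (pos (w n))) = (\<integral>z. indicator B (pth z) * stage_incr ?u ?v z \<partial>stage (pos (w n)))"
      proof (intro Bochner_Integration.integral_cong refl)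
        fix z assume "z \<in> space (stage (pos (w n)))"
        then have z: "pth z \<in> \<Omega>" using sets_eq_imp_space_eq[OF sets_stage, of "pos (w n)"] by (auto simp: space_pair_measure)
        show "F (?h, z) = indicator B (pth z) * stage_incr ?u ?v z"
          using True clip[OF bnd[OF z True]] z by (auto simp: F_def B_def split: split_indicator)
      qed
      also have "\<dots> = 0" by (rule stage_martingale[OF elapsed_nonneg ub[OF True] B])
      finally show ?thesis .
    qed (simp add: F_def)
  qed
  finally show ?thesis by simp
qed

lemma LINT_alive:
  assumes \<eta>: "\<eta> \<in> \<Omega>" and r: "0 < r" "r \<le> v"
  shows "(LINT q:{0..v}|lborel. of_bool (alive q r) * cc (ev \<eta> q)) = (LINT q:{0..r}|lborel. cc (ev \<eta> q))"
  unfolding set_lebesgue_integral_def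
proof (rule integral_cong_AE)
  have m: "(\<lambda>q. cc (ev \<eta> q)) \<in> borel_measurable borel"
    by (rule measurable_compose[OF measurable_ev_path[OF \<eta>] cc_measurable])
  show "AE q in lborel. indicator {0..v} q *\<^sub>R (of_bool (alive q r) * cc (ev \<eta> q)) = indicator {0..r} q *\<^sub>R cc (ev \<eta> q)"
    using AE_lborel_singleton[of r] by eventually_elim (use r in \<open>auto simp: alive_def split: split_indicator\<close>)
  show "(\<lambda>q. indicator {0..v} q *\<^sub>R (of_bool (alive q r) * cc (ev \<eta> q))) \<in> borel_measurable lborel"
    using measurable_alive_cc[OF \<eta>, of r] by simp
  show "(\<lambda>q. indicator {0..r} q *\<^sub>R cc (ev \<eta> q)) \<in> borel_measurable lborel"
    using m by simp
qed

lemma proc_path_measurable: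
  assumes w: "w \<in> good"
  shows "(\<lambda>s. cc (proc w (max 0 s))) \<in> borel_measurable borel"
proof -
  have "(\<lambda>(p, t). proc w (max 0 t)) \<in> (borel :: real measure) \<Otimes>\<^sub>M borel \<rightarrow>\<^sub>M borel"
    by (rule measurable_right_continuous_process[where X="\<lambda>_. proc w"]) (auto intro: proc_right_cont[OF w])
  from measurable_compose[OF measurable_Pair1'[of 0] this]
  have "(\<lambda>t. proc w (max 0 t)) \<in> borel \<rightarrow>\<^sub>M borel" by simp
  from measurable_compose[OF this cc_measurable] show ?thesis .
qed

lemma proc_set_integrable:
  assumes w: "w \<in> good" and "0 \<le> u"
  shows "set_integrable lborel {u..v} (\<lambda>s. cc (proc w s))"
proof -
  have "set_integrable lborel {u..v} (\<lambda>s. cc (proc w (max 0 s)))"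
    by (rule set_integrable_bounded_Icc[OF proc_path_measurable[OF w] cc_bound])
  also have "set_integrable lborel {u..v} (\<lambda>s. cc (proc w (max 0 s))) = set_integrable lborel {u..v} (\<lambda>s. cc (proc w s))"
    using assms(2) by (intro set_integrable_cong) auto
  finally show ?thesis .
qed

lemma LINT_proc_stage:
  assumes w: "w \<in> good" and c: "jump_time n w = ereal c" and L: "0 \<le> L" "ereal (c + L) \<le> jump_time (Suc n) w"
  shows "(LINT s:{c..c+L}|lborel. cc (proc w s)) = (LINT q:{0..L}|lborel. cc (ev (pth (w (Suc n))) q))"
proof -
  have c0: "0 \<le> c" using jump_time_nonneg[of n w] c by simp
  have "(LINT s:{c..c+L}|lborel. cc (proc w s)) = (LINT s:{c..c+L}|lborel. cc (proc w (max 0 s)))"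
    using c0 by (intro set_lebesgue_integral_cong) auto
  also have "\<dots> = (LINT q:{0..L}|lborel. cc (proc w (max 0 (c + q))))"
    using LINT_shift[of c 0 L] by simp
  also have "\<dots> = (LINT q:{0..L}|lborel. cc (ev (pth (w (Suc n))) q))"
  proof (rule LINT_cong_but_end)
    show "(\<lambda>q. cc (ev (pth (w (Suc n))) q)) \<in> borel_measurable borel"
      by (rule measurable_compose[OF measurable_ev_path[OF goodD(3)[OF w]] cc_measurable])
    show "(\<lambda>s. cc (proc w (max 0 (c + s)))) \<in> borel_measurable borel"
      using measurable_compose[OF _ proc_path_measurable[OF w], of "\<lambda>s. c + s" borel] by simp
    fix q assume q: "0 \<le> q" "q < L"
    have "ereal (c + q) < jump_time (Suc n) w" using less_le_trans[of "ereal (c + q)" "ereal (c + L)"] q L by simp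
    then show "cc (proc w (max 0 (c + q))) = cc (ev (pth (w (Suc n))) q)"
      using proc_eq[of n w "c + q"] c c0 q by (simp add: ev_nonneg)
  qed
  finally show ?thesis .
qed

lemma J_eq_0: "\<lbrakk>ereal t < jump_time (Suc m) w; m < n\<rbrakk> \<Longrightarrow> J n t w = 0"
  using jump_time_mono[of "Suc m" n w] by (auto simp: J_def)

lemma Z_sum:
  assumes "ereal t < jump_time (Suc m) w"
  shows "Z t w = (\<Sum>n\<le>m. J n t w)"
  unfolding Z_def by (rule suminf_finite) (use J_eq_0[OF assms] in auto)

text \<open>The shares telescope: a completed stage contributes a at the new landing point minus a
  at the old one, plus d of the mark, minus the drift over its duration; the running stage
  contributes up to the present state.\<close>

lemma Z_eq:
  assumes w: "w \<in> good" and t: "0 \<le> t"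
  shows "Z t w = a (proc w t) - a (proc w 0) + (\<Sum>k | 1 \<le> k \<and> jump_time k w \<le> ereal t. d (mrk (w k)))
    - (LINT s:{0..t}|lborel. cc (proc w s))"
proof -
  obtain m where m: "jump_time m w \<le> ereal t" "ereal t < jump_time (Suc m) w" using good_stage[OF w t] .
  have jm: "jump_time n w \<le> ereal t" if "n \<le> m" for n using jump_time_mono[OF that] m(1) by (rule order_trans)
  have fin: "jump_time n w < \<infinity>" if "n \<le> m" for n using jm[OF that] by (rule le_less_trans) simp
  define c where "c n = real_of_ereal (jump_time n w)" for n
  have c: "jump_time n w = ereal (c n)" "0 \<le> c n" "c n \<le> t" if "n \<le> m" for n
  proof -
    have "jump_time n w < \<infinity>" by (rule fin[OF that])
    then obtain r where "jump_time n w = ereal r" "0 \<le> r" "real_of_ereal (jump_time n w) = r"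
      by (rule stage_interval)
    then show "jump_time n w = ereal (c n)" "0 \<le> c n" "c n \<le> t" using jm[OF that] by (simp_all add: c_def)
  qed
  \<comment> \<open>The sum over the stages completed before the n-th jump, by induction on
    n.\<close>
  have partial: "(\<Sum>k<n. J k t w) = a (pos (w n)) - a (pos (w 0)) + (\<Sum>k\<in>{1..n}. d (mrk (w k))) - (LINT s:{0..c n}|lborel. cc (proc w s))"
    if "n \<le> m" for n
    using that
  proof (induction n)
    case 0
    have "\<bar>LINT s:{0..0::real}|lborel. cc (proc w (max 0 s))\<bar> \<le> Cc * (0 - 0)"
      by (rule set_integral_Icc_le[OF proc_path_measurable[OF w] cc_bound]) simp
    moreover have "(LINT s:{0..0::real}|lborel. cc (proc w (max 0 s))) = (LINT s:{0..0::real}|lborel. cc (proc w s))"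
      by (intro set_lebesgue_integral_cong) auto
    ultimately show ?case by (simp add: c_def)
  next
    case (Suc n)
    let ?w = "w (Suc n)"
    have n: "n \<le> m" "n < m" using Suc.prems by auto
    have r: "0 < clk ?w" and cS: "c (Suc n) = c n + clk ?w"
    proof -
      have "ereal (c (Suc n)) = ereal (c n) + (if 0 < clk ?w then ereal (clk ?w) else \<infinity>)"
        using jump_time.simps(2)[of n w] c(1)[OF Suc.prems] c(1)[OF n(1)] by simp
      then show "0 < clk ?w" "c (Suc n) = c n + clk ?w" by (auto split: if_splits)
    qed
    have le: "clk ?w \<le> t - c n" using c(3)[OF Suc.prems] cS by simp
    have "(LINT s:{c n..c n + clk ?w}|lborel. cc (proc w s)) = (LINT q:{0..clk ?w}|lborel. cc (ev (pth ?w) q))"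
      using r c[OF Suc.prems] cS by (intro LINT_proc_stage[OF w c(1)[OF n(1)]]) auto
    also have "\<dots> = (LINT q:{0..t - c n}|lborel. of_bool (alive q (clk ?w)) * cc (ev (pth ?w) q))"
      by (rule LINT_alive[symmetric, OF goodD(3)[OF w] r le])
    finally have I: "(LINT q:{0..t - c n}|lborel. of_bool (alive q (clk ?w)) * cc (ev (pth ?w) q)) = (LINT s:{c n..c (Suc n)}|lborel. cc (proc w s))"
      by (simp add: cS)
    have "J n t w = b (mrk ?w) - a (pos (w n)) - (LINT s:{c n..c (Suc n)}|lborel. cc (proc w s))"
      using jm[OF n(1)] r le goodD(2)[OF w, of n] I
      by (simp add: J_def stage_incr_def Let_def alive_def c_def ev_nonneg)
    moreover have "(LINT s:{0..c (Suc n)}|lborel. cc (proc w s)) = (LINT s:{0..c n}|lborel. cc (proc w s)) + (LINT s:{c n..c (Suc n)}|lborel. cc (proc w s))"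
      using c(2)[OF n(1)] cS r by (intro set_integral_Icc_split proc_set_integrable[OF w]) auto
    ultimately show ?case using Suc.IH[OF n(1)] by (simp add: b_def)
  qed
  let ?w = "w (Suc m)"
  have al: "alive q (clk ?w)" if "q \<le> t - c m" for q
  proof -
    have "ereal t < ereal (c m) + (if 0 < clk ?w then ereal (clk ?w) else \<infinity>)"
      using m(2) jump_time.simps(2)[of m w] c(1)[of m] by simp
    then show ?thesis using that by (auto simp: alive_def split: if_splits)
  qed
  have "(LINT s:{c m..c m + (t - c m)}|lborel. cc (proc w s)) = (LINT q:{0..t - c m}|lborel. cc (ev (pth ?w) q))"
    using c(3)[of m] m(2) by (intro LINT_proc_stage[OF w c(1)]) auto
  also have "\<dots> = (LINT q:{0..t - c m}|lborel. of_bool (alive q (clk ?w)) * cc (ev (pth ?w) q))"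
    using al by (intro set_lebesgue_integral_cong) auto
  finally have I: "(LINT q:{0..t - c m}|lborel. of_bool (alive q (clk ?w)) * cc (ev (pth ?w) q)) = (LINT s:{c m..t}|lborel. cc (proc w s))" by simp
  have "proc w t = pth ?w (t - c m)" using proc_eq[OF m] by (simp add: c_def)
  then have "J m t w = a (proc w t) - a (pos (w m)) - (LINT s:{c m..t}|lborel. cc (proc w s))"
    using m(1) al[of 0] al[of "t - c m"] c(3)[of m] goodD(2)[OF w, of m] I
    by (simp add: J_def stage_incr_def Let_def c_def ev_nonneg)
  moreover have "(LINT s:{0..t}|lborel. cc (proc w s)) = (LINT s:{0..c m}|lborel. cc (proc w s)) + (LINT s:{c m..t}|lborel. cc (proc w s))"
    using c(2,3)[of m] by (intro set_integral_Icc_split proc_set_integrable[OF w]) auto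
  moreover have "{k. 1 \<le> k \<and> jump_time k w \<le> ereal t} = {1..m}"
  proof -
    have "k \<le> m" if "jump_time k w \<le> ereal t" for k
    proof (rule ccontr)
      assume "\<not> k \<le> m"
      then have "jump_time (Suc m) w \<le> jump_time k w" by (intro jump_time_mono) auto
      then show False using m(2) that by auto
    qed
    then show ?thesis using jm by auto
  qed
  ultimately show ?thesis
    unfolding Z_sum[OF m(2)] lessThan_Suc_atMost[symmetric] using partial[of m] proc_0[OF w] by simp
qed

text \<open>One majorant of \<bar>Z s\<bar> for all s \<le> t. It justifies dominated convergence
  when the starting time of an increment is approached from the right.\<close>

definition W :: "real \<Rightarrow> ('a, 'e) sample \<Rightarrow> real" where
  "W t w = (\<Sum>n. (3 * C + Cc * t) * of_bool (jump_time n w \<le> ereal t))"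

lemma summable_of_jump_time:
  fixes g :: "nat \<Rightarrow> real"
  assumes w: "w \<in> good" and g: "\<And>n. \<not> jump_time n w \<le> ereal t \<Longrightarrow> g n = 0"
  shows "summable g"
proof -
  obtain m where m: "ereal t < jump_time m w" using goodD(5)[OF w] by blast
  have "g n = 0" if "n \<notin> {..<m}" for n
    using g[of n] less_le_trans[OF m jump_time_mono[of m n w]] that by auto
  then show ?thesis by (rule summable_finite[OF finite_lessThan])
qed

lemma jump_sum_integrable:
  fixes f :: "nat \<Rightarrow> ('a, 'e) sample \<Rightarrow> real"
  assumes m[measurable]: "\<And>n. f n \<in> borel_measurable Full" and K: "0 \<le> K"
    and bd: "\<And>n w. w \<in> space Full \<Longrightarrow> \<bar>f n w\<bar> \<le> K * of_bool (jump_time n w \<le> ereal t)"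
  shows "integrable (law x) (f n)" "integrable (law x) (\<lambda>w. \<Sum>n. f n w)"
    "(\<integral>w. (\<Sum>n. f n w) \<partial>law x) = (\<Sum>n. \<integral>w. f n w \<partial>law x)"
proof -
  interpret prob_space "law x" by (rule prob_law)
  show i: "integrable (law x) (f n)" for n
  proof (rule integrable_const_bound[where B=K])
    show "AE w in law x. norm (f n w) \<le> K"
      using bd[of _ n] K by (intro AE_I2) (force intro: order_trans)
  qed measurable
  have s1: "AE w in law x. summable (\<lambda>n. norm (f n w))"
    using AE_good[of x]
  proof eventually_elim
    fix w assume w: "w \<in> good"
    show "summable (\<lambda>n. norm (f n w))"
    proof (rule summable_of_jump_time[OF w, where t=t])
      fix n assume "\<not> jump_time n w \<le> ereal t"
      then show "norm (f n w) = 0" using bd[OF goodD(1)[OF w], of n] by simp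
    qed
  qed
  have s2: "summable (\<lambda>n. \<integral>w. norm (f n w) \<partial>law x)"
  proof (rule summable_comparison_test'[where N=0])
    show "summable (\<lambda>n. K * exp t * q ^ n)" using q by (intro summable_mult summable_geometric) auto
    fix n :: nat
    have "(\<integral>w. norm (f n w) \<partial>law x) \<le> (\<integral>w. K * indicator {w \<in> space Full. jump_time n w \<le> ereal t} w \<partial>law x)"
    proof (rule integral_mono)
      show "integrable (law x) (\<lambda>w. norm (f n w))" using i by simp
      show "integrable (law x) (\<lambda>w. K * indicator {w \<in> space Full. jump_time n w \<le> ereal t} w)"
        by (intro integrable_mult_right integrable_const_bound[where B=1]) auto
      show "norm (f n w) \<le> K * indicator {w \<in> space Full. jump_time n w \<le> ereal t} w" if "w \<in> space (law x)" for w
        using bd[of w n] that by (auto split: split_indicator)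
    qed
    also have "\<dots> = K * measure (law x) {w \<in> space Full. jump_time n w \<le> ereal t}" by simp
    also have "\<dots> \<le> K * (exp t * q ^ n)" using prob_jump_time_le[where x=x] K by (intro mult_left_mono) auto
    finally show "norm (\<integral>w. norm (f n w) \<partial>law x) \<le> K * exp t * q ^ n" by (simp add: mult.assoc)
  qed
  show "integrable (law x) (\<lambda>w. \<Sum>n. f n w)" by (rule integrable_suminf[OF i s1 s2])
  show "(\<integral>w. (\<Sum>n. f n w) \<partial>law x) = (\<Sum>n. \<integral>w. f n w \<partial>law x)" by (rule integral_suminf[OF i s1 s2])
qed

lemma K_nonneg: "0 \<le> t \<Longrightarrow> 0 \<le> 3 * C + Cc * t" using C_nonneg Cc_nonneg by simp

lemma W_integrable: "0 \<le> t \<Longrightarrow> integrable (law x) (W t)"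
  unfolding W_def[abs_def] by (rule jump_sum_integrable(2)[where K="3 * C + Cc * t" and t=t]) (auto simp: K_nonneg)

lemma Z_integrable: "0 \<le> t \<Longrightarrow> integrable (law x) (Z t)"
  unfolding Z_def[abs_def] by (rule jump_sum_integrable(2)[where K="3 * C + Cc * t" and t=t]) (auto simp: K_nonneg J_bound)

lemma Z_bound:
  assumes w: "w \<in> good" and t: "0 \<le> s" "s \<le> t"
  shows "\<bar>Z s w\<bar> \<le> W t w"
proof -
  have le: "\<bar>J n s w\<bar> \<le> (3 * C + Cc * t) * of_bool (jump_time n w \<le> ereal t)" for n
  proof -
    have "\<bar>J n s w\<bar> \<le> (3 * C + Cc * s) * of_bool (jump_time n w \<le> ereal s)" by (rule J_bound[OF goodD(1)[OF w] t(1)])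
    also have "\<dots> \<le> (3 * C + Cc * t) * of_bool (jump_time n w \<le> ereal t)"
    proof (rule mult_mono)
      show "(of_bool (jump_time n w \<le> ereal s) :: real) \<le> of_bool (jump_time n w \<le> ereal t)"
        using t(2) order_trans[of "jump_time n w" "ereal s" "ereal t"] by auto
    qed (use t Cc_nonneg K_nonneg in \<open>auto intro: mult_left_mono\<close>)
    finally show ?thesis .
  qed
  have sJ: "summable (\<lambda>n. \<bar>J n s w\<bar>)" by (rule summable_of_jump_time[OF w, where t=s]) (simp add: J_def)
  have "\<bar>Z s w\<bar> \<le> (\<Sum>n. \<bar>J n s w\<bar>)" unfolding Z_def by (rule summable_rabs[OF sJ])
  also have "\<dots> \<le> W t w" unfolding W_def
    by (rule suminf_le[OF le sJ]) (rule summable_of_jump_time[OF w, where t=t], simp)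
  finally show ?thesis .
qed

lemma Z_martingale:
  assumes A: "determined s A" and st: "0 \<le> s" "s \<le> t"
  shows "(\<integral>w. indicator A w * (Z t w - Z s w) \<partial>law x) = 0"
proof -
  have [measurable]: "A \<in> sets Full" by (rule determined_sets[OF A st(1)])
  let ?f = "\<lambda>n w. indicator A w * (J n t w - J n s w)"
  have "\<bar>?f n w\<bar> \<le> (2 * (3 * C + Cc * t)) * of_bool (jump_time n w \<le> ereal t)" if "w \<in> space Full" for n w
  proof -
    have "0 \<le> Cc * s" "Cc * s \<le> Cc * t" using Cc_nonneg st by (auto intro: mult_left_mono)
    then have "\<bar>J n s w\<bar> \<le> (3 * C + Cc * t) * of_bool (jump_time n w \<le> ereal t)"
      using J_bound[OF that st(1), of n] order_trans[of "jump_time n w" "ereal s" "ereal t"] st C_nonneg by (auto split: if_splits simp: of_bool_def)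
    moreover have "\<bar>J n t w\<bar> \<le> (3 * C + Cc * t) * of_bool (jump_time n w \<le> ereal t)"
      using st by (intro J_bound that) simp
    ultimately show ?thesis by (auto split: split_indicator)
  qed
  note js = jump_sum_integrable(3)[where f="?f", OF _ _ this, of x]
  have "(\<integral>w. indicator A w * (Z t w - Z s w) \<partial>law x) = (\<integral>w. (\<Sum>n. ?f n w) \<partial>law x)"
  proof (rule integral_cong_AE)
    show "AE w in law x. indicator A w * (Z t w - Z s w) = (\<Sum>n. ?f n w)"
      using AE_good[of x]
    proof eventually_elim
      fix w assume w: "w \<in> good"
      have s: "summable (\<lambda>n. J n u w)" for u by (rule summable_of_jump_time[OF w, where t=u]) (simp add: J_def)
      have "Z t w - Z s w = (\<Sum>n. J n t w - J n s w)" unfolding Z_def by (rule suminf_diff[OF s s])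
      then show "indicator A w * (Z t w - Z s w) = (\<Sum>n. ?f n w)"
        using suminf_mult[OF summable_diff[OF s[of t] s[of s]], of "indicator A w"] by simp
    qed
  qed measurable
  also have "\<dots> = (\<Sum>n. \<integral>w. ?f n w \<partial>law x)" 
  proof (rule js)
    show "?f n \<in> borel_measurable Full" for n by measurable
    show "0 \<le> 2 * (3 * C + Cc * t)" using K_nonneg[of t] st by simp
  qed
  also have "\<dots> = 0" using determined_increment_eq_0[OF A st] by simp
  finally show ?thesis .
qed

lemma stage_incr_right_cont:
  assumes z: "pth z \<in> \<Omega>" and v: "0 \<le> v"
  shows "((\<lambda>v. stage_incr 0 v z) \<longlongrightarrow> stage_incr 0 v z) (at_right v)"
proof -
  let ?r = "clk z" and ?\<eta> = "pth z"
  let ?f = "\<lambda>q. of_bool (alive q ?r) * cc (ev ?\<eta> q)"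
  have int: "set_integrable lborel {a..b} ?f" for a b
    by (rule set_integrable_bounded_Icc[OF measurable_alive_cc[OF z] alive_cc_bound])
  have I: "((\<lambda>v. LINT q:{0..v}|lborel. ?f q) \<longlongrightarrow> (LINT q:{0..v}|lborel. ?f q)) (at_right v)"
  proof (rule Lim_null_comparison[THEN LIM_zero_cancel])
    show "\<forall>\<^sub>F u in at_right v. norm ((LINT q:{0..u}|lborel. ?f q) - (LINT q:{0..v}|lborel. ?f q)) \<le> Cc * (u - v)"
      unfolding eventually_at_right_field
    proof (intro exI[of _ "v + 1"] conjI allI impI)
      fix u assume u: "v < u"
      have "(LINT q:{0..u}|lborel. ?f q) - (LINT q:{0..v}|lborel. ?f q) = (LINT q:{v..u}|lborel. ?f q)"
        using set_integral_Icc_split[OF int, of 0 v u] u v by simp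
      then show "norm ((LINT q:{0..u}|lborel. ?f q) - (LINT q:{0..v}|lborel. ?f q)) \<le> Cc * (u - v)"
        using set_integral_Icc_le[OF measurable_alive_cc[OF z] alive_cc_bound, of v u] u by simp
    qed simp
    have "((\<lambda>u. Cc * (u - v)) \<longlongrightarrow> Cc * (v - v)) (at_right v)" by (intro tendsto_intros)
    then show "((\<lambda>u. Cc * (u - v)) \<longlongrightarrow> 0) (at_right v)" by simp
  qed
  have a: "((\<lambda>v. if alive v ?r then a (ev ?\<eta> v) else b (mrk z)) \<longlongrightarrow> (if alive v ?r then a (ev ?\<eta> v) else b (mrk z))) (at_right v)"
  proof (cases "alive v ?r")
    case True
    have "\<exists>e>v. \<forall>y>v. y < e \<longrightarrow> a (?\<eta> y) = (if alive y ?r then a (ev ?\<eta> y) else b (mrk z))"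
      using True v by (intro exI[of _ "if 0 < ?r then ?r else v + 1"]) (auto simp: alive_def ev_nonneg)
    then have "\<forall>\<^sub>F y in at_right v. a (?\<eta> y) = (if alive y ?r then a (ev ?\<eta> y) else b (mrk z))"
      unfolding eventually_at_right_field by simp
    from Lim_transform_eventually[OF a_right_cont[OF z v] this] show ?thesis using True v by (simp add: ev_nonneg)
  next
    case False
    then have "\<exists>e>v. \<forall>y>v. y < e \<longrightarrow> b (mrk z) = (if alive y ?r then a (ev ?\<eta> y) else b (mrk z))"
      by (intro exI[of _ "v + 1"]) (auto simp: alive_def)
    then have "\<forall>\<^sub>F y in at_right v. b (mrk z) = (if alive y ?r then a (ev ?\<eta> y) else b (mrk z))"
      unfolding eventually_at_right_field by simp
    from Lim_transform_eventually[OF tendsto_const this] show ?thesis using False by simp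
  qed
  have a0: "alive 0 ?r" by (simp add: alive_def)
  show ?thesis
    unfolding stage_incr_def Let_def if_P[OF a0] by (intro tendsto_intros a I)
qed

lemma Z_right_cont:
  assumes w: "w \<in> good" and s: "0 \<le> s"
  shows "((\<lambda>t. Z t w) \<longlongrightarrow> Z s w) (at_right s)"
proof -
  \<comment> \<open>Up to time s + 1 the same finite number of terms represents Z, so right
    continuity passes through the sum.\<close>
  obtain m where m: "ereal (s + 1) < jump_time (Suc m) w" using good_stage[OF w, of "s + 1"] s by auto
  have Zu: "Z u w = (\<Sum>n\<le>m. J n u w)" if "u \<le> s + 1" for u
    by (rule Z_sum) (rule le_less_trans[OF _ m], use that in simp)
  have "((\<lambda>u. J n u w) \<longlongrightarrow> J n s w) (at_right s)" for n
  proof (cases "jump_time n w \<le> ereal s")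
    case True
    obtain c where c: "jump_time n w = ereal c" "0 \<le> c" "real_of_ereal (jump_time n w) = c"
      using stage_interval[OF le_less_trans[OF True]] by auto
    have "filterlim (\<lambda>u. u - c) (at_right (s - c)) (at_right s)"
      by (rule filterlim_at_withinI) (auto intro!: tendsto_intros simp: eventually_at_right_field intro: exI[of _ "s+1"])
    then have "((\<lambda>u. stage_incr 0 (u - c) (w (Suc n))) \<longlongrightarrow> stage_incr 0 (s - c) (w (Suc n))) (at_right s)"
      using True c by (intro filterlim_compose[OF stage_incr_right_cont[OF goodD(3)[OF w]]]) auto
    moreover have "\<exists>b>s. \<forall>y>s. y < b \<longrightarrow> stage_incr 0 (y - c) (w (Suc n)) = J n y w"
      using True c by (intro exI[of _ "s+1"]) (auto simp: J_def)
    then have "\<forall>\<^sub>F u in at_right s. stage_incr 0 (u - c) (w (Suc n)) = J n u w"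
      unfolding eventually_at_right_field by simp
    ultimately show ?thesis using True c by (auto simp: J_def dest: Lim_transform_eventually)
  next
    case False
    obtain b where b: "s < b" "ereal b \<le> jump_time n w"
    proof (cases "jump_time n w")
      case (real r) then show ?thesis using that[of r] False by auto
    next
      case PInf then show ?thesis using that[of "s + 1"] by auto
    qed (use False in auto)
    have "J n u w = 0" if "u < b" for u
      using that b(2) less_le_trans[of "ereal u" "ereal b" "jump_time n w"] by (auto simp: J_def)
    then have "\<exists>b>s. \<forall>y>s. y < b \<longrightarrow> 0 = J n y w" using b(1) by (intro exI[of _ b]) auto
    then have "\<forall>\<^sub>F u in at_right s. 0 = J n u w" unfolding eventually_at_right_field by simp
    from Lim_transform_eventually[OF tendsto_const this] show ?thesis using False by (simp add: J_def)
  qed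
  then have "((\<lambda>u. \<Sum>n\<le>m. J n u w) \<longlongrightarrow> (\<Sum>n\<le>m. J n s w)) (at_right s)" by (intro tendsto_sum)
  moreover have "\<exists>b>s. \<forall>y>s. y < b \<longrightarrow> (\<Sum>n\<le>m. J n y w) = Z y w" using Zu by (intro exI[of _ "s+1"]) auto
  then have "\<forall>\<^sub>F u in at_right s. (\<Sum>n\<le>m. J n u w) = Z u w" unfolding eventually_at_right_field by simp
  ultimately show ?thesis using Zu[of s] by (auto dest: Lim_transform_eventually)
qed

end

section \<open>Usual augmentation\<close>

text \<open>An intersection of sigma-algebras is one already, so the outer \<open>sigma\<close> of
  the definition adds no sets.\<close>

lemma sets_usual_augmentation:
  "sets (usual_augmentation M F t) = (\<Inter>u\<in>{t<..}. sets (sigma (space M) (sets (F u) \<union> null_sets M)))"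
  if sub: "\<And>u. sets (F u) \<subseteq> Pow (space M)"
proof -
  have P: "sets (F u) \<union> null_sets M \<subseteq> Pow (space M)" for u
    using sub sets.space_closed[of M] by (auto simp: null_sets_def)
  have sp: "space (sigma (space M) (sets (F u) \<union> null_sets M)) = space M" for u
    by (rule space_measure_of[OF P])
  have sa: "sigma_algebra (space M) (\<Inter>u\<in>{t<..}. sets (sigma (space M) (sets (F u) \<union> null_sets M)))"
    unfolding sigma_algebra_iff2
  proof (intro conjI ballI allI impI)
    show "(\<Inter>u\<in>{t<..}. sets (sigma (space M) (sets (F u) \<union> null_sets M))) \<subseteq> Pow (space M)"
    proof
      fix A assume "A \<in> (\<Inter>u\<in>{t<..}. sets (sigma (space M) (sets (F u) \<union> null_sets M)))"
      then have "A \<in> sets (sigma (space M) (sets (F (t + 1)) \<union> null_sets M))" by auto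
      from sets.sets_into_space[OF this] show "A \<in> Pow (space M)" by (simp add: sp)
    qed
    show "space M - A \<in> (\<Inter>u\<in>{t<..}. sets (sigma (space M) (sets (F u) \<union> null_sets M)))"
      if "A \<in> (\<Inter>u\<in>{t<..}. sets (sigma (space M) (sets (F u) \<union> null_sets M)))" for A
    proof
      fix u assume "u \<in> {t<..}"
      then have "A \<in> sets (sigma (space M) (sets (F u) \<union> null_sets M))" using that by auto
      from sets.compl_sets[OF this] show "space M - A \<in> sets (sigma (space M) (sets (F u) \<union> null_sets M))" by (simp add: sp)
    qed
  qed auto
  show ?thesis unfolding usual_augmentation_def
    by (rule sigma_algebra.sets_measure_of_eq[OF sa])
qed

lemma space_usual_augmentation:
  assumes "\<And>u. sets (F u) \<subseteq> Pow (space M)"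
  shows "space (usual_augmentation M F t) = space M"
  unfolding usual_augmentation_def
proof (rule space_measure_of)
  have "sets (F u) \<union> null_sets M \<subseteq> Pow (space M)" for u
    using assms sets.space_closed[of M] by (auto simp: null_sets_def)
  then have "space (sigma (space M) (sets (F u) \<union> null_sets M)) = space M" for u by (rule space_measure_of)
  then show "(\<Inter>u\<in>{t<..}. sets (sigma (space M) (sets (F u) \<union> null_sets M))) \<subseteq> Pow (space M)"
  proof (intro subsetI)
    fix A assume "A \<in> (\<Inter>u\<in>{t<..}. sets (sigma (space M) (sets (F u) \<union> null_sets M)))"
    then have "A \<in> sets (sigma (space M) (sets (F (t + 1)) \<union> null_sets M))" by auto
    from sets.sets_into_space[OF this] show "A \<in> Pow (space M)"
      by (simp add: \<open>\<And>u. space (sigma (space M) (sets (F u) \<union> null_sets M)) = space M\<close>)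
  qed
qed

text \<open>The sets that agree almost everywhere with a member of F form a sigma-algebra containing
  the null sets.\<close>

lemma null_augmented_approx:
  assumes F: "space F = space M" "sets F \<subseteq> sets M"
    and A: "A \<in> sets (sigma (space M) (sets F \<union> null_sets M))"
  shows "\<exists>B\<in>sets F. AE w in M. w \<in> A \<longleftrightarrow> w \<in> B"
proof -
  have P: "sets F \<union> null_sets M \<subseteq> Pow (space M)"
    using F(2) sets.space_closed[of M] by (auto simp: null_sets_def)
  have "A \<in> sigma_sets (space M) (sets F \<union> null_sets M)" using A P by (simp add: sets_measure_of)
  then show ?thesis
  proof (induction rule: sigma_sets.induct)
    case (Basic a)
    then show ?case
    proof
      assume a: "a \<in> null_sets M"
      then have "AE w in M. w \<in> a \<longleftrightarrow> w \<in> {}" using AE_not_in[OF a] by auto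
      then show ?thesis by (rule bexI[of _ "{}"]) simp
    qed auto
  next
    case Empty
    then show ?case by (intro bexI[of _ "{}"]) auto
  next
    case (Compl a)
    then obtain B where B: "B \<in> sets F" "AE w in M. w \<in> a \<longleftrightarrow> w \<in> B" by blast
    have "AE w in M. w \<in> space M - a \<longleftrightarrow> w \<in> space F - B"
      using B(2) AE_space by eventually_elim (auto simp: F)
    then show ?case using B(1) by (intro bexI[of _ "space F - B"]) auto
  next
    case (Union a)
    then obtain B where B: "\<And>i. B i \<in> sets F" "\<And>i. AE w in M. w \<in> a i \<longleftrightarrow> w \<in> B i" by metis
    have "AE w in M. \<forall>i. w \<in> a i \<longleftrightarrow> w \<in> B i" using B(2) by (simp add: AE_all_countable)
    then have "AE w in M. w \<in> (\<Union>i. a i) \<longleftrightarrow> w \<in> (\<Union>i. B i)" by eventually_elim auto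
    then show ?case using B(1) by (intro bexI[of _ "\<Union>i. B i"]) auto
  qed
qed

text \<open>In a complete space every part of the exceptional set is a null set, hence belongs to
  the augmentation. This serves compensators that agree with an adapted process only almost
  everywhere.\<close>

lemma usual_augmentation_AE_measurable:
  assumes M: "complete_measure M" and F: "\<And>u. sets (F u) \<subseteq> sets M" "\<And>u. space (F u) = space M"
    and mono: "\<And>u v. u \<le> v \<Longrightarrow> sets (F u) \<subseteq> sets (F v)"
    and f: "f \<in> borel_measurable (F t)" and eq: "AE w in M. g w = (f w :: real)"
  shows "g \<in> borel_measurable (usual_augmentation M F t)"
proof -
  have FP: "sets (F u) \<subseteq> Pow (space M)" for u using F(1)[of u] sets.space_closed[of M] by auto
  obtain Nl where "\<And>w. w \<in> space M - Nl \<Longrightarrow> g w = f w" and Nl: "Nl \<in> null_sets M"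
    using AE_E3[OF eq] by blast
  then have Nl2: "{w \<in> space M. g w \<noteq> f w} \<subseteq> Nl" by auto
  have null: "A \<in> null_sets M" if "A \<subseteq> Nl" for A
    using complete_measure.complete2[OF M that Nl] .
  have P: "sets (F u) \<union> null_sets M \<subseteq> Pow (space M)" for u
    using FP sets.space_closed[of M] by (auto simp: null_sets_def)
  show ?thesis
  proof (rule measurableI)
    fix D :: "real set" assume D: "D \<in> sets borel"
    let ?G = "g -` D \<inter> space M" and ?Ff = "f -` D \<inter> space M"
    have eqs: "?G = (?Ff - (?Ff - ?G)) \<union> (?G - ?Ff)" by auto
    have n1: "?Ff - ?G \<in> null_sets M" and n2: "?G - ?Ff \<in> null_sets M"
      by (rule null, use Nl2 in auto)+
    have "?G \<in> sets (sigma (space M) (sets (F u) \<union> null_sets M))" if "t < u" for u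
    proof -
      have "?Ff \<in> sets (F t)" using measurable_sets[OF f D] by (simp add: F)
      then have "?Ff \<in> sets (F u)" using mono[of t u] that by auto
      then have "?Ff \<in> sets (sigma (space M) (sets (F u) \<union> null_sets M))" using P by (auto simp: sets_measure_of)
      moreover have "?Ff - ?G \<in> sets (sigma (space M) (sets (F u) \<union> null_sets M))"
         "?G - ?Ff \<in> sets (sigma (space M) (sets (F u) \<union> null_sets M))"
        using n1 n2 P by (auto simp: sets_measure_of)
      ultimately show ?thesis by (subst eqs) auto
    qed
    then show "g -` D \<inter> space (usual_augmentation M F t) \<in> sets (usual_augmentation M F t)"
      by (simp add: sets_usual_augmentation[OF FP] space_usual_augmentation[OF FP])
  qed simp
qed

text \<open>Two versions are kept apart: Z carries integrability and the increment identity, Z' is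
  the process in the form to be stated and carries adaptedness.\<close>

lemma martingaleI:
  fixes Z Z' :: "real \<Rightarrow> 'w \<Rightarrow> real"
  assumes M: "prob_space M" and filt: "filtration (space M) F" and sub: "\<And>t. 0 \<le> t \<Longrightarrow> subalgebra M (F t)"
    and int: "\<And>t. 0 \<le> t \<Longrightarrow> integrable M (Z t)"
    and adapted: "\<And>t. 0 \<le> t \<Longrightarrow> Z' t \<in> borel_measurable (F t)"
    and eq: "\<And>t. 0 \<le> t \<Longrightarrow> AE w in M. Z' t w = Z t w"
    and step: "\<And>s t A. 0 \<le> s \<Longrightarrow> s \<le> t \<Longrightarrow> A \<in> sets (F s) \<Longrightarrow> (\<integral>w. indicator A w * (Z t w - Z s w) \<partial>M) = 0"
  shows "martingale M F Z'"
  unfolding martingale_def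
proof (intro conjI allI impI)
  interpret prob_space M by (rule M)
  have Zm[measurable]: "Z t \<in> borel_measurable M" if "0 \<le> t" for t using int[OF that] by auto
  have Z'm: "Z' t \<in> borel_measurable M" if "0 \<le> t" for t
    using measurable_from_subalg[OF sub adapted] that by blast
  have int': "integrable M (Z' t)" if "0 \<le> t" for t
    using int[OF that] integrable_cong_AE[OF Z'm[OF that] Zm[OF that] eq[OF that]] by simp
  show "filtration (space M) F" by (rule filt)
  fix t :: real assume t: "0 \<le> t"
  show "subalgebra M (F t)" by (rule sub[OF t])
  show "Z' t \<in> borel_measurable (F t)" by (rule adapted[OF t])
  show "integrable M (Z' t)" by (rule int'[OF t])
  fix s :: real assume st: "0 \<le> t" "t \<le> s"
  have s: "0 \<le> s" using st by simp
  interpret S: sigma_finite_subalgebra M "F t"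
    by (intro finite_measure_subalgebra_is_sigma_finite finite_measure_subalgebra.intro
        finite_measure_subalgebra_axioms.intro sub[OF t] finite_measure_axioms)
  show "AE w in M. real_cond_exp M (F t) (Z' s) w = Z' t w"
  proof (rule S.real_cond_exp_charact)
    fix A assume A: "A \<in> sets (F t)"
    then have [measurable]: "A \<in> sets M" using sub[OF t] by (auto simp: subalgebra_def)
    have iA: "integrable M (\<lambda>w. indicator A w * Z u w)" if "0 \<le> u" for u
      using integrable_mult_indicator[OF _ int[OF that], of A] by simp
    have "(\<integral>w\<in>A. Z' u w \<partial>M) = (\<integral>w. indicator A w * Z u w \<partial>M)" if "0 \<le> u" for u
      unfolding set_lebesgue_integral_def
    proof (rule integral_cong_AE)
      show "AE w in M. indicator A w *\<^sub>R Z' u w = indicator A w * Z u w"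
        using eq[OF that] by eventually_elim simp
    qed (use Z'm[OF that] Zm[OF that] in measurable)
    moreover have "(\<integral>w. indicator A w * Z s w \<partial>M) - (\<integral>w. indicator A w * Z t w \<partial>M) = 0"
      using step[OF st A] Bochner_Integration.integral_diff[OF iA[OF s] iA[OF t]] by (simp add: right_diff_distrib)
    ultimately show "(\<integral>w\<in>A. Z' s w \<partial>M) = (\<integral>w\<in>A. Z' t w \<partial>M)" using t s by simp
  qed (use int' t s adapted in auto)
qed

text \<open>An event A of the augmentation at s agrees, for each u > s, almost everywhere with an
  event of \<open>F u\<close>. The increment identity thus holds from u to t, and u tends to s by
  right continuity and dominated convergence.\<close>

lemma martingale_usual_augmentation:
  fixes Z Z' :: "real \<Rightarrow> 'w \<Rightarrow> real"
  assumes M: "prob_space M" "complete_measure M" and F: "\<And>u. sets (F u) \<subseteq> sets M" "\<And>u. space (F u) = space M"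
    and mono: "\<And>u v. u \<le> v \<Longrightarrow> sets (F u) \<subseteq> sets (F v)"
    and int: "\<And>t. 0 \<le> t \<Longrightarrow> integrable M (Z t)"
    and adapted: "\<And>t. 0 \<le> t \<Longrightarrow> Z' t \<in> borel_measurable (usual_augmentation M F t)"
    and eq: "\<And>t. 0 \<le> t \<Longrightarrow> AE w in M. Z' t w = Z t w"
    and core: "\<And>s t A. 0 \<le> s \<Longrightarrow> s \<le> t \<Longrightarrow> A \<in> sets (F s) \<Longrightarrow> (\<integral>w. indicator A w * (Z t w - Z s w) \<partial>M) = 0"
    and rc: "\<And>s. 0 \<le> s \<Longrightarrow> AE w in M. ((\<lambda>t. Z t w) \<longlongrightarrow> Z s w) (at_right s)"
    and dom: "\<And>t. 0 \<le> t \<Longrightarrow> integrable M (W t)" "\<And>s t. 0 \<le> s \<Longrightarrow> s \<le> t \<Longrightarrow> AE w in M. \<bar>Z s w\<bar> \<le> W t w"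
  shows "martingale M (usual_augmentation M F) Z'"
proof -
  interpret prob_space M by (rule M(1))
  have FP: "sets (F u) \<subseteq> Pow (space M)" for u using F(1)[of u] sets.space_closed[of M] by auto
  note U = sets_usual_augmentation[where M=M and F=F, OF FP] space_usual_augmentation[where M=M and F=F, OF FP]
  have P: "sets (F u) \<union> null_sets M \<subseteq> Pow (space M)" for u
    using FP sets.space_closed[of M] by (auto simp: null_sets_def)
  have sub: "subalgebra M (usual_augmentation M F t)" for t
  proof -
    have "sets (sigma (space M) (sets (F (t + 1)) \<union> null_sets M)) \<subseteq> sets M"
      using P F(1)[of "t + 1"] by (subst sets_measure_of) (auto intro!: sets.sigma_sets_subset)
    then show ?thesis unfolding subalgebra_def U by force
  qed
  have filt: "filtration (space M) (usual_augmentation M F)"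
    by standard (auto simp: U)
  have Zm[measurable]: "Z t \<in> borel_measurable M" if "0 \<le> t" for t using int[OF that] by auto
  have step: "(\<integral>w. indicator A w * (Z t w - Z s w) \<partial>M) = 0" if s: "0 \<le> s" "s \<le> t" and A: "A \<in> sets (usual_augmentation M F s)" for s t A
  proof (cases "s = t")
    case False
    then have st: "s < t" using s by simp
    have AM[measurable]: "A \<in> sets M" using A sub by (auto simp: subalgebra_def)
    \<comment> \<open>Strictly above s, as the right limit demands, and never beyond t.\<close>
    define u where "u n = s + (t - s) / real (Suc n)" for n
    have u: "s < u n" "u n \<le> t" for n
    proof -
      show "s < u n" using st by (simp add: u_def)
      have "(t - s) / real (Suc n) \<le> (t - s) / 1" using st by (intro divide_left_mono) auto
      then show "u n \<le> t" by (simp add: u_def)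
    qed
    have ulim: "filterlim u (at_right s) sequentially"
    proof (rule filterlim_at_withinI)
      have "(\<lambda>n. s + (t - s) * (1 / real (Suc n))) \<longlonglongrightarrow> s + (t - s) * 0"
        using LIMSEQ_inverse_real_of_nat by (intro tendsto_intros) (simp add: inverse_eq_divide)
      then show "u \<longlonglongrightarrow> s" by (simp add: u_def[abs_def])
      show "\<forall>\<^sub>F n in sequentially. u n \<in> {s<..} - {s}" using u(1) by (intro always_eventually) (auto simp: less_imp_neq)
    qed
    have z: "(\<integral>w. indicator A w * (Z t w - Z (u n) w) \<partial>M) = 0" for n
    proof -
      have "A \<in> sets (sigma (space M) (sets (F (u n)) \<union> null_sets M))" using A u(1)[of n] by (auto simp: U)
      from null_augmented_approx[OF F(2) F(1) this]
      obtain B where B: "B \<in> sets (F (u n))" "AE w in M. w \<in> A \<longleftrightarrow> w \<in> B" by blast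
      have [measurable]: "B \<in> sets M" using B(1) F(1) by auto
      have u0: "0 \<le> u n" using u(1)[of n] s by simp
      have "(\<integral>w. indicator A w * (Z t w - Z (u n) w) \<partial>M) = (\<integral>w. indicator B w * (Z t w - Z (u n) w) \<partial>M)"
      proof (rule integral_cong_AE)
        show "AE w in M. indicator A w * (Z t w - Z (u n) w) = indicator B w * (Z t w - Z (u n) w)"
          using B(2) by eventually_elim (auto split: split_indicator)
        have [measurable]: "Z t \<in> borel_measurable M" "Z (u n) \<in> borel_measurable M" using s u0 by (auto intro: Zm)
        show "(\<lambda>w. indicator A w * (Z t w - Z (u n) w)) \<in> borel_measurable M"
          "(\<lambda>w. indicator B w * (Z t w - Z (u n) w)) \<in> borel_measurable M" by measurable
      qed
      also have "\<dots> = 0" by (rule core[OF u0 u(2) B(1)])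
      finally show ?thesis .
    qed
    have "(\<lambda>n. \<integral>w. indicator A w * (Z t w - Z (u n) w) \<partial>M) \<longlonglongrightarrow> (\<integral>w. indicator A w * (Z t w - Z s w) \<partial>M)"
    proof (rule integral_dominated_convergence[where w="\<lambda>w. 2 * W t w"])
      show "(\<lambda>w. indicator A w * (Z t w - Z s w)) \<in> borel_measurable M"
        using Zm[OF order_trans[OF s]] Zm[OF s(1)] by measurable
      show "(\<lambda>w. indicator A w * (Z t w - Z (u n) w)) \<in> borel_measurable M" for n
        using Zm[OF order_trans[OF s]] Zm[OF less_imp_le[OF order.strict_trans1[OF s(1) u(1)]]] by measurable
      show "integrable M (\<lambda>w. 2 * W t w)" using dom(1)[of t] s by simp
      show "AE w in M. (\<lambda>n. indicator A w * (Z t w - Z (u n) w)) \<longlonglongrightarrow> indicator A w * (Z t w - Z s w)"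
        using rc[OF s(1)]
      proof eventually_elim
        fix w assume "((\<lambda>t. Z t w) \<longlongrightarrow> Z s w) (at_right s)"
        from filterlim_compose[OF this ulim] show "(\<lambda>n. indicator A w * (Z t w - Z (u n) w)) \<longlonglongrightarrow> indicator A w * (Z t w - Z s w)"
          by (intro tendsto_intros)
      qed
      show "AE w in M. norm (indicator A w * (Z t w - Z (u n) w)) \<le> 2 * W t w" for n
      proof -
        have "0 \<le> t" "0 \<le> u n" using s u(1)[of n] by auto
        from dom(2)[OF this(1) order_refl] dom(2)[OF this(2) u(2)] show ?thesis
          by eventually_elim (auto split: split_indicator)
      qed
    qed
    then show ?thesis using z by (simp add: LIMSEQ_const_iff)
  qed simp
  show ?thesis by (rule martingaleI[OF M(1) filt sub int adapted eq step])
qed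

section \<open>The path of a stage given the history\<close>

context jump_diffusion
begin

text \<open>The counterpart of \<open>determined\<close> at a jump time: no running path has been
  observed, so the components 0 to n say everything.\<close>

definition history_determined :: "nat \<Rightarrow> ('a, 'e) sample set \<Rightarrow> bool" where
  "history_determined n A \<longleftrightarrow> (\<exists>A'\<in>sets (Hist (Suc n)). A = {w \<in> good. restrict w {0..<Suc n} \<in> A'})"

lemma restrict_good_space: "w \<in> good \<Longrightarrow> restrict w {0..<n} \<in> space (Hist n)"
  using measurable_space[OF measurable_restrict_Full goodD(1)] .

lemma sigma_algebra_history_determined: "sigma_algebra good {A. history_determined n A}"
  unfolding sigma_algebra_iff2 mem_Collect_eq
proof (intro conjI allI impI ballI)
  show "{A. history_determined n A} \<subseteq> Pow good" by (auto simp: history_determined_def)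
  show "history_determined n {}" by (auto simp: history_determined_def intro!: bexI[of _ "{}"])
  fix A assume "A \<in> {A. history_determined n A}"
  then obtain A' where "A' \<in> sets (Hist (Suc n))" "A = {w \<in> good. restrict w {0..<Suc n} \<in> A'}"
    by (auto simp: history_determined_def)
  then show "history_determined n (good - A)"
    unfolding history_determined_def using restrict_good_space
    by (intro bexI[of _ "space (Hist (Suc n)) - A'"]) auto
next
  fix A :: "nat \<Rightarrow> _" assume "range A \<subseteq> {A. history_determined n A}"
  then have "\<forall>i. \<exists>A'\<in>sets (Hist (Suc n)). A i = {w \<in> good. restrict w {0..<Suc n} \<in> A'}"
    by (auto simp: history_determined_def)
  then have "\<exists>A'. \<forall>i. A' i \<in> sets (Hist (Suc n)) \<and> A i = {w \<in> good. restrict w {0..<Suc n} \<in> A' i}"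
    unfolding Bex_def by (rule choice)
  then obtain A' where "\<And>i. A' i \<in> sets (Hist (Suc n))" "\<And>i. A i = {w \<in> good. restrict w {0..<Suc n} \<in> A' i}" by blast
  then show "history_determined n (\<Union>i. A i)"
    unfolding history_determined_def by (intro bexI[of _ "\<Union>i. A' i"]) auto
qed

lemma history_determined_jump_history:
  assumes M: "space M = good" and A: "A \<in> sets (jump_history M proc jump_time ety n)"
  shows "history_determined n A"
proof -
  interpret D: sigma_algebra good "{A. history_determined n A}" by (rule sigma_algebra_history_determined)
  let ?X = "\<lambda>s w. proc w (real_of_ereal (min (ereal s) (jump_time n w)))"
  let ?G = "{?X s -` B \<inter> good | s B. 0 \<le> s \<and> B \<in> sets borel} \<union>
      {jump_time k -` B \<inter> good | k B. k \<le> n \<and> B \<in> sets borel} \<union>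
      {(\<lambda>w. fst (mrk (w k))) -` B \<inter> good | k B. 1 \<le> k \<and> k \<le> n}"
  have [measurable]: "jump_time k \<in> borel_measurable (Hist (Suc n))" if "k \<le> n" for k
    using that by (intro measurable_jump_time_Hist) simp
  have [measurable]: "(\<lambda>h. h k) \<in> Hist (Suc n) \<rightarrow>\<^sub>M St" if "k \<le> n" for k
    using that by (intro measurable_component_singleton) auto
  have jt: "jump_time k (restrict w {0..<Suc n}) = jump_time k w" if "k \<le> n" for k and w :: "nat \<Rightarrow> (real \<Rightarrow> 'a) \<times> real \<times> 'e \<times> 'a"
    using that by (intro jump_time_cong) auto
  have "A \<in> sigma_sets good ?G"
    using A unfolding jump_history_def M by (subst (asm) sets_measure_of) auto
  moreover have "sigma_sets good ?G \<subseteq> {A. history_determined n A}"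
  proof (rule D.sigma_sets_subset, intro Un_least)
    show "{?X s -` B \<inter> good | s B. 0 \<le> s \<and> B \<in> sets borel} \<subseteq> {A. history_determined n A}"
    proof clarify
      fix s :: real and B :: "'a set" assume s: "0 \<le> s" and B[measurable]: "B \<in> sets borel"
      \<comment> \<open>The process stopped at the n-th jump: before that jump it is read off the
        earlier stages, afterwards it rests at the landing point.\<close>
      let ?A = "{h \<in> space (Hist (Suc n)). ereal s < jump_time n h \<and> proc h s \<in> B} \<union> {h \<in> space (Hist (Suc n)). jump_time n h \<le> ereal s \<and> pos (h n) \<in> B}"
      have "?A \<in> sets (Hist (Suc n))"
      proof (rule sets.Un)
        show "{h \<in> space (Hist (Suc n)). ereal s < jump_time n h \<and> proc h s \<in> B} \<in> sets (Hist (Suc n))"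
          by (rule proc_before_sets[OF _ s B]) (auto intro!: measurable_component_singleton)
      qed measurable
      moreover have "?X s -` B \<inter> good = {w \<in> good. restrict w {0..<Suc n} \<in> ?A}"
      proof (intro set_eqI)
        fix w
        show "w \<in> ?X s -` B \<inter> good \<longleftrightarrow> w \<in> {w \<in> good. restrict w {0..<Suc n} \<in> ?A}"
        proof (cases "w \<in> good")
          case True
          show ?thesis
          proof (cases "ereal s < jump_time n w")
            case T: True
            have "proc (restrict w {0..<Suc n}) s = proc w s" by (rule proc_cong[symmetric, OF _ s T]) auto
            then show ?thesis using T True restrict_good_space[OF True, of "Suc n"] jt[OF order_refl, of w] not_le[THEN iffD2, OF T] by (simp add: min_absorb1 less_imp_le)
          next
            case F: False
            then have le: "jump_time n w \<le> ereal s" by simp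
            then have "?X s w = pos (w n)" using proc_jump[OF True le_less_trans[OF le]] by (simp add: min_absorb2)
            then show ?thesis using F le True restrict_good_space[OF True, of "Suc n"] jt[OF order_refl, of w] by simp
          qed
        qed simp
      qed
      ultimately show "history_determined n (?X s -` B \<inter> good)" unfolding history_determined_def by blast
    qed
    show "{jump_time k -` B \<inter> good | k B. k \<le> n \<and> B \<in> sets borel} \<subseteq> {A. history_determined n A}"
    proof clarify
      fix k and B :: "ereal set" assume k: "k \<le> n" and B: "B \<in> sets borel"
      have "jump_time k -` B \<inter> space (Hist (Suc n)) \<in> sets (Hist (Suc n))" using k B by (intro measurable_sets[OF measurable_jump_time_Hist]) auto
      moreover have "jump_time k -` B \<inter> good = {w \<in> good. restrict w {0..<Suc n} \<in> jump_time k -` B \<inter> space (Hist (Suc n))}"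
        using jt[OF k] restrict_good_space by auto
      ultimately show "history_determined n (jump_time k -` B \<inter> good)" unfolding history_determined_def by blast
    qed
    show "{(\<lambda>w. fst (mrk (w k))) -` B \<inter> good | k B. 1 \<le> k \<and> k \<le> n} \<subseteq> {A. history_determined n A}"
    proof clarify
      fix k and B :: "'e set" assume k: "1 \<le> k" "k \<le> n"
      have "(\<lambda>h. fst (mrk (h k))) \<in> Hist (Suc n) \<rightarrow>\<^sub>M count_space E" using k by measurable
      then have "(\<lambda>h. fst (mrk (h k))) -` (B \<inter> E) \<inter> space (Hist (Suc n)) \<in> sets (Hist (Suc n))" by (rule measurable_sets) simp
      moreover have "(\<lambda>w. fst (mrk (w k))) -` B \<inter> good = {w \<in> good. restrict w {0..<Suc n} \<in> (\<lambda>h. fst (mrk (h k))) -` (B \<inter> E) \<inter> space (Hist (Suc n))}"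
      proof -
        have "fst (mrk (w k)) \<in> E" if "w \<in> good" for w using goodD(4)[OF that, of k] by (auto simp: space_pair_measure)
        then show ?thesis using k restrict_good_space[of _ "Suc n"] by auto
      qed
      ultimately show "history_determined n ((\<lambda>w. fst (mrk (w k))) -` B \<inter> good)" unfolding history_determined_def by blast
    qed
  qed
  ultimately show ?thesis by auto
qed

lemma history_determined_sets: "history_determined n A \<Longrightarrow> A \<in> sets Full"
proof -
  assume "history_determined n A"
  then obtain A' where A': "A' \<in> sets (Hist (Suc n))" "A = {w \<in> good. restrict w {0..<Suc n} \<in> A'}"
    by (auto simp: history_determined_def)
  have "A = good \<inter> ((\<lambda>w. restrict w {0..<Suc n}) -` A' \<inter> space Full)" using A' goodD(1) by auto
  then show ?thesis using measurable_sets[OF measurable_restrict_Full A'(1)] good_sets by auto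
qed

text \<open>Within a stage the path is drawn before clock and mark; integrating these out leaves
  \<open>Q\<close> at the landing point, untouched by the rates.\<close>

lemma integral_history_path:
  assumes A: "history_determined n A" and G[measurable]: "\<Gamma> \<in> sets N"
  shows "(\<integral>w. indicator A w * indicator \<Gamma> (pth (w (Suc n))) \<partial>law x) = (\<integral>w. indicator A w * measure (Q (pos (w n))) \<Gamma> \<partial>law x)"
proof -
  have [measurable]: "A \<in> sets Full" by (rule history_determined_sets[OF A])
  obtain A' where A'[measurable]: "A' \<in> sets (Hist (Suc n))" and AA: "A = {w \<in> good. restrict w {0..<Suc n} \<in> A'}"
    using A by (auto simp: history_determined_def)
  have mQ: "(\<lambda>w. measure (Q (pos (w n))) \<Gamma>) \<in> borel_measurable Full"
    by (rule measurable_compose[OF _ measurable_measure_subprob_algebra[OF G]])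
      (rule measurable_compose[OF _ measurable_prob_algebraD[OF Q]], measurable)
  note [measurable] = this
  let ?f = "\<lambda>(h, z). indicator A' h * indicator \<Gamma> (pth z) :: real"
  have "(\<integral>w. indicator A w * indicator \<Gamma> (pth (w (Suc n))) \<partial>law x) = (\<integral>w. ?f (restrict w {0..<Suc n}, w (Suc n)) \<partial>law x)"
  proof (rule integral_cong_AE)
    show "AE w in law x. indicator A w * indicator \<Gamma> (pth (w (Suc n))) = ?f (restrict w {0..<Suc n}, w (Suc n))"
      using AE_good[of x] by eventually_elim (auto simp: AA split: split_indicator)
    have "?f \<in> borel_measurable (Hist (Suc n) \<Otimes>\<^sub>M St)" by measurable
    from measurable_compose[OF measurable_hist_pair this]
    show "(\<lambda>w. ?f (restrict w {0..<Suc n}, w (Suc n))) \<in> borel_measurable (law x)" by (simp add: measurable_cong_sets[OF sets_law refl])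
  qed measurable
  also have "\<dots> = (\<integral>w. \<integral>z. ?f (restrict w {0..<Suc n}, z) \<partial>stage (pos (w n)) \<partial>law x)"
    by (rule integral_law_stage[where B=1]) (auto split: split_indicator)
  also have "\<dots> = (\<integral>w. indicator A' (restrict w {0..<Suc n}) * measure (Q (pos (w n))) \<Gamma> \<partial>law x)"
  proof (intro Bochner_Integration.integral_cong refl)
    fix w :: "nat \<Rightarrow> (real \<Rightarrow> 'a) \<times> real \<times> 'e \<times> 'a"
    have "(\<integral>z. indicator \<Gamma> (pth z) \<partial>stage (pos (w n))) = (\<integral>\<eta>. \<integral>r. \<integral>p. (indicator \<Gamma> \<eta> :: real) \<partial>\<pi> (ev \<eta> r) \<partial>clock \<eta> \<partial>Q (pos (w n)))"
      by (subst integral_stage[where B=1]) (auto split: split_indicator)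
    also have "\<dots> = (\<integral>\<eta>. indicator \<Gamma> \<eta> \<partial>Q (pos (w n)))"
      by (intro Bochner_Integration.integral_cong refl)
        (simp add: prob_space.prob_space[OF prob_\<pi>] prob_space.prob_space[OF prob_clock] del: space_clock)
    also have "\<dots> = measure (Q (pos (w n))) \<Gamma>" using sets.sets_into_space[OF G] by (simp add: Int_absorb2)
    finally show "(\<integral>z. ?f (restrict w {0..<Suc n}, z) \<partial>stage (pos (w n))) = indicator A' (restrict w {0..<Suc n}) * measure (Q (pos (w n))) \<Gamma>" by simp
  qed
  also have "\<dots> = (\<integral>w. indicator A w * measure (Q (pos (w n))) \<Gamma> \<partial>law x)"
  proof (rule integral_cong_AE)
    show "AE w in law x. indicator A' (restrict w {0..<Suc n}) * measure (Q (pos (w n))) \<Gamma> = indicator A w * measure (Q (pos (w n))) \<Gamma>"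
      using AE_good[of x] by eventually_elim (auto simp: AA split: split_indicator)
    have "(\<lambda>w. indicator A' (restrict w {0..<Suc n}) :: real) \<in> borel_measurable Full"
      by (rule measurable_compose[OF measurable_restrict_Full]) measurable
    then show "(\<lambda>w. indicator A' (restrict w {0..<Suc n}) * measure (Q (pos (w n))) \<Gamma>) \<in> borel_measurable (law x)" by measurable
  qed measurable
  finally show ?thesis .
qed

end

section \<open>Non-explosion and exceptional sets\<close>

text \<open>Around each time the one-sided limits confine the path to a single set of the increasing
  sequence; a bisection argument makes this local bound global on [0, T]. The guard
  \<open>0 \<le> t\<close> admits intervals that reach below 0.\<close>

lemma cadlag_range_in_exhaustion:
  fixes w :: "real \<Rightarrow> 'a::metric_space"
  assumes w: "w \<in> cadlag_paths UNIV" and O: "\<And>m. open (O' m)" "\<And>m. O' m \<subseteq> O' (Suc m)" "(\<Union>m. O' m) = UNIV" and T: "0 \<le> T"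
  shows "\<exists>m. \<forall>t\<in>{0..T}. w t \<in> O' m"
proof -
  have mono: "O' m \<subseteq> O' n" if "m \<le> n" for m n using lift_Suc_mono_le[of O', OF O(2) that] .
  have ex: "\<exists>m. x \<in> O' m" for x using O(3) by auto
  have "\<exists>m. \<forall>t\<in>{0..T}. 0 \<le> t \<longrightarrow> w t \<in> O' m"
  proof (rule Bolzano[of 0 T "\<lambda>a b. \<exists>m. \<forall>t\<in>{a..b}. 0 \<le> t \<longrightarrow> w t \<in> O' m"])
    fix a b c assume "\<exists>m. \<forall>t\<in>{a..b}. 0 \<le> t \<longrightarrow> w t \<in> O' m" "\<exists>m. \<forall>t\<in>{b..c}. 0 \<le> t \<longrightarrow> w t \<in> O' m" "a \<le> b" "b \<le> c"
    then obtain m n where mn: "\<And>t. t \<in> {a..b} \<Longrightarrow> 0 \<le> t \<Longrightarrow> w t \<in> O' m" "\<And>t. t \<in> {b..c} \<Longrightarrow> 0 \<le> t \<Longrightarrow> w t \<in> O' n" by blast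
    have "w t \<in> O' (max m n)" if "t \<in> {a..c}" "0 \<le> t" for t
    proof (cases "t \<le> b")
      case True
      then have "w t \<in> O' m" using mn(1)[of t] that by simp
      then show ?thesis using mono[of m "max m n"] by auto
    next
      case False
      then have "w t \<in> O' n" using mn(2)[of t] that by simp
      then show ?thesis using mono[of n "max m n"] by auto
    qed
    then show "\<exists>m. \<forall>t\<in>{a..c}. 0 \<le> t \<longrightarrow> w t \<in> O' m" by blast
  next
    fix x :: real assume x: "0 \<le> x" "x \<le> T"
    obtain m0 where m0: "w x \<in> O' m0" using ex by blast
    have "\<forall>\<^sub>F s in at_right x. w s \<in> O' m0"
      using topological_tendstoD[OF cadlag_pathsD(2)[OF w x(1)] O(1) m0] .
    then obtain b where b: "x < b" "\<And>s. x < s \<Longrightarrow> s < b \<Longrightarrow> w s \<in> O' m0" unfolding eventually_at_right_field by blast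
    obtain c m1 where c: "c < x" "\<And>s. c < s \<Longrightarrow> s < x \<Longrightarrow> 0 \<le> s \<Longrightarrow> w s \<in> O' m1"
    proof (cases "x = 0")
      case True
      then show ?thesis using that[of "-1" 0] by auto
    next
      case False
      then obtain l where l: "(w \<longlongrightarrow> l) (at_left x)" using cadlag_pathsD(3)[OF w, of x] x by auto
      obtain m1 where m1: "l \<in> O' m1" using ex by blast
      have "\<forall>\<^sub>F s in at_left x. w s \<in> O' m1" using topological_tendstoD[OF l O(1) m1] .
      then obtain c where "c < x" "\<And>s. c < s \<Longrightarrow> s < x \<Longrightarrow> w s \<in> O' m1" unfolding eventually_at_left_field by blast
      then show ?thesis using that by blast
    qed
    \<comment> \<open>An interval around x shorter than both distances stays between c and
      b.\<close>
    have "\<exists>m. \<forall>t\<in>{a'..b'}. 0 \<le> t \<longrightarrow> w t \<in> O' m" if ab: "a' \<le> x" "x \<le> b'" "b' - a' < min (b - x) (x - c)" for a' b'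
    proof (intro exI[of _ "max m0 m1"] ballI impI)
      fix t assume t: "t \<in> {a'..b'}" "0 \<le> t"
      have "w t \<in> O' m0 \<or> w t \<in> O' m1"
        using b(2)[of t] c(2)[of t] m0 t ab by (cases t x rule: linorder_cases) auto
      then show "w t \<in> O' (max m0 m1)" using mono[of m0 "max m0 m1"] mono[of m1 "max m0 m1"] by auto
    qed
    then show "\<exists>d>0. \<forall>a b. a \<le> x \<and> x \<le> b \<and> b - a < d \<longrightarrow> (\<exists>m. \<forall>t\<in>{a..b}. 0 \<le> t \<longrightarrow> w t \<in> O' m)"
      using b(1) c(1) by (intro exI[of _ "min (b - x) (x - c)"]) auto
  qed (rule T)
  then show ?thesis by auto
qed

lemma exit_time_tendsto_infinity:
  fixes w :: "real \<Rightarrow> 'a::metric_space"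
  assumes w: "w \<in> cadlag_paths UNIV" and O: "relatively_compact_exhaustion O'"
  shows "(\<lambda>m. exit_time (O' m) w) \<longlonglongrightarrow> \<infinity>"
  unfolding tendsto_PInfty
proof
  fix r :: real
  have O1: "open (O' m)" "O' m \<subseteq> O' (Suc m)" "(\<Union>m. O' m) = UNIV" for m
    using O closure_subset[of "O' m"] unfolding relatively_compact_exhaustion_def by blast+
  obtain m where m: "\<forall>t\<in>{0..\<bar>r\<bar> + 1}. w t \<in> O' m"
    using cadlag_range_in_exhaustion[OF w O1, of "\<bar>r\<bar> + 1"] by force
  have "ereal r < exit_time (O' n) w" if "m \<le> n" for n
  proof -
    have "O' m \<subseteq> O' n" using lift_Suc_mono_le[of O', OF O1(2) that] .
    then have "ereal (\<bar>r\<bar> + 1) \<le> exit_time (O' n) w"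
      unfolding exit_time_def using m by (intro Inf_greatest) (force simp: not_le[symmetric])
    then show ?thesis by (rule less_le_trans[rotated]) simp
  qed
  then show "\<forall>\<^sub>F n in sequentially. ereal r < exit_time (O' n) w" unfolding eventually_sequentially by blast
qed

text \<open>Take a countable base of relatively compact open sets; each new set of the sequence
  swallows the closures of its predecessor and of the next base set.\<close>

lemma relatively_compact_exhaustion_exists:
  assumes lc: "locally compact (UNIV :: 'a::{metric_space, second_countable_topology} set)"
  shows "\<exists>O' :: nat \<Rightarrow> 'a set. relatively_compact_exhaustion O'"
proof -
  have nb: "\<exists>V. open V \<and> compact (closure V) \<and> x \<in> V" for x :: 'a
  proof -
    obtain u v where uv: "open u" "compact v" "x \<in> u" "u \<subseteq> v"
      using lc[unfolded locally_def, rule_format, of UNIV x] by auto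
    have "closure u \<subseteq> v" using uv by (intro closure_minimal compact_imp_closed)
    then have "compact (closure u)" using compact_Int_closed[OF uv(2) closed_closure[of u]] by (simp add: Int_absorb1)
    then show ?thesis using uv by blast
  qed
  have cov: "\<exists>V. open V \<and> compact (closure V) \<and> K \<subseteq> V" if K: "compact K" for K :: "'a set"
  proof -
    define \<C> where "\<C> = {V :: 'a set. open V \<and> compact (closure V)}"
    have "K \<subseteq> \<Union>\<C>" using nb by (auto simp: \<C>_def)
    moreover have "\<And>V. V \<in> \<C> \<Longrightarrow> open V" by (auto simp: \<C>_def)
    ultimately obtain \<D> where D: "\<D> \<subseteq> \<C>" "finite \<D>" "K \<subseteq> \<Union>\<D>" using compactE[OF K, of \<C>] by metis
    have c: "compact (\<Union>V\<in>\<D>. closure V)" using D by (intro compact_UN) (auto simp: \<C>_def)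
    have "closure (\<Union>\<D>) \<subseteq> (\<Union>V\<in>\<D>. closure V)"
      using closure_subset by (intro closure_minimal compact_imp_closed[OF c]) blast
    then have "compact (closure (\<Union>\<D>))" using compact_Int_closed[OF c closed_closure[of "\<Union>\<D>"]] by (simp add: Int_absorb1)
    then show ?thesis using D by (intro exI[of _ "\<Union>\<D>"]) (auto simp: \<C>_def)
  qed
  obtain B :: "'a set set" where cB: "countable B" and tB: "topological_basis B" using ex_countable_basis by blast
  have B: "countable B" "\<And>V. V \<in> B \<Longrightarrow> open V" "\<And>U x. open U \<Longrightarrow> x \<in> U \<Longrightarrow> \<exists>V\<in>B. x \<in> V \<and> V \<subseteq> U"
    using cB topological_basis_open[OF tB] topological_basisE[OF tB] by metis+
  \<comment> \<open>The empty set is added so that \<open>from_nat_into\<close> enumerates a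
    nonempty family.\<close>
  define B' where "B' = insert {} {V\<in>B. compact (closure V)}"
  have B': "countable B'" "B' \<noteq> {}" using B(1) by (auto simp: B'_def)
  define U where "U = from_nat_into B'"
  have U: "open (U n)" "compact (closure (U n))" for n
    using from_nat_into[OF B'(2), of n] B(2) by (auto simp: U_def B'_def)
  have Ucov: "\<exists>n. x \<in> U n" for x
  proof -
    obtain V where V: "open V" "compact (closure V)" "x \<in> V" using nb by blast
    obtain V' where V': "V' \<in> B" "x \<in> V'" "V' \<subseteq> V" using B(3)[OF V(1,3)] by blast
    have "compact (closure V')"
      using compact_Int_closed[OF V(2) closed_closure[of V']] closure_mono[OF V'(3)] by (simp add: Int_absorb1)
    then have "V' \<in> B'" using V' by (simp add: B'_def)
    then show ?thesis using V'(2) from_nat_into_surj[OF B'(1)] unfolding U_def by metis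
  qed
  define nxt where "nxt K = (SOME V. open V \<and> compact (closure V) \<and> K \<subseteq> V)" for K :: "'a set"
  have nxt: "open (nxt K)" "compact (closure (nxt K))" "K \<subseteq> nxt K" if "compact K" for K
    using someI_ex[OF cov[OF that]] unfolding nxt_def by auto
  define O' where "O' = rec_nat {} (\<lambda>n V. nxt (closure V \<union> closure (U n)))"
  have O0: "O' 0 = {}" and OS: "O' (Suc n) = nxt (closure (O' n) \<union> closure (U n))" for n by (simp_all add: O'_def)
  have P: "open (O' n) \<and> compact (closure (O' n))" for n
  proof (induction n)
    case (Suc n)
    then have "compact (closure (O' n) \<union> closure (U n))" using U by (intro compact_Un) auto
    then show ?case unfolding OS using nxt by auto
  qed (simp add: O0)
  have sub: "closure (O' n) \<union> closure (U n) \<subseteq> O' (Suc n)" for n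
    unfolding OS by (rule nxt(3)) (use P U in \<open>auto intro: compact_Un\<close>)
  have "(\<Union>m. O' m) = UNIV"
  proof (intro equalityI subsetI UNIV_I)
    fix x obtain n where "x \<in> U n" using Ucov by blast
    then have "x \<in> O' (Suc n)" using sub[of n] closure_subset[of "U n"] by blast
    then show "x \<in> (\<Union>m. O' m)" by blast
  qed
  then show ?thesis unfolding relatively_compact_exhaustion_def using P sub by blast
qed

section \<open>The completed probability space of the process\<close>

context jump_diffusion
begin

text \<open>Restriction to \<open>good\<close> removes the exceptional samples once and for all; the
  completion is what the usual augmentation is taken in.\<close>

abbreviation Rg where "Rg x \<equiv> restrict_space (law x) good"
abbreviation Pr where "Pr x \<equiv> completion (Rg x)"

lemma good_subset: "good \<subseteq> space Full" using goodD(1) by blast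

lemma space_Rg [simp]: "space (Rg x) = good"
  using good_subset by (simp add: space_restrict_space Int_absorb2)

lemma sets_Rg: "sets (Rg x) = sets (restrict_space Full good)"
  by (rule sets_restrict_space_cong) simp

lemma sets_Rg_iff: "A \<in> sets (Rg x) \<longleftrightarrow> A \<in> sets Full \<and> A \<subseteq> good"
  using good_sets good_subset by (subst sets_restrict_space_iff) (auto simp: Int_absorb2)

lemma sets_PrI: "A \<in> sets Full \<Longrightarrow> A \<subseteq> good \<Longrightarrow> A \<in> sets (Pr x)"
  using sets_Rg_iff by (intro sets_completionI_sets) auto

lemma prob_Rg: "prob_space (Rg x)"
proof -
  interpret prob_space "law x" by (rule prob_law)
  have "emeasure (law x) good = 1" using AE_good[of x] emeasure_eq_1_AE by auto
  then show ?thesis using good_subset by (intro prob_spaceI) (simp add: emeasure_restrict_space)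
qed

lemma prob_Pr: "prob_space (Pr x)"
  by (rule prob_space.prob_space_completion[OF prob_Rg])

lemma complete_Pr: "complete_measure (Pr x)"
  by (rule completion.complete_measure_axioms)

lemma AE_Pr: "(AE w in law x. P w) \<Longrightarrow> AE w in Pr x. P w"
  using good_sets good_subset by (intro AE_completion) (auto simp: AE_restrict_space_iff Int_absorb2)

lemma AE_Pr_good: "AE w in Pr x. w \<in> good"
  by (rule AE_Pr[OF AE_good])

lemma measurable_Pr: "f \<in> restrict_space Full good \<rightarrow>\<^sub>M L \<Longrightarrow> f \<in> Pr x \<rightarrow>\<^sub>M L"
  by (intro measurable_completion) (simp add: measurable_cong_sets[OF sets_Rg refl])

lemma measurable_Pr_Full: "f \<in> Full \<rightarrow>\<^sub>M L \<Longrightarrow> f \<in> Pr x \<rightarrow>\<^sub>M L"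
  by (intro measurable_Pr measurable_restrict_space1)

lemma integral_Pr:
  fixes f :: "_ \<Rightarrow> real"
  assumes f: "f \<in> borel_measurable Full"
  shows "(\<integral>w. f w \<partial>Pr x) = (\<integral>w. f w \<partial>law x)"
proof -
  have "(\<integral>w. f w \<partial>Pr x) = (\<integral>w. f w \<partial>Rg x)"
    using measurable_restrict_space1[OF f, of good] by (intro integral_completion) (simp add: measurable_cong_sets[OF sets_Rg refl])
  also have "\<dots> = (\<integral>w. indicator good w *\<^sub>R f w \<partial>law x)"
    using good_subset by (intro integral_restrict_space) (simp add: Int_absorb2)
  also have "\<dots> = (\<integral>w. f w \<partial>law x)"
  proof (rule integral_cong_AE)
    show "AE w in law x. indicator good w *\<^sub>R f w = f w" using AE_good[of x] by eventually_elim simp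
  qed (use f in measurable)
  finally show ?thesis .
qed

lemma integrable_Pr:
  fixes f :: "_ \<Rightarrow> real"
  assumes f: "integrable (law x) f"
  shows "integrable (Pr x) f"
proof -
  have fm: "f \<in> borel_measurable Full" using borel_measurable_integrable[OF f] by (simp add: measurable_cong_sets[OF sets_law refl])
  have "integrable (law x) (\<lambda>w. indicator good w *\<^sub>R f w)"
    by (rule integrable_mult_indicator[OF _ f]) simp
  then have "integrable (Rg x) f" using good_subset by (subst integrable_restrict_space) (simp_all add: Int_absorb2)
  moreover have "f \<in> borel_measurable (Rg x)"
    using measurable_restrict_space1[OF fm, of good] by (simp add: measurable_cong_sets[OF sets_Rg refl])
  ultimately show ?thesis by (simp add: integrable_completion)
qed

lemma proc_measurable_Pr: "proc \<in> Pr x \<rightarrow>\<^sub>M skorokhod_borel UNIV"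
  by (intro measurable_Pr measurable_into_skorokhod measurable_proc)
    (use good_subset in \<open>auto simp: space_restrict_space proc_cadlag\<close>)

lemma AE_proc_start: "AE w in Pr x. proc w 0 = x"
  using AE_Pr[OF AE_law_pos0[of x]] AE_Pr_good by eventually_elim (simp add: proc_0)

lemma non_explosive_Pr:
  assumes "locally compact (UNIV :: 'a set)"
  shows "non_explosive (Pr x) proc"
  unfolding non_explosive_def
proof (intro conjI allI impI)
  show "\<exists>O' :: nat \<Rightarrow> 'a set. relatively_compact_exhaustion O'" by (rule relatively_compact_exhaustion_exists[OF assms])
  fix O' :: "nat \<Rightarrow> 'a set" assume O: "relatively_compact_exhaustion O'"
  show "AE w in Pr x. (\<lambda>m. exit_time (O' m) (proc w)) \<longlonglongrightarrow> \<infinity>"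
    using AE_Pr_good by eventually_elim (rule exit_time_tendsto_infinity[OF proc_cadlag O])
qed

text \<open>Preimages under \<open>proc\<close> are measurable before completion and do not depend
  on x, so measurability in x is inherited from \<open>law\<close>.\<close>

lemma law_of_proc_measurable:
  "(\<lambda>x. distr (Pr x) (skorokhod_borel UNIV) proc) \<in> borel \<rightarrow>\<^sub>M prob_algebra (skorokhod_borel UNIV)"
proof (rule measurable_prob_algebraI)
  show p: "prob_space (distr (Pr x) (skorokhod_borel UNIV) proc)" for x
    by (rule prob_space.prob_space_distr[OF prob_Pr proc_measurable_Pr])
  show "(\<lambda>x. distr (Pr x) (skorokhod_borel UNIV) proc) \<in> borel \<rightarrow>\<^sub>M subprob_algebra (skorokhod_borel UNIV)"
  proof (rule measurable_subprob_algebra)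
    fix A assume A: "A \<in> sets (skorokhod_borel (UNIV :: 'a set))"
    let ?A = "proc -` A \<inter> good"
    have "proc \<in> restrict_space Full good \<rightarrow>\<^sub>M skorokhod_borel UNIV"
      by (intro measurable_into_skorokhod measurable_proc) (use good_subset in \<open>auto simp: space_restrict_space proc_cadlag\<close>)
    from measurable_sets[OF this A] have m: "?A \<in> sets (restrict_space Full good)"
      using good_subset by (simp add: space_restrict_space Int_absorb2)
    then have mF: "?A \<in> sets Full" using sets_Rg sets_Rg_iff by blast
    have "emeasure (distr (Pr x) (skorokhod_borel UNIV) proc) A = emeasure (law x) ?A" for x
    proof -
      have "emeasure (distr (Pr x) (skorokhod_borel UNIV) proc) A = emeasure (Pr x) ?A"
        by (subst emeasure_distr[OF proc_measurable_Pr A]) simp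
      also have "\<dots> = emeasure (Rg x) ?A" using m by (subst emeasure_completion) (auto simp: sets_Rg main_part)
      also have "\<dots> = emeasure (law x) ?A" using good_subset by (intro emeasure_restrict_space) (auto simp: Int_absorb2)
      finally show ?thesis .
    qed
    then show "(\<lambda>x. emeasure (distr (Pr x) (skorokhod_borel UNIV) proc) A) \<in> borel_measurable borel"
      using measurable_emeasure_kernel[OF measurable_prob_algebraD[OF measurable_law] mF] by simp
  qed (auto intro: prob_space_imp_subprob_space[OF p])
qed

lemma measurable_ety: "ety k \<in> Pr x \<rightarrow>\<^sub>M count_space UNIV"
proof -
  have "ety k \<in> Full \<rightarrow>\<^sub>M count_space E" by measurable
  then have "ety k \<in> Pr x \<rightarrow>\<^sub>M count_space E" by (rule measurable_Pr_Full)
  moreover have "(\<lambda>e. e) \<in> count_space E \<rightarrow>\<^sub>M count_space UNIV" by simp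
  ultimately show ?thesis by (rule measurable_compose)
qed

lemma AE_jumps:
  assumes R: "Measurable.pred (borel \<Otimes>\<^sub>M EM) (\<lambda>(y, p). R y p)" and "\<And>y. 0 < \<Lambda> y \<Longrightarrow> AE p in \<pi> y. R y p"
  shows "AE w in law x. \<forall>n. 0 < clk (w (Suc n)) \<longrightarrow> R (pth (w (Suc n)) (clk (w (Suc n)))) (mrk (w (Suc n)))"
  unfolding AE_all_countable
proof
  fix n
  have m: "Measurable.pred (borel \<Otimes>\<^sub>M St) (\<lambda>(y :: 'a, z). 0 < clk z \<longrightarrow> R (ev (pth z) (clk z)) (mrk z))"
  proof -
    have "Measurable.pred (borel \<Otimes>\<^sub>M St) (\<lambda>x :: 'a \<times> _. R (ev (pth (snd x)) (clk (snd x))) (mrk (snd x)))"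
      using measurable_compose[OF _ R, of "\<lambda>x. (ev (pth (snd x)) (clk (snd x)), mrk (snd x))" "borel \<Otimes>\<^sub>M St"] by simp
    then show ?thesis unfolding split_beta' by measurable
  qed
  have "AE z in stage y. 0 < clk z \<longrightarrow> R (ev (pth z) (clk z)) (mrk z)" for y
  proof -
    have "AE z in stage y. 0 < clk z \<longrightarrow> R (pth z (clk z)) (mrk z)"
      by (rule AE_stage_jump[OF R]) (rule assms(2))
    then show ?thesis by (rule AE_mp) (auto intro!: AE_I2 simp: ev_nonneg)
  qed
  from AE_law_stage[where P="\<lambda>y z. 0 < clk z \<longrightarrow> R (ev (pth z) (clk z)) (mrk z)", OF m this]
  show "AE w in law x. 0 < clk (w (Suc n)) \<longrightarrow> R (pth (w (Suc n)) (clk (w (Suc n)))) (mrk (w (Suc n)))"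
    by (rule AE_mp) (auto intro!: AE_I2 simp: ev_nonneg)
qed

text \<open>
  A right-continuous path is continuous iff on each bounded interval it is uniformly continuous along
  the rationals; hence continuity is a measurable property.
\<close>

lemma measurable_continuous_path: "Measurable.pred N (\<lambda>\<eta>. continuous_on {0..} \<eta>)"
proof -
  let ?P = "\<lambda>\<eta> (T::nat) (k::nat) (m::nat) (r::rat) (s::rat). 0 \<le> r \<and> 0 \<le> s \<and> of_rat r \<le> real T \<and> of_rat s \<le> real T \<and> \<bar>of_rat r - of_rat s\<bar> < 1 / real (Suc m) \<longrightarrow>
      dist (ev \<eta> (of_rat r)) (ev \<eta> (of_rat s)) \<le> 1 / real (Suc k)"
  have iff: "continuous_on {0..} \<eta> \<longleftrightarrow> (\<forall>T k. \<exists>m. \<forall>r s. ?P \<eta> T k m r s)" (is "?c \<longleftrightarrow> ?u") if \<eta>: "\<eta> \<in> \<Omega>" for \<eta>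
  proof
    assume c: ?c
    show ?u
    proof (intro allI)
      fix T k :: nat
      have "uniformly_continuous_on {0..real T} \<eta>"
        by (intro compact_uniformly_continuous continuous_on_subset[OF c]) auto
      moreover have "0 < 1 / real (Suc k)" by simp
      ultimately obtain d where d: "d > 0" "\<And>x y. x \<in> {0..real T} \<Longrightarrow> y \<in> {0..real T} \<Longrightarrow> dist y x < d \<Longrightarrow> dist (\<eta> y) (\<eta> x) < 1 / real (Suc k)"
        unfolding uniformly_continuous_on_def by metis
      obtain m where m: "1 / real (Suc m) < d" using nat_approx_posE[OF d(1)] by blast
      have "?P \<eta> T k m r s" for r s
        using d(2)[of "of_rat s" "of_rat r"] m by (auto simp: ev_nonneg dist_real_def intro!: less_imp_le)
      then show "\<exists>m. \<forall>r s. ?P \<eta> T k m r s" by blast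
    qed
  next
    assume u: ?u
    show ?c
      unfolding continuous_on_iff
    proof (intro ballI allI impI)
      fix t \<epsilon> :: real assume t: "t \<in> {0..}" and \<epsilon>: "0 < \<epsilon>"
      obtain k where k: "1 / real (Suc k) < \<epsilon>" using nat_approx_posE[OF \<epsilon>] by blast
      obtain T :: nat where T: "t + 2 < real T" using reals_Archimedean2 by blast
      obtain m where m: "\<And>r s. ?P \<eta> T k m r s" using u by blast
      have close: "dist (\<eta> a) (\<eta> b) \<le> 1 / real (Suc k)"
        if ab: "0 \<le> a" "0 \<le> b" "a < real T" "b < real T" "\<bar>a - b\<bar> < 1 / real (Suc m)" for a b
      proof -
        \<comment> \<open>The rationals that approach a and b from the right overshoot by less than
          \<gamma>, which keeps them below T and closer than 1/(m+1) to each other.\<close>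
        define \<gamma> where "\<gamma> = min (min (real T - a) (real T - b)) ((1 / real (Suc m) - \<bar>a - b\<bar>) / 2)"
        have \<gamma>: "0 < \<gamma>" "\<gamma> \<le> real T - a" "\<gamma> \<le> real T - b" using ab by (auto simp: \<gamma>_def)
        have \<gamma>': "\<gamma> \<le> (1 / real (Suc m) - \<bar>a - b\<bar>) / 2" unfolding \<gamma>_def by (rule min.cobounded2)
        have "\<forall>n. \<exists>r s. a < of_rat r \<and> of_rat r < a + \<gamma> / real (Suc n) \<and> b < of_rat s \<and> of_rat s < b + \<gamma> / real (Suc n)"
          using of_rat_dense[of a] of_rat_dense[of b] \<gamma>(1) by (metis add_strict_left_mono add.right_neutral divide_pos_pos of_nat_0_less_iff zero_less_Suc)
        then obtain r s where rs: "\<And>n. a < of_rat (r n)" "\<And>n. of_rat (r n) < a + \<gamma> / real (Suc n)" "\<And>n. b < of_rat (s n)" "\<And>n. of_rat (s n) < b + \<gamma> / real (Suc n)"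
          by metis
        have lim: "filterlim (\<lambda>n. of_rat (f n)) (at_right c) sequentially"
          if "\<And>n. c < of_rat (f n)" "\<And>n. of_rat (f n) < c + \<gamma> / real (Suc n)" for c :: real and f :: "nat \<Rightarrow> rat"
        proof (rule filterlim_at_withinI)
          have "(\<lambda>n. c + \<gamma> * (1 / real (Suc n))) \<longlonglongrightarrow> c + \<gamma> * 0"
            using LIMSEQ_inverse_real_of_nat by (intro tendsto_intros) (simp add: inverse_eq_divide)
          then have "(\<lambda>n. c + \<gamma> / real (Suc n)) \<longlonglongrightarrow> c" by simp
          then show "(\<lambda>n. of_rat (f n)) \<longlonglongrightarrow> c"
            by (rule tendsto_sandwich[rotated 2, OF tendsto_const[of c]]) (use that less_imp_le in \<open>auto intro!: always_eventually\<close>)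
          show "\<forall>\<^sub>F n in sequentially. of_rat (f n) \<in> {c<..} - {c}" using that(1) by (intro always_eventually) (auto simp: less_imp_neq)
        qed
        have "dist (\<eta> (of_rat (r n))) (\<eta> (of_rat (s n))) \<le> 1 / real (Suc k)" for n
        proof -
          have "\<gamma> / real (Suc n) \<le> \<gamma> / 1" using \<gamma>(1) by (intro divide_left_mono) auto
          then have "of_rat (r n) < a + \<gamma>" "of_rat (s n) < b + \<gamma>" using rs(2,4)[of n] by auto
          moreover have 0: "(0::real) \<le> of_rat (r n)" "(0::real) \<le> of_rat (s n)"
            by (rule order_trans[OF ab(1) less_imp_le[OF rs(1)]], rule order_trans[OF ab(2) less_imp_le[OF rs(3)]])
          ultimately have "of_rat (r n) \<le> real T" "of_rat (s n) \<le> real T" "\<bar>of_rat (r n) - of_rat (s n) :: real\<bar> < \<bar>a - b\<bar> + \<gamma>"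
            using rs(1,3)[of n] \<gamma> by linarith+
          moreover have "z + x \<le> y" if "x \<le> (y - z) / 2" "z < y" for x y z :: real using that by (simp add: field_simps)
          from this[OF \<gamma>' ab(5)] have "\<bar>a - b\<bar> + \<gamma> \<le> 1 / real (Suc m)" .
          ultimately have "of_rat (r n) \<le> real T" "of_rat (s n) \<le> real T" "\<bar>of_rat (r n) - of_rat (s n) :: real\<bar> < 1 / real (Suc m)"
            by (simp_all only: less_le_trans)
          then show ?thesis using m[of "r n" "s n"] 0 by (simp add: ev_nonneg)
        qed
        moreover have "(\<lambda>n. dist (\<eta> (of_rat (r n))) (\<eta> (of_rat (s n)))) \<longlonglongrightarrow> dist (\<eta> a) (\<eta> b)"
          by (intro tendsto_dist filterlim_compose[OF right_cont[OF \<eta> ab(1)] lim[OF rs(1,2)]]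
              filterlim_compose[OF right_cont[OF \<eta> ab(2)] lim[OF rs(3,4)]])
        ultimately show ?thesis by (intro LIMSEQ_le_const2) auto
      qed
      show "\<exists>d>0. \<forall>x'\<in>{0..}. dist x' t < d \<longrightarrow> dist (\<eta> x') (\<eta> t) < \<epsilon>"
      proof (intro exI[of _ "1 / real (Suc m)"] conjI ballI impI)
        fix x' assume x': "x' \<in> {0..}" "dist x' t < 1 / real (Suc m)"
        have "1 / real (Suc m) \<le> 1" by simp
        then have "x' < real T" using x'(2)[unfolded dist_real_def] T by linarith
        then show "dist (\<eta> x') (\<eta> t) < \<epsilon>" using close[of x' t] x' t T k by (auto simp: dist_real_def)
      qed simp
    qed
  qed
  have "Measurable.pred N (\<lambda>\<eta>. \<forall>T k. \<exists>m. \<forall>r s. ?P \<eta> T k m r s)" by measurable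
  then show ?thesis by (rule measurable_cong[THEN iffD1, rotated]) (use iff in auto)
qed

lemma AE_continuous_stages:
  assumes "\<And>y. AE \<eta> in Q y. continuous_on {0..} \<eta>"
  shows "AE w in law x. \<forall>n. continuous_on {0..} (pth (w (Suc n)))"
  unfolding AE_all_countable
proof
  fix n
  have m: "Measurable.pred St (\<lambda>z. continuous_on {0..} (pth z))"
    by (rule measurable_compose[OF measurable_fst measurable_continuous_path])
  have "AE z in stage y. continuous_on {0..} (pth z)" for y
    unfolding AE_stage_iff[OF m] using assms[of y] by eventually_elim simp
  moreover have "Measurable.pred (borel \<Otimes>\<^sub>M St) (\<lambda>(y :: 'a, z). continuous_on {0..} (pth z))"
    using measurable_compose[OF measurable_snd m] by (simp add: split_beta')
  ultimately show "AE w in law x. continuous_on {0..} (pth (w (Suc n)))"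
    by (intro AE_law_stage[where P="\<lambda>y z. continuous_on {0..} (pth z)"])
qed

text \<open>With continuous stages and jumps that move the process, the discontinuities are the jump times.\<close>

definition regular :: "('a, 'e) sample \<Rightarrow> bool" where
  "regular w \<longleftrightarrow> w \<in> good \<and> (\<forall>n. continuous_on {0..} (pth (w (Suc n)))) \<and>
     (\<forall>n. 0 < clk (w (Suc n)) \<longrightarrow> pos (w (Suc n)) \<noteq> pth (w (Suc n)) (clk (w (Suc n))))"

lemma regular_left_lim:
  assumes r: "regular w" and n: "jump_time n w < ereal t" "ereal t \<le> jump_time (Suc n) w"
  shows "left_lim (proc w) t = pth (w (Suc n)) (t - real_of_ereal (jump_time n w))"
proof -
  have w: "w \<in> good" and c: "continuous_on {0..} (pth (w (Suc n)))" using r by (auto simp: regular_def)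
  obtain c where c': "jump_time n w = ereal c" "0 \<le> c" "real_of_ereal (jump_time n w) = c"
    using stage_interval[OF less_trans[OF n(1)]] by auto
  have pos: "0 < t - c" using n(1) c' by simp
  have "(pth (w (Suc n)) \<longlongrightarrow> pth (w (Suc n)) (t - c)) (at (t - c) within {0..})"
    using c pos by (auto simp: continuous_on_def)
  then have "(pth (w (Suc n)) \<longlongrightarrow> pth (w (Suc n)) (t - c)) (at (t - c) within {0..t - c})"
    by (rule tendsto_within_subset) auto
  then have "(pth (w (Suc n)) \<longlongrightarrow> pth (w (Suc n)) (t - c)) (at_left (t - c))"
    using pos by (simp add: at_within_Icc_at_left)
  then have "(proc w \<longlongrightarrow> pth (w (Suc n)) (t - c)) (at_left t)"
    using proc_left_limit[OF w n] c' by simp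
  then have "Lim (at_left t) (proc w) = pth (w (Suc n)) (t - c)" by (intro tendsto_Lim) auto
  then show ?thesis using c' n(1) by (simp add: left_lim_def)
qed

lemma regular_jump_times:
  assumes r: "regular w"
  shows "{t. 0 < t \<and> proc w t \<noteq> left_lim (proc w) t} = {t. \<exists>n\<ge>1. jump_time n w = ereal t}"
proof (intro equalityI subsetI)
  have w: "w \<in> good" using r by (simp add: regular_def)
  fix t assume "t \<in> {t. 0 < t \<and> proc w t \<noteq> left_lim (proc w) t}"
  then have t: "0 < t" "proc w t \<noteq> left_lim (proc w) t" by auto
  obtain n where n: "jump_time n w < ereal t" "ereal t \<le> jump_time (Suc n) w" using good_left_stage[OF w t(1)] .
  have "\<not> ereal t < jump_time (Suc n) w"
    using regular_left_lim[OF r n] proc_eq[OF less_imp_le[OF n(1)]] t(2) by auto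
  then show "t \<in> {t. \<exists>n\<ge>1. jump_time n w = ereal t}" using n(2) by (intro CollectI exI[of _ "Suc n"]) auto
next
  have w: "w \<in> good" using r by (simp add: regular_def)
  fix t assume "t \<in> {t. \<exists>n\<ge>1. jump_time n w = ereal t}"
  then obtain n where "1 \<le> n" "jump_time n w = ereal t" by auto
  then obtain m where m: "jump_time (Suc m) w = ereal t" by (cases n) auto
  then have "jump_time m w < \<infinity>" using jump_time_Suc_inf[of m w] by auto
  then obtain c where c: "jump_time m w = ereal c" "0 \<le> c" "real_of_ereal (jump_time m w) = c" using stage_interval by blast
  have k: "0 < clk (w (Suc m))" "t = c + clk (w (Suc m))" using m c by (auto simp: jump_time.simps(2) split: if_splits)
  then have "left_lim (proc w) t = pth (w (Suc m)) (clk (w (Suc m)))"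
    using regular_left_lim[OF r, of m t] m c by simp
  moreover have "proc w t = pos (w (Suc m))" using proc_jump[OF w, of "Suc m"] m by simp
  ultimately show "t \<in> {t. 0 < t \<and> proc w t \<noteq> left_lim (proc w) t}" using r k c by (auto simp: regular_def)
qed

text \<open>The integrands differ at jump times only, and these are countably many. This links the
  compensator, stated with left limits, to the drift integral of the martingale.\<close>

lemma regular_LINT_left_lim:
  fixes g :: "'a \<Rightarrow> real"
  assumes r: "regular w"
  shows "(LINT s:{0..t}|lborel. g (left_lim (proc w) s)) = (LINT s:{0..t}|lborel. g (proc w s))"
  unfolding set_lebesgue_integral_def
proof (rule integral_discrete_difference)
  let ?X = "{t. \<exists>n\<ge>1. jump_time n w = ereal t}"
  have "?X \<subseteq> range (\<lambda>n. real_of_ereal (jump_time n w))"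
  proof
    fix s assume "s \<in> ?X"
    then obtain n where "jump_time n w = ereal s" by auto
    then have "s = real_of_ereal (jump_time n w)" by simp
    then show "s \<in> range (\<lambda>n. real_of_ereal (jump_time n w))" by (rule range_eqI)
  qed
  then show "countable ?X" by (rule countable_subset) simp
  fix s assume s: "s \<notin> ?X"
  have "left_lim (proc w) s = proc w s" if "0 \<le> s"
  proof (cases "s = 0")
    case False
    have "s \<notin> {t. 0 < t \<and> proc w t \<noteq> left_lim (proc w) t}" using s unfolding regular_jump_times[OF r] .
    then show ?thesis using that False by auto
  qed (simp add: left_lim_def)
  then show "indicator {0..t} s *\<^sub>R g (left_lim (proc w) s) = indicator {0..t} s *\<^sub>R g (proc w s)"
    by (auto split: split_indicator)
qed auto

lemma jump_time_tendsto:
  assumes "w \<in> good"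
  shows "(\<lambda>n. jump_time n w) \<longlonglongrightarrow> \<infinity>"
  unfolding tendsto_PInfty eventually_sequentially
proof
  fix r
  obtain m where "ereal (max 0 r) < jump_time (Suc m) w" using good_stage[OF assms, of "max 0 r"] by auto
  moreover have "ereal r \<le> ereal (max 0 r)" by simp
  ultimately show "\<exists>N. \<forall>n\<ge>N. ereal r < jump_time n w"
    using jump_time_mono[of "Suc m" _ w] less_le_trans le_less_trans by metis
qed

section \<open>Conditional law of the next path given the jump history\<close>

lemma jump_history_sets:
  "A \<in> sets (jump_history (Pr x) proc jump_time ety n) \<Longrightarrow> A \<in> sets (Pr x)"
  using history_determined_jump_history[of "Pr x" A n] history_determined_sets[of n A]
  by (intro sets_PrI) (auto simp: history_determined_def)

lemma space_jump_history: "space (jump_history M X \<tau> Y n) = space M"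
  unfolding jump_history_def by (rule space_measure_of) auto

lemma subalgebra_jump_history: "subalgebra (Pr x) (jump_history (Pr x) proc jump_time ety n)"
  using jump_history_sets by (auto simp: subalgebra_def space_jump_history)

text \<open>If the n-th jump happens by time m, the landing point is the value at time m of the
  process stopped at that jump, which is a generator of the jump history.\<close>

lemma measurable_landing_jump_history:
  assumes B: "B \<in> sets borel"
  shows "{w \<in> good. jump_time n w < \<infinity> \<and> pos (w n) \<in> B} \<in> sets (jump_history (Pr x) proc jump_time ety n)"
proof -
  let ?JH = "jump_history (Pr x) proc jump_time ety n"
  let ?G = "{(\<lambda>w. proc w (real_of_ereal (min (ereal s) (jump_time n w)))) -` B \<inter> space (Pr x) | s B. 0 \<le> s \<and> B \<in> sets borel} \<union>
      {jump_time k -` B \<inter> space (Pr x) | k B. k \<le> n \<and> B \<in> sets borel} \<union>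
      {ety k -` B \<inter> space (Pr x) | k B. 1 \<le> k \<and> k \<le> n}"
  have "sets ?JH = sigma_sets (space (Pr x)) ?G" unfolding jump_history_def by (rule sets_measure_of) auto
  then have G: "?G \<subseteq> sets ?JH" by (simp only: sigma_sets_superset_generator)
  have 1: "(\<lambda>w. proc w (real_of_ereal (min (ereal (real m)) (jump_time n w)))) -` B \<inter> space (Pr x) \<in> sets ?JH" for m
    by (rule subsetD[OF G]) (use B in \<open>auto intro!: exI[of _ "real m"]\<close>)
  have 2: "jump_time n -` {..ereal (real m)} \<inter> space (Pr x) \<in> sets ?JH" for m
    by (rule subsetD[OF G]) (auto intro!: exI[of _ n] exI[of _ "{..ereal (real m)}"])
  have "{w \<in> good. jump_time n w < \<infinity> \<and> pos (w n) \<in> B} =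
    (\<Union>m. ((\<lambda>w. proc w (real_of_ereal (min (ereal (real m)) (jump_time n w)))) -` B \<inter> space (Pr x)) \<inter>
       (jump_time n -` {..ereal (real m)} \<inter> space (Pr x)))" (is "?l = ?r")
  proof (intro equalityI subsetI)
    fix w assume "w \<in> ?l"
    then have w: "w \<in> good" "jump_time n w < \<infinity>" "pos (w n) \<in> B" by auto
    obtain c where c: "jump_time n w = ereal c" using stage_interval[OF w(2)] by blast
    obtain m :: nat where "c < real m" using reals_Archimedean2 by blast
    then show "w \<in> ?r" using w c proc_jump[OF w(1,2)] by (auto intro!: exI[of _ m] simp: min_def)
  next
    fix w assume "w \<in> ?r"
    then obtain m where m: "w \<in> good" "jump_time n w \<le> ereal (real m)" "proc w (real_of_ereal (min (ereal (real m)) (jump_time n w))) \<in> B" by auto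
    have "jump_time n w < \<infinity>" using m(2) by (rule le_less_trans) simp
    then show "w \<in> ?l" using m proc_jump[OF m(1), of n] by (simp add: min_absorb2)
  qed
  also have "\<dots> \<in> sets ?JH" by (intro sets.countable_UN'' countableI_type sets.Int[OF 1 2])
  finally show ?thesis .
qed

text \<open>R belongs to the jump history, so every test event can be intersected with it, and
  \<open>integral_history_path\<close> gives the integrals.\<close>

lemma stage_path_given_history:
  fixes n :: nat
  assumes B[measurable]: "B \<in> sets borel" and \<Gamma>[measurable]: "\<Gamma> \<in> sets N"
  defines "R \<equiv> {w \<in> good. jump_time n w < \<infinity> \<and> pos (w n) \<in> B}"
  shows "AE w in Pr x. real_cond_exp (Pr x) (jump_history (Pr x) proc jump_time ety n)
     (indicator {w \<in> R. pth (w (Suc n)) \<in> \<Gamma>}) w = indicator R w * measure (Q (pos (w n))) \<Gamma>"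
proof -
  let ?JH = "jump_history (Pr x) proc jump_time ety n"
  interpret prob_space "Pr x" by (rule prob_Pr)
  interpret sigma_finite_subalgebra "Pr x" ?JH
    by (intro finite_measure_subalgebra_is_sigma_finite finite_measure_subalgebra.intro
        finite_measure_subalgebra_axioms.intro subalgebra_jump_history finite_measure_axioms)
  have R: "R \<in> sets ?JH" unfolding R_def by (rule measurable_landing_jump_history[OF B])
  have spJ: "space ?JH = good" by (simp add: space_jump_history)
  have [measurable]: "(\<lambda>w. measure (Q (pos (w n))) \<Gamma>) \<in> borel_measurable Full"
    by (rule measurable_compose[OF _ measurable_measure_subprob_algebra[OF \<Gamma>]])
      (rule measurable_compose[OF _ measurable_prob_algebraD[OF Q]], measurable)
  have Qm: "(\<lambda>y. measure (Q y) \<Gamma>) \<in> borel_measurable borel"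
    by (rule measurable_compose[OF measurable_prob_algebraD[OF Q] measurable_measure_subprob_algebra[OF \<Gamma>]])
  have gm: "(\<lambda>w. indicator R w * measure (Q (pos (w n))) \<Gamma>) \<in> borel_measurable ?JH"
  proof (rule measurableI)
    fix D :: "real set" assume D: "D \<in> sets borel"
    have "{y. measure (Q y) \<Gamma> \<in> D} \<in> sets borel" using measurable_sets[OF Qm D] by (simp add: vimage_def)
    then have "B \<inter> {y. measure (Q y) \<Gamma> \<in> D} \<in> sets borel" by simp
    from measurable_landing_jump_history[OF this, of n x]
    have 1: "{w \<in> R. measure (Q (pos (w n))) \<Gamma> \<in> D} \<in> sets ?JH"
      by (rule back_subst[where P="\<lambda>A. A \<in> sets ?JH"]) (auto simp: R_def)
    have "(\<lambda>w. indicator R w * measure (Q (pos (w n))) \<Gamma>) -` D \<inter> space ?JH =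
       {w \<in> R. measure (Q (pos (w n))) \<Gamma> \<in> D} \<union> (if 0 \<in> D then space ?JH - R else {})"
      using sets.sets_into_space[OF R] by (auto split: split_indicator_asm)
    also have "\<dots> \<in> sets ?JH" using 1 R by auto
    finally show "(\<lambda>w. indicator R w * measure (Q (pos (w n))) \<Gamma>) -` D \<inter> space ?JH \<in> sets ?JH" .
  qed simp
  have RF[measurable]: "R \<in> sets Full" unfolding R_def by measurable
  have [measurable]: "(\<lambda>w. pth (w (Suc n))) \<in> Full \<rightarrow>\<^sub>M N" by measurable
  have fF: "{w \<in> R. pth (w (Suc n)) \<in> \<Gamma>} \<in> sets Full"
  proof -
    have "{w \<in> R. pth (w (Suc n)) \<in> \<Gamma>} = R \<inter> ((\<lambda>w. pth (w (Suc n))) -` \<Gamma> \<inter> space Full)"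
      using sets.sets_into_space[OF RF] by auto
    then show ?thesis by simp
  qed
  then have fP: "{w \<in> R. pth (w (Suc n)) \<in> \<Gamma>} \<in> sets (Pr x)" by (rule sets_PrI) (auto simp: R_def)
  show ?thesis
  proof (rule real_cond_exp_charact)
    fix A assume A: "A \<in> sets ?JH"
    then have AR: "A \<inter> R \<in> sets ?JH" using R by auto
    have hd: "history_determined n (A \<inter> R)" by (rule history_determined_jump_history[OF _ AR]) simp
    have [measurable]: "A \<inter> R \<in> sets Full" by (rule history_determined_sets[OF hd])
    have "(\<integral>w\<in>A. (indicator {w \<in> R. pth (w (Suc n)) \<in> \<Gamma>} w :: real) \<partial>Pr x) = (\<integral>w. indicator (A \<inter> R) w * indicator \<Gamma> (pth (w (Suc n))) \<partial>Pr x)"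
      unfolding set_lebesgue_integral_def by (intro Bochner_Integration.integral_cong) (auto split: split_indicator)
    also have "\<dots> = (\<integral>w. indicator (A \<inter> R) w * indicator \<Gamma> (pth (w (Suc n))) \<partial>law x)" by (rule integral_Pr) measurable
    also have "\<dots> = (\<integral>w. indicator (A \<inter> R) w * measure (Q (pos (w n))) \<Gamma> \<partial>law x)" by (rule integral_history_path[OF hd \<Gamma>])
    also have "\<dots> = (\<integral>w. indicator (A \<inter> R) w * measure (Q (pos (w n))) \<Gamma> \<partial>Pr x)" by (rule integral_Pr[symmetric]) measurable
    also have "\<dots> = (\<integral>w\<in>A. (indicator R w * measure (Q (pos (w n))) \<Gamma>) \<partial>Pr x)"
      unfolding set_lebesgue_integral_def by (intro Bochner_Integration.integral_cong) (auto split: split_indicator)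
    finally show "(\<integral>w\<in>A. indicator {w \<in> R. pth (w (Suc n)) \<in> \<Gamma>} w \<partial>Pr x) = (\<integral>w\<in>A. (indicator R w * measure (Q (pos (w n))) \<Gamma>) \<partial>Pr x)" .
  next
    show "integrable (Pr x) (indicator {w \<in> R. pth (w (Suc n)) \<in> \<Gamma>} :: _ \<Rightarrow> real)"
      by (rule integrable_real_indicator[OF fP]) (simp add: emeasure_finite less_top[symmetric])
    have "measure (Q y) \<Gamma> \<le> 1" for y using prob_space.prob_le_1[OF prob_Q] .
    then show "integrable (Pr x) (\<lambda>w. indicator R w * measure (Q (pos (w n))) \<Gamma>)"
      by (intro integrable_const_bound[where B=1] AE_I2 measurable_Pr_Full) (auto split: split_indicator)
  qed (rule gm)
qed

section \<open>The martingales of the process\<close>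

lemma space_marked_filtration [simp]: "space (marked_filtration M X Edges \<tau> Y t) = space M"
  unfolding marked_filtration_def
  by (rule space_measure_of) (use sets.sets_into_space[of _ "natural_filtration (space M) X t"] in auto)

lemma sets_natural_filtration:
  "sets (natural_filtration \<Omega>' X t) = sigma_sets \<Omega>' {(\<lambda>w. X w s) -` B \<inter> \<Omega>' | s B. s \<in> {0..t} \<and> B \<in> sets borel}"
  unfolding natural_filtration_def by (rule sets_measure_of) auto

lemma sets_marked_filtration:
  "sets (marked_filtration M X Edges \<tau> Y t) = sigma_sets (space M)
     (sets (natural_filtration (space M) X t) \<union>
      {jump_count X \<tau> Y e B s -` D \<inter> space M | e B s D.
         e \<in> Edges \<and> B \<in> sets borel \<and> s \<in> {0..t} \<and> D \<in> sets borel})"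
  unfolding marked_filtration_def
  by (rule sets_measure_of) (use sets.sets_into_space[of _ "natural_filtration (space M) X t"] in auto)

lemma natural_filtration_mono: "u \<le> v \<Longrightarrow> sets (natural_filtration \<Omega>' X u) \<subseteq> sets (natural_filtration \<Omega>' X v)"
  unfolding sets_natural_filtration by (rule sigma_sets_mono') force

lemma marked_filtration_mono:
  assumes "u \<le> v"
  shows "sets (marked_filtration M X Edges \<tau> Y u) \<subseteq> sets (marked_filtration M X Edges \<tau> Y v)"
  unfolding sets_marked_filtration
  by (rule sigma_sets_mono', rule Un_mono[OF natural_filtration_mono[OF assms]]) (use assms in force)

lemma natural_subset_marked: "sets (natural_filtration (space M) X t) \<subseteq> sets (marked_filtration M X Edges \<tau> Y t)"
  unfolding sets_marked_filtration by (auto intro: sigma_sets.Basic)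

abbreviation MF where "MF x Edges \<equiv> marked_filtration (Pr x) proc Edges jump_time ety"
abbreviation NF where "NF \<equiv> natural_filtration good proc"

lemma determined_MF: "A \<in> sets (MF x Edges s) \<Longrightarrow> determined s A"
  by (rule determined_marked[of "Pr x"]) simp_all

lemma MF_sets: "sets (MF x Edges u) \<subseteq> sets (Pr x)"
proof
  fix A assume "A \<in> sets (MF x Edges u)"
  \<comment> \<open>Filtrations are indexed by all reals, but \<open>determined_sets\<close> needs a
    nonnegative time.\<close>
  then have "A \<in> sets (MF x Edges (max u 0))" by (rule subsetD[OF marked_filtration_mono, rotated]) simp
  from determined_MF[OF this] show "A \<in> sets (Pr x)"
    by (intro sets_PrI determined_sets[where s="max u 0"]) (auto simp: determined_def)
qed

lemma measurable_MF_jump_count: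
  assumes "e \<in> Edges" "B \<in> sets borel" "0 \<le> t"
  shows "jump_count proc jump_time ety e B t \<in> borel_measurable (MF x Edges t)"
proof (rule measurableI)
  fix D :: "real set" assume "D \<in> sets borel"
  then show "jump_count proc jump_time ety e B t -` D \<inter> space (MF x Edges t) \<in> sets (MF x Edges t)"
    using assms unfolding sets_marked_filtration space_marked_filtration
    by (intro sigma_sets.Basic UnI2 CollectI exI[of _ e] exI[of _ B] exI[of _ t] exI[of _ D]) auto
qed simp

end

context jump_martingale
begin

text \<open>Stated for any filtration inside the marked one, to serve both the natural filtration of
  (iv) and the marked filtration of (iii).\<close>

lemma martingale_Z:
  fixes Z' :: "real \<Rightarrow> ('a, 'e) sample \<Rightarrow> real"
  assumes F: "\<And>u. sets (F u) \<subseteq> sets (MF x Edges u)" "\<And>u. space (F u) = good"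
    and mono: "\<And>u v. u \<le> v \<Longrightarrow> sets (F u) \<subseteq> sets (F v)"
    and adapted: "\<And>t. 0 \<le> t \<Longrightarrow> \<exists>f\<in>borel_measurable (F t). AE w in Pr x. Z' t w = f w"
    and eq: "\<And>t. 0 \<le> t \<Longrightarrow> AE w in Pr x. Z' t w = Z t w"
  shows "martingale (Pr x) (usual_augmentation (Pr x) F) Z'"
proof (rule martingale_usual_augmentation[where Z=Z and W=W])
  show "prob_space (Pr x)" "complete_measure (Pr x)" by (rule prob_Pr complete_Pr)+
  show Fs: "sets (F u) \<subseteq> sets (Pr x)" and Fsp: "space (F u) = space (Pr x)" for u
    using order_trans[OF F(1) MF_sets] F(2) by simp_all
  show "sets (F u) \<subseteq> sets (F v)" if "u \<le> v" for u v by (rule mono[OF that])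
  fix t :: real assume t: "0 \<le> t"
  show "integrable (Pr x) (Z t)" "integrable (Pr x) (W t)"
    by (intro integrable_Pr Z_integrable W_integrable t)+
  show "Z' t \<in> borel_measurable (usual_augmentation (Pr x) F t)"
  proof -
    obtain f where f: "f \<in> borel_measurable (F t)" "AE w in Pr x. Z' t w = f w" using adapted[OF t] by blast
    show ?thesis by (rule usual_augmentation_AE_measurable[where F=F, OF complete_Pr Fs Fsp mono f])
  qed
  show "AE w in Pr x. Z' t w = Z t w" by (rule eq[OF t])
  show "AE w in Pr x. ((\<lambda>u. Z u w) \<longlongrightarrow> Z t w) (at_right t)"
    using AE_Pr_good by eventually_elim (rule Z_right_cont[OF _ t])
next
  fix s t :: real and A assume st: "0 \<le> s" "s \<le> t"
  show "AE w in Pr x. \<bar>Z s w\<bar> \<le> W t w" using AE_Pr_good by eventually_elim (rule Z_bound[OF _ st])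
  assume "A \<in> sets (F s)"
  then have d: "determined s A" using F determined_MF by blast
  have [measurable]: "A \<in> sets Full" by (rule determined_sets[OF d st(1)])
  have "(\<integral>w. indicator A w * (Z t w - Z s w) \<partial>Pr x) = (\<integral>w. indicator A w * (Z t w - Z s w) \<partial>law x)"
    by (rule integral_Pr) measurable
  also have "\<dots> = 0" by (rule Z_martingale[OF d st])
  finally show "(\<integral>w. indicator A w * (Z t w - Z s w) \<partial>Pr x) = 0" .
qed

lemma measurable_NF_integral: "(\<lambda>w. LINT s:{0..t}|lborel. cc (proc w s)) \<in> borel_measurable (NF t)"
  by (rule measurable_integral_adapted) (auto intro: proc_right_cont measurable_natural_filtration_at)

lemma measurable_NF_process:
  assumes "0 \<le> t"
  shows "(\<lambda>w. a (proc w t) - a (proc w 0) - (LINT s:{0..t}|lborel. cc (proc w s))) \<in> borel_measurable (NF t)"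
  using assms measurable_compose[OF measurable_natural_filtration_at a_measurable]
  by (intro borel_measurable_diff measurable_NF_integral) auto

lemma Z_eq_no_marks:
  assumes "\<And>p. d p = 0" "w \<in> good" "0 \<le> t"
  shows "Z t w = a (proc w t) - a (proc w 0) - (LINT s:{0..t}|lborel. cc (proc w s))"
  using Z_eq[OF assms(2,3)] assms(1) by simp

lemma state_martingale:
  assumes d: "\<And>p. d p = 0"
  shows "martingale (Pr x) (usual_augmentation (Pr x) (natural_filtration (space (Pr x)) proc))
    (\<lambda>t w. a (proc w t) - a (proc w 0) - (LINT s:{0..t}|lborel. cc (proc w s)))"
proof (rule martingale_Z)
  show "sets (natural_filtration (space (Pr x)) proc u) \<subseteq> sets (MF x {} u)" for u by (rule natural_subset_marked)
  fix t :: real assume t: "0 \<le> t"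
  show "\<exists>f\<in>borel_measurable (natural_filtration (space (Pr x)) proc t). AE w in Pr x.
     a (proc w t) - a (proc w 0) - (LINT s:{0..t}|lborel. cc (proc w s)) = f w"
    using measurable_NF_process[OF t] by auto
  show "AE w in Pr x. a (proc w t) - a (proc w 0) - (LINT s:{0..t}|lborel. cc (proc w s)) = Z t w"
    using AE_Pr_good by eventually_elim (simp add: Z_eq_no_marks[OF d _ t])
qed (simp_all add: natural_filtration_mono)

text \<open>Events of the canonical filtration pull back under \<open>proc\<close> to events of its
  natural filtration, so the increment identity is transported by the change of variables.\<close>

lemma canonical_martingale:
  assumes d: "\<And>p. d p = 0"
  shows "martingale (distr (Pr x) (skorokhod_borel UNIV) proc) (natural_filtration (cadlag_paths UNIV) (\<lambda>w. w))
    (\<lambda>t w. a (w t) - a (w 0) - (LINT s:{0..t}|lborel. cc (w s)))"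
proof -
  let ?D = "distr (Pr x) (skorokhod_borel UNIV) proc" and ?F = "natural_filtration (cadlag_paths UNIV) (\<lambda>w :: real \<Rightarrow> 'a. w)"
  let ?Z = "\<lambda>t w. a (w t) - a (w 0) - (LINT s:{0..t}|lborel. cc (w s))"
  have sp: "space ?D = cadlag_paths UNIV" by (simp add: space_skorokhod_borel)
  have sub: "subalgebra ?D (?F t)" for t
    by (rule subalgebra_natural_filtration) (auto simp: space_skorokhod_borel intro: measurable_skorokhod_eval)
  have ad: "?Z t \<in> borel_measurable (?F t)" if "0 \<le> t" for t
  proof -
    have "(\<lambda>w. LINT s:{0..t}|lborel. cc (w s)) \<in> borel_measurable (?F t)"
      by (rule measurable_integral_adapted[where X="\<lambda>w. w"])
        (auto intro: cadlag_pathsD(2) measurable_natural_filtration_at)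
    then show ?thesis using that
      by (intro borel_measurable_diff measurable_compose[OF measurable_natural_filtration_at[where X="\<lambda>w :: real \<Rightarrow> 'a. w"] a_measurable]) auto
  qed
  then have Zm: "?Z t \<in> borel_measurable (skorokhod_borel UNIV)" if "0 \<le> t" for t
    using measurable_from_subalg[OF sub ad[OF that]] by simp
  have int: "integrable ?D (?Z t)" if t: "0 \<le> t" for t
  proof -
    have "(\<lambda>w. ?Z t (proc w)) \<in> borel_measurable (Pr x)" by (rule measurable_compose[OF proc_measurable_Pr Zm[OF t]])
    moreover have "AE w in Pr x. ?Z t (proc w) = Z t w"
      using AE_Pr_good by eventually_elim (simp add: Z_eq_no_marks[OF d _ t])
    ultimately have "integrable (Pr x) (\<lambda>w. ?Z t (proc w))"
      using integrable_cong_AE[of "\<lambda>w. ?Z t (proc w)" "Pr x" "Z t"] integrable_Pr[OF Z_integrable[OF t, of x]] by auto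
    then show ?thesis by (subst integrable_distr_eq[OF proc_measurable_Pr Zm[OF t]])
  qed
  show ?thesis
  proof (rule martingaleI[where Z="?Z"])
    show "prob_space ?D" by (rule prob_space.prob_space_distr[OF prob_Pr proc_measurable_Pr])
    show "filtration (space ?D) ?F"
      by standard (simp_all add: space_skorokhod_borel natural_filtration_mono)
    fix s t :: real and A assume st: "0 \<le> s" "s \<le> t" and A: "A \<in> sets (?F s)"
    have AS: "A \<in> sets (skorokhod_borel UNIV)" using A sub[of s] by (auto simp: subalgebra_def)
    define A' where "A' = proc -` A \<inter> good"
    have "proc \<in> NF s \<rightarrow>\<^sub>M ?F s"
      by (rule measurable_natural_filtration) (auto intro: proc_cadlag measurable_natural_filtration_at)
    from measurable_sets[OF this A] have "A' \<in> sets (natural_filtration (space (Pr x)) proc s)" by (simp add: A'_def)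
    then have d': "determined s A'" using natural_subset_marked determined_MF[of A' x "{}"] by blast
    have [measurable]: "A' \<in> sets Full" by (rule determined_sets[OF d' st(1)])
    have t: "0 \<le> t" using st by simp
    have "(\<integral>w. indicator A w * (?Z t w - ?Z s w) \<partial>?D) = (\<integral>w. indicator A (proc w) * (?Z t (proc w) - ?Z s (proc w)) \<partial>Pr x)"
      by (rule integral_distr[OF proc_measurable_Pr]) (use Zm[OF t] Zm[OF st(1)] AS in measurable)
    also have "\<dots> = (\<integral>w. indicator A' w * (Z t w - Z s w) \<partial>Pr x)"
      by (rule Bochner_Integration.integral_cong) (auto simp: A'_def Z_eq_no_marks[OF d _ t] Z_eq_no_marks[OF d _ st(1)] split: split_indicator)
    also have "\<dots> = (\<integral>w. indicator A' w * (Z t w - Z s w) \<partial>law x)" by (rule integral_Pr) measurable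
    also have "\<dots> = 0" by (rule Z_martingale[OF d' st])
    finally show "(\<integral>w. indicator A w * (?Z t w - ?Z s w) \<partial>?D) = 0" .
  qed (use sub int ad in auto)
qed

text \<open>With a = 0 and d an indicator, the sum of marks in \<open>Z_eq\<close> is the jump
  count; regularity replaces states by left limits in the compensator.\<close>

lemma jump_count_martingale:
  assumes a: "\<And>y. a y = 0" and e: "e \<in> Edges" and B: "B \<in> sets borel"
    and d: "\<And>p. d p = indicator ({e} \<times> B) p" and r: "AE w in Pr x. regular w"
  shows "martingale (Pr x) (usual_augmentation (Pr x) (MF x Edges))
    (\<lambda>t w. jump_count proc jump_time ety e B t w - (LINT s:{0..t}|lborel. cc (left_lim (proc w) s)))"
proof (rule martingale_Z[where Edges=Edges])
  fix t :: real assume t: "0 \<le> t"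
  let ?f = "\<lambda>w. jump_count proc jump_time ety e B t w - (LINT s:{0..t}|lborel. cc (proc w s))"
  have NM: "NF t \<rightarrow>\<^sub>M borel \<subseteq> MF x Edges t \<rightarrow>\<^sub>M (borel :: real measure)"
    using natural_subset_marked[of "Pr x" proc t] by (intro measurable_mono) simp_all
  have "?f \<in> borel_measurable (MF x Edges t)"
    by (rule borel_measurable_diff[OF measurable_MF_jump_count[OF e B t] subsetD[OF NM measurable_NF_integral]])
  moreover have eq: "AE w in Pr x. jump_count proc jump_time ety e B t w - (LINT s:{0..t}|lborel. cc (left_lim (proc w) s)) = ?f w"
    using r by (rule AE_mp) (intro AE_I2 impI arg_cong2[where f="(-)"] refl regular_LINT_left_lim)
  ultimately show "\<exists>f\<in>borel_measurable (MF x Edges t). AE w in Pr x.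
    jump_count proc jump_time ety e B t w - (LINT s:{0..t}|lborel. cc (left_lim (proc w) s)) = f w" by (rule rev_bexI[where x="?f"])
  have "?f w = Z t w" if w: "w \<in> good" for w
  proof -
    obtain n where n: "ereal t < jump_time (Suc n) w" using good_stage[OF w t] by blast
    have sub: "{k. 1 \<le> k \<and> jump_time k w \<le> ereal t} \<subseteq> {1..n}"
    proof
      fix k assume "k \<in> {k. 1 \<le> k \<and> jump_time k w \<le> ereal t}"
      then have k: "1 \<le> k" "jump_time k w < jump_time (Suc n) w" using le_less_trans[OF _ n] by auto
      have "\<not> Suc n \<le> k" using k(2) jump_time_mono[of "Suc n" k w] leD by blast
      then show "k \<in> {1..n}" using k(1) by simp
    qed
    have "(\<Sum>k | 1 \<le> k \<and> jump_time k w \<le> ereal t. d (mrk (w k)))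
      = (\<Sum>k\<in>{1..n}. of_bool (jump_time k w \<le> ereal t \<and> fst (mrk (w k)) = e \<and> pos (w k) \<in> B))"
      by (rule sum.mono_neutral_cong_left[OF _ sub]) (auto simp: d indicator_def mem_Times_iff)
    also have "\<dots> = jump_count proc jump_time ety e B t w" by (rule jump_count_eq[OF w n order_refl, symmetric])
    finally show ?thesis using Z_eq[OF w t] by (simp add: a)
  qed
  then have "AE w in Pr x. ?f w = Z t w" by (rule eventually_mono[OF AE_Pr_good])
  with eq show "AE w in Pr x. jump_count proc jump_time ety e B t w - (LINT s:{0..t}|lborel. cc (left_lim (proc w) s)) = Z t w"
    by eventually_elim simp
qed (simp_all add: marked_filtration_mono)

end

section \<open>Jump rates, jump kernels and strata\<close>

text \<open>A sum of nonnegative terms is the supremum over finite subsets; an injection into the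
  naturals exhausts A by increasing finite sets, and monotone convergence applies.\<close>

lemma infsum_ennreal_eq_nn_integral:
  fixes f :: "'b \<Rightarrow> ennreal"
  assumes A: "countable A"
  shows "(\<Sum>\<^sub>\<infinity>x\<in>A. f x) = (\<integral>\<^sup>+x. f x \<partial>count_space A)"
proof -
  have fin: "sum f F = (\<integral>\<^sup>+x. f x * indicator F x \<partial>count_space A)" if F: "finite F" "F \<subseteq> A" for F
  proof -
    have "(\<integral>\<^sup>+x. f x * indicator F x \<partial>count_space A) = (\<Sum>x\<in>F. f x * indicator F x)"
      by (rule nn_integral_count_space') (use F in auto)
    then show ?thesis by simp
  qed
  have "(SUP F\<in>{F. finite F \<and> F \<subseteq> A}. sum f F) = (\<integral>\<^sup>+x. f x \<partial>count_space A)"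
  proof (rule antisym)
    show "(SUP F\<in>{F. finite F \<and> F \<subseteq> A}. sum f F) \<le> (\<integral>\<^sup>+x. f x \<partial>count_space A)"
      by (rule SUP_least) (auto simp: fin split: split_indicator intro!: nn_integral_mono)
    obtain g :: "'b \<Rightarrow> nat" where g: "inj_on g A" using A by (auto simp: countable_def)
    define F where "F n = {x\<in>A. g x \<le> n}" for n
    have F: "finite (F n)" "F n \<subseteq> A" for n
    proof -
      have "g ` F n \<subseteq> {..n}" by (auto simp: F_def)
      then have "finite (g ` F n)" by (rule finite_subset) simp
      then show "finite (F n)" by (rule finite_imageD) (rule inj_on_subset[OF g], auto simp: F_def)
    qed (auto simp: F_def)
    have "(\<integral>\<^sup>+x. f x \<partial>count_space A) \<le> (\<integral>\<^sup>+x. (SUP n. f x * indicator (F n) x) \<partial>count_space A)"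
    proof (rule nn_integral_mono)
      fix x assume "x \<in> space (count_space A)"
      then have "f x = f x * indicator (F (g x)) x" by (simp add: F_def)
      also have "\<dots> \<le> (SUP n. f x * indicator (F n) x)" by (rule SUP_upper) simp
      finally show "f x \<le> (SUP n. f x * indicator (F n) x)" .
    qed
    also have "\<dots> = (SUP n. \<integral>\<^sup>+x. f x * indicator (F n) x \<partial>count_space A)"
      by (rule nn_integral_monotone_convergence_SUP)
        (auto simp: incseq_def le_fun_def F_def split: split_indicator)
    also have "\<dots> \<le> (SUP F\<in>{F. finite F \<and> F \<subseteq> A}. sum f F)"
      by (rule SUP_least) (use F in \<open>auto simp: fin[symmetric] intro!: SUP_upper\<close>)
    finally show "(\<integral>\<^sup>+x. f x \<partial>count_space A) \<le> (SUP F\<in>{F. finite F \<and> F \<subseteq> A}. sum f F)" .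
  qed
  then show ?thesis by (subst nonneg_infsum_complete) auto
qed

lemma measurable_nn_integral_count_space:
  fixes f :: "'c \<Rightarrow> 'b \<Rightarrow> ennreal"
  assumes A: "countable A" and f: "\<And>e. e \<in> A \<Longrightarrow> (\<lambda>y. f y e) \<in> borel_measurable M"
  shows "(\<lambda>y. \<integral>\<^sup>+e. f y e \<partial>count_space A) \<in> borel_measurable M"
proof -
  interpret sigma_finite_measure "count_space A" by (rule sigma_finite_measure_count_space_countable[OF A])
  have "(\<lambda>(e, y). f y e) \<in> borel_measurable (count_space A \<Otimes>\<^sub>M M)"
    by (rule measurable_pair_measure_countable1[OF A]) (simp add: f)
  then have "(\<lambda>(y, e). f y e) \<in> borel_measurable (M \<Otimes>\<^sub>M count_space A)"
    by (subst measurable_pair_swap_iff) (simp add: split_beta')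
  then show ?thesis by (rule borel_measurable_nn_integral)
qed

lemma stop_path_cadlag:
  assumes \<eta>: "\<eta> \<in> cadlag_paths S" and u: "0 \<le> u"
  shows "stop_path u \<eta> \<in> cadlag_paths S"
  unfolding cadlag_paths_def mem_Collect_eq
proof (intro conjI allI impI)
  show "stop_path u \<eta> \<in> {0..} \<rightarrow>\<^sub>E S" using cadlag_pathsD(4)[OF \<eta>] u by (auto simp: stop_path_def)
  fix t :: real assume t: "0 \<le> t"
  have sp: "stop_path u \<eta> s = \<eta> (min s u)" if "0 \<le> s" for s using that by (simp add: stop_path_def)
  have late: "(stop_path u \<eta> \<longlongrightarrow> \<eta> u) F" if "\<forall>\<^sub>F s in F. u \<le> s" for F
  proof (rule tendsto_eventually)
    show "\<forall>\<^sub>F s in F. stop_path u \<eta> s = \<eta> u" using that by eventually_elim (use u sp in \<open>simp add: min_absorb2\<close>)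
  qed
  have early: "(stop_path u \<eta> \<longlongrightarrow> l) F" if "\<forall>\<^sub>F s in F. 0 \<le> s \<and> s \<le> u" "(\<eta> \<longlongrightarrow> l) F" for F l
  proof (rule Lim_transform_eventually[OF that(2)])
    show "\<forall>\<^sub>F s in F. \<eta> s = stop_path u \<eta> s" using that(1) by eventually_elim (simp add: sp min_absorb1)
  qed
  show "(stop_path u \<eta> \<longlongrightarrow> stop_path u \<eta> t) (at_right t)"
  proof (cases "t < u")
    case True
    have "\<forall>\<^sub>F s in at_right t. 0 \<le> s \<and> s \<le> u"
      unfolding eventually_at_right_field using True t by (intro exI[of _ u]) auto
    then show ?thesis using early[OF _ cadlag_pathsD(2)[OF \<eta> t]] sp[OF t] True by simp
  next
    case False
    have "\<forall>\<^sub>F s in at_right t. u \<le> s"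
      unfolding eventually_at_right_field using False by (intro exI[of _ "t + 1"]) auto
    then show ?thesis using late[of "at_right t"] sp[OF t] False by (simp add: min_absorb2)
  qed
  assume t0: "0 < t"
  show "\<exists>l\<in>S. (stop_path u \<eta> \<longlongrightarrow> l) (at_left t)"
  proof (cases "t \<le> u")
    case True
    obtain l where l: "l \<in> S" "(\<eta> \<longlongrightarrow> l) (at_left t)" using cadlag_pathsD(3)[OF \<eta> t0] by blast
    have "\<forall>\<^sub>F s in at_left t. 0 \<le> s \<and> s \<le> u"
      unfolding eventually_at_left_field using True t0 by (intro exI[of _ 0]) auto
    then show ?thesis using early[OF _ l(2)] l(1) by blast
  next
    case False
    have "\<forall>\<^sub>F s in at_left t. u \<le> s"
      unfolding eventually_at_left_field using False by (intro exI[of _ u]) auto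
    then show ?thesis using late[of "at_left t"] cadlag_pathsD(4)[OF \<eta> u] by blast
  qed
qed

lemma const_cadlag: "x \<in> S \<Longrightarrow> (\<lambda>t\<in>{0..}. x) \<in> cadlag_paths S"
proof -
  assume x: "x \<in> S"
  have "((\<lambda>t\<in>{0..}. x) \<longlongrightarrow> x) F" if "\<forall>\<^sub>F s in F. (0::real) \<le> s" for F
    by (rule tendsto_eventually) (use that in \<open>eventually_elim, simp\<close>)
  moreover have "\<forall>\<^sub>F s in at_right t. 0 \<le> s" if "0 \<le> t" for t :: real
    unfolding eventually_at_right_field using that by (intro exI[of _ "t + 1"]) auto
  moreover have "\<forall>\<^sub>F s in at_left t. 0 \<le> s" if "0 < t" for t :: real
    unfolding eventually_at_left_field using that by (intro exI[of _ 0]) auto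
  ultimately show ?thesis using x by (auto simp: cadlag_paths_def)
qed

section \<open>From strata, diffusions and edges to the abstract jump diffusion\<close>

locale hybrid =
  fixes I :: "'i set" and S :: "'i \<Rightarrow> 'a::{metric_space, second_countable_topology} set"
    and Q :: "'i \<Rightarrow> 'a \<Rightarrow> (real \<Rightarrow> 'a) measure" and C :: "'i \<Rightarrow> ('a \<Rightarrow> real) set"
    and Edges :: "'e set" and src tgt :: "'e \<Rightarrow> 'i"
    and K :: "'e \<Rightarrow> 'a \<Rightarrow> 'a measure" and rate :: "'e \<Rightarrow> 'a \<Rightarrow> real" and \<Lambda>max :: real
  assumes I: "countable I" and disj: "disjoint_family_on S I" and cover: "(\<Union>\<alpha>\<in>I. S \<alpha>) = UNIV"
    and S_borel: "\<And>\<alpha>. \<alpha> \<in> I \<Longrightarrow> S \<alpha> \<in> sets borel"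
    and diffusions: "strata_diffusions I S Q C"
    and jumps: "jump_structure I S Edges src tgt K rate \<Lambda>max"
begin

abbreviation str where "str \<equiv> stratum_of I S"

lemma str_eq: "\<alpha> \<in> I \<Longrightarrow> y \<in> S \<alpha> \<Longrightarrow> str y = \<alpha>"
  unfolding stratum_of_def using disj by (intro the_equality) (auto simp: disjoint_family_on_def)

lemma str: "str y \<in> I" "y \<in> S (str y)"
proof -
  obtain \<alpha> where "\<alpha> \<in> I" "y \<in> S \<alpha>" using cover by blast
  then show "str y \<in> I" "y \<in> S (str y)" using str_eq by auto
qed

lemma Edges: "countable Edges" "e \<in> Edges \<Longrightarrow> src e \<in> I"
    "e \<in> Edges \<Longrightarrow> K e \<in> restrict_space borel (S (src e)) \<rightarrow>\<^sub>M prob_algebra borel"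
    "e \<in> Edges \<Longrightarrow> rate e \<in> borel_measurable (restrict_space borel (S (src e)))"
    "e \<in> Edges \<Longrightarrow> y \<in> S (src e) \<Longrightarrow> measure (K e y) {y} = 0" "e \<in> Edges \<Longrightarrow> y \<in> S (src e) \<Longrightarrow> 0 \<le> rate e y"
  and total: "total_rate I S Edges src rate y \<le> ennreal \<Lambda>max"
  using jumps by (auto simp: jump_structure_def)

lemma edges_at_eq: "edges_at I S Edges src y = {e\<in>Edges. y \<in> S (src e)}"
proof -
  have "src e = str y \<longleftrightarrow> y \<in> S (src e)" if "e \<in> Edges" for e
    using str(2)[of y] str_eq[OF Edges(2)[OF that], of y] by metis
  then show ?thesis unfolding edges_at_def by blast
qed

lemma diffusion: "\<alpha> \<in> I \<Longrightarrow> feller_diffusion (S \<alpha>) (Q \<alpha>)"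
    "\<alpha> \<in> I \<Longrightarrow> y \<in> S \<alpha> \<Longrightarrow> AE \<eta> in Q \<alpha> y. continuous_on {0..} \<eta>"
    "\<alpha> \<in> I \<Longrightarrow> generator_core (S \<alpha>) (transition_op (S \<alpha>) (Q \<alpha>)) (C \<alpha>)"
proof -
  assume \<alpha>: "\<alpha> \<in> I"
  note D = bspec[OF diffusions[unfolded strata_diffusions_def] \<alpha>]
  have AE: "AE \<eta> in Q \<alpha> y. \<eta> 0 = y \<and> (\<forall>t\<ge>0. \<eta> t \<in> S \<alpha>) \<and> continuous_on {0..} \<eta>" if "y \<in> S \<alpha>" for y
    using D that by simp
  show "feller_diffusion (S \<alpha>) (Q \<alpha>)"
  proof -
    have "AE \<eta> in Q \<alpha> y. \<eta> 0 = y" if "y \<in> S \<alpha>" for y using AE[OF that] by eventually_elim simp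
    then show ?thesis unfolding feller_diffusion_def using D S_borel[OF \<alpha>] by simp
  qed
  show "AE \<eta> in Q \<alpha> y. continuous_on {0..} \<eta>" if "y \<in> S \<alpha>"
    using AE[OF that] by eventually_elim simp
  show "generator_core (S \<alpha>) (transition_op (S \<alpha>) (Q \<alpha>)) (C \<alpha>)" using D by simp
qed

lemma Q_kernel: "\<alpha> \<in> I \<Longrightarrow> Q \<alpha> \<in> restrict_space borel (S \<alpha>) \<rightarrow>\<^sub>M prob_algebra (skorokhod_borel (S \<alpha>))"
  using diffusions by (simp add: strata_diffusions_def)

text \<open>Each path stays in one stratum, left limits included, so any single value reveals which
  one. The union is needed because all stages share one sample space.\<close>

definition \<Omega> :: "(real \<Rightarrow> 'a) set" where "\<Omega> = (\<Union>\<alpha>\<in>I. cadlag_paths (S \<alpha>))"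

abbreviation N where "N \<equiv> path_algebra \<Omega>"

lemma \<Omega>_cadlag: "\<Omega> \<subseteq> cadlag_paths UNIV"
  unfolding \<Omega>_def using cadlag_paths_mono[OF subset_UNIV] by blast

lemma \<Omega>_PiE: "\<Omega> \<subseteq> {0..} \<rightarrow>\<^sub>E UNIV" using \<Omega>_cadlag cadlag_paths_subset by blast

lemma \<Omega>_stratum:
  assumes "\<eta> \<in> \<Omega>" "0 \<le> t" "\<alpha> \<in> I" "\<eta> t \<in> S \<alpha>"
  shows "\<eta> \<in> cadlag_paths (S \<alpha>)"
proof -
  obtain \<beta> where \<beta>: "\<beta> \<in> I" "\<eta> \<in> cadlag_paths (S \<beta>)" using assms(1) by (auto simp: \<Omega>_def)
  have "\<eta> t \<in> S \<beta>" by (rule cadlag_pathsD(4)[OF \<beta>(2) assms(2)])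
  then have "\<beta> = \<alpha>" using str_eq[OF \<beta>(1)] str_eq[OF assms(3,4)] by simp
  then show ?thesis using \<beta>(2) by simp
qed

text \<open>The laws of the various strata moved to the common path space, giving one kernel on the
  whole of E.\<close>

definition Qn :: "'a \<Rightarrow> (real \<Rightarrow> 'a) measure" where "Qn y = distr (Q (str y) y) N (\<lambda>\<eta>. \<eta>)"

lemma measurable_inclusion: "\<alpha> \<in> I \<Longrightarrow> (\<lambda>\<eta>. \<eta>) \<in> skorokhod_borel (S \<alpha>) \<rightarrow>\<^sub>M N"
  by (rule measurable_into_path_algebra[OF \<Omega>_PiE])
    (auto simp: space_skorokhod_borel \<Omega>_def intro: measurable_skorokhod_eval)

lemma measurable_Qn: "Qn \<in> borel \<rightarrow>\<^sub>M prob_algebra N"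
proof (rule measurable_piecewise_restrict[of "S ` I"])
  show "countable (S ` I)" using I by simp
  fix \<Omega>' assume "\<Omega>' \<in> S ` I"
  then obtain \<alpha> where \<alpha>: "\<alpha> \<in> I" "\<Omega>' = S \<alpha>" by auto
  show "\<Omega>' \<inter> space borel \<in> sets borel" using S_borel \<alpha> by simp
  have "(\<lambda>y. distr (Q \<alpha> y) N (\<lambda>\<eta>. \<eta>)) \<in> restrict_space borel (S \<alpha>) \<rightarrow>\<^sub>M prob_algebra N"
    by (rule measurable_compose[OF Q_kernel[OF \<alpha>(1)] measurable_distr_prob_space[OF measurable_inclusion[OF \<alpha>(1)]]])
  then show "Qn \<in> restrict_space borel \<Omega>' \<rightarrow>\<^sub>M prob_algebra N"
    unfolding \<alpha>(2) by (rule measurable_cong[THEN iffD1, rotated]) (auto simp: Qn_def space_restrict_space str_eq[OF \<alpha>(1)])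
qed (use cover in auto)

lemma Q_stratum: "sets (Q (str y) y) = sets (skorokhod_borel (S (str y)))" "space (Q (str y) y) = cadlag_paths (S (str y))"
    "prob_space (Q (str y) y)" "AE \<eta> in Q (str y) y. \<eta> 0 = y"
proof -
  interpret feller_diffusion "S (str y)" "Q (str y)" by (rule diffusion(1)[OF str(1)])
  show "sets (Q (str y) y) = sets (skorokhod_borel (S (str y)))" "space (Q (str y) y) = cadlag_paths (S (str y))"
    "prob_space (Q (str y) y)" "AE \<eta> in Q (str y) y. \<eta> 0 = y"
    using sets_Q[OF str(2)] space_Q[OF str(2)] Q_prob[OF str(2)] start[OF str(2)] by simp_all
qed

lemma measurable_Q_inclusion: "(\<lambda>\<eta>. \<eta>) \<in> Q (str y) y \<rightarrow>\<^sub>M N"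
  using measurable_inclusion[OF str(1)] by (simp add: measurable_cong_sets[OF Q_stratum(1) refl])

lemma AE_Qn:
  assumes "Measurable.pred N P" "AE \<eta> in Q (str y) y. P \<eta>"
  shows "AE \<eta> in Qn y. P \<eta>"
  unfolding Qn_def using assms
  by (subst AE_distr_iff[OF measurable_Q_inclusion]) (auto simp: pred_def)

text \<open>Inside \<Omega>, the paths of a stratum are singled out by their value at time 0, which
  is a measurable condition.\<close>

lemma stratum_paths:
  assumes \<alpha>: "\<alpha> \<in> I" and \<Gamma>: "\<Gamma> \<in> sets (skorokhod_borel (S \<alpha>))"
  shows "\<Gamma> \<in> sets N"
proof -
  obtain A where A: "A \<in> sets (PiM {0..} (\<lambda>_. borel :: 'a measure))" "\<Gamma> = cadlag_paths (S \<alpha>) \<inter> A"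
    using \<Gamma> unfolding sets_skorokhod_borel path_algebra_def sets_restrict_space by auto
  have 1: "\<Omega> \<inter> A \<in> sets N" using A(1) unfolding path_algebra_def sets_restrict_space by auto
  have 2: "(\<lambda>\<eta>. \<eta> 0) -` S \<alpha> \<inter> space N \<in> sets N"
    by (rule measurable_sets[OF measurable_path_algebra_eval S_borel[OF \<alpha>]]) simp
  have sub: "cadlag_paths (S \<alpha>) \<subseteq> \<Omega>" using \<alpha> by (auto simp: \<Omega>_def)
  have "\<Gamma> = (\<Omega> \<inter> A) \<inter> ((\<lambda>\<eta>. \<eta> 0) -` S \<alpha> \<inter> space N)"
    using \<Omega>_stratum[of _ 0 \<alpha>] \<alpha> cadlag_pathsD(4)[of _ "S \<alpha>" 0]
      sub
    by (auto simp: A(2) space_path_algebra[OF \<Omega>_PiE])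
  then show ?thesis using 1 2 by simp
qed

lemma measure_Qn:
  assumes "\<alpha> \<in> I" "y \<in> S \<alpha>" "\<Gamma> \<in> sets (skorokhod_borel (S \<alpha>))"
  shows "measure (Qn y) \<Gamma> = measure (Q \<alpha> y) \<Gamma>"
proof -
  have "\<Gamma> \<subseteq> cadlag_paths (S \<alpha>)" using sets.sets_into_space[OF assms(3)] by (simp add: space_skorokhod_borel)
  then show ?thesis
    unfolding Qn_def using stratum_paths[OF assms(1,3)] Q_stratum(2)[of y] measurable_Q_inclusion[of y] str_eq[OF assms(1,2)]
    by (subst measure_distr) (auto simp: Int_absorb2)
qed

text \<open>Rates and kernels are made total, with rate 0 off the source stratum; the filler law in
  \<open>K'\<close> is then never weighted by a positive rate.\<close>

definition lam :: "'e \<Rightarrow> 'a \<Rightarrow> real" where "lam e y = (if e \<in> Edges \<and> y \<in> S (src e) then rate e y else 0)"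
definition \<Lambda> :: "'a \<Rightarrow> real" where "\<Lambda> y = enn2real (\<integral>\<^sup>+e. ennreal (lam e y) \<partial>count_space Edges)"
definition K' :: "'e \<Rightarrow> 'a \<Rightarrow> 'a measure" where
  "K' e y = (if e \<in> Edges \<and> y \<in> S (src e) then K e y else return borel undefined)"
definition E :: "'e set" where "E = insert undefined Edges"

text \<open>Where the total rate vanishes, the jump distribution is irrelevant; it is put on the mark \<open>undefined\<close>.\<close>

definition wt :: "'a \<Rightarrow> 'e \<Rightarrow> real" where
  "wt y e = (if 0 < \<Lambda> y then lam e y / \<Lambda> y else of_bool (e = undefined))"
definition mk :: "'a \<Rightarrow> 'e measure" where "mk y = density (count_space E) (\<lambda>e. ennreal (wt y e))"
definition \<pi> :: "'a \<Rightarrow> ('e \<times> 'a) measure" where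
  "\<pi> y = mk y \<bind> (\<lambda>e. distr (K' e y) (count_space E \<Otimes>\<^sub>M borel) (Pair e))"

abbreviation EM where "EM \<equiv> count_space E \<Otimes>\<^sub>M (borel :: 'a measure)"

lemma lam_nonneg: "0 \<le> lam e y" using Edges(6) by (simp add: lam_def)

lemma measurable_lam: "lam e \<in> borel_measurable borel"
proof (cases "e \<in> Edges")
  case True
  have "rate e \<in> borel_measurable (restrict_space borel (S (src e))) \<longleftrightarrow> (\<lambda>y. if y \<in> S (src e) then rate e y else 0) \<in> borel_measurable borel"
    by (rule measurable_restrict_space_iff) (use S_borel[OF Edges(2)[OF True]] in auto)
  then show ?thesis using True Edges(4)[OF True] by (simp add: lam_def[abs_def])
qed (simp add: lam_def[abs_def])

lemma measurable_K': "K' e \<in> borel \<rightarrow>\<^sub>M prob_algebra borel"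
proof (cases "e \<in> Edges")
  case True
  have "K e \<in> restrict_space borel (S (src e)) \<rightarrow>\<^sub>M prob_algebra borel \<longleftrightarrow>
    (\<lambda>y. if y \<in> S (src e) then K e y else return borel undefined) \<in> borel \<rightarrow>\<^sub>M prob_algebra borel"
    by (rule measurable_restrict_space_iff) (use S_borel[OF Edges(2)[OF True]] in \<open>auto simp: space_prob_algebra prob_space_return\<close>)
  then show ?thesis using True Edges(3)[OF True] by (simp add: K'_def[abs_def])
next
  case False
  have "return borel undefined \<in> space (prob_algebra (borel :: 'a measure))" by (simp add: space_prob_algebra prob_space_return)
  then show ?thesis using False by (simp add: K'_def[abs_def])
qed

lemma prob_K': "prob_space (K' e y)" and sets_K': "sets (K' e y) = sets borel"
  using measurable_space[OF measurable_K', of y e] by (auto simp: space_prob_algebra)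

lemma nn_integral_edges_at:
  fixes g :: "'e \<Rightarrow> ennreal"
  shows "(\<Sum>\<^sub>\<infinity>e\<in>edges_at I S Edges src y. g e) = (\<integral>\<^sup>+e. (if y \<in> S (src e) then g e else 0) \<partial>count_space Edges)"
proof -
  have "countable (edges_at I S Edges src y)" unfolding edges_at_eq by (rule countable_subset[OF _ Edges(1)]) auto
  from infsum_ennreal_eq_nn_integral[OF this]
  have "(\<Sum>\<^sub>\<infinity>e\<in>edges_at I S Edges src y. g e) = (\<integral>\<^sup>+e. g e \<partial>count_space (edges_at I S Edges src y))" .
  also have "\<dots> = (\<integral>\<^sup>+e. (if y \<in> S (src e) then g e else 0) \<partial>count_space Edges)"
    unfolding edges_at_eq by (subst (1 2) nn_integral_count_space_indicator) (auto intro!: nn_integral_cong split: split_indicator)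
  finally show ?thesis .
qed

lemma total_rate_eq: "total_rate I S Edges src rate y = (\<integral>\<^sup>+e. ennreal (lam e y) \<partial>count_space Edges)"
  unfolding total_rate_def nn_integral_edges_at by (rule nn_integral_cong) (simp add: lam_def)

lemma nn_integral_lam: "(\<integral>\<^sup>+e. ennreal (lam e y) \<partial>count_space Edges) = ennreal (\<Lambda> y)"
  using total[of y] le_less_trans[OF _ ennreal_less_top] unfolding \<Lambda>_def total_rate_eq
  by (subst ennreal_enn2real) auto

text \<open>\<open>\<Lambda>max\<close> is an arbitrary real number and \<open>ennreal\<close>
  truncates negative ones to 0, whence the maximum with 0.\<close>

lemma \<Lambda>: "0 \<le> \<Lambda> y" "\<Lambda> y \<le> max 0 \<Lambda>max" "\<Lambda> \<in> borel_measurable borel"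
proof -
  show "0 \<le> \<Lambda> y" by (simp add: \<Lambda>_def)
  have "ennreal (\<Lambda> y) \<le> ennreal \<Lambda>max" using total[of y] by (simp add: total_rate_eq nn_integral_lam)
  also have "\<dots> \<le> ennreal (max 0 \<Lambda>max)" by (rule ennreal_leI) simp
  finally show "\<Lambda> y \<le> max 0 \<Lambda>max" by (simp only: ennreal_le_iff max.cobounded1)
  show "\<Lambda> \<in> borel_measurable borel"
    unfolding \<Lambda>_def[abs_def] using measurable_lam
    by (intro measurable_compose[OF measurable_nn_integral_count_space[OF Edges(1)] borel_measurable_enn2real]) auto
qed

lemma wt_nonneg: "0 \<le> wt y e" using lam_nonneg \<Lambda> by (simp add: wt_def)

lemma measurable_wt: "(\<lambda>y. wt y e) \<in> borel_measurable borel"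
proof -
  note [measurable] = \<Lambda>(3) measurable_lam[of e]
  show ?thesis unfolding wt_def by measurable
qed

lemma E: "countable E" "Edges \<subseteq> E" using Edges(1) by (auto simp: E_def)

lemma nn_integral_E:
  fixes g :: "'e \<Rightarrow> ennreal"
  assumes "\<And>e. e \<notin> Edges \<Longrightarrow> g e = 0"
  shows "(\<integral>\<^sup>+e. g e \<partial>count_space E) = (\<integral>\<^sup>+e. g e \<partial>count_space Edges)"
  by (subst (1 2) nn_integral_count_space_indicator) (use assms E(2) in \<open>auto intro!: nn_integral_cong split: split_indicator\<close>)

text \<open>Multiplication by \<Lambda> undoes the normalisation. If \<Lambda> y = 0, all rates at y
  vanish, and the bound on g makes the right-hand side vanish as well.\<close>

lemma rate_wt:
  assumes "\<And>e. g e \<le> 1"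
  shows "ennreal (\<Lambda> y) * (\<integral>\<^sup>+e. ennreal (wt y e) * g e \<partial>count_space E) = (\<integral>\<^sup>+e. ennreal (lam e y) * g e \<partial>count_space Edges)"
proof (cases "0 < \<Lambda> y")
  case True
  have "ennreal (\<Lambda> y) * (\<integral>\<^sup>+e. ennreal (wt y e) * g e \<partial>count_space E) = (\<integral>\<^sup>+e. ennreal (\<Lambda> y) * (ennreal (wt y e) * g e) \<partial>count_space E)"
    by (rule nn_integral_cmult[symmetric]) simp
  also have "\<dots> = (\<integral>\<^sup>+e. ennreal (lam e y) * g e \<partial>count_space E)"
    using True wt_nonneg lam_nonneg by (intro nn_integral_cong) (simp add: wt_def mult.assoc[symmetric] ennreal_mult[symmetric])
  also have "\<dots> = (\<integral>\<^sup>+e. ennreal (lam e y) * g e \<partial>count_space Edges)"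
    by (rule nn_integral_E) (simp add: lam_def)
  finally show ?thesis .
next
  case False
  then have 0: "\<Lambda> y = 0" using \<Lambda>(1)[of y] by simp
  have "(\<integral>\<^sup>+e. ennreal (lam e y) * g e \<partial>count_space Edges) \<le> (\<integral>\<^sup>+e. ennreal (lam e y) \<partial>count_space Edges)"
    using mult_left_mono[OF assms] by (intro nn_integral_mono) fastforce
  then show ?thesis using 0 by (simp add: nn_integral_lam)
qed

lemma nn_integral_wt: "(\<integral>\<^sup>+e. ennreal (wt y e) \<partial>count_space E) = 1"
proof (cases "0 < \<Lambda> y")
  case True
  have eq: "ennreal (\<Lambda> y) * (\<integral>\<^sup>+e. ennreal (wt y e) \<partial>count_space E) = ennreal (\<Lambda> y)"
    using rate_wt[of "\<lambda>_. 1" y] by (simp add: nn_integral_lam)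
  have "ennreal (inverse (\<Lambda> y)) * ennreal (\<Lambda> y) = 1" using True by (simp add: ennreal_mult[symmetric])
  then show ?thesis using arg_cong[OF eq, of "\<lambda>r. ennreal (inverse (\<Lambda> y)) * r"] by (simp add: mult.assoc[symmetric])
next
  case False
  have "(\<integral>\<^sup>+e. ennreal (wt y e) \<partial>count_space E) = (\<Sum>e\<in>{undefined}. ennreal (wt y e))"
    by (rule nn_integral_count_space') (use False in \<open>auto simp: wt_def E_def\<close>)
  then show ?thesis using False by (simp add: wt_def)
qed

lemma measurable_mk: "mk \<in> borel \<rightarrow>\<^sub>M prob_algebra (count_space E)"
proof (rule measurable_prob_algebraI)
  show p: "prob_space (mk y)" for y
  proof (rule prob_spaceI)
    have "emeasure (mk y) (space (mk y)) = (\<integral>\<^sup>+e. ennreal (wt y e) * indicator E e \<partial>count_space E)"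
      by (simp add: mk_def emeasure_density)
    also have "\<dots> = (\<integral>\<^sup>+e. ennreal (wt y e) \<partial>count_space E)" by (rule nn_integral_cong) simp
    finally show "emeasure (mk y) (space (mk y)) = 1" by (simp only: nn_integral_wt)
  qed
  show "mk \<in> borel \<rightarrow>\<^sub>M subprob_algebra (count_space E)"
  proof (rule measurable_subprob_algebra)
    show "subprob_space (mk y)" for y by (rule prob_space_imp_subprob_space[OF p])
    show "sets (mk y) = sets (count_space E)" for y by (simp add: mk_def)
    fix A assume A: "A \<in> sets (count_space E)"
    have "(\<lambda>y. \<integral>\<^sup>+e. ennreal (wt y e) * indicator A e \<partial>count_space E) \<in> borel_measurable borel"
      using measurable_wt by (intro measurable_nn_integral_count_space E) auto
    then show "(\<lambda>y. emeasure (mk y) A) \<in> borel_measurable borel" using A by (simp add: mk_def emeasure_density)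
  qed
qed

lemma measurable_mark_kernel:
  assumes "e \<in> E"
  shows "(\<lambda>y. distr (K' e y) EM (Pair e)) \<in> borel \<rightarrow>\<^sub>M prob_algebra EM"
proof -
  have "Pair e \<in> borel \<rightarrow>\<^sub>M EM" using assms by (intro measurable_Pair1') simp
  from measurable_compose[OF measurable_K' measurable_distr_prob_space[OF this]] show ?thesis .
qed

lemma measurable_\<pi>: "\<pi> \<in> borel \<rightarrow>\<^sub>M prob_algebra EM"
  unfolding \<pi>_def[abs_def]
proof (rule measurable_bind_prob_space2[OF measurable_mk])
  have "(\<lambda>(e, y). distr (K' e y) EM (Pair e)) \<in> count_space E \<Otimes>\<^sub>M borel \<rightarrow>\<^sub>M prob_algebra EM"
    by (rule measurable_pair_measure_countable1[OF E(1)]) (simp add: measurable_mark_kernel)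
  then show "(\<lambda>(y, e). distr (K' e y) EM (Pair e)) \<in> borel \<Otimes>\<^sub>M count_space E \<rightarrow>\<^sub>M prob_algebra EM"
    by (subst measurable_pair_swap_iff) (simp add: split_beta')
qed

lemma emeasure_\<pi>:
  assumes X: "X \<in> sets EM"
  shows "emeasure (\<pi> y) X = (\<integral>\<^sup>+e. ennreal (wt y e) * emeasure (K' e y) (Pair e -` X) \<partial>count_space E)"
proof -
  have mk: "mk y \<in> space (prob_algebra (count_space E))" using measurable_space[OF measurable_mk] by simp
  have "(\<lambda>e. distr (K' e y) EM (Pair e)) \<in> count_space E \<rightarrow>\<^sub>M prob_algebra EM"
    using measurable_space[OF measurable_mark_kernel, of _ y] by auto
  from emeasure_bind_prob_algebra[OF mk this X]
  have "emeasure (\<pi> y) X = (\<integral>\<^sup>+e. emeasure (distr (K' e y) EM (Pair e)) X \<partial>mk y)" by (simp add: \<pi>_def)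
  also have "\<dots> = (\<integral>\<^sup>+e. ennreal (wt y e) * emeasure (distr (K' e y) EM (Pair e)) X \<partial>count_space E)"
    unfolding mk_def by (rule nn_integral_density) auto
  also have "\<dots> = (\<integral>\<^sup>+e. ennreal (wt y e) * emeasure (K' e y) (Pair e -` X) \<partial>count_space E)"
  proof (rule nn_integral_cong)
    fix e assume "e \<in> space (count_space E)"
    then have "Pair e \<in> K' e y \<rightarrow>\<^sub>M EM" unfolding measurable_cong_sets[OF sets_K' refl] by (intro measurable_Pair1') simp
    moreover have "space (K' e y) = UNIV" using sets_eq_imp_space_eq[OF sets_K'] by simp
    ultimately show "ennreal (wt y e) * emeasure (distr (K' e y) EM (Pair e)) X = ennreal (wt y e) * emeasure (K' e y) (Pair e -` X)"
      using X by (simp add: emeasure_distr)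
  qed
  finally show ?thesis .
qed

lemma rate_\<pi>:
  assumes "X \<in> sets EM"
  shows "ennreal (\<Lambda> y) * emeasure (\<pi> y) X = (\<integral>\<^sup>+e. ennreal (lam e y) * emeasure (K' e y) (Pair e -` X) \<partial>count_space Edges)"
  unfolding emeasure_\<pi>[OF assms] by (rule rate_wt) (rule subprob_space.subprob_emeasure_le_1[OF prob_space_imp_subprob_space[OF prob_K']])

lemma prob_\<pi>: "prob_space (\<pi> y)" and sets_\<pi>: "sets (\<pi> y) = sets EM"
  using measurable_space[OF measurable_\<pi>, of y] by (auto simp: space_prob_algebra)

text \<open>The set function of the definition agrees on Borel sets with a measure, \<Lambda> y
  times the landing law under \<pi>, so \<open>measure_of\<close> returns that measure.\<close>

lemma jump_measure_eq: "jump_measure I S Edges src K rate y = density (distr (\<pi> y) borel snd) (\<lambda>_. ennreal (\<Lambda> y))"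
proof -
  let ?D = "density (distr (\<pi> y) borel snd) (\<lambda>_. ennreal (\<Lambda> y))"
  have snd: "snd \<in> \<pi> y \<rightarrow>\<^sub>M borel" unfolding measurable_cong_sets[OF sets_\<pi> refl] by simp
  have D: "emeasure ?D B = (\<Sum>\<^sub>\<infinity>e\<in>edges_at I S Edges src y. ennreal (rate e y) * emeasure (K e y) B)" if B: "B \<in> sets borel" for B
  proof -
    have X: "E \<times> B \<in> sets EM" using B by auto
    have sp: "space (\<pi> y) = E \<times> UNIV" using sets_eq_imp_space_eq[OF sets_\<pi>] by (simp add: space_pair_measure)
    have "emeasure ?D B = ennreal (\<Lambda> y) * emeasure (\<pi> y) (snd -` B \<inter> space (\<pi> y))"
      using B snd by (simp add: emeasure_density nn_integral_cmult emeasure_distr)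
    also have "snd -` B \<inter> space (\<pi> y) = E \<times> B" by (auto simp: sp)
    also have "ennreal (\<Lambda> y) * emeasure (\<pi> y) (E \<times> B) = (\<integral>\<^sup>+e. ennreal (lam e y) * emeasure (K' e y) (Pair e -` (E \<times> B)) \<partial>count_space Edges)"
      by (rule rate_\<pi>[OF X])
    also have "\<dots> = (\<integral>\<^sup>+e. (if y \<in> S (src e) then ennreal (rate e y) * emeasure (K e y) B else 0) \<partial>count_space Edges)"
    proof (rule nn_integral_cong)
      fix e assume "e \<in> space (count_space Edges)"
      then have e: "e \<in> Edges" by simp
      then have "Pair e -` (E \<times> B) = B" using E(2) by auto
      then show "ennreal (lam e y) * emeasure (K' e y) (Pair e -` (E \<times> B)) = (if y \<in> S (src e) then ennreal (rate e y) * emeasure (K e y) B else 0)"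
        using e by (simp add: lam_def K'_def)
    qed
    finally show ?thesis by (simp add: nn_integral_edges_at)
  qed
  have "jump_measure I S Edges src K rate y = measure_of UNIV (sets borel) (emeasure ?D)"
    unfolding jump_measure_def using sets.sigma_sets_eq[of "borel :: 'a measure"] by (intro measure_of_eq) (auto simp: D)
  also have "\<dots> = ?D" using measure_of_of_measure[of ?D] by simp
  finally show ?thesis .
qed

lemma integral_jump_measure:
  assumes f: "f \<in> borel_measurable borel" and B: "\<And>x. \<bar>f x\<bar> \<le> B"
  shows "(\<integral>z. (f z - f y) \<partial>jump_measure I S Edges src K rate y) = \<Lambda> y * ((\<integral>p. f (snd p) \<partial>\<pi> y) - f y)"
proof -
  interpret prob_space "\<pi> y" by (rule prob_\<pi>)
  have snd: "snd \<in> \<pi> y \<rightarrow>\<^sub>M borel" unfolding measurable_cong_sets[OF sets_\<pi> refl] by simp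
  have i: "integrable (\<pi> y) (\<lambda>p. f (snd p))"
    by (rule integrable_const_bound[where B=B]) (use B measurable_compose[OF snd f] in auto)
  have "(\<integral>z. (f z - f y) \<partial>jump_measure I S Edges src K rate y) = (\<integral>z. \<Lambda> y *\<^sub>R (f z - f y) \<partial>distr (\<pi> y) borel snd)"
    unfolding jump_measure_eq by (rule integral_density) (use f \<Lambda>(1) in auto)
  also have "\<dots> = (\<integral>p. \<Lambda> y *\<^sub>R (f (snd p) - f y) \<partial>\<pi> y)" by (rule integral_distr[OF snd]) (use f in auto)
  also have "\<dots> = \<Lambda> y * ((\<integral>p. f (snd p) \<partial>\<pi> y) - f y)" using i by (simp add: prob_space)
  finally show ?thesis .
qed

lemma rate_kernel:
  assumes e: "e \<in> Edges" and B: "B \<in> sets borel"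
  shows "\<Lambda> y * measure (\<pi> y) ({e} \<times> B) = (if y \<in> S (src e) then rate e y * measure (K e y) B else 0)"
proof -
  have X: "{e} \<times> B \<in> sets EM" using e E(2) B by auto
  have "ennreal (\<Lambda> y) * emeasure (\<pi> y) ({e} \<times> B) = (\<integral>\<^sup>+e'. ennreal (lam e' y) * emeasure (K' e' y) (Pair e' -` ({e} \<times> B)) \<partial>count_space Edges)"
    by (rule rate_\<pi>[OF X])
  also have "\<dots> = (\<Sum>e'\<in>{e}. ennreal (lam e' y) * emeasure (K' e' y) (Pair e' -` ({e} \<times> B)))"
    by (rule nn_integral_count_space') (use e in auto)
  also have "\<dots> = ennreal (lam e y) * emeasure (K' e y) B" by (simp add: vimage_def)
  finally have "enn2real (ennreal (\<Lambda> y) * emeasure (\<pi> y) ({e} \<times> B)) = enn2real (ennreal (lam e y) * emeasure (K' e y) B)" by simp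
  then have "\<Lambda> y * measure (\<pi> y) ({e} \<times> B) = lam e y * measure (K' e y) B"
    by (simp add: enn2real_mult measure_def \<Lambda>(1) lam_nonneg)
  then show ?thesis using e by (simp add: lam_def K'_def)
qed

text \<open>Because the kernels do not charge the present point, every ring of a clock is a visible
  discontinuity carrying a genuine edge.\<close>

lemma AE_\<pi>:
  assumes "0 < \<Lambda> y"
  shows "AE p in \<pi> y. fst p \<in> Edges \<and> snd p \<noteq> y"
proof -
  let ?X = "{p \<in> space EM. \<not> (fst p \<in> Edges \<and> snd p \<noteq> y)}"
  have "Edges \<times> (UNIV - {y}) \<in> sets EM" using E(2) by auto
  then have "space EM - Edges \<times> (UNIV - {y}) \<in> sets EM" by (rule sets.compl_sets)
  moreover have "?X = space EM - Edges \<times> (UNIV - {y})" by (auto simp: mem_Times_iff)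
  ultimately have X: "?X \<in> sets EM" by simp
  have "(\<integral>\<^sup>+e. ennreal (lam e y) * emeasure (K' e y) (Pair e -` ?X) \<partial>count_space Edges) = (\<integral>\<^sup>+e. 0 \<partial>count_space Edges)"
  proof (rule nn_integral_cong)
    fix e assume "e \<in> space (count_space Edges)"
    then have e: "e \<in> Edges" by simp
    have v: "Pair e -` ?X = {y}" using e E(2) by (auto simp: space_pair_measure)
    interpret prob_space "K' e y" by (rule prob_K')
    have "emeasure (K' e y) {y} = 0" if "y \<in> S (src e)"
      using Edges(5)[OF e that] emeasure_eq_measure[of "{y}"] e that by (simp add: K'_def)
    then show "ennreal (lam e y) * emeasure (K' e y) (Pair e -` ?X) = 0" unfolding v by (auto simp: lam_def)
  qed
  with rate_\<pi>[OF X, of y] have "ennreal (\<Lambda> y) * emeasure (\<pi> y) ?X = (\<integral>\<^sup>+e. 0 \<partial>count_space Edges)" by (rule trans)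
  then have "ennreal (\<Lambda> y) = 0 \<or> emeasure (\<pi> y) ?X = 0" by (simp only: nn_integral_const mult_zero_left mult_eq_0_iff)
  then have "emeasure (\<pi> y) ?X = 0" using assms by (auto simp only: ennreal_eq_0_iff)
  then have "?X \<in> null_sets (\<pi> y)" using X by (auto simp: null_sets_def sets_\<pi>)
  then show ?thesis by (rule AE_I') (use sets_eq_imp_space_eq[OF sets_\<pi>[of y]] in auto)
qed

sublocale jd: jump_diffusion \<Omega> Qn \<Lambda> "max 0 \<Lambda>max" E \<pi>
proof
  fix \<eta> :: "real \<Rightarrow> 'a" and u :: real and x :: 'a
  show "\<Omega> \<subseteq> cadlag_paths UNIV" by (rule \<Omega>_cadlag)
  show "stop_path u \<eta> \<in> \<Omega>" if "\<eta> \<in> \<Omega>" "0 \<le> u" using that stop_path_cadlag by (auto simp: \<Omega>_def)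
  show "(\<lambda>t\<in>{0..}. x) \<in> \<Omega>" using const_cadlag[OF str(2)[of x]] str(1)[of x] by (auto simp: \<Omega>_def)
  show "AE \<eta> in Qn x. \<eta> 0 = x"
  proof (rule AE_Qn[OF _ Q_stratum(4)])
    have [measurable]: "(\<lambda>\<eta>. \<eta> 0) \<in> N \<rightarrow>\<^sub>M borel" by (rule measurable_path_algebra_eval) simp
    show "Measurable.pred N (\<lambda>\<eta>. \<eta> 0 = x)" by measurable
  qed
qed (rule measurable_Qn \<Lambda> E(1) measurable_\<pi>)+

section \<open>The operator and Dynkin's formula across the strata\<close>

abbreviation gen :: "'i \<Rightarrow> ('a \<Rightarrow> real) \<Rightarrow> 'a \<Rightarrow> real" where
  "gen \<alpha> f \<equiv> generator (S \<alpha>) (transition_op (S \<alpha>) (Q \<alpha>)) (restrict f (S \<alpha>))"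
abbreviation A where "A \<equiv> hybrid_op I S Q Edges src K rate"

lemma gen_value:
  assumes "f \<in> op_domain I S C" "\<alpha> \<in> I"
  shows "is_generator_value (S \<alpha>) (transition_op (S \<alpha>) (Q \<alpha>)) (restrict f (S \<alpha>)) (gen \<alpha> f)"
proof -
  have "restrict f (S \<alpha>) \<in> C \<alpha>" using assms by (simp add: op_domain_def)
  moreover have "C \<alpha> \<subseteq> generator_domain (S \<alpha>) (transition_op (S \<alpha>) (Q \<alpha>))"
    using diffusion(3)[OF assms(2)] by (simp add: generator_core_def)
  ultimately show ?thesis by (intro generator_value_generator) auto
qed

text \<open>Needed for a global bound: on all but finitely many strata f vanishes and so does its
  generator.\<close>

lemma gen_zero:
  assumes f: "f \<in> op_domain I S C" and \<alpha>: "\<alpha> \<in> I" and z: "\<And>x. x \<in> S \<alpha> \<Longrightarrow> f x = 0" and x: "x \<in> S \<alpha>"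
  shows "gen \<alpha> f x = 0"
proof -
  have r: "restrict f (S \<alpha>) = (\<lambda>x\<in>S \<alpha>. 0)" using z by (intro restrict_ext) auto
  have C0: "(\<lambda>x\<in>S \<alpha>. 0) \<in> C0 (S \<alpha>)" using gen_value[OF f \<alpha>] by (simp add: is_generator_value_def r)
  interpret feller_diffusion "S \<alpha>" "Q \<alpha>" by (rule diffusion(1)[OF \<alpha>])
  have T: "transition_op (S \<alpha>) (Q \<alpha>) t (\<lambda>x\<in>S \<alpha>. 0) x = 0" if "0 < t" "x \<in> S \<alpha>" for t x
  proof -
    have "(\<integral>w. (\<lambda>x\<in>S \<alpha>. 0) (w t) \<partial>Q \<alpha> x) = (\<integral>w. (0::real) \<partial>Q \<alpha> x)"
      using that by (intro Bochner_Integration.integral_cong) (auto simp: space_Q cadlag_pathsD(4))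
    then show ?thesis using that by (simp add: transition_op_def)
  qed
  have "is_generator_value (S \<alpha>) (transition_op (S \<alpha>) (Q \<alpha>)) (\<lambda>x\<in>S \<alpha>. 0) (\<lambda>x\<in>S \<alpha>. 0)"
    unfolding is_generator_value_def
  proof (intro conjI C0 uniform_limitI)
    fix e :: real assume "0 < e"
    have "\<forall>\<^sub>F t in at_right (0::real). 0 < t" by (simp add: eventually_at_right_less)
    then show "\<forall>\<^sub>F t in at_right 0. \<forall>x\<in>S \<alpha>. dist ((transition_op (S \<alpha>) (Q \<alpha>) t (\<lambda>x\<in>S \<alpha>. 0) x - (\<lambda>x\<in>S \<alpha>. 0) x) / t) ((\<lambda>x\<in>S \<alpha>. 0) x) < e"
      by eventually_elim (use \<open>0 < e\<close> T in simp)
  qed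
  then show ?thesis using x by (simp add: r generator_eq)
qed

lemma gen_bounded:
  assumes f: "f \<in> op_domain I S C"
  shows "\<exists>c. \<forall>y. \<bar>gen (str y) f y\<bar> \<le> c"
proof -
  let ?F = "{\<alpha>\<in>I. \<exists>x\<in>S \<alpha>. f x \<noteq> 0}"
  have F: "finite ?F" using f by (simp add: op_domain_def)
  have "\<exists>c. \<forall>y\<in>S \<alpha>. \<bar>gen \<alpha> f y\<bar> \<le> c" if "\<alpha> \<in> I" for \<alpha>
  proof -
    have "gen \<alpha> f \<in> C0 (S \<alpha>)" using gen_value[OF f that] by (simp add: is_generator_value_def)
    then obtain c where "\<And>y. y \<in> S \<alpha> \<Longrightarrow> \<bar>gen \<alpha> f y\<bar> \<le> c" using C0_bounded by blast
    then show ?thesis by blast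
  qed
  then obtain c where c: "\<And>\<alpha> y. \<alpha> \<in> I \<Longrightarrow> y \<in> S \<alpha> \<Longrightarrow> \<bar>gen \<alpha> f y\<bar> \<le> c \<alpha>" by metis
  have "\<bar>gen (str y) f y\<bar> \<le> (\<Sum>\<alpha>\<in>?F. \<bar>c \<alpha>\<bar>)" for y
  proof (cases "str y \<in> ?F")
    case True
    have "\<bar>gen (str y) f y\<bar> \<le> \<bar>c (str y)\<bar>" using c[OF str] by (rule order_trans) simp
    also have "\<dots> \<le> (\<Sum>\<alpha>\<in>?F. \<bar>c \<alpha>\<bar>)" by (rule member_le_sum[OF True]) (use F in auto)
    finally show ?thesis .
  next
    case False
    then have "gen (str y) f y = 0" using str by (intro gen_zero[OF f]) auto
    then show ?thesis by (simp add: sum_nonneg)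
  qed
  then show ?thesis by blast
qed

lemma gen_measurable:
  assumes f: "f \<in> op_domain I S C"
  shows "(\<lambda>y. gen (str y) f y) \<in> borel_measurable borel"
proof (rule measurable_piecewise_restrict[of "S ` I"])
  show "countable (S ` I)" using I by simp
  fix \<Omega>' assume "\<Omega>' \<in> S ` I"
  then obtain \<alpha> where \<alpha>: "\<alpha> \<in> I" "\<Omega>' = S \<alpha>" by auto
  show "\<Omega>' \<inter> space borel \<in> sets borel" using S_borel \<alpha> by simp
  have "gen \<alpha> f \<in> borel_measurable (restrict_space borel (S \<alpha>))"
    using gen_value[OF f \<alpha>(1)] by (intro C0_measurable) (simp add: is_generator_value_def)
  then show "(\<lambda>y. gen (str y) f y) \<in> borel_measurable (restrict_space borel \<Omega>')"
    unfolding \<alpha>(2) by (rule measurable_cong[THEN iffD1, rotated]) (auto simp: space_restrict_space str_eq[OF \<alpha>(1)])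
qed (use cover in auto)

text \<open>Under the law started at y all paths stay in the stratum of y; there B traces an event
  of that stratum's own filtration and the piecewise generator is a single one.\<close>

lemma Qn_dynkin:
  assumes f: "f \<in> op_domain I S C" and u: "0 \<le> u" "u \<le> v" and B: "B \<in> sets (natural_filtration \<Omega> (\<lambda>\<eta>. \<eta>) u)"
  shows "(\<integral>\<eta>. indicator B \<eta> * (f (\<eta> v) - f (\<eta> u) - (LINT r:{u..v}|lborel. gen (str (\<eta> r)) f (\<eta> r))) \<partial>Qn y) = 0"
proof -
  let ?\<alpha> = "str y"
  interpret feller_diffusion "S ?\<alpha>" "Q ?\<alpha>" by (rule diffusion(1)[OF str(1)])
  let ?g = "\<lambda>\<eta>. indicator B \<eta> * (f (\<eta> v) - f (\<eta> u) - (LINT r:{u..v}|lborel. gen (str (\<eta> r)) f (\<eta> r)))"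
  have fm: "f \<in> borel_measurable borel" using f by (simp add: op_domain_def)
  have ev: "(\<lambda>\<eta>. \<eta> t) \<in> N \<rightarrow>\<^sub>M borel" if "0 \<le> t" for t by (rule measurable_path_algebra_eval[OF that])
  have sub: "subalgebra N (natural_filtration \<Omega> (\<lambda>\<eta>. \<eta>) u)"
    by (rule subalgebra_natural_filtration) (simp_all add: ev)
  then have BN: "B \<in> sets N" using B by (auto simp: subalgebra_def)
  have "(\<lambda>\<eta>. LINT r:{u..v}|lborel. gen (str (\<eta> r)) f (\<eta> r)) \<in> borel_measurable N"
    by (rule measurable_integral_adapted[where X="\<lambda>\<eta>. \<eta>", OF _ _ gen_measurable[OF f] u(1)])
      (auto intro: jd.right_cont ev)
  then have gm: "?g \<in> borel_measurable N"
    using u measurable_compose[OF ev fm] BN by (intro borel_measurable_times borel_measurable_diff) auto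
  define B' where "B' = B \<inter> cadlag_paths (S ?\<alpha>)"
  have "(\<lambda>\<eta>. \<eta>) \<in> natural_filtration (cadlag_paths (S ?\<alpha>)) (\<lambda>\<eta>. \<eta>) u \<rightarrow>\<^sub>M natural_filtration \<Omega> (\<lambda>\<eta>. \<eta>) u"
    by (rule measurable_natural_filtration) (use str(1) in \<open>auto simp: \<Omega>_def intro: measurable_natural_filtration_at\<close>)
  from measurable_sets[OF this B] have B': "B' \<in> sets (natural_filtration (cadlag_paths (S ?\<alpha>)) (\<lambda>\<eta>. \<eta>) u)"
    by (simp add: B'_def)
  have "(\<integral>\<eta>. ?g \<eta> \<partial>Qn y) = (\<integral>\<eta>. ?g \<eta> \<partial>Q ?\<alpha> y)"
    unfolding Qn_def by (rule integral_distr[OF measurable_Q_inclusion gm])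
  also have "\<dots> = (\<integral>\<eta>. indicator B' \<eta> * (restrict f (S ?\<alpha>) (\<eta> v) - restrict f (S ?\<alpha>) (\<eta> u) - (LINT r:{u..v}|lborel. gen ?\<alpha> f (\<eta> r))) \<partial>Q ?\<alpha> y)"
  proof (rule Bochner_Integration.integral_cong)
    fix \<eta> assume "\<eta> \<in> space (Q ?\<alpha> y)"
    then have \<eta>: "\<eta> \<in> cadlag_paths (S ?\<alpha>)" by (simp add: Q_stratum)
    have in_S: "\<eta> t \<in> S ?\<alpha>" if "0 \<le> t" for t by (rule cadlag_pathsD(4)[OF \<eta> that])
    have "(LINT r:{u..v}|lborel. gen (str (\<eta> r)) f (\<eta> r)) = (LINT r:{u..v}|lborel. gen ?\<alpha> f (\<eta> r))"
      by (rule set_lebesgue_integral_cong) (use u in \<open>auto simp: str_eq[OF str(1) in_S]\<close>)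
    then show "?g \<eta> = indicator B' \<eta> * (restrict f (S ?\<alpha>) (\<eta> v) - restrict f (S ?\<alpha>) (\<eta> u) - (LINT r:{u..v}|lborel. gen ?\<alpha> f (\<eta> r)))"
      using u in_S \<eta> by (simp add: B'_def indicator_def)
  qed simp
  also have "\<dots> = 0" by (rule dynkin[OF str(2) u B' gen_value[OF f str(1)]])
  finally show ?thesis .
qed

lemma hybrid_jump_martingale:
  assumes f: "f \<in> op_domain I S C"
  shows "\<exists>c. jump_martingale \<Omega> Qn \<Lambda> (max 0 \<Lambda>max) E \<pi> f (\<lambda>y. gen (str y) f y) (\<lambda>_. 0) c"
proof -
  have fm: "f \<in> borel_measurable borel" using f by (simp add: op_domain_def)
  obtain c1 where c1: "\<And>y. \<bar>f y\<bar> \<le> c1" using f by (auto simp: op_domain_def bounded_iff)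
  obtain c2 where c2: "\<And>y. \<bar>gen (str y) f y\<bar> \<le> c2" using gen_bounded[OF f] by blast
  have "jump_martingale \<Omega> Qn \<Lambda> (max 0 \<Lambda>max) E \<pi> f (\<lambda>y. gen (str y) f y) (\<lambda>_. 0) (max c1 c2)"
  proof unfold_locales
    show "\<bar>f y\<bar> \<le> max c1 c2" "\<bar>gen (str y) f y\<bar> \<le> max c1 c2" "\<bar>0::real\<bar> \<le> max c1 c2" for y
      using c1[of y] c2[of y] by auto
    fix \<eta> :: "real \<Rightarrow> 'a" and t :: real assume \<eta>: "\<eta> \<in> \<Omega>" and t: "0 \<le> t"
    let ?\<alpha> = "str (\<eta> t)"
    have \<eta>': "\<eta> \<in> cadlag_paths (S ?\<alpha>)" by (rule \<Omega>_stratum[OF \<eta> t str])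
    have "continuous_on (S ?\<alpha>) (restrict f (S ?\<alpha>))"
      using gen_value[OF f str(1)] by (simp add: is_generator_value_def C0_def)
    then have cf: "continuous_on (S ?\<alpha>) f" by (rule continuous_on_cong[THEN iffD1, rotated 2]) auto
    have "\<forall>\<^sub>F s in at_right t. 0 \<le> s"
      unfolding eventually_at_right_field using t by (intro exI[of _ "t + 1"]) auto
    then have "\<forall>\<^sub>F s in at_right t. \<eta> s \<in> S ?\<alpha>" by eventually_elim (rule cadlag_pathsD(4)[OF \<eta>'])
    then show "((\<lambda>s. f (\<eta> s)) \<longlongrightarrow> f (\<eta> t)) (at_right t)"
      by (rule continuous_on_tendsto_compose[OF cf cadlag_pathsD(2)[OF \<eta>' t] str(2)])
  qed (use fm gen_measurable[OF f] Qn_dynkin[OF f] in auto)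
  then show ?thesis ..
qed

lemma hybrid_martingale:
  assumes f: "f \<in> op_domain I S C"
  shows "martingale (jd.Pr x) (usual_augmentation (jd.Pr x) (natural_filtration (space (jd.Pr x)) proc)) (martingale_process A proc f)"
    and "martingale (distr (jd.Pr x) (skorokhod_borel UNIV) proc) (natural_filtration (cadlag_paths UNIV) (\<lambda>w. w)) (martingale_process A (\<lambda>w. w) f)"
proof -
  obtain c where "jump_martingale \<Omega> Qn \<Lambda> (max 0 \<Lambda>max) E \<pi> f (\<lambda>y. gen (str y) f y) (\<lambda>_. 0) c"
    using hybrid_jump_martingale[OF f] ..
  then interpret jm: jump_martingale \<Omega> Qn \<Lambda> "max 0 \<Lambda>max" E \<pi> f "\<lambda>y. gen (str y) f y" "\<lambda>_. 0" c .
  \<comment> \<open>With d = 0 the jump part of the drift is \<Lambda> times the mean change under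
    \<pi>, which is the integral against the jump measure.\<close>
  have cc: "jm.cc y = A f y" for y
    using integral_jump_measure[OF jm.a_measurable jm.a_bound, of y]
    by (simp add: jm.cc_def jm.\<beta>_def jm.b_def hybrid_op_def Let_def)
  show "martingale (jd.Pr x) (usual_augmentation (jd.Pr x) (natural_filtration (space (jd.Pr x)) proc)) (martingale_process A proc f)"
    using jm.state_martingale[of x] by (simp add: cc martingale_process_def[abs_def])
  show "martingale (distr (jd.Pr x) (skorokhod_borel UNIV) proc) (natural_filtration (cadlag_paths UNIV) (\<lambda>w. w)) (martingale_process A (\<lambda>w. w) f)"
    using jm.canonical_martingale[of x] by (simp add: cc martingale_process_def[abs_def])
qed

section \<open>Regularity of the trajectories and the properties (ii) to (iii)\<close>

lemma AE_regular:
  "AE w in jd.Pr x. jd.regular w \<and> (\<forall>n. 0 < clk (w (Suc n)) \<longrightarrow> ety (Suc n) w \<in> Edges)"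
proof -
  have [measurable]: "Measurable.pred (borel \<Otimes>\<^sub>M EM) (\<lambda>p. fst (snd p) \<in> Edges)"
    by (rule measurable_compose[where f="\<lambda>p. fst (snd p)" and N="count_space E"]) auto
  have R: "Measurable.pred (borel \<Otimes>\<^sub>M EM) (\<lambda>(y, p). fst p \<in> Edges \<and> snd p \<noteq> y)"
    unfolding split_beta' by measurable
  have "AE \<eta> in Qn y. continuous_on {0..} \<eta>" for y
    by (rule AE_Qn[OF jd.measurable_continuous_path diffusion(2)[OF str]])
  then have "AE w in jd.Pr x. \<forall>n. continuous_on {0..} (pth (w (Suc n)))"
    by (rule jd.AE_Pr[OF jd.AE_continuous_stages])
  moreover have "AE w in jd.Pr x. \<forall>n. 0 < clk (w (Suc n)) \<longrightarrow> ety (Suc n) w \<in> Edges \<and>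
      pos (w (Suc n)) \<noteq> pth (w (Suc n)) (clk (w (Suc n)))"
    by (rule jd.AE_Pr[OF jd.AE_jumps[OF R]]) (rule AE_\<pi>)
  ultimately show ?thesis using jd.AE_Pr_good[of x] by eventually_elim (auto simp: jd.regular_def)
qed

lemma hybrid_successive_jumps: "successive_jumps (jd.Pr x) proc Edges jump_time ety"
  unfolding successive_jumps_def
proof (intro conjI allI)
  show "jump_time n \<in> borel_measurable (jd.Pr x)" for n by (rule jd.measurable_Pr_Full) simp
  show "ety n \<in> jd.Pr x \<rightarrow>\<^sub>M count_space UNIV" for n by (rule jd.measurable_ety)
  show "AE w in jd.Pr x. jump_time 0 w = 0 \<and>
        (\<forall>n. if jump_time n w < \<infinity> then jump_time n w < jump_time (Suc n) w else jump_time (Suc n) w = \<infinity>) \<and>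
        (\<lambda>n. jump_time n w) \<longlonglongrightarrow> \<infinity> \<and>
        {t. 0 < t \<and> proc w t \<noteq> left_lim (proc w) t} = {t. \<exists>n\<ge>1. jump_time n w = ereal t} \<and>
        (\<forall>n\<ge>1. jump_time n w < \<infinity> \<longrightarrow> ety n w \<in> Edges)"
    (is "AE w in _. ?P w")
    using AE_regular
  proof eventually_elim
    fix w assume r: "jd.regular w \<and> (\<forall>n. 0 < clk (w (Suc n)) \<longrightarrow> ety (Suc n) w \<in> Edges)"
    have "ety n w \<in> Edges" if n: "1 \<le> n" "jump_time n w < \<infinity>" for n
    proof -
      obtain m where m: "n = Suc m" using n(1) by (cases n) auto
      then have "0 < clk (w (Suc m))" using n(2) by (auto simp: jump_time.simps(2) split: if_splits)
      then show ?thesis using r m by blast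
    qed
    moreover have "jump_time (Suc n) w = \<infinity>" if "\<not> jump_time n w < \<infinity>" for n using that by (intro jump_time_Suc_inf) simp
    ultimately show "?P w"
      using r jump_time_less_Suc jd.jump_time_tendsto[of w] jd.regular_jump_times[of w] by (auto simp: jd.regular_def)
  qed
qed

text \<open>Without a discontinuity at t, a whole neighbourhood of t belongs to one stage, whose
  path lives in one stratum.\<close>

lemma stratum_preserved:
  assumes r: "jd.regular w" and t: "0 \<le> t" and \<alpha>: "\<alpha> \<in> I"
    and l: "left_lim (proc w) t \<in> S \<alpha>" "proc w t = left_lim (proc w) t"
  shows "\<forall>\<^sub>F s in at t within {0..}. proc w s \<in> S \<alpha>"
proof -
  have w: "w \<in> jd.good" using r by (simp add: jd.regular_def)
  obtain n where n: "jump_time n w \<le> ereal t" "ereal t < jump_time (Suc n) w" using jd.good_stage[OF w t] .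
  have "jump_time n w < \<infinity>" using n(1) by (rule le_less_trans) simp
  then obtain c where c: "jump_time n w = ereal c" "0 \<le> c" "real_of_ereal (jump_time n w) = c" using jd.stage_interval by blast
  have ct: "c \<le> t" using n(1) c by simp
  have pe: "proc w s = pth (w (Suc n)) (s - c)" if "c \<le> s" "ereal s < jump_time (Suc n) w" for s
    using proc_eq[of n w s] that c by simp
  have path: "pth (w (Suc n)) \<in> cadlag_paths (S \<alpha>)"
    by (rule \<Omega>_stratum[OF jd.goodD(3)[OF w], of "t - c"]) (use ct pe[OF ct n(2)] l \<alpha> in auto)
  \<comment> \<open>A stage that started exactly at t > 0 would make t a jump time, hence a
    discontinuity. At t = 0 only times to the right matter.\<close>
  have "t = 0 \<or> c < t"
  proof (rule ccontr)
    assume "\<not> ?thesis"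
    then have "0 < t" "c = t" using ct t by auto
    then have "t \<notin> {t. \<exists>n\<ge>1. jump_time n w = ereal t}" using l(2) unfolding jd.regular_jump_times[OF r, symmetric] by simp
    then have "\<not> 1 \<le> n" using c(1) \<open>c = t\<close> by auto
    then have "jump_time n w = 0" by (cases n) auto
    then show False using c \<open>0 < t\<close> \<open>c = t\<close> by simp
  qed
  then have 1: "\<forall>\<^sub>F s in at t within {0..}. c \<le> s"
  proof
    assume "t = 0"
    then show ?thesis using ct c(2) by (simp add: eventually_at_filter)
  next
    assume "c < t"
    then have "\<forall>\<^sub>F s in at t within {0..}. c < s" by (intro order_tendstoD(1)[OF tendsto_ident_at])
    then show ?thesis by eventually_elim simp
  qed
  obtain b where b: "t < b" "ereal b \<le> jump_time (Suc n) w"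
  proof (cases "jump_time (Suc n) w")
    case (real r)
    then show ?thesis using that[of r] n(2) by simp
  next
    case PInf
    then show ?thesis using that[of "t + 1"] by simp
  qed (use n(2) in simp)
  have "\<forall>\<^sub>F s in at t within {0..}. s < b" using b(1) by (intro order_tendstoD(2)[OF tendsto_ident_at])
  with 1 show ?thesis
  proof eventually_elim
    fix s assume s: "c \<le> s" "s < b"
    have "ereal s < jump_time (Suc n) w" by (rule less_le_trans[OF _ b(2)]) (use s in simp)
    then show "proc w s \<in> S \<alpha>" using pe[OF s(1)] cadlag_pathsD(4)[OF path, of "s - c"] s by simp
  qed
qed

lemma hybrid_diffuses: "diffuses_between_jumps I S Q (jd.Pr x) proc jump_time ety (\<lambda>n w. pth (w (Suc n)))"
  unfolding diffuses_between_jumps_def Let_def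
proof (intro conjI allI ballI)
  show "AE w in jd.Pr x. \<forall>n. jump_time n w < \<infinity> \<longrightarrow> (\<forall>s\<ge>0. jump_time n w + ereal s < jump_time (Suc n) w \<longrightarrow>
           proc w (real_of_ereal (jump_time n w) + s) = pth (w (Suc n)) s)"
  proof (intro AE_I2 allI impI)
    fix w :: "nat \<Rightarrow> (real \<Rightarrow> 'a) \<times> real \<times> 'e \<times> 'a" and n s assume n: "jump_time n w < \<infinity>" and s: "0 \<le> s" "jump_time n w + ereal s < jump_time (Suc n) w"
    obtain c where c: "jump_time n w = ereal c" "0 \<le> c" "real_of_ereal (jump_time n w) = c" using jd.stage_interval[OF n] by blast
    show "proc w (real_of_ereal (jump_time n w) + s) = pth (w (Suc n)) s"
      using proc_eq[of n w "c + s"] s c by simp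
  qed
  show "subalgebra (jd.Pr x) (jump_history (jd.Pr x) proc jump_time ety n)" for n by (rule jd.subalgebra_jump_history)
  fix n \<alpha> assume \<alpha>: "\<alpha> \<in> I"
  let ?R = "{w \<in> space (jd.Pr x). jump_time n w < \<infinity> \<and> state_at_jump proc jump_time n w \<in> S \<alpha>}"
  have R: "?R = {w \<in> jd.good. jump_time n w < \<infinity> \<and> pos (w n) \<in> S \<alpha>}"
    by (auto simp: jd.proc_jump)
  show "(\<lambda>w. pth (w (Suc n))) \<in> restrict_space (jd.Pr x) ?R \<rightarrow>\<^sub>M skorokhod_borel (S \<alpha>)"
  proof (rule measurable_into_skorokhod)
    fix w assume "w \<in> space (restrict_space (jd.Pr x) ?R)"
    then have "w \<in> jd.good" "pos (w n) \<in> S \<alpha>" unfolding R by (auto simp: space_restrict_space)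
    then show "pth (w (Suc n)) \<in> cadlag_paths (S \<alpha>)"
      using \<Omega>_stratum[OF jd.goodD(3) order_refl \<alpha>, of w "Suc n"] jd.goodD(2)[of w n] by simp
  next
    fix t :: real assume "0 \<le> t"
    then have "(\<lambda>w. pth (w (Suc n)) t) \<in> jd.Pr x \<rightarrow>\<^sub>M borel"
      by (intro jd.measurable_Pr_Full jd.measurable_path_at[where f="\<lambda>w. w (Suc n)"]) simp
    then show "(\<lambda>w. pth (w (Suc n)) t) \<in> restrict_space (jd.Pr x) ?R \<rightarrow>\<^sub>M borel" by (rule measurable_restrict_space1)
  qed
  fix \<Gamma> assume \<Gamma>: "\<Gamma> \<in> sets (skorokhod_borel (S \<alpha>))"
  show "AE w in jd.Pr x. w \<in> ?R \<longrightarrow>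
     real_cond_exp (jd.Pr x) (jump_history (jd.Pr x) proc jump_time ety n) (indicator {w\<in>?R. pth (w (Suc n)) \<in> \<Gamma>}) w
             = measure (Q \<alpha> (state_at_jump proc jump_time n w)) \<Gamma>"
    unfolding R using jd.stage_path_given_history[OF S_borel[OF \<alpha>] stratum_paths[OF \<alpha> \<Gamma>], of x n]
    by eventually_elim (auto simp: measure_Qn[OF \<alpha> _ \<Gamma>] jd.proc_jump)
qed

lemma hybrid_jumps_governed: "jumps_governed_by S Edges src K rate (jd.Pr x) proc jump_time ety"
  unfolding jumps_governed_by_def
proof (intro ballI)
  fix e and B :: "'a set" assume e: "e \<in> Edges" and B: "B \<in> sets borel"
  have X: "{e} \<times> B \<in> sets EM" using e E(2) B by auto
  \<comment> \<open>Nothing is observed of the state; only marks with edge e and landing point in B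
    are counted.\<close>
  interpret jm: jump_martingale \<Omega> Qn \<Lambda> "max 0 \<Lambda>max" E \<pi> "\<lambda>_. 0" "\<lambda>_. 0" "indicator ({e} \<times> B)" 1
    by unfold_locales (use X in \<open>auto split: split_indicator\<close>)
  have "jm.\<beta> y = measure (\<pi> y) ({e} \<times> B)" for y
    using X sets_eq_imp_space_eq[OF sets_\<pi>] sets.sets_into_space[OF X] by (simp add: jm.\<beta>_def jm.b_def Int_absorb2)
  then have cc: "jm.cc y = (if y \<in> S (src e) then rate e y * measure (K e y) B else 0)" for y
    using rate_kernel[OF e B, of y] by (simp add: jm.cc_def)
  have "AE w in jd.Pr x. jd.regular w" using AE_regular by eventually_elim simp
  from jm.jump_count_martingale[OF _ e B _ this]
  show "martingale (jd.Pr x) (usual_augmentation (jd.Pr x) (marked_filtration (jd.Pr x) proc Edges jump_time ety))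
          (\<lambda>t w. jump_count proc jump_time ety e B t w -
             (LINT s:{0..t}|lborel. let y = left_lim (proc w) s in if y \<in> S (src e) then rate e y * measure (K e y) B else 0))"
    by (simp add: cc Let_def)
qed

end

text \<open>Process, jump times, types and diffusive pieces are the same functions of the sample for
  every starting point; only the measure depends on x.\<close>

theorem theorem1:
  fixes I :: "'i set"
    and S :: "'i \<Rightarrow> 'a::{metric_space, second_countable_topology} set"
    and dm :: "'i \<Rightarrow> nat"
    and \<A> :: "'i \<Rightarrow> 'a chart set"
    and g :: "'i \<Rightarrow> 'a chart \<Rightarrow> (nat \<Rightarrow> real) \<Rightarrow> nat \<Rightarrow> nat \<Rightarrow> real"
    and Q :: "'i \<Rightarrow> 'a \<Rightarrow> (real \<Rightarrow> 'a) measure"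
    and C :: "'i \<Rightarrow> ('a \<Rightarrow> real) set"
    and Edges :: "'e set"
    and src tgt :: "'e \<Rightarrow> 'i"
    and K :: "'e \<Rightarrow> 'a \<Rightarrow> 'a measure"
    and rate :: "'e \<Rightarrow> 'a \<Rightarrow> real"
    and \<Lambda>max :: real
  defines "A \<equiv> hybrid_op I S Q Edges src K rate"
    and "\<D> \<equiv> op_domain I S C"
  assumes "locally compact (UNIV :: 'a set)"
    and "stratified_riemannian_space I S dm \<A> g"
    and "strata_diffusions I S Q C"
    and "jump_structure I S Edges src tgt K rate \<Lambda>max"
  shows "\<exists>(P :: 'a \<Rightarrow> ('a, 'e) sample measure) X \<tau> Y \<eta>.
    (\<forall>x.
       prob_space (P x) \<and> complete_measure (P x) \<and>
       X x \<in> P x \<rightarrow>\<^sub>M skorokhod_borel UNIV \<and>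
       \<comment> \<open>(i)\<close>
       (AE \<omega> in P x. X x \<omega> 0 = x) \<and>
       successive_jumps (P x) (X x) Edges (\<tau> x) (Y x) \<and>
       \<comment> \<open>(ii)\<close>
       (AE \<omega> in P x. \<forall>t\<ge>0. \<forall>\<alpha>\<in>I.
          left_lim (X x \<omega>) t \<in> S \<alpha> \<and> X x \<omega> t = left_lim (X x \<omega>) t \<longrightarrow>
          (\<forall>\<^sub>F s in at t within {0..}. X x \<omega> s \<in> S \<alpha>)) \<and>
       diffuses_between_jumps I S Q (P x) (X x) (\<tau> x) (Y x) (\<eta> x) \<and>
       \<comment> \<open>(iii)\<close>
       jumps_governed_by S Edges src K rate (P x) (X x) (\<tau> x) (Y x) \<and>
       \<comment> \<open>(iv)\<close>
       (\<forall>f\<in>\<D>. martingale (P x)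
          (usual_augmentation (P x) (natural_filtration (space (P x)) (X x)))
          (martingale_process A (X x) f)) \<and>
       solves_martingale_problem A \<D> x (distr (P x) (skorokhod_borel UNIV) (X x)) \<and>
       non_explosive (P x) (X x)) \<and>
    (\<lambda>x. distr (P x) (skorokhod_borel UNIV) (X x)) \<in> borel \<rightarrow>\<^sub>M prob_algebra (skorokhod_borel UNIV)"
proof -
  interpret hybrid I S Q C Edges src tgt K rate \<Lambda>max
    using assms(4-6) by unfold_locales (auto simp: stratified_riemannian_space_def)
  have mp: "solves_martingale_problem A \<D> x (distr (jd.Pr x) (skorokhod_borel UNIV) proc)" for x
    unfolding solves_martingale_problem_def
  proof (intro conjI ballI)
    show "distr (jd.Pr x) (skorokhod_borel UNIV) proc \<in> space (prob_algebra (skorokhod_borel UNIV))"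
      using measurable_space[OF jd.law_of_proc_measurable] by simp
    have "(\<lambda>\<omega>. \<omega> 0) -` {x} \<inter> space (skorokhod_borel (UNIV :: 'a set)) \<in> sets (skorokhod_borel UNIV)"
      by (rule measurable_sets[OF measurable_skorokhod_eval]) auto
    then have "{\<omega> \<in> space (skorokhod_borel UNIV). \<omega> 0 = x} \<in> sets (skorokhod_borel UNIV)"
      by (simp add: vimage_def Int_def conj_commute)
    then show "AE \<omega> in distr (jd.Pr x) (skorokhod_borel UNIV) proc. \<omega> 0 = x"
      by (subst AE_distr_iff[OF jd.proc_measurable_Pr]) (auto intro: jd.AE_proc_start)
  qed (unfold \<D>_def A_def, rule hybrid_martingale(2))
  have "AE \<omega> in jd.Pr x. \<forall>t\<ge>0. \<forall>\<alpha>\<in>I. left_lim (proc \<omega>) t \<in> S \<alpha> \<and> proc \<omega> t = left_lim (proc \<omega>) t \<longrightarrow>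
      (\<forall>\<^sub>F s in at t within {0..}. proc \<omega> s \<in> S \<alpha>)" for x
    using AE_regular by eventually_elim (use stratum_preserved in blast)
  then show ?thesis
    unfolding A_def \<D>_def
    by (intro exI[of _ jd.Pr] exI[of _ "\<lambda>_. proc"] exI[of _ "\<lambda>_. jump_time"] exI[of _ "\<lambda>_. ety"]
        exI[of _ "\<lambda>_ n \<omega>. pth (\<omega> (Suc n))"] conjI allI ballI)
      (rule jd.prob_Pr jd.complete_Pr jd.proc_measurable_Pr jd.AE_proc_start hybrid_successive_jumps
        hybrid_diffuses hybrid_jumps_governed hybrid_martingale(1) mp[unfolded A_def \<D>_def]
        jd.non_explosive_Pr[OF assms(3)] jd.law_of_proc_measurable | assumption | blast)+
qed

end
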